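(* Assume condition (NonRev): $B>0$, $R_{\widehat{\mathfrak q}}(k,k+1)>0$ for all $k\in\mathbb Z$, and $R_{\widehat{\mathfrak q}}(j,j-1)=0$ for some $j\in\mathbb Z$. Let $\omega\in\mathcal P(\mathcal S_{\widehat{\mathfrak q}})$ be strictly positive and let $\mu=\sum_{\mathcal M\in\mathcal S_{\widehat{\mathfrak q}}}\omega(\mathcal M)\,\mu^{\widehat{\mathfrak q}}_{\mathcal M}\in\mathcal P(\mathbb T)$. Let $\mu_{\widehat{\mathfrak q},\epsilon}$ be the stationary state of the tilted generator $L_{\widehat{\mathfrak q},\epsilon}$ built from $\omega$ (see context). Then $$\limsup_{\epsilon\to0}\theta^{(\widehat{\mathfrak q})}_\epsilon\,I_\epsilon(\mu_{\widehat{\mathfrak q},\epsilon})\le J^{(\widehat{\mathfrak q})}(\mu).$$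
   Context: SETTING. $\mathbb T=[0,1)$ is the one-dimensional torus of length $1$. Standing assumptions: $a,b:\mathbb T\to\mathbb R$ are of class $C^2(\mathbb T)$; $a(x)\ge c_0>0$; $b$ vanishes at exactly finitely many points $x_1,\dots,x_{2N}$ ($N\ge1$), and $b'(x_j)\ne0$ for each $j$; $B=\int_{\mathbb T} b/a\,dx\ge0$. $L_\epsilon f=bf'+\epsilon a f''$, $f\in C^2(\mathbb T)$. $\mathcal P(\mathbb M)$ is the set of Borel probability measures on a metric space $\mathbb M$. $I_\epsilon(\mu)=\sup_u-\int_{\mathbb T}\frac{L_\epsilon u}{u}\,d\mu$, the supremum over all strictly positive $u\in C^2(\mathbb T)$ (the domain of the generator). HIERARCHICAL METASTABLE STRUCTURE. Regard $a,b$ as $1$-periodic functions on $\mathbb R$ and let $S(x)=-\int_0^x b(z)/a(z)\,dz$, $x\in\mathbb R$. The zeros of $b$ in $\mathbb R$ with $b'<0$ (local minima of $S$) are labelled $m_k$, $k\in\mathbb Z$, and those with $b'>0$ (local maxima of $S$) are labelled $\sigma_k$, with $m_{k+N}=m_k+1$, $\sigma_{k+N}=\sigma_k+1$ and, choosing the origin suitably (without loss of generality), $m_{-1}<0<\sigma_0<m_0<\dots<\sigma_{N-1}<m_{N-1}<1<\sigma_N$. For a local minimum $m$ put $\pi_1(\{m\})=\frac1{a(m)}\sqrt{\frac{2\pi}{S''(m)}}$. Level $1$: $\widetilde{\mathcal M}_1(k)=\{m_k\}$, $k\in\mathbb Z$, $\mathfrak u_1=N$. At level $q\ge1$ one has a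 family $\widetilde{\mathcal S}_q=\{\widetilde{\mathcal M}_q(k):k\in\mathbb Z\}$ of disjoint nonempty finite sets of local minima of $S$, ordered ($x<y$ for $x\in\widetilde{\mathcal M}_q(k)$, $y\in\widetilde{\mathcal M}_q(k+1)$), with $S$ constant on each $\widetilde{\mathcal M}_q(k)$ (common value $S(\widetilde{\mathcal M}_q(k))$), and $\widetilde{\mathcal M}_q(k+\mathfrak u_q)=\widetilde{\mathcal M}_q(k)+1$ where $\mathfrak u_q\ge1$ is the number of these sets up to integer translation. Let $m^-_{q,k}=\min\widetilde{\mathcal M}_q(k)$, $m^+_{q,k}=\max\widetilde{\mathcal M}_q(k)$; let $W^{(q)}_{k,k+1}$ be the set of points where $S$ attains its maximum on $[m^+_{q,k},m^-_{q,k+1}]$, and $S(W^{(q)}_{k,k+1})$ that maximum. Define $h^{q,+}_k=S(W^{(q)}_{k,k+1})-S(\widetilde{\mathcal M}_q(k))$, $h^{q,-}_k=S(W^{(q)}_{k-1,k})-S(\widetilde{\mathcal M}_q(k))$, $\mathfrak h_q=\min_{k\in\mathbb Z}\min\{h^{q,-}_k,h^{q,+}_k\}$, $\theta^{(q)}_\epsilon=e^{\mathfrak h_q/\epsilon}$, $\pi_q(k)=\sum_{m\in\widetilde{\mathcal M}_q(k)}\pi_1(\{m\})$, $\sigma_q(k,k+1)=\sum_{\sigma\in W^{(q)}_{k,k+1}}\sqrt{\frac{2\pi}{-S''(\sigma)}}$, and jump rates $R_q(k,k+1)=\frac{\mathbf 1\{h^{q,+}_k=\mathfrak h_q\}}{\pi_q(k)\sigma_q(k,k+1)}$,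 $R_q(k,k-1)=\frac{\mathbf 1\{h^{q,-}_k=\mathfrak h_q\}}{\pi_q(k)\sigma_q(k-1,k)}$. $\mathbb X_q$ is the continuous-time Markov chain on $\widetilde{\mathcal S}_q$ jumping from $\widetilde{\mathcal M}_q(k)$ to $\widetilde{\mathcal M}_q(k\pm1)$ at rate $R_q(k,k\pm1)$ (no other jumps). Recursion: if $\mathbb X_q$ has two or more closed irreducible classes (absorbing states count as such), the sets of level $q+1$ are the unions $\bigcup_{\widetilde{\mathcal M}\in\mathfrak R}\widetilde{\mathcal M}$, one for each closed irreducible class $\mathfrak R$ of $\mathbb X_q$, labelled increasingly by $\mathbb Z$ so that $\widetilde{\mathcal M}_{q+1}(0)$ contains the smallest nonnegative element of their union. (It is known that the stated structural properties persist from level to level.) The recursion stops at the first level $\mathfrak q$ at which $\mathbb X_{\mathfrak q}$ has one or no closed irreducible class. Projection: $\Pi(x)=x-\lfloor x\rfloor$, $\mathcal M_q(k)=\Pi(\widetilde{\mathcal M}_q(k))\subset\mathbb T$, $\mathcal S_q=\{\mathcal M_q(k):0\le k<\mathfrak u_q\}$. $\widehat{\mathbb X}_q=\Pi(\mathbb X_q)$ is the Markov chain on $\mathcal S_q$ with generator $(\widehat{\mathbb L}_qf)(\mathcal M_q(k))=\sum_{c=\pm1}R_q(k,k+c)[f(\mathcal M_q(k+c))-f(\mathcal M_q(k))]$ (indices modulo $\mathfrak u_q$). $\widehat{\mathfrak q}$ is the first integer $p\ge1$ such that $\widehat{\mathbb X}_p$ has a unique closed irreducible class; $\widehat{\mathfrak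 q}\le\mathfrak q$. For $\omega\in\mathcal P(\mathcal S_p)$, $\mathbb I^{(p)}(\omega)=\sup_H-\sum_{\mathcal M\in\mathcal S_p}\frac{(\widehat{\mathbb L}_pH)(\mathcal M)}{H(\mathcal M)}\omega(\mathcal M)$, over all $H:\mathcal S_p\to(0,\infty)$. $\mu^p_{\mathcal M_p(k)}=\frac1{\pi_p(k)}\sum_{m\in\widetilde{\mathcal M}_p(k)}\pi_1(\{m\})\,\delta_{\Pi(m)}\in\mathcal P(\mathbb T)$. $J^{(p)}(\mu)=\mathbb I^{(p)}(\omega)$ if $\mu=\sum_{\mathcal M\in\mathcal S_p}\omega(\mathcal M)\mu^p_{\mathcal M}$ for some $\omega\in\mathcal P(\mathcal S_p)$, and $J^{(p)}(\mu)=+\infty$ otherwise. WELLS. For $x\in\mathbb R$, $r>0$, $N(x,r)$ is the connected component of $\{y\in\mathbb R:S(y)<S(x)+r\}$ containing $x$ and $B(x,r)$ the open ball of radius $r$. Fix $\hat r>0$ with $B(m_k,\hat r)\subsetneq(0,1)$ for $0\le k\le N-1$. For $0<r<\mathfrak h_1\wedge\hat r$ let $\mathcal N_r(m_k)=\Pi(N(m_k,r)\cap B(m_k,r))$, $0\le k\le N-1$. Fix $0<r_0<\frac12(\mathfrak h_1\wedge\hat r)$ and $r\in(2r_0,\mathfrak h_1\wedge\hat r)$. For $0\le k<\mathfrak u_{\widehat{\mathfrak q}}$ let $\mathcal E(k)$, resp. $\mathcal N(k)$, be the union of the sets $\mathcal N_{r_0}(m)$, resp. $\mathcal N_r(m)$,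 over the minima $m$ (identified with points of $\mathbb T$) in $\mathcal M_{\widehat{\mathfrak q}}(k)$, and let $\zeta^k:\mathbb T\to\mathbb R$ be a smooth function with $\mathbf 1_{\mathcal E(k)}\le\zeta^k\le\mathbf 1_{\mathcal N(k)}$. TILTED DIFFUSION. Given strictly positive $\omega\in\mathcal P(\mathcal S_{\widehat{\mathfrak q}})$, let $\widehat h:\mathcal S_{\widehat{\mathfrak q}}\to(0,\infty)$ be an optimizer, unique up to a multiplicative constant, of the variational problem for $\mathbb I^{(\widehat{\mathfrak q})}(\omega)$: $\mathbb I^{(\widehat{\mathfrak q})}(\omega)=-\sum_{\mathcal M}\frac{(\widehat{\mathbb L}_{\widehat{\mathfrak q}}\widehat h)(\mathcal M)}{\widehat h(\mathcal M)}\omega(\mathcal M)$. Fix $\lambda>0$ and let $\phi_\epsilon\in C^2(\mathbb T)$ be the unique solution of $$(\lambda-\theta^{(\widehat{\mathfrak q})}_\epsilon L_\epsilon)\phi_\epsilon=\sum_{0\le k<\mathfrak u_{\widehat{\mathfrak q}}}[(\lambda-\widehat{\mathbb L}_{\widehat{\mathfrak q}})\widehat h](\mathcal M_{\widehat{\mathfrak q}}(k))\,\zeta^k .$$ For $\epsilon$ small enough $\phi_\epsilon$ is strictly positive (bounded below by a positive constant uniformly in small $\epsilon$). The tilted generator is $$(L_{\widehat{\mathfrak q},\epsilon}F)(x)=\Big\{b(x)+2\epsilon\,a(x)\frac{\phi_\epsilon'(x)}{\phi_\epsilon(x)}\Big\}F'(x)+\epsilon\,a(x)F''(x),$$ and $\mu_{\widehat{\mathfrak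 q},\epsilon}\in\mathcal P(\mathbb T)$ is its unique stationary state. *)

theory Defs
  imports "HOL-Probability.Probability"
begin

section \<open>Functions and measures on the torus\<close>

text \<open>
  The torus is the set \<open>{0..<1}\<close>. Functions on it are represented by their 1-periodic
  extensions to the real line, so that regularity across the point 0 is accounted for. The Borel
  sets of the circle are the Borel subsets of \<open>{0..<1}\<close>; the projection of the line onto the
  torus is \<^const>\<open>frac\<close>.
\<close>

definition periodic1 :: "(real \<Rightarrow> real) \<Rightarrow> bool" where
  "periodic1 f \<longleftrightarrow> (\<forall>x. f (x + 1) = f x)"

definition C2_torus :: "(real \<Rightarrow> real) set" where
  "C2_torus = {f. periodic1 f \<and> f differentiable_on UNIV \<and> deriv f differentiable_on UNIV
      \<and> continuous_on UNIV (deriv (deriv f))}"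

definition smooth_torus :: "(real \<Rightarrow> real) set" where
  "smooth_torus = {f. periodic1 f \<and> (\<forall>n. (deriv ^^ n) f differentiable_on UNIV)}"

definition torus_borel :: "real measure" where
  "torus_borel = restrict_space borel {0..<1}"

definition torus_probs :: "real measure set" where
  "torus_probs = {\<mu>. prob_space \<mu> \<and> sets \<mu> = sets torus_borel}"

definition mixture :: "'i set \<Rightarrow> ('i \<Rightarrow> real) \<Rightarrow> ('i \<Rightarrow> real measure) \<Rightarrow> real measure" where
  "mixture I w \<nu> = measure_of (space torus_borel) (sets torus_borel)
      (\<lambda>E. \<Sum>i\<in>I. ennreal (w i) * emeasure (\<nu> i) E)"


section \<open>The diffusion and its level two rate functional\<close>

definition diffusion_gen ::
  "(real \<Rightarrow> real) \<Rightarrow> (real \<Rightarrow> real) \<Rightarrow> real \<Rightarrow> (real \<Rightarrow> real) \<Rightarrow> real \<Rightarrow> real" where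
  "diffusion_gen a b \<epsilon> f x = b x * deriv f x + \<epsilon> * a x * deriv (deriv f) x"

definition rate_functional ::
  "(real \<Rightarrow> real) \<Rightarrow> (real \<Rightarrow> real) \<Rightarrow> real \<Rightarrow> real measure \<Rightarrow> ereal" where
  "rate_functional a b \<epsilon> \<mu> =
     (SUP u \<in> {u \<in> C2_torus. \<forall>x. u x > 0}.
        ereal (- (\<integral>x. diffusion_gen a b \<epsilon> u x / u x \<partial>\<mu>)))"

definition tilted_gen ::
  "(real \<Rightarrow> real) \<Rightarrow> (real \<Rightarrow> real) \<Rightarrow> (real \<Rightarrow> real) \<Rightarrow> real \<Rightarrow> (real \<Rightarrow> real) \<Rightarrow> real \<Rightarrow> real" where
  "tilted_gen a b \<phi> \<epsilon> F x =
     (b x + 2 * \<epsilon> * a x * (deriv \<phi> x / \<phi> x)) * deriv F x + \<epsilon> * a x * deriv (deriv F) x"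

text \<open>Stationarity is expressed through the generator, on the domain of class \<open>C\<^sup>2\<close> functions.\<close>

definition stationary_state ::
  "((real \<Rightarrow> real) \<Rightarrow> real \<Rightarrow> real) \<Rightarrow> real measure \<Rightarrow> bool" where
  "stationary_state L \<mu> \<longleftrightarrow> \<mu> \<in> torus_probs \<and> (\<forall>F \<in> C2_torus. (\<integral>x. L F x \<partial>\<mu>) = 0)"


section \<open>The potential and the standing assumptions\<close>

text \<open>The interval integral is oriented, so the formula is also the intended one for negative
  arguments.\<close>

definition potential :: "(real \<Rightarrow> real) \<Rightarrow> (real \<Rightarrow> real) \<Rightarrow> real \<Rightarrow> real" where
  "potential a b x = - (LBINT z=0..x. b z / a z)"

definition circulation :: "(real \<Rightarrow> real) \<Rightarrow> (real \<Rightarrow> real) \<Rightarrow> real" where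
  "circulation a b = (LBINT x=0..1. b x / a x)"

locale torus_setting =
  fixes a b :: "real \<Rightarrow> real" and c\<^sub>0 :: real and N :: nat and m \<sigma> :: "int \<Rightarrow> real"
  assumes a_C2: "a \<in> C2_torus"
    and b_C2: "b \<in> C2_torus"
    and c0_pos: "c\<^sub>0 > 0"
    and a_lower: "\<And>x. a x \<ge> c\<^sub>0"
    and N_pos: "N \<ge> 1"
    and finite_zeros: "finite {x \<in> {0..<1}. b x = 0}"
    and card_zeros: "card {x \<in> {0..<1}. b x = 0} = 2 * N"
    and nondegenerate: "\<And>x. b x = 0 \<Longrightarrow> deriv b x \<noteq> 0"
    and circulation_nonneg: "circulation a b \<ge> 0"
    and minima: "range m = {x. b x = 0 \<and> deriv b x < 0}"
    and maxima: "range \<sigma> = {x. b x = 0 \<and> deriv b x > 0}"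
    and m_shift: "\<And>k. m (k + int N) = m k + 1"
    and \<sigma>_shift: "\<And>k. \<sigma> (k + int N) = \<sigma> k + 1"
    and interlaced: "\<And>k. \<sigma> k < m k \<and> m k < \<sigma> (k + 1)"
    and origin: "m (-1) < 0" "0 < \<sigma> 0" "m (int N - 1) < 1" "1 < \<sigma> (int N)"


section \<open>One level of the hierarchy\<close>

text \<open>
  A level is a family \<open>M :: int \<Rightarrow> real set\<close> of sets of local minima on the line; the quantities
  below are attached to such a family. \<open>potential_on\<close> is only used for sets on which the
  potential is constant.
\<close>

definition potential_on :: "(real \<Rightarrow> real) \<Rightarrow> (real \<Rightarrow> real) \<Rightarrow> real set \<Rightarrow> real" where
  "potential_on a b A = the_elem (potential a b ` A)"

definition gates ::
  "(real \<Rightarrow> real) \<Rightarrow> (real \<Rightarrow> real) \<Rightarrow> (int \<Rightarrow> real set) \<Rightarrow> int \<Rightarrow> real set" where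
  "gates a b M k =
     {x \<in> {Max (M k)..Min (M (k + 1))}.
        \<forall>y \<in> {Max (M k)..Min (M (k + 1))}. potential a b y \<le> potential a b x}"

definition height_right ::
  "(real \<Rightarrow> real) \<Rightarrow> (real \<Rightarrow> real) \<Rightarrow> (int \<Rightarrow> real set) \<Rightarrow> int \<Rightarrow> real" where
  "height_right a b M k = potential_on a b (gates a b M k) - potential_on a b (M k)"

definition height_left ::
  "(real \<Rightarrow> real) \<Rightarrow> (real \<Rightarrow> real) \<Rightarrow> (int \<Rightarrow> real set) \<Rightarrow> int \<Rightarrow> real" where
  "height_left a b M k = potential_on a b (gates a b M (k - 1)) - potential_on a b (M k)"

text \<open>The infimum is a minimum, since the heights are periodic in \<open>k\<close>.\<close>

definition depth :: "(real \<Rightarrow> real) \<Rightarrow> (real \<Rightarrow> real) \<Rightarrow> (int \<Rightarrow> real set) \<Rightarrow> real" where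
  "depth a b M = (INF k. min (height_left a b M k) (height_right a b M k))"

definition time_scale ::
  "(real \<Rightarrow> real) \<Rightarrow> (real \<Rightarrow> real) \<Rightarrow> (int \<Rightarrow> real set) \<Rightarrow> real \<Rightarrow> real" where
  "time_scale a b M \<epsilon> = exp (depth a b M / \<epsilon>)"

definition minimum_weight :: "(real \<Rightarrow> real) \<Rightarrow> (real \<Rightarrow> real) \<Rightarrow> real \<Rightarrow> real" where
  "minimum_weight a b x = 1 / a x * sqrt (2 * pi / deriv (deriv (potential a b)) x)"

definition well_weight ::
  "(real \<Rightarrow> real) \<Rightarrow> (real \<Rightarrow> real) \<Rightarrow> (int \<Rightarrow> real set) \<Rightarrow> int \<Rightarrow> real" where
  "well_weight a b M k = (\<Sum>x \<in> M k. minimum_weight a b x)"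

definition gate_weight ::
  "(real \<Rightarrow> real) \<Rightarrow> (real \<Rightarrow> real) \<Rightarrow> (int \<Rightarrow> real set) \<Rightarrow> int \<Rightarrow> real" where
  "gate_weight a b M k =
     (\<Sum>x \<in> gates a b M k. sqrt (2 * pi / (- deriv (deriv (potential a b)) x)))"

definition jump_rate ::
  "(real \<Rightarrow> real) \<Rightarrow> (real \<Rightarrow> real) \<Rightarrow> (int \<Rightarrow> real set) \<Rightarrow> int \<Rightarrow> int \<Rightarrow> real" where
  "jump_rate a b M k j =
     (if j = k + 1 then
        (if height_right a b M k = depth a b M
         then 1 / (well_weight a b M k * gate_weight a b M k) else 0)
      else if j = k - 1 then
        (if height_left a b M k = depth a b M
         then 1 / (well_weight a b M k * gate_weight a b M (k - 1)) else 0)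
      else 0)"

text \<open>The chain on the family \<open>M\<close> is described on the labels \<open>k\<close>; only its graph of possible
  jumps matters for the closed irreducible classes.\<close>

definition jumps :: "(real \<Rightarrow> real) \<Rightarrow> (real \<Rightarrow> real) \<Rightarrow> (int \<Rightarrow> real set) \<Rightarrow> (int \<times> int) set" where
  "jumps a b M = {(k, j). jump_rate a b M k j > 0}"

definition closed_irreducible :: "'s set \<Rightarrow> ('s \<times> 's) set \<Rightarrow> 's set \<Rightarrow> bool" where
  "closed_irreducible V E C \<longleftrightarrow> C \<noteq> {} \<and> C \<subseteq> V
     \<and> (\<forall>x\<in>C. \<forall>y\<in>C. (x, y) \<in> E\<^sup>*) \<and> (\<forall>x\<in>C. \<forall>y. (x, y) \<in> E \<longrightarrow> y \<in> C)"


section \<open>The recursion over levels\<close>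

definition increasing_labelling :: "real set set \<Rightarrow> (int \<Rightarrow> real set) \<Rightarrow> bool" where
  "increasing_labelling \<F> M \<longleftrightarrow> range M = \<F>
     \<and> (\<forall>k. \<forall>x \<in> M k. \<forall>y \<in> M (k + 1). x < y)
     \<and> (\<exists>x \<in> M 0. 0 \<le> x \<and> (\<forall>y \<in> \<Union>\<F>. 0 \<le> y \<longrightarrow> x \<le> y))"

text \<open>Once the recursion has stopped, the last family is repeated.\<close>

definition next_level ::
  "(real \<Rightarrow> real) \<Rightarrow> (real \<Rightarrow> real) \<Rightarrow> (int \<Rightarrow> real set) \<Rightarrow> int \<Rightarrow> real set" where
  "next_level a b M =
     (let \<C> = Collect (closed_irreducible UNIV (jumps a b M)) in
      if \<exists>C\<in>\<C>. \<exists>C'\<in>\<C>. C \<noteq> C'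
      then (THE M'. increasing_labelling ((\<lambda>C. \<Union> (M ` C)) ` \<C>) M')
      else M)"

text \<open>Levels are counted from 1.\<close>

definition level ::
  "(real \<Rightarrow> real) \<Rightarrow> (real \<Rightarrow> real) \<Rightarrow> (int \<Rightarrow> real) \<Rightarrow> nat \<Rightarrow> int \<Rightarrow> real set" where
  "level a b m q = (next_level a b ^^ (q - 1)) (\<lambda>k. {m k})"


section \<open>Projection onto the torus\<close>

text \<open>Number of sets of the family up to integer translations.\<close>

definition num_wells :: "(int \<Rightarrow> real set) \<Rightarrow> nat" where
  "num_wells M = card (range M // {(A, A'). \<exists>n::int. A' = (\<lambda>x. x + of_int n) ` A})"

definition labels :: "(int \<Rightarrow> real set) \<Rightarrow> int set" where
  "labels M = {0..<int (num_wells M)}"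

definition proj :: "(int \<Rightarrow> real set) \<Rightarrow> int \<Rightarrow> real set" where
  "proj M k = frac ` M k"

definition states :: "(int \<Rightarrow> real set) \<Rightarrow> real set set" where
  "states M = proj M ` labels M"

text \<open>
  Reduction of labels modulo \<open>num_wells M\<close> is automatic, because \<open>proj M\<close> is periodic
  with that period.
\<close>

definition proj_gen ::
  "(real \<Rightarrow> real) \<Rightarrow> (real \<Rightarrow> real) \<Rightarrow> (int \<Rightarrow> real set) \<Rightarrow> (real set \<Rightarrow> real) \<Rightarrow> int \<Rightarrow> real" where
  "proj_gen a b M f k =
     (\<Sum>c \<in> {1, -1}. jump_rate a b M k (k + c) * (f (proj M (k + c)) - f (proj M k)))"

definition proj_jumps ::
  "(real \<Rightarrow> real) \<Rightarrow> (real \<Rightarrow> real) \<Rightarrow> (int \<Rightarrow> real set) \<Rightarrow> (real set \<times> real set) set" where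
  "proj_jumps a b M = map_prod (proj M) (proj M) ` jumps a b M"

definition q_hat :: "(real \<Rightarrow> real) \<Rightarrow> (real \<Rightarrow> real) \<Rightarrow> (int \<Rightarrow> real) \<Rightarrow> nat" where
  "q_hat a b m = (LEAST p. p \<ge> 1 \<and>
     (\<exists>!C. closed_irreducible (states (level a b m p)) (proj_jumps a b (level a b m p)) C))"

definition state_probs :: "(int \<Rightarrow> real set) \<Rightarrow> real set pmf set" where
  "state_probs M = {\<omega>. set_pmf \<omega> \<subseteq> states M}"

definition chain_functional ::
  "(real \<Rightarrow> real) \<Rightarrow> (real \<Rightarrow> real) \<Rightarrow> (int \<Rightarrow> real set) \<Rightarrow> real set pmf \<Rightarrow> (real set \<Rightarrow> real) \<Rightarrow> real"
where
  "chain_functional a b M \<omega> H =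
     - (\<Sum>k \<in> labels M. proj_gen a b M H k / H (proj M k) * pmf \<omega> (proj M k))"

definition chain_rate ::
  "(real \<Rightarrow> real) \<Rightarrow> (real \<Rightarrow> real) \<Rightarrow> (int \<Rightarrow> real set) \<Rightarrow> real set pmf \<Rightarrow> ereal" where
  "chain_rate a b M \<omega> =
     (SUP H \<in> {H. \<forall>A \<in> states M. H A > 0}. ereal (chain_functional a b M \<omega> H))"

definition well_measure ::
  "(real \<Rightarrow> real) \<Rightarrow> (real \<Rightarrow> real) \<Rightarrow> (int \<Rightarrow> real set) \<Rightarrow> int \<Rightarrow> real measure" where
  "well_measure a b M k =
     mixture (M k) (\<lambda>x. minimum_weight a b x / well_weight a b M k)
       (\<lambda>x. return torus_borel (frac x))"

definition state_mixture ::
  "(real \<Rightarrow> real) \<Rightarrow> (real \<Rightarrow> real) \<Rightarrow> (int \<Rightarrow> real set) \<Rightarrow> real set pmf \<Rightarrow> real measure" where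
  "state_mixture a b M \<omega> = mixture (labels M) (\<lambda>k. pmf \<omega> (proj M k)) (well_measure a b M)"

definition level_rate ::
  "(real \<Rightarrow> real) \<Rightarrow> (real \<Rightarrow> real) \<Rightarrow> (int \<Rightarrow> real set) \<Rightarrow> real measure \<Rightarrow> ereal" where
  "level_rate a b M \<mu> =
     (if \<exists>\<omega> \<in> state_probs M. \<mu> = state_mixture a b M \<omega>
      then chain_rate a b M (THE \<omega>. \<omega> \<in> state_probs M \<and> \<mu> = state_mixture a b M \<omega>)
      else \<infinity>)"


section \<open>Neighbourhoods of the wells\<close>

definition minimum_nbhd :: "(real \<Rightarrow> real) \<Rightarrow> (real \<Rightarrow> real) \<Rightarrow> real \<Rightarrow> real \<Rightarrow> real set" where
  "minimum_nbhd a b r x =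
     frac ` (connected_component_set {y. potential a b y < potential a b x + r} x \<inter> ball x r)"

text \<open>The union runs over the representatives of the minima in \<open>{0..<1}\<close>.\<close>

definition well_nbhd ::
  "(real \<Rightarrow> real) \<Rightarrow> (real \<Rightarrow> real) \<Rightarrow> (int \<Rightarrow> real set) \<Rightarrow> real \<Rightarrow> int \<Rightarrow> real set" where
  "well_nbhd a b M r k = (\<Union>x \<in> proj M k. minimum_nbhd a b r x)"

end

theory Submission
  imports Defs "HOL-Real_Asymp.Real_Asymp"
begin

text \<open>
  If \<open>\<mu>\<^sub>\<epsilon>\<close> is stationary for the \<open>\<phi>\<^sub>\<epsilon>\<close>-transform of \<open>L\<^sub>\<epsilon>\<close>, then testing stationarity with
  \<open>ln (u / \<phi>\<^sub>\<epsilon>)\<close> shows that \<open>u = \<phi>\<^sub>\<epsilon>\<close> is optimal in \<open>I\<^sub>\<epsilon>(\<mu>\<^sub>\<epsilon>)\<close>. So, for \<open>G\<close> the right-hand side of the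
  resolvent equation, the quantity to control is the integral of \<open>(G - \<lambda> \<phi>\<^sub>\<epsilon>) / \<phi>\<^sub>\<epsilon>\<close> against \<open>\<mu>\<^sub>\<epsilon>\<close>.

  In one dimension \<open>\<theta> L\<^sub>\<epsilon> u = F\<close> integrates explicitly: up to the factor \<open>1 - e\<^bsup>-B/\<epsilon>\<^esup>\<close>, \<open>u'(z)\<close> is the integral
  of \<open>F(y) e\<^bsup>(S(z) - S(y) - H)/\<epsilon>\<^esup> / (\<epsilon> a(y))\<close> over \<open>y\<close> in \<open>[z - 1, z]\<close>. Under (NonRev) the largest
  ascent \<open>S(z) - S(y)\<close>, \<open>y \<le> z\<close>, equals the depth \<open>H\<close>, and it is attained only from minima of the level
  to gates. By Laplace's method \<open>u\<close> is therefore almost constant on each well and jumps at the gates by the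
  increments prescribed by the generator of the limiting chain. Applied to \<open>\<phi>\<^sub>\<epsilon>\<close> this gives convergence to
  \<open>hhat\<close> on the wells; applied to well-chosen \<open>F\<close> it gives test functions for the stationarity of
  \<open>\<mu>\<^sub>\<epsilon>\<close>, which show that the mass of \<open>\<mu>\<^sub>\<epsilon>\<close> in the wells converges to the stationary law of the tilted
  chain. Since \<open>hhat\<close> is optimal, that law is \<open>\<omega>\<close>.

  The recursive construction of the levels enters only through the following description: the sets of a level
  are the classes, for the relation of being joined by a path that climbs at most \<open>h\<close>, of the points
  from which no lower point can be reached by climbing at most \<open>h\<close>; passing to the next level replaces \<open>h\<close>
  by the depth.
\<close>


section \<open>Laplace asymptotics\<close>

text \<open>The obstacle is that the flux across a gate is not determined by the adjacent well
  alone. The exponent \<open>S z - S y - H\<close> vanishes for every minimum upstream of the gate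
  at the same height, so a solution increases over gate \<open>k\<close> by the gate weight times
  the cumulated source \<open>upstream_sum k\<close>. The rates appear only after differencing
  across a well: a left jump from \<open>k\<close> has positive rate exactly when
  \<open>lev (k - 1) = lev k\<close>, and this is exactly when \<open>upstream (k - 1)\<close> is
  part of \<open>upstream k\<close>. The cumulation ends within one turn, because the potential
  drops by \<open>B > 0\<close>.

  The tilted generator is a Doob transform. The natural test functions are therefore
  \<open>v / \<phi> \<epsilon>\<close>, and the natural masses are the integrals of
  \<open>\<zeta> k / \<phi> \<epsilon>\<close>, with limits \<open>\<omega> / hhat\<close>.

  What happens off the wells is controlled by one auxiliary equation, with source
  \<open>outside\<close>. This source vanishes at the minima, so its solution is uniformly small; it
  yields both the positive lower bound of \<phi> and the loss of mass outside the wells.\<close>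

lemma gaussian_integral:
  assumes "\<kappa> > (0::real)"
  shows "(\<integral>t. exp (- (\<kappa> / 2 * t\<^sup>2)) \<partial>lborel) = sqrt (2 * pi / \<kappa>)"
    and "integrable lborel (\<lambda>t::real. exp (- (\<kappa> / 2 * t\<^sup>2)))"
proof -
  have s: "sqrt (1 / \<kappa>) > 0" "(sqrt (1 / \<kappa>))\<^sup>2 = 1 / \<kappa>"
    using assms by (auto simp: less_imp_le)
  have eq: "exp (- (\<kappa> / 2 * t\<^sup>2)) = sqrt (2 * pi / \<kappa>) * normal_density 0 (sqrt (1 / \<kappa>)) t" for t
    using assms by (simp add: normal_density_def real_sqrt_divide real_sqrt_mult field_simps)
  show "(\<integral>t. exp (- (\<kappa> / 2 * t\<^sup>2)) \<partial>lborel) = sqrt (2 * pi / \<kappa>)"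
    unfolding eq using s(1) by (simp add: integral_normal_density)
  show "integrable lborel (\<lambda>t::real. exp (- (\<kappa> / 2 * t\<^sup>2)))"
    unfolding eq using s(1) by (intro integrable_mult_right integrable_normal_density)
qed

text \<open>The quotient \<open>g y / (y - y0)\<^sup>2\<close>, completed by
  \<open>\<kappa> / 2\<close> at \<open>y0\<close>, is continuous and positive on a compact
  interval, so its minimum serves as \<gamma>. It supplies the Gaussian majorant for Laplace's
  method.\<close>

lemma quadratic_lower_bound:
  fixes g :: "real \<Rightarrow> real"
  assumes "continuous_on {p..q} g" and "\<And>y. y \<in> {p..q} \<Longrightarrow> y \<noteq> y0 \<Longrightarrow> g y > 0"
    and lim: "((\<lambda>y. g y / (y - y0)\<^sup>2) \<longlongrightarrow> \<kappa> / 2) (at y0)" and "\<kappa> > 0" "g y0 = 0"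
  obtains \<gamma> where "\<gamma> > 0" "\<And>y. y \<in> {p..q} \<Longrightarrow> g y \<ge> \<gamma> * (y - y0)\<^sup>2"
proof -
  define G where "G y = (if y = y0 then \<kappa> / 2 else g y / (y - y0)\<^sup>2)" for y
  have "continuous_on {p..q} G"
    unfolding continuous_on_eq_continuous_within
  proof
    fix y assume y: "y \<in> {p..q}"
    show "continuous (at y within {p..q}) G"
    proof (cases "y = y0")
      case True
      have "(G \<longlongrightarrow> \<kappa> / 2) (at y0)"
        using lim by (rule Lim_transform_eventually) (auto simp: G_def eventually_at_filter)
      then have "(G \<longlongrightarrow> G y0) (at y0 within {p..q})"
        by (simp add: G_def) (rule tendsto_within_subset, auto)
      then show ?thesis using True by (simp add: continuous_within)
    next
      case False
      have "continuous (at y within {p..q}) (\<lambda>y. g y / (y - y0)\<^sup>2)"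
        using assms(1) y False
        by (intro continuous_intros) (auto simp: continuous_on_eq_continuous_within)
      moreover have "\<forall>\<^sub>F z in at y within {p..q}. z \<noteq> y0"
        using eventually_neq_at_within[of y0 y "{p..q}"] by simp
      then have "\<forall>\<^sub>F z in at y within {p..q}. g z / (z - y0)\<^sup>2 = G z"
        by eventually_elim (simp add: G_def)
      ultimately show ?thesis
        using False unfolding continuous_within
        by (simp add: G_def[of y]) (rule Lim_transform_eventually, auto)
    qed
  qed
  then have "\<exists>\<gamma>>0. \<forall>y\<in>{p..q}. \<gamma> \<le> G y"
  proof (cases "{p..q} = {}")
    case False
    assume c: "continuous_on {p..q} G"
    obtain y1 where y1: "y1 \<in> {p..q}" "\<forall>y\<in>{p..q}. G y1 \<le> G y"
      using continuous_attains_inf[OF _ False c] by auto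
    have "G y1 > 0" using assms(2)[of y1] y1(1) \<open>\<kappa> > 0\<close> by (auto simp: G_def)
    with y1 show ?thesis by blast
  qed (auto intro: exI[of _ 1])
  then obtain \<gamma> where \<gamma>: "\<gamma> > 0" "\<forall>y\<in>{p..q}. \<gamma> \<le> G y" by blast
  show thesis
  proof (rule that[OF \<gamma>(1)])
    fix y assume y: "y \<in> {p..q}"
    show "g y \<ge> \<gamma> * (y - y0)\<^sup>2"
      using \<gamma>(2)[rule_format, OF y] assms(5)
      by (cases "y = y0") (auto simp: G_def field_simps)
  qed
qed

text \<open>The substitution \<open>y = y0 + sqrt \<epsilon> * t\<close> makes the exponent converge
  to \<open>- \<kappa> / 2 * t\<^sup>2\<close>; \<open>quadratic_lower_bound\<close> then permits
  dominated convergence.\<close>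

lemma laplace_single:
  fixes g w :: "real \<Rightarrow> real"
  assumes y0: "p < y0" "y0 < q" and g: "continuous_on {p..q} g" and w: "continuous_on {p..q} w"
    and pos: "\<And>y. y \<in> {p..q} \<Longrightarrow> y \<noteq> y0 \<Longrightarrow> g y > 0" and g0: "g y0 = 0"
    and lim: "((\<lambda>y. g y / (y - y0)\<^sup>2) \<longlongrightarrow> \<kappa> / 2) (at y0)" and \<kappa>: "\<kappa> > 0"
  shows "((\<lambda>\<epsilon>. integral {p..q} (\<lambda>y. w y * exp (- g y / \<epsilon>)) / sqrt \<epsilon>) \<longlongrightarrow> w y0 * sqrt (2 * pi / \<kappa>))
    (at_right 0)"
\<comment> \<open>Dominated convergence is used for sequences, so \<epsilon> runs through a sequence
  tending to 0 from the right.\<close>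
proof (rule tendsto_at_right_sequentially[of 0 1])
  fix e :: "nat \<Rightarrow> real"
  assume e: "\<And>n. 0 < e n" and e0: "e \<longlonglongrightarrow> 0"
  obtain \<gamma> where \<gamma>: "\<gamma> > 0" "\<And>y. y \<in> {p..q} \<Longrightarrow> g y \<ge> \<gamma> * (y - y0)\<^sup>2"
    using quadratic_lower_bound[OF g pos lim \<kappa> g0] by blast
  obtain C where C: "C > 0" "\<And>y. y \<in> {p..q} \<Longrightarrow> \<bar>w y\<bar> \<le> C"
    using compact_imp_bounded[OF compact_continuous_image[OF w compact_Icc]]
    unfolding bounded_pos by (auto simp: image_iff)
  define W where "W y = (if y \<in> {p..q} then w y else 0)" for y
  define Gg where "Gg y = (if y \<in> {p..q} then g y else 0)" for y
  \<comment> \<open>The integrand after the substitution; the Jacobian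
    \<open>sqrt \<epsilon>\<close> cancels the denominator in the claim. \<open>W\<close> and
    \<open>Gg\<close> extend the data by 0 so that everything is measurable on the whole
    line.\<close>
  define f where "f \<epsilon> t = indicator {p..q} (y0 + sqrt \<epsilon> * t) *\<^sub>R (W (y0 + sqrt \<epsilon> * t) * exp (- Gg (y0 + sqrt \<epsilon> * t) / \<epsilon>))" for \<epsilon> t
  have "W = (\<lambda>y. indicator {p..q} y *\<^sub>R w y)" "Gg = (\<lambda>y. indicator {p..q} y *\<^sub>R g y)"
    by (auto simp: W_def Gg_def)
  then have W_m: "W \<in> borel_measurable borel" and G_m: "Gg \<in> borel_measurable borel"
    using g w by (auto intro!: borel_measurable_continuous_on_indicator simp del: real_scaleR_def)
  have f_m: "f \<epsilon> \<in> borel_measurable lborel" for \<epsilon>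
    unfolding f_def using W_m G_m by measurable
  have conv: "integral {p..q} (\<lambda>y. w y * exp (- g y / \<epsilon>)) / sqrt \<epsilon> = (\<integral>t. f \<epsilon> t \<partial>lborel)" if "\<epsilon> > 0" for \<epsilon>
  proof -
    have c: "continuous_on {p..q} (\<lambda>y. w y * exp (- g y / \<epsilon>))"
      using that by (intro continuous_intros w g) auto
    have "integral {p..q} (\<lambda>y. w y * exp (- g y / \<epsilon>)) = (LINT y:{p..q}|lborel. w y * exp (- g y / \<epsilon>))"
      using set_borel_integral_eq_integral(2)[OF borel_integrable_atLeastAtMost'[OF c]] by simp
    also have "\<dots> = (\<integral>y. indicator {p..q} y *\<^sub>R (W y * exp (- Gg y / \<epsilon>)) \<partial>lborel)"
      unfolding set_lebesgue_integral_def W_def Gg_def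
      by (intro Bochner_Integration.integral_cong) (auto simp: indicator_def)
    also have "\<dots> = \<bar>sqrt \<epsilon>\<bar> *\<^sub>R (\<integral>t. f \<epsilon> t \<partial>lborel)"
      unfolding f_def using that
      by (intro lborel_integral_real_affine[where t=y0 and c="sqrt \<epsilon>"]) auto
    finally show ?thesis using that by simp
  qed
  have se: "(\<lambda>n. sqrt (e n)) \<longlonglongrightarrow> 0" using tendsto_real_sqrt[OF e0] by simp
  have "(\<lambda>n. \<integral>t. f (e n) t \<partial>lborel) \<longlonglongrightarrow> (\<integral>t. w y0 * exp (- (\<kappa> / 2 * t\<^sup>2)) \<partial>lborel)"
  proof (rule integral_dominated_convergence[where w = "\<lambda>t. C * exp (- (2 * \<gamma> / 2 * t\<^sup>2))"])
    show "(\<lambda>t. w y0 * exp (- (\<kappa> / 2 * t\<^sup>2))) \<in> borel_measurable lborel" by measurable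
    show "f (e n) \<in> borel_measurable lborel" for n by (rule f_m)
    show "integrable lborel (\<lambda>t. C * exp (- (2 * \<gamma> / 2 * t\<^sup>2)))"
      using gaussian_integral(2)[of "2 * \<gamma>"] \<gamma>(1) by (intro integrable_mult_right) auto
    show "AE t in lborel. norm (f (e n) t) \<le> C * exp (- (2 * \<gamma> / 2 * t\<^sup>2))" for n
    proof (rule AE_I2)
      fix t
      show "norm (f (e n) t) \<le> C * exp (- (2 * \<gamma> / 2 * t\<^sup>2))"
      proof (cases "y0 + sqrt (e n) * t \<in> {p..q}")
        case True
        have "g (y0 + sqrt (e n) * t) \<ge> \<gamma> * (e n * t\<^sup>2)"
          using \<gamma>(2)[OF True] e[of n] by (simp add: power_mult_distrib less_imp_le)
        then have "- g (y0 + sqrt (e n) * t) / e n \<le> - (2 * \<gamma> / 2 * t\<^sup>2)"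
          using e[of n] by (simp add: field_simps)
        then have "\<bar>w (y0 + sqrt (e n) * t)\<bar> * exp (- g (y0 + sqrt (e n) * t) / e n) \<le> C * exp (- (2 * \<gamma> / 2 * t\<^sup>2))"
          using C(2)[OF True] C(1) by (intro mult_mono) auto
        then show ?thesis using True by (simp add: f_def W_def Gg_def abs_mult)
      qed (use C(1) in \<open>simp add: f_def\<close>)
    qed
    show "AE t in lborel. (\<lambda>n. f (e n) t) \<longlonglongrightarrow> w y0 * exp (- (\<kappa> / 2 * t\<^sup>2))"
    proof (rule AE_I2)
      fix t :: real
      have y: "(\<lambda>n. y0 + sqrt (e n) * t) \<longlonglongrightarrow> y0"
        using tendsto_add[OF tendsto_const tendsto_mult[OF se tendsto_const]] by force
      have ev: "\<forall>\<^sub>F n in sequentially. y0 + sqrt (e n) * t \<in> {p<..<q}"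
        using topological_tendstoD[OF y, of "{p<..<q}"] y0 by auto
      have iw: "isCont w y0" using w y0 by (intro continuous_on_interior[OF w]) auto
      have wl: "(\<lambda>n. w (y0 + sqrt (e n) * t)) \<longlonglongrightarrow> w y0"
        using isCont_tendsto_compose[OF iw y] .
      have gl: "(\<lambda>n. g (y0 + sqrt (e n) * t) / e n) \<longlonglongrightarrow> \<kappa> / 2 * t\<^sup>2"
      proof (cases "t = 0")
        case False
        have "filterlim (\<lambda>n. y0 + sqrt (e n) * t) (at y0) sequentially"
          using y False e by (intro filterlim_atI) (auto simp: less_imp_neq[symmetric])
        then have "(\<lambda>n. g (y0 + sqrt (e n) * t) / (y0 + sqrt (e n) * t - y0)\<^sup>2 * t\<^sup>2) \<longlonglongrightarrow> \<kappa> / 2 * t\<^sup>2"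
          by (intro tendsto_mult tendsto_const filterlim_compose[OF lim])
        moreover have "g (y0 + sqrt (e n) * t) / (y0 + sqrt (e n) * t - y0)\<^sup>2 * t\<^sup>2 = g (y0 + sqrt (e n) * t) / e n" for n
          using e[of n] False by (simp add: power_mult_distrib less_imp_le)
        ultimately show ?thesis by simp
      qed (simp add: g0)
      have "(\<lambda>n. w (y0 + sqrt (e n) * t) * exp (- (g (y0 + sqrt (e n) * t) / e n))) \<longlonglongrightarrow> w y0 * exp (- (\<kappa> / 2 * t\<^sup>2))"
        by (intro tendsto_intros wl gl)
      then show "(\<lambda>n. f (e n) t) \<longlonglongrightarrow> w y0 * exp (- (\<kappa> / 2 * t\<^sup>2))"
        by (rule Lim_transform_eventually)
           (use ev in eventually_elim, auto simp: f_def W_def Gg_def)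
    qed
  qed
  moreover have "(\<integral>t. w y0 * exp (- (\<kappa> / 2 * t\<^sup>2)) \<partial>lborel) = w y0 * sqrt (2 * pi / \<kappa>)"
    using gaussian_integral[OF \<kappa>] by simp
  ultimately show "(\<lambda>n. integral {p..q} (\<lambda>y. w y * exp (- g y / e n)) / sqrt (e n)) \<longlonglongrightarrow> w y0 * sqrt (2 * pi / \<kappa>)"
    by (simp only: conv[OF e])
qed simp

lemma exp_over_power_limit:
  fixes \<eta> :: real assumes "\<eta> > 0"
  shows "((\<lambda>\<epsilon>. exp (- \<eta> / \<epsilon>) / \<epsilon>) \<longlongrightarrow> 0) (at_right 0)"
    and "((\<lambda>\<epsilon>. exp (- \<eta> / \<epsilon>) / sqrt \<epsilon>) \<longlongrightarrow> 0) (at_right 0)"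
    and "((\<lambda>\<epsilon>. exp (- \<eta> / \<epsilon>)) \<longlongrightarrow> 0) (at_right 0)"
  using assms by real_asymp+

lemma laplace_none:
  fixes g w :: "real \<Rightarrow> real"
  assumes g: "continuous_on {p..q} g" and w: "continuous_on {p..q} w"
    and pos: "\<And>y. y \<in> {p..q} \<Longrightarrow> g y > 0"
  shows "((\<lambda>\<epsilon>. integral {p..q} (\<lambda>y. w y * exp (- g y / \<epsilon>)) / sqrt \<epsilon>) \<longlongrightarrow> 0) (at_right 0)"
proof (cases "p \<le> q")
  case True
  obtain C where C: "C > 0" "\<And>y. y \<in> {p..q} \<Longrightarrow> \<bar>w y\<bar> \<le> C"
    using compact_imp_bounded[OF compact_continuous_image[OF w compact_Icc]]
    unfolding bounded_pos by (auto simp: image_iff)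
  obtain y1 where y1: "y1 \<in> {p..q}" "\<forall>y\<in>{p..q}. g y1 \<le> g y"
    using continuous_attains_inf[OF _ _ g] True by auto
  let ?\<eta> = "g y1"
  have \<eta>: "?\<eta> > 0" using pos y1 by auto
  show ?thesis
  proof (rule Lim_null_comparison)
    show "((\<lambda>\<epsilon>. C * (q - p) * (exp (- ?\<eta> / \<epsilon>) / sqrt \<epsilon>)) \<longlongrightarrow> 0) (at_right 0)"
      using tendsto_mult[OF tendsto_const exp_over_power_limit(2)[OF \<eta>]] by simp
    show "\<forall>\<^sub>F \<epsilon> in at_right 0. norm (integral {p..q} (\<lambda>y. w y * exp (- g y / \<epsilon>)) / sqrt \<epsilon>) \<le> C * (q - p) * (exp (- ?\<eta> / \<epsilon>) / sqrt \<epsilon>)"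
      using eventually_at_right_less[of 0]
    proof eventually_elim
      case (elim \<epsilon>)
      have "norm (integral {p..q} (\<lambda>y. w y * exp (- g y / \<epsilon>))) \<le> (C * exp (- ?\<eta> / \<epsilon>)) * (q - p)"
      proof (rule integral_bound[OF True])
        show "continuous_on {p..q} (\<lambda>y. w y * exp (- g y / \<epsilon>))"
          using elim by (intro continuous_intros w g) auto
        show "norm (w y * exp (- g y / \<epsilon>)) \<le> C * exp (- ?\<eta> / \<epsilon>)" if "y \<in> {p..q}" for y
          using that C y1 elim by (auto simp: abs_mult intro!: mult_mono divide_right_mono)
      qed
      then show ?case using elim by (simp add: divide_simps mult_ac)
    qed
  qed
qed simp

text \<open>Induction on the number of zeros, with the left end \<open>p\<close> free: the interval
  is cut at a point \<open>s\<close> just behind the leftmost zero, which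
  \<open>laplace_single\<close> handles. Positivity of \<open>g\<close> at both ends keeps the zeros
  in the interior and is inherited by the pieces.\<close>

lemma laplace_finite:
  fixes g w :: "real \<Rightarrow> real"
  assumes "finite Z" "p < q" "Z = {y \<in> {p..q}. g y = 0}" "g p > 0" "g q > 0"
    and "continuous_on {p..q} g" and "continuous_on {p..q} w"
    and "\<And>y. y \<in> {p..q} \<Longrightarrow> g y \<ge> 0"
    and "\<And>y. y \<in> Z \<Longrightarrow> \<kappa> y > 0 \<and> ((\<lambda>z. g z / (z - y)\<^sup>2) \<longlongrightarrow> \<kappa> y / 2) (at y)"
  shows "((\<lambda>\<epsilon>. integral {p..q} (\<lambda>y. w y * exp (- g y / \<epsilon>)) / sqrt \<epsilon>) \<longlongrightarrow>
    (\<Sum>y\<in>Z. w y * sqrt (2 * pi / \<kappa> y))) (at_right 0)"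
  using assms
proof (induction "card Z" arbitrary: Z p)
  case 0
  then have Z: "Z = {}" by auto
  then have "\<And>y. y \<in> {p..q} \<Longrightarrow> g y > 0" using 0 by (force simp: order_less_le)
  then show ?case using Z laplace_none[OF 0(7,8)] by simp
next
  case (Suc n)
  define y0 where "y0 = Min Z"
  have Zne: "Z \<noteq> {}" using Suc.hyps(2) by (metis card.empty nat.simps(3))
  have y0: "y0 \<in> Z" "\<And>y. y \<in> Z \<Longrightarrow> y0 \<le> y" using Zne Suc.prems(1) by (auto simp: y0_def)
  define Z' where "Z' = Z - {y0}"
  have y0q: "p < y0" "y0 < q" using y0(1) Suc.prems by (auto simp: order_less_le)
  obtain s where s: "y0 < s" "s < q" "\<And>y. y \<in> Z' \<Longrightarrow> s < y"
  proof (cases "Z' = {}")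
    case True
    then show thesis using that[of "(y0 + q) / 2"] y0q by auto
  next
    case False
    have "finite Z'" using Suc.prems(1) by (simp add: Z'_def)
    then have "Min Z' \<in> Z'" using False by simp
    then have "y0 < Min Z'" "Min Z' \<le> q" using y0 Suc.prems(3) by (auto simp: Z'_def order_less_le)
    then show thesis using that[of "(y0 + Min Z') / 2"] \<open>finite Z'\<close>
      by (force dest: Min_le)
  qed
  have sZ: "s \<notin> Z" using s by (auto simp: Z'_def)
  have gs: "g s > 0" using sZ Suc.prems s y0q by (auto simp: order_less_le)
  have Z'eq: "Z' = {y \<in> {s..q}. g y = 0}"
  proof
    show "Z' \<subseteq> {y \<in> {s..q}. g y = 0}" using s(3) Suc.prems(3) by (auto simp: Z'_def dest: less_imp_le)
    show "{y \<in> {s..q}. g y = 0} \<subseteq> Z'" using s y0q Suc.prems(3) by (auto simp: Z'_def)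
  qed
  have sub: "{s..q} \<subseteq> {p..q}" "{p..s} \<subseteq> {p..q}" using s y0q by auto
  have 1: "((\<lambda>\<epsilon>. integral {p..s} (\<lambda>y. w y * exp (- g y / \<epsilon>)) / sqrt \<epsilon>) \<longlongrightarrow> w y0 * sqrt (2 * pi / \<kappa> y0)) (at_right 0)"
  proof (rule laplace_single)
    fix y assume y: "y \<in> {p..s}" "y \<noteq> y0"
    have "y \<notin> Z" using y s(3)[of y] by (auto simp: Z'_def)
    then show "g y > 0" using y sub Suc.prems(3) Suc.prems(8)[of y] by (auto simp: order_less_le)
  qed (use y0q s Suc.prems y0(1) sub in \<open>auto intro: continuous_on_subset\<close>)
  have 2: "((\<lambda>\<epsilon>. integral {s..q} (\<lambda>y. w y * exp (- g y / \<epsilon>)) / sqrt \<epsilon>) \<longlongrightarrow>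
    (\<Sum>y\<in>Z'. w y * sqrt (2 * pi / \<kappa> y))) (at_right 0)"
  proof (rule Suc.hyps(1))
    show "n = card Z'" using Suc.hyps(2) Suc.prems(1) y0(1) by (simp add: Z'_def)
    show "Z' = {y \<in> {s..q}. g y = 0}" by (rule Z'eq)
  qed (use s gs Suc.prems sub in \<open>auto simp: Z'_def intro: continuous_on_subset\<close>)
  have "((\<lambda>\<epsilon>. integral {p..s} (\<lambda>y. w y * exp (- g y / \<epsilon>)) / sqrt \<epsilon> + integral {s..q} (\<lambda>y. w y * exp (- g y / \<epsilon>)) / sqrt \<epsilon>)
     \<longlongrightarrow> (\<Sum>y\<in>Z. w y * sqrt (2 * pi / \<kappa> y))) (at_right 0)"
    using tendsto_add[OF 1 2] Suc.prems(1) y0(1) by (simp add: Z'_def sum.remove)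
  then show ?case
  proof (rule Lim_transform_eventually)
    show "\<forall>\<^sub>F \<epsilon> in at_right 0. integral {p..s} (\<lambda>y. w y * exp (- g y / \<epsilon>)) / sqrt \<epsilon> + integral {s..q} (\<lambda>y. w y * exp (- g y / \<epsilon>)) / sqrt \<epsilon>
      = integral {p..q} (\<lambda>y. w y * exp (- g y / \<epsilon>)) / sqrt \<epsilon>"
      using eventually_at_right_less[of 0]
    proof eventually_elim
      case (elim \<epsilon>)
      have "(\<lambda>y. w y * exp (- g y / \<epsilon>)) integrable_on {p..q}"
        using elim Suc.prems by (intro integrable_continuous_real continuous_intros) auto
      then have "integral {p..s} (\<lambda>y. w y * exp (- g y / \<epsilon>)) + integral {s..q} (\<lambda>y. w y * exp (- g y / \<epsilon>)) = integral {p..q} (\<lambda>y. w y * exp (- g y / \<epsilon>))"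
        using s y0q by (intro Henstock_Kurzweil_Integration.integral_combine) auto
      then show ?case by (simp add: add_divide_distrib[symmetric])
    qed
  qed
qed

text \<open>One application of l'Hospital's rule reduces the claim to the difference quotient of
  \<open>f'\<close> at \<open>y\<close>.\<close>

lemma second_order_quotient_limit:
  fixes f f' :: "real \<Rightarrow> real"
  assumes "\<And>x. (f has_real_derivative f' x) (at x)" and "(f' has_real_derivative \<kappa>) (at y)"
    and "f y = 0" "f' y = 0"
  shows "((\<lambda>z. f z / (z - y)\<^sup>2) \<longlongrightarrow> \<kappa> / 2) (at y)"
proof -
  have "((\<lambda>z. (f' z - f' y) / (z - y)) \<longlongrightarrow> \<kappa>) (at y)"
    using assms(2) by (simp add: has_field_derivative_iff)
  then have "((\<lambda>z. (f' z - f' y) / (z - y) / 2) \<longlongrightarrow> \<kappa> / 2) (at y)"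
    by (intro tendsto_divide tendsto_const) auto
  then have lim: "((\<lambda>z. f' z / (2 * (z - y))) \<longlongrightarrow> \<kappa> / 2) (at y)"
    using assms(4) by (simp add: mult.commute)
  have "isCont f y" using assms(1) DERIV_isCont by blast
  show ?thesis
  proof (rule lhopital[where f'=f' and g'="\<lambda>z. 2 * (z - y)"])
    show "f \<midarrow>y\<rightarrow> 0" using \<open>isCont f y\<close> assms(3) by (simp add: isCont_def)
    show "(\<lambda>z. (z - y)\<^sup>2) \<midarrow>y\<rightarrow> 0" by (rule tendsto_eq_intros | simp)+
    show "\<forall>\<^sub>F x in at y. ((\<lambda>z. (z - y)\<^sup>2) has_real_derivative 2 * (x - y)) (at x)"
      by (intro always_eventually allI) (auto intro!: derivative_eq_intros)
  qed (use assms(1) lim in \<open>auto simp: eventually_at_filter\<close>)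
qed

section \<open>Valleys of a descending potential\<close>

lemma step_less_imp_less:
  fixes f :: "int \<Rightarrow> 'a::order"
  assumes "\<And>k. f k < f (k + 1)" and "j < k"
  shows "f j < f k"
  using assms(2)
proof (induction k rule: int_gr_induct)
  case (step i)
  then show ?case using assms(1)[of i] by (meson less_trans)
qed (rule assms(1))

text \<open>The climb is measured from the starting point \<open>x\<close>, so the relation is not
  symmetric. On the line the only path to consider is the segment; \<open>min\<close> and
  \<open>max\<close> admit both directions.\<close>

definition reach :: "(real \<Rightarrow> real) \<Rightarrow> real \<Rightarrow> real \<Rightarrow> real \<Rightarrow> bool" where
  "reach S h x y \<longleftrightarrow> (\<forall>t\<in>{min x y..max x y}. S t \<le> S x + h)"

definition bottoms :: "(real \<Rightarrow> real) \<Rightarrow> real \<Rightarrow> real set" where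
  "bottoms S h = {x. \<forall>y. reach S h x y \<longrightarrow> S x \<le> S y}"

definition valley :: "(real \<Rightarrow> real) \<Rightarrow> real \<Rightarrow> real \<Rightarrow> real set" where
  "valley S h x = {y \<in> bottoms S h. reach S h x y}"

definition valleys :: "(real \<Rightarrow> real) \<Rightarrow> real \<Rightarrow> real set set" where
  "valleys S h = valley S h ` bottoms S h"

definition increasing :: "(int \<Rightarrow> real set) \<Rightarrow> bool" where
  "increasing M \<longleftrightarrow> (\<forall>k. \<forall>x \<in> M k. \<forall>y \<in> M (k + 1). x < y)"

lemma reach_refl: "0 \<le> h \<Longrightarrow> reach S h x x"
  by (simp add: reach_def)

text \<open>The second hypothesis says that the ceiling \<open>S y + h'\<close> of the continuation
  stays below the ceiling of the first leg. With \<open>h' = h\<close> it amounts to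
  \<open>S y\<close> not exceeding \<open>S x\<close>, which replaces the missing symmetry.\<close>

lemma reach_trans:
  assumes "reach S h x y" "S y + h' \<le> S x + h" "reach S h' y z"
  shows "reach S h x z"
  unfolding reach_def
proof
  fix t assume "t \<in> {min x z..max x z}"
  then have "t \<in> {min x y..max x y} \<or> t \<in> {min y z..max y z}" by (auto simp: min_def max_def split: if_splits)
  then show "S t \<le> S x + h" using assms unfolding reach_def by fastforce
qed

lemma reach_subsegment:
  assumes "reach S h x y" "t \<in> {min x y..max x y}"
  shows "reach S h x t"
  using assms unfolding reach_def by (auto simp: min_def max_def split: if_splits)

lemma reach_mono: "reach S h x y \<Longrightarrow> h \<le> h' \<Longrightarrow> reach S h' x y"
  unfolding reach_def by force

lemma reach_sym: "reach S h x y \<Longrightarrow> S x \<le> S y \<Longrightarrow> reach S h y x"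
  unfolding reach_def by (force simp: min.commute max.commute)

lemma bottomsD: "x \<in> bottoms S h \<Longrightarrow> reach S h x y \<Longrightarrow> S x \<le> S y"
  by (simp add: bottoms_def)

lemma bottoms_antimono: "h \<le> h' \<Longrightarrow> bottoms S h' \<subseteq> bottoms S h"
  unfolding bottoms_def using reach_mono by blast

lemma bottoms_transfer:
  assumes "x \<in> bottoms S h" "reach S h x y" "S y \<le> S x"
  shows "y \<in> bottoms S h"
proof -
  have "S y \<le> S t" if "reach S h y t" for t
    using bottomsD[OF assms(1) reach_trans[OF assms(2) _ that]] assms(3) by simp
  then show ?thesis by (simp add: bottoms_def)
qed

text \<open>Two bottoms, one of which reaches the other, have equal heights, and
  \<open>reach\<close> is symmetric between points of equal height. Hence valleys are equivalence
  classes of bottoms.\<close>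

lemma valleyD:
  assumes "x \<in> bottoms S h" "y \<in> valley S h x"
  shows "y \<in> bottoms S h" "S y = S x" "reach S h x y" "reach S h y x"
proof -
  show 1: "y \<in> bottoms S h" "reach S h x y" using assms by (auto simp: valley_def)
  have "S x \<le> S y" using bottomsD[OF assms(1) 1(2)] .
  then show 2: "reach S h y x" using reach_sym[OF 1(2)] by simp
  show "S y = S x" using bottomsD[OF 1(1) 2] \<open>S x \<le> S y\<close> by simp
qed

lemma valley_self: "0 \<le> h \<Longrightarrow> x \<in> bottoms S h \<Longrightarrow> x \<in> valley S h x"
  by (simp add: valley_def reach_refl)

lemma valley_eq:
  assumes "x \<in> bottoms S h" "y \<in> valley S h x"
  shows "valley S h y = valley S h x"
  using valleyD[OF assms] unfolding valley_def by (auto intro: reach_trans)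

lemma Union_valleys: "0 \<le> h \<Longrightarrow> \<Union> (valleys S h) = bottoms S h"
  using valley_self by (auto simp: valleys_def valley_def)

lemma valley_convex:
  assumes x: "x \<in> bottoms S h" and z: "z \<in> valley S h x" and y: "y \<in> bottoms S h" "x \<le> y" "y \<le> z"
  shows "y \<in> valley S h x"
  using valleyD(3)[OF x z] y reach_subsegment[of S h x z y] by (auto simp: valley_def)

text \<open>If the order failed for some pair, \<open>valley_convex\<close> would put a point of one
  valley into the other.\<close>

lemma valley_order:
  assumes x: "x \<in> bottoms S h" and y: "y \<in> bottoms S h" and h: "0 \<le> h"
    and "x < y" and ne: "valley S h x \<noteq> valley S h y"
    and x': "x' \<in> valley S h x" and y': "y' \<in> valley S h y"
  shows "x' < y'"
proof (rule ccontr)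
  assume "\<not> x' < y'"
  note X = valleyD[OF x x'] and Y = valleyD[OF y y']
  have "y \<notin> valley S h x" using valley_eq[OF x] ne by metis
  then have "x' < y"
    using valley_convex[OF x x' y] \<open>x < y\<close> by force
  have x'_in: "x \<in> valley S h x'" using valley_self[OF h x] valley_eq[OF x x'] by simp
  have y_in: "y \<in> valley S h y'" using valley_self[OF h y] valley_eq[OF y y'] by simp
  have "x' \<in> valley S h y'"
    using valley_convex[OF Y(1) y_in X(1)] \<open>\<not> x' < y'\<close> \<open>x' < y\<close> by simp
  then show False
    using valley_eq[OF Y(1)] valley_eq[OF y y'] valley_eq[OF x x'] ne by metis
qed

lemma increasing_less:
  assumes M: "increasing M" "\<And>k. M k \<noteq> {}" and "j < k" "x \<in> M j" "y \<in> M k"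
  shows "x < y"
proof -
  have "\<forall>x\<in>M j. \<forall>y\<in>M k. x < y" using \<open>j < k\<close>
  proof (induction k rule: int_gr_induct)
    case base then show ?case using M(1) by (auto simp: increasing_def)
  next
    case (step i)
    obtain z where z: "z \<in> M i" using M(2) by blast
    show ?case
    proof (intro ballI)
      fix x y assume "x \<in> M j" "y \<in> M (i + 1)"
      then have "x < z" "z < y" using z M(1) step by (auto simp: increasing_def)
      then show "x < y" by simp
    qed
  qed
  with assms show ?thesis by blast
qed

lemma increasing_disjoint:
  assumes M: "increasing M" "\<And>k. M k \<noteq> {}" and "x \<in> M j" "x \<in> M k"
  shows "j = k"
  using increasing_less[OF M, of j k x x] increasing_less[OF M, of k j x x] assms
  by (cases j k rule: linorder_cases) auto

text \<open>The map that sends a label of \<open>M'\<close> to the label of the same set in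
  \<open>M\<close> is strictly increasing and onto, hence a translation of the integers. This serves
  twice: for the uniqueness of a labelling, and, applied to a family and its unit translate, for
  periodicity.\<close>

lemma increasing_family_unique:
  assumes M: "increasing M" "\<And>k. M k \<noteq> {}" and M': "increasing M'" and range: "range M' = range M"
  obtains c where "\<And>k. M' k = M (k + c)"
proof -
  have M'ne: "M' k \<noteq> {}" for k
    using range M(2) by (metis rangeE rangeI)
  have "\<exists>j. M' k = M j" for k using range by (metis rangeE rangeI)
  then obtain t where t: "\<And>k. M' k = M (t k)" by metis
  have mono: "t j < t k" if "j < k" for j k
  proof (rule ccontr)
    assume "\<not> t j < t k"
    obtain x y where xy: "x \<in> M' j" "y \<in> M' k" using M'ne by blast
    then have "x < y" using increasing_less[OF M' M'ne that] by blast
    have "t j \<noteq> t k"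
      using increasing_disjoint[OF M' M'ne, of x j k] xy t that by auto
    with \<open>\<not> t j < t k\<close> have "y < x" using increasing_less[OF M, of "t k" "t j" y x] xy t by auto
    then show False using \<open>x < y\<close> by simp
  qed
  \<comment> \<open>Surjectivity gives an index \<open>j\<close> with \<open>t j = t k + 1\<close>;
    monotonicity forces \<open>j\<close> beyond \<open>k\<close>, so no value is skipped.\<close>
  have step: "t (k + 1) = t k + 1" for k
  proof -
    obtain j where j: "M' j = M (t k + 1)" using range by (metis rangeE rangeI)
    obtain x where "x \<in> M' j" using M'ne by blast
    then have tj: "t j = t k + 1" using increasing_disjoint[OF M, of x] j t by metis
    have "k < j"
      using mono[of j k] tj by (cases j k rule: linorder_cases) auto
    then have "t (k + 1) \<le> t j" using mono[of "k + 1" j] by (cases "k + 1 = j") auto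
    then show ?thesis using tj mono[of k "k + 1"] by simp
  qed
  have "t k = k + t 0" for k
  proof (induction k rule: int_induct[where k = 0])
    case (step2 i) then show ?case using step[of "i - 1"] by simp
  qed (simp_all add: step)
  then show thesis using that[of "t 0"] t by metis
qed

lemma periodic_discrete_enumeration:
  fixes T :: "real set"
  assumes shift: "\<And>t. t + 1 \<in> T \<longleftrightarrow> t \<in> T" and fin: "\<And>p q. finite (T \<inter> {p..q})" and t0: "t0 \<in> T"
  shows "\<exists>e :: int \<Rightarrow> real. (\<forall>j k. j < k \<longrightarrow> e j < e k) \<and> range e = T \<and> e 0 = t0"
proof -
  have shift_nat: "t + real n \<in> T \<longleftrightarrow> t \<in> T" for t n
    using shift[of "t + real _"] by (induction n) (auto simp: add_ac)
  have shift_int: "t + real_of_int n \<in> T \<longleftrightarrow> t \<in> T" for t n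
    using shift_nat[of t "nat n"] shift_nat[of "t + real_of_int n" "nat (- n)"] by (cases "n \<ge> 0") auto
  define T0 where "T0 = T \<inter> {t0..<t0 + 1}"
  have fT0: "finite T0" by (rule finite_subset[OF _ fin[of t0 "t0 + 1"]]) (auto simp: T0_def)
  define l where "l = sorted_list_of_set T0"
  define n where "n = int (length l)"
  have setl: "set l = T0" and sl: "sorted_wrt (<) l"
    using fT0 sorted_list_of_set.strict_sorted_key_list_of_set[of T0] by (auto simp: l_def)
  have "t0 \<in> T0" using t0 by (simp add: T0_def)
  then have n: "n > 0" using setl by (cases l) (auto simp: n_def)
  \<comment> \<open>\<open>l\<close> lists the points of one fundamental interval starting at
    \<open>t0\<close>; division with remainder continues it periodically, also to negative
    labels.\<close>
  define e where "e k = l ! nat (k mod n) + of_int (k div n)" for k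
  have nth: "l ! i \<in> T" "t0 \<le> l ! i" "l ! i < t0 + 1" if "i < length l" for i
    using nth_mem[OF that] setl by (auto simp: T0_def)
  have l0: "l ! 0 = t0"
  proof -
    obtain i where i: "i < length l" "l ! i = t0" using \<open>t0 \<in> T0\<close> setl by (metis in_set_conv_nth)
    have "l ! 0 \<le> l ! i" using sl i by (cases "i = 0") (auto simp: sorted_wrt_iff_nth_less less_imp_le)
    then show ?thesis using i nth[of 0] n by (auto simp: n_def)
  qed
  have step: "e k < e (k + 1)" for k
  proof -
    define r d where "r = k mod n" and "d = k div n"
    have r: "0 \<le> r" "r < n" and k: "k = n * d + r" using n by (auto simp: r_def d_def)
    have rl: "nat r < length l" using r by (simp add: n_def)
    have ek: "e k = l ! nat r + of_int d" by (simp add: e_def r_def d_def)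
    show ?thesis
    proof (cases "r + 1 < n")
      case True
      have "(k + 1) div n = d" "(k + 1) mod n = r + 1"
        using int_div_pos_eq[of "k + 1" n d "r + 1"] int_mod_pos_eq[of "k + 1" n d "r + 1"] k r True by auto
      then have "e (k + 1) = l ! Suc (nat r) + of_int d"
        using r(1) by (simp add: e_def nat_add_distrib)
      moreover have "l ! nat r < l ! Suc (nat r)"
        using sl True r(1) by (auto simp: sorted_wrt_iff_nth_less n_def)
      ultimately show ?thesis using ek by simp
    next
      case False
      then have "(k + 1) div n = d + 1" "(k + 1) mod n = 0"
        using int_div_pos_eq[of "k + 1" n "d + 1" 0] int_mod_pos_eq[of "k + 1" n "d + 1" 0] k r n
        by (auto simp: algebra_simps)
      then have "e (k + 1) = t0 + of_int d + 1" by (simp add: e_def l0)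
      then show ?thesis using ek nth(3)[OF rl] by simp
    qed
  qed
  show ?thesis
  proof (intro exI[of _ e] conjI allI impI)
    show "e j < e k" if "j < k" for j k by (rule step_less_imp_less[of e, OF step that])
    show "e 0 = t0" using n l0 by (simp add: e_def)
    show "range e = T"
    proof
      show "range e \<subseteq> T"
      proof
        fix t assume "t \<in> range e"
        then obtain k where k: "t = e k" by blast
        have "nat (k mod n) < length l" using n by (simp add: n_def nat_less_iff)
        then show "t \<in> T" using shift_int nth(1) by (simp add: k e_def)
      qed
      show "T \<subseteq> range e"
      proof
        fix t assume t: "t \<in> T"
        define d where "d = \<lfloor>t - t0\<rfloor>"
        have "t - of_int d \<in> T" using shift_int[of "t - of_int d" d] t by simp
        moreover have "t0 \<le> t - of_int d" "t - of_int d < t0 + 1" unfolding d_def by linarith+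
        ultimately have "t - of_int d \<in> set l" using setl by (simp add: T0_def)
        then obtain i where i: "i < length l" "l ! i = t - of_int d" by (metis in_set_conv_nth)
        have "(d * n + int i) div n = d" "(d * n + int i) mod n = int i"
          using i n by (auto simp: n_def)
        then have "e (d * n + int i) = t" by (simp add: e_def i)
        then show "t \<in> range e" by blast
      qed
    qed
  qed
qed

section \<open>Valleys of a potential that drops by a fixed positive amount per period\<close>

locale descending =
  fixes S :: "real \<Rightarrow> real" and B :: real
  assumes cont: "\<And>x. isCont S x" and shift1: "\<And>x. S (x + 1) = S x - B" and B_pos: "B > 0"
    and locally_finite: "\<And>p q. finite (bottoms S 0 \<inter> {p..q})"
begin

lemma shift: "S (x + of_int n) = S x - of_int n * B"
proof -
  have nat: "S (x + of_nat n) = S x - of_nat n * B" for x n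
  proof (induction n)
    case (Suc n)
    then show ?case using shift1[of "x + of_nat n"] by (simp add: algebra_simps)
  qed simp
  show ?thesis
    using nat[of x "nat n"] nat[of "x + of_int n" "nat (- n)"] by (cases "n \<ge> 0") auto
qed

lemma reach_shift: "reach S h (x + of_int n) (y + of_int n) \<longleftrightarrow> reach S h x y"
proof -
  have 1: "reach S h (x + of_int n) (y + of_int n)" if "reach S h x y" for x y n
    unfolding reach_def
  proof
    fix t assume "t \<in> {min (x + of_int n) (y + of_int n)..max (x + of_int n) (y + of_int n)}"
    then have "t - of_int n \<in> {min x y..max x y}" by (auto simp: min_def max_def split: if_splits)
    then have "S (t - of_int n) \<le> S x + h" using that by (simp add: reach_def)
    then show "S t \<le> S (x + of_int n) + h" using shift[of "t - of_int n" n] shift[of x n] by simp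
  qed
  show ?thesis using 1 1[of "x + of_int n" "y + of_int n" "-n"] by auto
qed

lemma bottoms_shift: "x + of_int n \<in> bottoms S h \<longleftrightarrow> x \<in> bottoms S h"
proof -
  have 1: "x + of_int n \<in> bottoms S h" if "x \<in> bottoms S h" for x n
  proof -
    have "S (x + of_int n) \<le> S y" if r: "reach S h (x + of_int n) y" for y
    proof -
      have "reach S h x (y - of_int n)" using reach_shift[of h x n "y - of_int n"] r by simp
      then have "S x \<le> S (y - of_int n)" using bottomsD \<open>x \<in> bottoms S h\<close> by blast
      then show ?thesis using shift[of "y - of_int n" n] shift[of x n] by simp
    qed
    then show ?thesis by (simp add: bottoms_def)
  qed
  show ?thesis using 1 1[of "x + of_int n" "-n"] by auto
qed

lemma valley_shift: "y + of_int n \<in> valley S h (x + of_int n) \<longleftrightarrow> y \<in> valley S h x"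
  by (simp add: valley_def bottoms_shift reach_shift)

text \<open>Reaching \<open>x + 1\<close> from \<open>x\<close> would reach the lower value
  \<open>S x - B\<close>, which a bottom forbids. So a valley is shorter than a period, and with
  local finiteness it is finite.\<close>

lemma valley_near:
  assumes "x \<in> bottoms S h" "y \<in> valley S h x"
  shows "\<bar>y - x\<bar> < 1"
proof -
  have *: "v < u + 1" if "u \<in> bottoms S h" "reach S h u v" for u v
  proof (rule ccontr)
    assume "\<not> v < u + 1"
    then have "reach S h u (u + 1)" using reach_subsegment[OF that(2), of "u + 1"] by auto
    then have "S u \<le> S (u + 1)" using bottomsD that(1) by blast
    then show False using shift1 B_pos by simp
  qed
  show ?thesis using *[of x y] *[of y x] valleyD[OF assms] assms(1) by (simp add: abs_less_iff)
qed

lemma finite_bottoms: "0 \<le> h \<Longrightarrow> finite (bottoms S h \<inter> {p..q})"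
  using locally_finite bottoms_antimono[of 0 h S] by (meson finite_subset Int_mono order_refl)

lemma finite_valley:
  assumes "0 \<le> h" "x \<in> bottoms S h"
  shows "finite (valley S h x)"
proof (rule finite_subset[OF _ finite_bottoms[OF assms(1), of "x - 1" "x + 1"]])
  show "valley S h x \<subseteq> bottoms S h \<inter> {x - 1..x + 1}"
    using valley_near[OF assms(2)] by (force simp: valley_def abs_less_iff)
qed

lemma ex_int_greater: "\<exists>n::int. x < y + of_int n" for x y :: real
  using ex_less_of_int[of "x - y"] by (auto simp: algebra_simps)

text \<open>Far to the right lies a translate of a known bottom that is not higher than
  \<open>x\<close>. If the way to it is open, it is the point sought. Otherwise a barrier blocks the
  right side, the growth of \<open>S\<close> to the left blocks the other, and the set reached from
  \<open>x\<close> is compact; a minimizer of \<open>S\<close> on it is a bottom.\<close>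

lemma reaches_bottom:
  assumes h: "0 \<le> h" and ne: "bottoms S h \<noteq> {}"
  obtains y where "y \<in> bottoms S h" "reach S h x y" "S y \<le> S x"
proof -
  obtain w where "w \<in> bottoms S h" using ne by blast
  obtain n1 :: int where n1: "x < w + of_int n1" using ex_int_greater by blast
  \<comment> \<open>\<open>n1\<close> moves the bottom to the right of \<open>x\<close>, and
    \<open>n2\<close> lowers it to at most \<open>S x\<close>; the maximum of the two does
    both.\<close>
  obtain n2 :: int where n2: "S w - S x < of_int n2 * B"
    using ex_less_of_int[of "(S w - S x) / B"] B_pos by (auto simp: field_simps)
  define n where "n = max n1 n2"
  have "of_int n1 \<le> (of_int n :: real)" "of_int n2 \<le> (of_int n :: real)" by (auto simp: n_def)
  then have "of_int n2 * B \<le> of_int n * B" using B_pos by simp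
  then have w: "w + of_int n \<in> bottoms S h" "x < w + of_int n" "S (w + of_int n) \<le> S x"
    using \<open>w \<in> bottoms S h\<close> n1 n2 \<open>of_int n1 \<le> (of_int n :: real)\<close> shift[of w n] by (auto simp: bottoms_shift)
  show thesis
  proof (cases "reach S h x (w + of_int n)")
    case True then show ?thesis using that w by blast
  next
    case False
    then obtain T where T: "x \<le> T" "S T > S x + h" unfolding reach_def using w(2) by force
    \<comment> \<open>Translating \<open>x\<close> to the left by \<open>n'\<close> raises the
      potential by more than \<open>h\<close>; this is the barrier on the left.\<close>
    obtain n' :: int where n': "h < of_int n' * B" using ex_less_of_int[of "h / B"] B_pos by (auto simp: field_simps)
    then have "0 < of_int n' * B" using h by simp
    then have n'0: "of_int n' > (0::real)" using B_pos zero_less_mult_pos2 by blast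
    have low: "S (x - of_int n') > S x + h" using shift[of "x - of_int n'" n'] n' by simp
    define K where "K = connected_component_set {t. S t \<le> S x + h} x"
    have K: "t \<in> K \<longleftrightarrow> reach S h x t" for t
    proof
      assume "t \<in> K"
      have "connected K" unfolding K_def by (rule connected_connected_component)
      moreover have "x \<in> K" unfolding K_def using h by (simp add: connected_component_refl_eq)
      ultimately have "{min x t..max x t} \<subseteq> K"
        using connected_contains_Icc[of K "min x t" "max x t"] \<open>t \<in> K\<close> by (simp add: min_def max_def)
      moreover have "K \<subseteq> {t. S t \<le> S x + h}" unfolding K_def by (rule connected_component_subset)
      ultimately show "reach S h x t" by (auto simp: reach_def)
    next
      assume r: "reach S h x t"
      show "t \<in> K"
        unfolding K_def mem_Collect_eq connected_component_def
        using r by (intro exI[of _ "{min x t..max x t}"]) (auto simp: reach_def)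
    qed
    have "closed {t. S t \<le> S x + h}"
      using cont by (intro closed_Collect_le continuous_intros continuous_at_imp_continuous_on) auto
    then have "closed K" unfolding K_def by (rule closed_connected_component)
    moreover have "K \<subseteq> {x - of_int n'..T}"
    proof
      fix t assume "t \<in> K"
      then have r: "reach S h x t" by (simp add: K)
      show "t \<in> {x - of_int n'..T}"
        using r T low n'0 unfolding reach_def
        by (smt (verit) atLeastAtMost_iff min_def max_def)
    qed
    ultimately have "compact K" by (meson compact_eq_bounded_closed bounded_closed_interval bounded_subset)
    moreover have "x \<in> K" by (simp add: K reach_refl h)
    ultimately obtain y where y: "y \<in> K" "\<And>t. t \<in> K \<Longrightarrow> S y \<le> S t"
      using continuous_attains_inf[of K S] cont by (metis continuous_at_imp_continuous_on empty_iff)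
    have "S y \<le> S x" using y(2) \<open>x \<in> K\<close> by blast
    moreover have "y \<in> bottoms S h"
      unfolding bottoms_def
    proof (intro CollectI allI impI)
      fix t assume "reach S h y t"
      then have "reach S h x t" using reach_trans[of S h x y h t] y(1) K \<open>S y \<le> S x\<close> by simp
      then show "S y \<le> S t" using y(2) K by blast
    qed
    ultimately show ?thesis using that y(1) K by blast
  qed
qed

text \<open>The valleys are enumerated through their leftmost points, collected in \<open>T\<close>.
  Label 0 goes to the valley of the smallest nonnegative bottom \<open>x0\<close>; the leftmost
  point of that valley may be negative, so the enumeration starts at this point and not at
  \<open>x0\<close>.\<close>

lemma ex_increasing_labelling:
  assumes h: "0 \<le> h" and ne: "bottoms S h \<noteq> {}"
  obtains M where "increasing_labelling (valleys S h) M"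
proof -
  obtain w where "w \<in> bottoms S h" using ne by blast
  obtain n1 :: int where n1: "0 < w + of_int n1" using ex_int_greater by blast
  define w' where "w' = w + of_int n1"
  have w': "w' \<in> bottoms S h" "0 < w'" using n1 \<open>w \<in> bottoms S h\<close> by (auto simp: w'_def bottoms_shift)
  define x0 where "x0 = Min (bottoms S h \<inter> {0..w'})"
  have fin: "finite (bottoms S h \<inter> {0..w'})" by (rule finite_bottoms[OF h])
  moreover have "bottoms S h \<inter> {0..w'} \<noteq> {}" using w' by (auto intro: exI[of _ w'])
  ultimately have "x0 \<in> bottoms S h \<inter> {0..w'}" unfolding x0_def by (rule Min_in)
  then have x0: "x0 \<in> bottoms S h" "0 \<le> x0" "x0 \<le> w'" by auto
  have x0_least: "x0 \<le> y" if "y \<in> bottoms S h" "0 \<le> y" for y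
    using Min_le[OF fin, of y] that x0(3) by (cases "y \<le> w'") (auto simp: x0_def)
  define T where "T = {t \<in> bottoms S h. \<forall>y\<in>valley S h t. t \<le> y}"
  have T_Min: "Min (valley S h x) \<in> T \<and> valley S h (Min (valley S h x)) = valley S h x" if "x \<in> bottoms S h" for x
  proof -
    note f = finite_valley[OF h that]
    have "Min (valley S h x) \<in> valley S h x" using f valley_self[OF h that] by (intro Min_in) auto
    then show ?thesis using f valleyD[OF that] valley_eq[OF that] by (auto simp: T_def)
  qed
  have "t + 1 \<in> T \<longleftrightarrow> t \<in> T" for t
  proof -
    have "(\<forall>y\<in>valley S h (t + 1). t + 1 \<le> y) \<longleftrightarrow> (\<forall>y\<in>valley S h t. t \<le> y)"
      using valley_shift[of _ 1 h t] by (metis add_le_cancel_right diff_add_cancel of_int_1)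
    then show ?thesis using bottoms_shift[of t 1] by (simp add: T_def)
  qed
  moreover have "finite (T \<inter> {p..q})" for p q
    by (rule finite_subset[OF _ finite_bottoms[OF h]]) (auto simp: T_def)
  moreover have "Min (valley S h x0) \<in> T" using T_Min x0(1) by blast
  ultimately obtain e :: "int \<Rightarrow> real" where e: "\<And>j k. j < k \<Longrightarrow> e j < e k" "range e = T" "e 0 = Min (valley S h x0)"
    using periodic_discrete_enumeration[of T "Min (valley S h x0)"] by blast
  have eT: "e k \<in> T" for k using e(2) by blast
  define M where "M k = valley S h (e k)" for k
  show thesis
  proof (rule that[of M], unfold increasing_labelling_def, intro conjI allI ballI)
    show "range M = valleys S h"
      using eT T_Min e(2) by (fastforce simp: M_def valleys_def T_def image_iff)
    show "x < y" if "x \<in> M k" "y \<in> M (k + 1)" for k x y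
    proof (rule valley_order[of "e k" S h "e (k + 1)"])
      have ek: "e k < e (k + 1)" by (rule e(1)) simp
      show "e k < e (k + 1)" by fact
      show "valley S h (e k) \<noteq> valley S h (e (k + 1))"
      proof
        assume "valley S h (e k) = valley S h (e (k + 1))"
        then have "e k \<in> valley S h (e (k + 1))" using valley_self[OF h, of "e k"] eT by (auto simp: T_def)
        then show False using eT[of "k + 1"] ek by (force simp: T_def)
      qed
    qed (use eT h that in \<open>auto simp: T_def M_def\<close>)
    show "\<exists>x\<in>M 0. 0 \<le> x \<and> (\<forall>y\<in>\<Union> (valleys S h). 0 \<le> y \<longrightarrow> x \<le> y)"
      unfolding Union_valleys[OF h] M_def e(3)
      using T_Min[OF x0(1)] valley_self[OF h x0(1)] x0 x0_least by auto
  qed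
qed

lemma valleys_nonempty: "0 \<le> h \<Longrightarrow> A \<in> valleys S h \<Longrightarrow> A \<noteq> {}"
  using valley_self by (force simp: valleys_def)

text \<open>Two labellings differ by a shift, and the smallest nonnegative point, which both put
  into set 0, makes the shift vanish. This evaluates the definite description in
  \<open>next_level\<close>.\<close>

lemma the_increasing_labelling:
  assumes h: "0 \<le> h" and M: "increasing_labelling (valleys S h) M"
  shows "(THE M'. increasing_labelling (valleys S h) M') = M"
proof (rule the_equality)
  show "increasing_labelling (valleys S h) M" by (rule M)
  fix M' assume M': "increasing_labelling (valleys S h) M'"
  have i: "increasing M" "range M = valleys S h" "increasing M'" "range M' = valleys S h"
    using M M' by (auto simp: increasing_labelling_def increasing_def)
  have ne: "M k \<noteq> {}" for k using valleys_nonempty[OF h] i(2) by blast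
  obtain c where c: "\<And>k. M' k = M (k + c)"
    using increasing_family_unique[OF i(1) ne i(3)] i by auto
  obtain x where x: "x \<in> M 0" "0 \<le> x" "\<forall>y\<in>\<Union> (valleys S h). 0 \<le> y \<longrightarrow> x \<le> y"
    using M by (auto simp: increasing_labelling_def)
  obtain x' where x': "x' \<in> M' 0" "0 \<le> x'" "\<forall>y\<in>\<Union> (valleys S h). 0 \<le> y \<longrightarrow> x' \<le> y"
    using M' by (auto simp: increasing_labelling_def)
  have "x \<in> \<Union> (valleys S h)" "x' \<in> \<Union> (valleys S h)" using x(1) x'(1) i by blast+
  then have "x = x'" using x x' by force
  then have "c = 0" using increasing_disjoint[OF i(1) ne, of x 0 c] x(1) x'(1) c[of 0] by simp
  then show "M' = M" using c by auto
qed

end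

text \<open>The choice of the origin is left out: beyond the construction of the next level only the
  collection of sets and their order matter.\<close>

definition labels_valleys :: "(real \<Rightarrow> real) \<Rightarrow> real \<Rightarrow> (int \<Rightarrow> real set) \<Rightarrow> bool" where
  "labels_valleys S h M \<longleftrightarrow> 0 \<le> h \<and> range M = valleys S h \<and> increasing M"

locale labelled = descending +
  fixes h :: real and M :: "int \<Rightarrow> real set"
  assumes labels_valleys: "labels_valleys S h M"
begin

lemma h_nonneg: "0 \<le> h" and range_M: "range M = valleys S h" and M_increasing: "increasing M"
  using labels_valleys by (auto simp: labels_valleys_def)

lemma M_nonempty: "M k \<noteq> {}"
  using valleys_nonempty[OF h_nonneg] range_M by blast

lemmas M_less = increasing_less[OF M_increasing M_nonempty]
lemmas M_disjoint = increasing_disjoint[OF M_increasing M_nonempty]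

lemma Union_M: "(\<Union>k. M k) = bottoms S h"
  using Union_valleys[OF h_nonneg] range_M by auto

lemma M_bottoms: "x \<in> M k \<Longrightarrow> x \<in> bottoms S h"
  using Union_M by blast

lemma M_valley: "x \<in> M k \<Longrightarrow> M k = valley S h x"
proof -
  assume x: "x \<in> M k"
  obtain y where y: "y \<in> bottoms S h" "M k = valley S h y"
    using range_M rangeI[of M k] by (auto simp: valleys_def)
  then show ?thesis using valley_eq[OF y(1), of x] x by simp
qed

lemma M_finite: "finite (M k)"
  using M_nonempty[of k] M_valley finite_valley[OF h_nonneg] M_bottoms by fastforce

lemma M_level: "x \<in> M k \<Longrightarrow> y \<in> M k \<Longrightarrow> S x = S y"
  using M_valley[of x k] valleyD(2)[OF M_bottoms, of x k y] by simp

lemma bottoms_nonempty: "bottoms S h \<noteq> {}"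
  using Union_M M_nonempty by blast

text \<open>The family translated by 1 has the same sets in the same order, so it is
  \<open>M\<close> shifted by some \<open>c\<close>. The drop of \<open>S\<close> over a period
  excludes \<open>c = 0\<close>, and the order excludes negative \<open>c\<close>.\<close>

lemma M_period: obtains u :: nat where "u \<ge> 1" "\<And>k. M (k + int u) = (\<lambda>x. x + 1) ` M k"
proof -
  define M' where "M' k = (\<lambda>x. x + 1) ` M k" for k
  have shiftv: "(\<lambda>x. x + 1) ` valley S h y = valley S h (y + 1)" for y
  proof
    show "(\<lambda>x. x + 1) ` valley S h y \<subseteq> valley S h (y + 1)" using valley_shift[of _ 1 h y] by auto
    show "valley S h (y + 1) \<subseteq> (\<lambda>x. x + 1) ` valley S h y"
    proof
      fix z assume "z \<in> valley S h (y + 1)"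
      then have "z - 1 \<in> valley S h y" using valley_shift[of "z - 1" 1 h y] by simp
      then show "z \<in> (\<lambda>x. x + 1) ` valley S h y" by (auto intro!: image_eqI[of _ _ "z - 1"])
    qed
  qed
  have "range M' = range M"
  proof -
    have "range M' = (\<lambda>A. (\<lambda>x. x + 1) ` A) ` valleys S h"
      unfolding range_M[symmetric] M'_def by (simp add: image_image)
    also have "\<dots> = (\<lambda>y. valley S h (y + 1)) ` bottoms S h" by (auto simp: valleys_def image_image shiftv)
    also have "\<dots> = valley S h ` bottoms S h"
    proof
      show "(\<lambda>y. valley S h (y + 1)) ` bottoms S h \<subseteq> valley S h ` bottoms S h" using bottoms_shift[of _ 1] by auto
      show "valley S h ` bottoms S h \<subseteq> (\<lambda>y. valley S h (y + 1)) ` bottoms S h"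
      proof
        fix A assume "A \<in> valley S h ` bottoms S h"
        then obtain y where y: "y \<in> bottoms S h" "A = valley S h y" by blast
        then have "y - 1 \<in> bottoms S h" using bottoms_shift[of "y - 1" 1] by simp
        then show "A \<in> (\<lambda>y. valley S h (y + 1)) ` bottoms S h" using y by (auto intro!: image_eqI[of _ _ "y - 1"])
      qed
    qed
    finally show ?thesis using range_M by (simp add: valleys_def)
  qed
  moreover have "increasing M'" using M_increasing by (auto simp: increasing_def M'_def)
  ultimately obtain c where c: "\<And>k. M' k = M (k + c)"
    using increasing_family_unique[OF M_increasing M_nonempty] by metis
  obtain x where x: "x \<in> M 0" using M_nonempty by blast
  then have x1: "x + 1 \<in> M c" using c[of 0] by (auto simp: M'_def)
  have "M c \<noteq> M 0"
  proof
    assume "M c = M 0"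
    then have "S (x + 1) = S x" using M_level x x1 by metis
    then show False using shift1 B_pos by simp
  qed
  then have "0 < c" using M_less[of c 0 "x + 1" x] x x1 by (cases c "0::int" rule: linorder_cases) auto
  then show thesis using that[of "nat c"] c by (auto simp: M'_def)
qed

end

section \<open>The hierarchy of levels\<close>

lemma periodic1_shift:
  assumes "periodic1 f" shows "f (x + of_int n) = f x"
proof -
  have nat: "f (x + of_nat n) = f x" for x n
    using assms by (induction n) (simp_all add: periodic1_def add.assoc[symmetric] add.commute[of 1])
  show ?thesis
    using nat[of x "nat n"] nat[of "x + of_int n" "nat (- n)"] by (cases "n \<ge> 0") auto
qed

lemma periodic1_frac: "periodic1 f \<Longrightarrow> f (frac x) = f x"
  using periodic1_shift[of f "frac x" "\<lfloor>x\<rfloor>"] by (simp add: frac_def)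

lemma C2_torusD:
  assumes "f \<in> C2_torus"
  shows "periodic1 f" "(f has_real_derivative deriv f x) (at x)"
    "(deriv f has_real_derivative deriv (deriv f) x) (at x)"
    "isCont f x" "isCont (deriv f) x" "isCont (deriv (deriv f)) x"
    "continuous_on A f" "continuous_on A (deriv f)" "continuous_on A (deriv (deriv f))"
proof -
  show "periodic1 f" using assms by (simp add: C2_torus_def)
  show 1: "(f has_real_derivative deriv f x) (at x)" "(deriv f has_real_derivative deriv (deriv f) x) (at x)" for x
    using assms unfolding C2_torus_def differentiable_on_def
    by (auto simp: DERIV_deriv_iff_real_differentiable)
  show c: "isCont f x" "isCont (deriv f) x" for x using 1[of x] DERIV_isCont by blast+
  show c2: "isCont (deriv (deriv f)) x" for x
    using assms unfolding C2_torus_def by (auto simp: continuous_on_eq_continuous_at)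
  show "continuous_on A f" "continuous_on A (deriv f)" "continuous_on A (deriv (deriv f))"
    using c c2 by (auto intro: continuous_at_imp_continuous_on)
qed

lemma periodic1_deriv:
  assumes "f \<in> C2_torus" shows "periodic1 (deriv f)" "periodic1 (deriv (deriv f))"
proof -
  have *: "periodic1 g'" if "periodic1 g" "\<And>x. (g has_real_derivative g' x) (at x)" for g g' :: "real \<Rightarrow> real"
    unfolding periodic1_def
  proof
    fix x
    have "((\<lambda>x. g (x + 1)) has_real_derivative g' (x + 1)) (at x)"
      using that(2)[of "x + 1"] by (simp add: DERIV_shift)
    moreover have "(\<lambda>x. g (x + 1)) = g" using that(1) by (auto simp: periodic1_def)
    ultimately show "g' (x + 1) = g' x" using that(2)[of x] DERIV_unique by metis
  qed
  show 1: "periodic1 (deriv f)" using * C2_torusD(1,2)[OF assms] by blast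
  show "periodic1 (deriv (deriv f))" using *[OF 1] C2_torusD(3)[OF assms] by blast
qed

lemma C2_torusI:
  assumes "periodic1 f" and "\<And>x. (f has_real_derivative f' x) (at x)" and "\<And>x. (f' has_real_derivative f'' x) (at x)"
    and "\<And>x. isCont f'' x"
  shows "f \<in> C2_torus" "deriv f = f'" "deriv (deriv f) = f''"
proof -
  show d1: "deriv f = f'" using assms(2) by (auto intro!: DERIV_imp_deriv)
  show d2: "deriv (deriv f) = f''" unfolding d1 using assms(3) by (auto intro!: DERIV_imp_deriv)
  have "f differentiable_on UNIV" "f' differentiable_on UNIV"
    using assms(2,3) by (auto simp: differentiable_on_def real_differentiable_def)
  moreover have "continuous_on UNIV (deriv f')"
    using assms(4) d2 d1 by (simp add: continuous_on_eq_continuous_at)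
  ultimately show "f \<in> C2_torus" using assms(1) unfolding C2_torus_def mem_Collect_eq d1 by blast
qed

section \<open>The potential of the diffusion and its local minima\<close>

context torus_setting
begin

abbreviation "S \<equiv> potential a b"

lemma a_pos: "a x > 0" using a_lower[of x] c0_pos by linarith

lemmas a_D = C2_torusD[OF a_C2] and b_D = C2_torusD[OF b_C2]

lemma S_deriv: "(S has_real_derivative - (b x / a x)) (at x)"
proof -
  let ?p = "min 0 x - 1" and ?q = "max 0 x + 1"
  have "((\<lambda>u. LBINT z=ereal 0..ereal u. b z / a z) has_vector_derivative b x / a x) (at x within {?p..?q})"
    by (rule interval_integral_FTC2)
       (auto intro!: continuous_intros a_D b_D simp: a_pos less_imp_neq[OF a_pos, symmetric])
  moreover have "at x within {?p..?q} = at x" by (rule at_within_interior) (auto simp: interior_atLeastAtMost_real)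
  ultimately have "((\<lambda>u. LBINT z=ereal 0..ereal u. b z / a z) has_real_derivative b x / a x) (at x)"
    by (simp add: has_real_derivative_iff_has_vector_derivative)
  then have "((\<lambda>u. - (LBINT z=ereal 0..ereal u. b z / a z)) has_real_derivative - (b x / a x)) (at x)"
    by (rule DERIV_minus)
  then show ?thesis by (simp add: potential_def[abs_def] zero_ereal_def)
qed

lemma deriv_S: "deriv S = (\<lambda>x. - (b x / a x))"
  using S_deriv by (auto intro!: DERIV_imp_deriv)

definition S2 :: "real \<Rightarrow> real" where
  "S2 x = - ((deriv b x * a x - b x * deriv a x) / (a x * a x))"

lemma S_deriv2: "((\<lambda>x. - (b x / a x)) has_real_derivative S2 x) (at x)"
  unfolding S2_def using a_pos[of x]
  by (auto intro!: derivative_eq_intros a_D b_D)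

lemma deriv_deriv_S: "deriv (deriv S) = S2"
  unfolding deriv_S using S_deriv2 by (auto intro!: DERIV_imp_deriv)

lemma S2_zero: "b x = 0 \<Longrightarrow> S2 x = - deriv b x / a x"
  using a_pos[of x] by (simp add: S2_def)

lemma isCont_S: "isCont S x" using S_deriv DERIV_isCont by blast

lemma continuous_on_S: "continuous_on A S" using isCont_S by (simp add: continuous_at_imp_continuous_on)

lemma S_shift1: "S (x + 1) = S x - circulation a b"
proof -
  have "((\<lambda>x. S (x + 1) - S x) has_real_derivative 0) (at x)" for x
  proof -
    have "b (x + 1) = b x" "a (x + 1) = a x" using a_D(1) b_D(1) by (auto simp: periodic1_def)
    then have "((\<lambda>x. S (x + 1)) has_real_derivative - (b x / a x)) (at x)"
      using S_deriv[of "x + 1"] by (simp add: DERIV_shift)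
    from DERIV_diff[OF this S_deriv[of x]] show ?thesis by simp
  qed
  then have "S (x + 1) - S x = S (0 + 1) - S 0"
    using DERIV_isconst_all[of "\<lambda>x. S (x + 1) - S x" x 0] by blast
  moreover have "S 1 = - circulation a b" "S 0 = 0"
    by (simp_all add: potential_def circulation_def zero_ereal_def one_ereal_def)
  ultimately show ?thesis by simp
qed

text \<open>\<open>b\<close> changes sign from plus to minus at \<open>x\<close>, and the derivative
  of \<open>S\<close> is \<open>- b / a\<close>.\<close>

lemma stable_zero_strict_minimum:
  assumes "b x = 0" "deriv b x < 0"
  obtains d where "d > 0" "\<And>t. t \<noteq> x \<Longrightarrow> \<bar>t - x\<bar> < d \<Longrightarrow> S x < S t"
proof -
  obtain d1 where d1: "d1 > 0" "\<And>h. 0 < h \<Longrightarrow> h < d1 \<Longrightarrow> b (x + h) < 0"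
    using DERIV_neg_dec_right[OF b_D(2) assms(2)] assms(1) by auto
  obtain d2 where d2: "d2 > 0" "\<And>h. 0 < h \<Longrightarrow> h < d2 \<Longrightarrow> 0 < b (x - h)"
    using DERIV_neg_dec_left[OF b_D(2) assms(2)] assms(1) by auto
  show thesis
  proof (rule that[of "min d1 d2"])
    fix t assume t: "t \<noteq> x" "\<bar>t - x\<bar> < min d1 d2"
    show "S x < S t"
    proof (cases "x < t")
      case True
      show ?thesis
      proof (rule DERIV_pos_imp_increasing_open[OF True])
        fix z assume z: "x < z" "z < t"
        then have "b z < 0" using d1(2)[of "z - x"] t by auto
        then show "\<exists>y. (S has_real_derivative y) (at z) \<and> y > 0"
          using S_deriv[of z] a_pos[of z] by (auto simp: divide_neg_pos)
      qed (simp add: continuous_on_S)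
    next
      case False
      then have "t < x" using t by simp
      show ?thesis
      proof (rule DERIV_neg_imp_decreasing_open[OF \<open>t < x\<close>])
        fix z assume z: "t < z" "z < x"
        then have "b z > 0" using d2(2)[of "x - z"] t by auto
        then show "\<exists>y. (S has_real_derivative y) (at z) \<and> y < 0"
          using S_deriv[of z] a_pos[of z] by auto
      qed (simp add: continuous_on_S)
    qed
  qed (use d1 d2 in auto)
qed

text \<open>The start of the hierarchy, \<open>h = 0\<close>. Wherever \<open>S\<close> strictly
  descends in one direction, a lower point is reached without any climb; nondegeneracy of the zeros
  leaves only strict minima as exceptions.\<close>

lemma bottoms_zero: "bottoms S 0 = {x. b x = 0 \<and> deriv b x < 0}"
proof
  show "{x. b x = 0 \<and> deriv b x < 0} \<subseteq> bottoms S 0"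
  proof
    fix x assume "x \<in> {x. b x = 0 \<and> deriv b x < 0}"
    then obtain d where d: "d > 0" "\<And>t. t \<noteq> x \<Longrightarrow> \<bar>t - x\<bar> < d \<Longrightarrow> S x < S t"
      using stable_zero_strict_minimum by blast
    have "S x \<le> S y" if r: "reach S 0 x y" for y
    proof (rule ccontr)
      assume "\<not> S x \<le> S y"
      then have "y \<noteq> x" by auto
      define t where "t = (if x < y then min y (x + d / 2) else max y (x - d / 2))"
      have "t \<noteq> x" "\<bar>t - x\<bar> < d" "t \<in> {min x y..max x y}"
        using \<open>y \<noteq> x\<close> d(1) by (auto simp: t_def min_def max_def)
      then show False using d(2)[of t] r by (force simp: reach_def)
    qed
    then show "x \<in> bottoms S 0" by (simp add: bottoms_def)
  qed
  show "bottoms S 0 \<subseteq> {x. b x = 0 \<and> deriv b x < 0}"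
  proof (rule subsetI, rule ccontr)
    fix x assume x: "x \<in> bottoms S 0" and n: "x \<notin> {x. b x = 0 \<and> deriv b x < 0}"
    have right: False if d: "d > 0" "\<And>h. 0 < h \<Longrightarrow> h < d \<Longrightarrow> S (x + h) < S x" for d
    proof -
      have "S t \<le> S x" if "t \<in> {min x (x + d / 2)..max x (x + d / 2)}" for t
        using d(2)[of "t - x"] that d(1) by (cases "t = x") (auto simp: min_def max_def)
      then have "S x \<le> S (x + d / 2)" using bottomsD[OF x] by (auto simp: reach_def)
      then show False using d(2)[of "d / 2"] d(1) by simp
    qed
    have left: False if d: "d > 0" "\<And>h. 0 < h \<Longrightarrow> h < d \<Longrightarrow> S (x - h) < S x" for d
    proof -
      have "S t \<le> S x" if "t \<in> {min x (x - d / 2)..max x (x - d / 2)}" for t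
        using d(2)[of "x - t"] that d(1) by (cases "t = x") (auto simp: min_def max_def)
      then have "S x \<le> S (x - d / 2)" using bottomsD[OF x] by (auto simp: reach_def)
      then show False using d(2)[of "d / 2"] d(1) by simp
    qed
    consider "b x > 0" | "b x < 0" | "b x = 0" "deriv b x > 0"
      using n nondegenerate[of x] by fastforce
    then show False
    proof cases
      case 1
      then show False using DERIV_neg_dec_right[OF S_deriv[of x]] a_pos[of x] right by auto
    next
      case 2
      then have "- (b x / a x) > 0" using a_pos[of x] by (simp add: divide_neg_pos)
      then show False using DERIV_pos_inc_left[OF S_deriv[of x]] left by auto
    next
      case 3
      obtain d where d: "d > 0" "\<And>h. 0 < h \<Longrightarrow> h < d \<Longrightarrow> 0 < b (x + h)"
        using DERIV_pos_inc_right[OF b_D(2) 3(2)] 3(1) by auto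
      have "S (x + h) < S x" if h: "0 < h" "h < d" for h
      proof (rule DERIV_neg_imp_decreasing_open[of x "x + h" S])
        show "x < x + h" using h by simp
        fix z assume z: "x < z" "z < x + h"
        then have "b z > 0" using d(2)[of "z - x"] h by auto
        then show "\<exists>y. (S has_real_derivative y) (at z) \<and> y < 0"
          using S_deriv[of z] a_pos[of z] by auto
      qed (simp add: continuous_on_S)
      then show False using right d(1) by blast
    qed
  qed
qed

lemma finite_zeros_Icc: "finite ({x. b x = 0} \<inter> {p..q})"
proof (rule finite_subset)
  let ?Z = "{x \<in> {0..<1}. b x = 0}"
  show "finite (\<Union>n\<in>{\<lfloor>p\<rfloor>..\<lfloor>q\<rfloor>}. (\<lambda>x. x + of_int n) ` ?Z)" using finite_zeros by auto
  show "{x. b x = 0} \<inter> {p..q} \<subseteq> (\<Union>n\<in>{\<lfloor>p\<rfloor>..\<lfloor>q\<rfloor>}. (\<lambda>x. x + of_int n) ` ?Z)"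
  proof
    fix x assume x: "x \<in> {x. b x = 0} \<inter> {p..q}"
    then have "b (frac x) = 0" using periodic1_frac[OF b_D(1)] by simp
    then have "frac x \<in> ?Z" by (simp add: frac_lt_1)
    moreover have "x = frac x + of_int \<lfloor>x\<rfloor>" by (simp add: frac_def)
    moreover have "\<lfloor>x\<rfloor> \<in> {\<lfloor>p\<rfloor>..\<lfloor>q\<rfloor>}" using x by (auto intro: floor_mono)
    ultimately show "x \<in> (\<Union>n\<in>{\<lfloor>p\<rfloor>..\<lfloor>q\<rfloor>}. (\<lambda>x. x + of_int n) ` ?Z)" by blast
  qed
qed

end

locale drifting = torus_setting +
  assumes circulation_pos: "circulation a b > 0"
begin

sublocale descending "potential a b" "circulation a b"
proof
  show "finite (bottoms S 0 \<inter> {p..q})" for p q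
    by (rule finite_subset[OF _ finite_zeros_Icc[of p q]]) (auto simp: bottoms_zero)
qed (auto simp: isCont_S S_shift1 circulation_pos)

end

section \<open>Barriers of one level and the closed classes of its chain\<close>

locale level_family = drifting +
  fixes M :: "int \<Rightarrow> real set" and h :: real
  assumes valleys_M: "labels_valleys (potential a b) h M"
begin

sublocale labelled "potential a b" "circulation a b" h M
  by standard (rule valleys_M)

definition lo :: "int \<Rightarrow> real" where "lo k = Min (M k)"
definition hi :: "int \<Rightarrow> real" where "hi k = Max (M k)"
definition lev :: "int \<Rightarrow> real" where "lev k = S (hi k)"
definition top :: "int \<Rightarrow> real" where "top k = potential_on a b (gates a b M k)"

abbreviation "H \<equiv> depth a b M"

lemma lo_in: "lo k \<in> M k" and hi_in: "hi k \<in> M k"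
  unfolding lo_def hi_def using M_finite M_nonempty by auto

lemma lo_le: "x \<in> M k \<Longrightarrow> lo k \<le> x" and hi_ge: "x \<in> M k \<Longrightarrow> x \<le> hi k"
  unfolding lo_def hi_def using M_finite by auto

lemma lo_le_hi: "lo k \<le> hi k" using lo_in hi_ge by blast

lemma hi_less_lo: "j < k \<Longrightarrow> hi j < lo k" using M_less hi_in lo_in by blast

lemma S_lev: "x \<in> M k \<Longrightarrow> S x = lev k"
  unfolding lev_def using M_level hi_in by blast

lemma potential_on_M: "potential_on a b (M k) = lev k"
proof -
  have "S ` M k = {lev k}" using S_lev M_nonempty by (auto simp: image_iff) (metis S_lev hi_in)
  then show ?thesis by (simp add: potential_on_def)
qed

lemma M_zero: "x \<in> M k \<Longrightarrow> b x = 0" "x \<in> M k \<Longrightarrow> deriv b x < 0"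
  using M_bottoms[of x k] bottoms_antimono[OF h_nonneg, of S] bottoms_zero by auto

lemma S2_M_pos: "x \<in> M k \<Longrightarrow> S2 x > 0"
  using M_zero[of x k] S2_zero[of x] a_pos[of x] by (simp add: divide_neg_pos)

lemma gates_alt: "gates a b M k = {x \<in> {hi k..lo (k + 1)}. \<forall>y\<in>{hi k..lo (k + 1)}. S y \<le> S x}"
  by (simp add: gates_def hi_def lo_def)

lemma ex_gate: "\<exists>x. x \<in> gates a b M k"
  using continuous_attains_sup[of "{hi k..lo (k + 1)}" S] hi_less_lo[of k "k + 1"] continuous_on_S
  unfolding gates_alt by fastforce

lemma top_eq: "x \<in> gates a b M k \<Longrightarrow> S x = top k"
proof -
  assume x: "x \<in> gates a b M k"
  have "S ` gates a b M k = {S x}" using x by (force simp: gates_alt)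
  then show ?thesis by (simp add: top_def potential_on_def)
qed

lemma le_top: "x \<in> {hi k..lo (k + 1)} \<Longrightarrow> S x \<le> top k"
  using ex_gate[of k] top_eq by (force simp: gates_alt)

lemma gates_iff: "x \<in> gates a b M k \<longleftrightarrow> x \<in> {hi k..lo (k + 1)} \<and> S x = top k"
  using top_eq[of x k] le_top[of _ k] by (force simp: gates_alt)

lemma height_right_eq: "height_right a b M k = top k - lev k"
  and height_left_eq: "height_left a b M k = top (k - 1) - lev k"
  by (simp_all add: height_right_def height_left_def top_def potential_on_M)

lemma M_reach: "x \<in> M k \<Longrightarrow> y \<in> M k \<Longrightarrow> reach S h x y"
  using M_valley[of x k] by (auto simp: valley_def)

lemma M_not_reach: "x \<in> M j \<Longrightarrow> y \<in> M k \<Longrightarrow> j \<noteq> k \<Longrightarrow> \<not> reach S h x y"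
proof
  assume x: "x \<in> M j" and y: "y \<in> M k" and "j \<noteq> k" "reach S h x y"
  then have "y \<in> M j" using M_valley[OF x] M_bottoms by (auto simp: valley_def)
  then show False using M_disjoint y \<open>j \<noteq> k\<close> by blast
qed

text \<open>Neighbouring valleys do not reach each other with climb \<open>h\<close>, in either
  direction, so the barrier exceeds both heights by more than \<open>h\<close>.\<close>

lemma top_greater: "lev k + h < top k" "lev (k + 1) + h < top k"
proof -
  have l: "hi k \<le> lo (k + 1)" using hi_less_lo[of k "k + 1"] by simp
  have "\<not> reach S h (hi k) (lo (k + 1))" "\<not> reach S h (lo (k + 1)) (hi k)"
    using M_not_reach[OF hi_in lo_in, of k "k + 1"] M_not_reach[OF lo_in hi_in, of "k + 1" k] by auto
  then obtain t t' where t: "t \<in> {hi k..lo (k + 1)}" "S (hi k) + h < S t"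
      and t': "t' \<in> {hi k..lo (k + 1)}" "S (lo (k + 1)) + h < S t'"
    unfolding reach_def using l by (auto simp: not_le)
  then show "lev k + h < top k" "lev (k + 1) + h < top k"
    using le_top[OF t(1)] le_top[OF t'(1)] S_lev[OF lo_in, of "k + 1"] by (simp_all add: lev_def)
qed

lemma height_right_greater: "h < height_right a b M k" and height_left_greater: "h < height_left a b M k"
  using top_greater(1)[of k] top_greater(2)[of "k - 1"] by (simp_all add: height_right_eq height_left_eq)

text \<open>The infimum over all labels loses the strictness of the individual bounds; it returns in
  \<open>h_less_H\<close>, where the depth is known to be attained.\<close>

lemma h_le_depth: "h \<le> H"
  unfolding depth_def using height_right_greater height_left_greater
  by (intro cINF_greatest) (auto simp: less_imp_le)

lemma depth_le: "H \<le> height_right a b M k" "H \<le> height_left a b M k"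
proof -
  have "bdd_below (range (\<lambda>k. min (height_left a b M k) (height_right a b M k)))"
    using height_right_greater height_left_greater by (intro bdd_belowI[of _ h]) (auto simp: less_imp_le)
  then have "H \<le> min (height_left a b M k) (height_right a b M k)"
    unfolding depth_def by (rule cINF_lower) simp
  then show "H \<le> height_right a b M k" "H \<le> height_left a b M k" by auto
qed

lemma gate_interior: "x \<in> gates a b M k \<Longrightarrow> hi k < x \<and> x < lo (k + 1)"
proof -
  assume x: "x \<in> gates a b M k"
  have "S x \<noteq> S (hi k)" "S x \<noteq> S (lo (k + 1))"
    using top_eq[OF x] top_greater[of k] h_nonneg S_lev[OF lo_in] S_lev[OF hi_in] by auto
  then show ?thesis using x by (auto simp: gates_iff order_less_le)
qed

text \<open>A gate is an interior maximum, hence a critical point; \<open>deriv b x < 0\<close>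
  would make it a strict minimum, and degenerate zeros are excluded.\<close>

lemma gate_zero: assumes x: "x \<in> gates a b M k" shows "b x = 0" "deriv b x > 0" "S2 x < 0"
proof -
  note i = gate_interior[OF x]
  define d where "d = min (x - hi k) (lo (k + 1) - x)"
  have d: "d > 0" using i by (simp add: d_def)
  have le: "S t \<le> S x" if "\<bar>x - t\<bar> < d" for t
    using le_top[of t k] that top_eq[OF x] by (simp add: d_def abs_less_iff)
  have "- (b x / a x) = 0"
    by (rule DERIV_local_max[OF S_deriv d]) (use le in auto)
  then show b: "b x = 0" using a_pos[of x] by simp
  show b': "deriv b x > 0"
  proof (rule ccontr)
    assume "\<not> deriv b x > 0"
    then have "deriv b x < 0" using nondegenerate[OF b] by simp
    then obtain d' where d': "d' > 0" "\<And>t. t \<noteq> x \<Longrightarrow> \<bar>t - x\<bar> < d' \<Longrightarrow> S x < S t"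
      using stable_zero_strict_minimum[OF b] by blast
    define t where "t = x + min d d' / 2"
    have "t \<noteq> x" "\<bar>t - x\<bar> < d'" "\<bar>x - t\<bar> < d" using d d'(1) by (auto simp: t_def min_def)
    then show False using le[of t] d'(2)[of t] by simp
  qed
  show "S2 x < 0" using S2_zero[OF b] b' a_pos[of x] by (simp add: divide_neg_pos)
qed

lemma finite_gates: "finite (gates a b M k)"
  by (rule finite_subset[OF _ finite_zeros_Icc[of "hi k" "lo (k + 1)"]]) (auto simp: gate_zero gates_iff)

lemma minimum_weight_eq: "minimum_weight a b x = 1 / a x * sqrt (2 * pi / S2 x)"
  by (simp add: minimum_weight_def deriv_deriv_S)

lemma gate_weight_eq: "gate_weight a b M k = (\<Sum>x\<in>gates a b M k. sqrt (2 * pi / - S2 x))"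
  by (simp add: gate_weight_def deriv_deriv_S)

lemma minimum_weight_pos: "x \<in> M k \<Longrightarrow> minimum_weight a b x > 0"
  using S2_M_pos a_pos by (simp add: minimum_weight_eq)

lemma well_weight_pos: "well_weight a b M k > 0"
  unfolding well_weight_def using M_finite M_nonempty minimum_weight_pos by (intro sum_pos) auto

lemma gate_weight_pos: "gate_weight a b M k > 0"
proof -
  have "gates a b M k \<noteq> {}" using ex_gate[of k] by blast
  then show ?thesis
    unfolding gate_weight_eq using finite_gates gate_zero(3)
    by (intro sum_pos) (auto simp: divide_less_0_iff zero_less_divide_iff)
qed

lemma jumps_iff: "(k, j) \<in> jumps a b M \<longleftrightarrow>
   j = k + 1 \<and> height_right a b M k = H \<or> j = k - 1 \<and> height_left a b M k = H"
  using well_weight_pos[of k] gate_weight_pos[of k] gate_weight_pos[of "k - 1"]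
  by (auto simp: jumps_def jump_rate_def)

text \<open>A jump crosses a barrier exactly \<open>H\<close> above the well it leaves. Seen from
  the other side the same barrier is at least \<open>H\<close> high, so the target is not
  higher.\<close>

lemma jump_reach:
  assumes j: "(k, j) \<in> jumps a b M" and x: "x \<in> M k" and y: "y \<in> M j"
  shows "reach S H x y" "lev j \<le> lev k"
proof -
  have "reach S H x y \<and> lev j \<le> lev k"
    using j unfolding jumps_iff
  proof (elim disjE conjE)
    assume j: "j = k + 1" and e: "height_right a b M k = H"
    have lv: "lev j \<le> lev k" using e depth_le(2)[of j] j by (simp add: height_right_eq height_left_eq)
    have "S t \<le> S (hi k) + H" if "t \<in> {hi k..lo j}" for t
      using le_top[of t k] that e j by (simp add: height_right_eq lev_def)
    then have "reach S H (hi k) (lo j)"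
      using hi_less_lo[of k j] j by (auto simp: reach_def)
    moreover have "reach S H x (hi k)" using reach_mono[OF M_reach[OF x hi_in] h_le_depth] .
    moreover have "reach S H (lo j) y" using reach_mono[OF M_reach[OF lo_in y] h_le_depth] .
    moreover have "S (lo j) \<le> S x" "S (hi k) = S x" using S_lev x lo_in[of j] hi_in[of k] lv by auto
    ultimately show ?thesis
      using lv reach_trans[of S H x "hi k" H "lo j"] reach_trans[of S H x "lo j" H y] by simp
  next
    assume j: "j = k - 1" and e: "height_left a b M k = H"
    have lv: "lev j \<le> lev k" using e depth_le(1)[of j] j by (simp add: height_right_eq height_left_eq)
    have "S t \<le> S (lo k) + H" if "t \<in> {hi j..lo k}" for t
      using le_top[of t j] that e j S_lev[OF lo_in, of k] by (simp add: height_left_eq)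
    then have "reach S H (lo k) (hi j)"
      using hi_less_lo[of j k] j by (auto simp: reach_def)
    moreover have "reach S H x (lo k)" using reach_mono[OF M_reach[OF x lo_in] h_le_depth] .
    moreover have "reach S H (hi j) y" using reach_mono[OF M_reach[OF hi_in y] h_le_depth] .
    moreover have "S (hi j) \<le> S x" "S (lo k) = S x" using S_lev x lo_in[of k] hi_in[of j] lv by auto
    ultimately show ?thesis
      using lv reach_trans[of S H x "lo k" H "hi j"] reach_trans[of S H x "hi j" H y] by simp
  qed
  then show "reach S H x y" "lev j \<le> lev k" by auto
qed

text \<open>Climbs do not accumulate along jumps: the heights never increase, so every later ceiling
  stays below \<open>S x + H\<close>.\<close>

lemma path_reach:
  assumes "(k, j) \<in> (jumps a b M)\<^sup>*" and x: "x \<in> M k"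
  shows "(\<forall>y\<in>M j. reach S H x y) \<and> lev j \<le> lev k"
  using assms(1)
proof (induction rule: rtrancl_induct)
  case base
  then show ?case using reach_mono[OF M_reach[OF x] h_le_depth] by blast
next
  case (step i j)
  then have "S (hi i) \<le> S x" using S_lev[OF x] S_lev[OF hi_in, of i] by simp
  moreover have "reach S H x (hi i)" using step.IH hi_in by blast
  ultimately have "reach S H x y" if "y \<in> M j" for y
    using reach_trans[of S H x "hi i" H y] jump_reach(1)[OF step.hyps(2) hi_in that] by simp
  moreover have "lev j \<le> lev k" using jump_reach(2)[OF step.hyps(2) hi_in lo_in] step.IH by simp
  ultimately show ?case by blast
qed

text \<open>If no well strictly between lies below \<open>lev k\<close>, each barrier on the way is
  at most \<open>lev k + H\<close>, hence at most \<open>H\<close> above the well in front of it;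
  since the depth is a lower bound, it is exactly \<open>H\<close>, and the step is a jump.\<close>

lemma reach_path:
  assumes x: "x \<in> M k" and y: "y \<in> M j" and r: "reach S H x y"
    and between: "\<And>i. min k j < i \<Longrightarrow> i < max k j \<Longrightarrow> lev k \<le> lev i"
  shows "(k, j) \<in> (jumps a b M)\<^sup>*"
proof (cases "k \<le> j")
  case True
  have "i \<le> j \<Longrightarrow> (k, i) \<in> (jumps a b M)\<^sup>*" if "k \<le> i" for i using that
  proof (induction i rule: int_ge_induct)
    case (step i)
    have lv: "lev k \<le> lev i" using between[of i] step True by (cases "i = k") auto
    obtain z where z: "z \<in> gates a b M i" using ex_gate by blast
    have "x \<le> hi i" using hi_ge[OF x] hi_less_lo[of k i] lo_le_hi[of i] step by (cases "i = k") auto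
    moreover have "lo (i + 1) \<le> y" using lo_le[OF y] hi_less_lo[of "i + 1" j] lo_le_hi[of "i + 1"] step
      by (cases "i + 1 = j") auto
    ultimately have "z \<in> {min x y..max x y}" using gate_interior[OF z] by auto
    then have "top i \<le> lev k + H" using r top_eq[OF z] S_lev[OF x] by (force simp: reach_def)
    then have "height_right a b M i = H" using lv depth_le(1)[of i] by (simp add: height_right_eq)
    then have "(i, i + 1) \<in> jumps a b M" by (simp add: jumps_iff)
    then show ?case using step by auto
  qed simp
  then show ?thesis using True by simp
next
  case False
  then have jk: "j \<le> k" by simp
  have "j \<le> i \<Longrightarrow> (k, i) \<in> (jumps a b M)\<^sup>*" if "i \<le> k" for i using that
  proof (induction i rule: int_le_induct)
    case (step i)
    have lv: "lev k \<le> lev i" using between[of i] step False by (cases "i = k") auto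
    obtain z where z: "z \<in> gates a b M (i - 1)" using ex_gate by blast
    have "lo i \<le> x" using lo_le[OF x] hi_less_lo[of i k] lo_le_hi[of i] step by (cases "i = k") auto
    moreover have "y \<le> hi (i - 1)" using hi_ge[OF y] hi_less_lo[of j "i - 1"] lo_le_hi[of "i - 1"] step
      by (cases "i - 1 = j") auto
    ultimately have "z \<in> {min x y..max x y}" using gate_interior[OF z] by auto
    then have "top (i - 1) \<le> lev k + H" using r top_eq[OF z] S_lev[OF x] by (force simp: reach_def)
    then have "height_left a b M i = H" using lv depth_le(2)[of i] by (simp add: height_left_eq)
    then have "(i, i - 1) \<in> jumps a b M" by (simp add: jumps_iff)
    then show ?case using step by auto
  qed simp
  then show ?thesis using jk by simp
qed

text \<open>Suppose a lower point can be reached. Among the lower wells reached, take one with the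
  nearest label: no well in between is lower, so jumps lead to it. It then lies in the class, and
  irreducibility provides a way back, against the monotonicity of heights.\<close>

lemma closed_class_bottom:
  assumes C: "closed_irreducible UNIV (jumps a b M) C" and k: "k \<in> C" and x: "x \<in> M k"
  shows "x \<in> bottoms S H"
proof (rule ccontr)
  assume "x \<notin> bottoms S H"
  then obtain t where t: "reach S H x t" "S t < S x" by (auto simp: bottoms_def not_le)
  obtain y where y: "y \<in> bottoms S h" "reach S h t y" "S y \<le> S t"
    using reaches_bottom[OF h_nonneg bottoms_nonempty] by blast
  obtain j0 where j0: "y \<in> M j0" using Union_M y(1) by blast
  define P where "P n \<longleftrightarrow> (\<exists>j y. nat \<bar>j - k\<bar> = n \<and> y \<in> M j \<and> reach S H x y \<and> lev j < lev k)" for n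
  have "reach S H x y" using reach_trans[OF t(1) _ y(2)] t(2) h_le_depth by simp
  moreover have "lev j0 < lev k" using S_lev[OF x] S_lev[OF j0] y t by simp
  ultimately have "P (nat \<bar>j0 - k\<bar>)" unfolding P_def using j0 by blast
  then have "P (LEAST n. P n)" and least: "\<And>n. P n \<Longrightarrow> (LEAST n. P n) \<le> n"
    by (auto intro: LeastI Least_le)
  then obtain j y where j: "nat \<bar>j - k\<bar> = (LEAST n. P n)" "y \<in> M j" "reach S H x y" "lev j < lev k"
    unfolding P_def by blast
  have "(k, j) \<in> (jumps a b M)\<^sup>*"
  proof (rule reach_path[OF x j(2,3)])
    fix i assume i: "min k j < i" "i < max k j"
    show "lev k \<le> lev i"
    proof (rule ccontr)
      assume "\<not> lev k \<le> lev i"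
      have "hi i \<in> {min x y..max x y}"
      proof (cases "k < j")
        case True
        then show ?thesis using M_less[of k i x "hi i"] M_less[of i j "hi i" y] x j(2) hi_in[of i] i by auto
      next
        case False
        then show ?thesis using M_less[of j i y "hi i"] M_less[of i k "hi i" x] x j(2) hi_in[of i] i by auto
      qed
      then have "reach S H x (hi i)" using reach_subsegment[OF j(3)] by blast
      then have "P (nat \<bar>i - k\<bar>)" unfolding P_def using hi_in \<open>\<not> lev k \<le> lev i\<close> by (auto simp: not_le)
      then show False using least[of "nat \<bar>i - k\<bar>"] j(1) i by auto
    qed
  qed
  moreover have closed: "i \<in> C" if "(k, i) \<in> (jumps a b M)\<^sup>*" for i
    using that
  proof (induction rule: rtrancl_induct)
    case (step i j)
    then show ?case using C unfolding closed_irreducible_def by blast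
  qed (rule k)
  ultimately have "j \<in> C" by blast
  then have "(j, k) \<in> (jumps a b M)\<^sup>*" using C k unfolding closed_irreducible_def by blast
  then show False using path_reach[OF _ j(2), of k] j(4) by simp
qed

text \<open>For a bottom, every well met on the way is at least as high, so the extra hypothesis of
  \<open>reach_path\<close> is automatic.\<close>

lemma bottom_path_iff:
  assumes x: "x \<in> M k" "x \<in> bottoms S H" and y: "y \<in> M j"
  shows "(k, j) \<in> (jumps a b M)\<^sup>* \<longleftrightarrow> reach S H x y"
proof
  assume r: "reach S H x y"
  show "(k, j) \<in> (jumps a b M)\<^sup>*"
  proof (rule reach_path[OF x(1) y r])
    fix i assume i: "min k j < i" "i < max k j"
    have "hi i \<in> {min x y..max x y}"
    proof (cases "k < j")
      case True
      then show ?thesis using M_less[of k i x "hi i"] M_less[of i j "hi i" y] x y hi_in[of i] i by auto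
    next
      case False
      then show ?thesis using M_less[of j i y "hi i"] M_less[of i k "hi i" x] x y hi_in[of i] i by auto
    qed
    then have "S x \<le> S (hi i)" using bottomsD[OF x(2)] reach_subsegment[OF r] by blast
    then show "lev k \<le> lev i" using S_lev[OF x(1)] by (simp add: lev_def)
  qed
qed (use path_reach[OF _ x(1)] y in blast)

text \<open>The inductive step of the hierarchy: merging the closed classes of the chain on the
  valleys for \<open>h\<close> yields the valleys for the depth \<open>H\<close>.\<close>

lemma closed_classes:
  "(\<lambda>C. \<Union> (M ` C)) ` Collect (closed_irreducible UNIV (jumps a b M)) = valleys S H"
proof
  have H0: "0 \<le> H" using h_nonneg h_le_depth by simp
  have sub: "bottoms S H \<subseteq> bottoms S h" using bottoms_antimono[OF h_le_depth] .
  show "(\<lambda>C. \<Union> (M ` C)) ` Collect (closed_irreducible UNIV (jumps a b M)) \<subseteq> valleys S H"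
  proof clarify
    fix C assume C: "closed_irreducible UNIV (jumps a b M) C"
    then obtain k where k: "k \<in> C" by (auto simp: closed_irreducible_def)
    obtain x where x: "x \<in> M k" using M_nonempty by blast
    have xb: "x \<in> bottoms S H" by (rule closed_class_bottom[OF C k x])
    have closed: "i \<in> C" if "(k, i) \<in> (jumps a b M)\<^sup>*" for i
      using that
    proof (induction rule: rtrancl_induct)
      case (step i j)
      then show ?case using C unfolding closed_irreducible_def by blast
    qed (rule k)
    have conn: "(k, i) \<in> (jumps a b M)\<^sup>*" if "i \<in> C" for i
      using C k that by (auto simp: closed_irreducible_def)
    have "\<Union> (M ` C) = valley S H x"
    proof
      show "\<Union> (M ` C) \<subseteq> valley S H x"
        using closed_class_bottom[OF C] path_reach[OF conn x] by (auto simp: valley_def)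
      show "valley S H x \<subseteq> \<Union> (M ` C)"
      proof
        fix y assume y: "y \<in> valley S H x"
        then have "y \<in> bottoms S h" using sub by (auto simp: valley_def)
        then obtain j where j: "y \<in> M j" using Union_M by blast
        have "(k, j) \<in> (jumps a b M)\<^sup>*" using bottom_path_iff[OF x xb j] y by (simp add: valley_def)
        then show "y \<in> \<Union> (M ` C)" using closed j by blast
      qed
    qed
    then show "\<Union> (M ` C) \<in> valleys S H" using xb by (auto simp: valleys_def)
  qed
  show "valleys S H \<subseteq> (\<lambda>C. \<Union> (M ` C)) ` Collect (closed_irreducible UNIV (jumps a b M))"
  proof
    fix A assume "A \<in> valleys S H"
    then obtain x where xb: "x \<in> bottoms S H" and A: "A = valley S H x" by (auto simp: valleys_def)
    obtain k where x: "x \<in> M k" using Union_M sub xb by blast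
    define C where "C = {j. (k, j) \<in> (jumps a b M)\<^sup>*}"
    \<comment> \<open>Wells reached from a bottom are not higher, so \<open>bottoms_transfer\<close>
      makes their points bottoms for \<open>H\<close>; between bottoms \<open>reach\<close> is
      reversible, which provides the path back.\<close>
    have ret: "(j, k) \<in> (jumps a b M)\<^sup>* \<and> M j \<subseteq> bottoms S H" if j: "(k, j) \<in> (jumps a b M)\<^sup>*" for j
    proof -
      have *: "y \<in> bottoms S H \<and> reach S H y x" if y: "y \<in> M j" for y
      proof -
        have r: "reach S H x y" "S y \<le> S x" using path_reach[OF j x] y S_lev[OF x] S_lev[OF y] by auto
        then show ?thesis using bottoms_transfer[OF xb r] bottomsD[OF xb r(1)] reach_sym[OF r(1)] by simp
      qed
      then show ?thesis using bottom_path_iff[OF hi_in _ x, of j] hi_in[of j] by blast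
    qed
    have "closed_irreducible UNIV (jumps a b M) C"
      unfolding closed_irreducible_def C_def
    proof (intro conjI ballI allI impI)
      fix i j assume "i \<in> {j. (k, j) \<in> (jumps a b M)\<^sup>*}" "j \<in> {j. (k, j) \<in> (jumps a b M)\<^sup>*}"
      then show "(i, j) \<in> (jumps a b M)\<^sup>*" using ret by (meson mem_Collect_eq rtrancl_trans)
    qed auto
    moreover have "\<Union> (M ` C) = A"
    proof
      show "\<Union> (M ` C) \<subseteq> A" using ret path_reach[OF _ x] by (auto simp: A C_def valley_def)
      show "A \<subseteq> \<Union> (M ` C)"
      proof
        fix y assume y: "y \<in> A"
        then have "y \<in> bottoms S h" using sub by (auto simp: valley_def A)
        then obtain j where j: "y \<in> M j" using Union_M by blast
        have "(k, j) \<in> (jumps a b M)\<^sup>*" using bottom_path_iff[OF x xb j] y by (simp add: valley_def A)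
        then show "y \<in> \<Union> (M ` C)" using j by (auto simp: C_def)
      qed
    qed
    ultimately show "A \<in> (\<lambda>C. \<Union> (M ` C)) ` Collect (closed_irreducible UNIV (jumps a b M))" by blast
  qed
qed

text \<open>If the recursion stops, the family is kept and the old \<open>h\<close> still describes
  it; otherwise the new threshold is the depth.\<close>

lemma next_level_labels: "\<exists>h'. labels_valleys S h' (next_level a b M)"
proof (cases "\<exists>C\<in>Collect (closed_irreducible UNIV (jumps a b M)). \<exists>C'\<in>Collect (closed_irreducible UNIV (jumps a b M)). C \<noteq> C'")
  case True
  have H0: "0 \<le> H" using h_nonneg h_le_depth by simp
  have "valleys S H \<noteq> {}" using True closed_classes by auto
  then have "bottoms S H \<noteq> {}" by (auto simp: valleys_def)
  then obtain M' where M': "increasing_labelling (valleys S H) M'" using ex_increasing_labelling[OF H0] by blast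
  have "next_level a b M = M'"
    unfolding next_level_def Let_def closed_classes using True the_increasing_labelling[OF H0 M'] by simp
  then have "labels_valleys S H (next_level a b M)"
    using M' H0 by (auto simp: labels_valleys_def increasing_labelling_def increasing_def)
  then show ?thesis ..
next
  case False
  then show ?thesis using valleys_M by (auto simp: next_level_def Let_def)
qed

end

section \<open>Every level of the recursion consists of valleys\<close>

context drifting
begin

lemma level_one_labels: "labels_valleys S 0 (\<lambda>k. {m k})"
proof -
  have b0: "bottoms S 0 = range m" using bottoms_zero minima by simp
  have v: "valley S 0 x = {x}" if x: "x \<in> bottoms S 0" for x
  proof
    show "{x} \<subseteq> valley S 0 x" using valley_self[of 0 x S] x by simp
    show "valley S 0 x \<subseteq> {x}"
    proof
      fix y assume y: "y \<in> valley S 0 x"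
      obtain d where d: "d > 0" "\<And>t. t \<noteq> x \<Longrightarrow> \<bar>t - x\<bar> < d \<Longrightarrow> S x < S t"
        using x bottoms_zero stable_zero_strict_minimum[of x] by blast
      show "y \<in> {x}"
      proof (rule ccontr)
        assume "y \<notin> {x}"
        define t where "t = (if x < y then min y (x + d / 2) else max y (x - d / 2))"
        have "t \<noteq> x" "\<bar>t - x\<bar> < d" "t \<in> {min x y..max x y}"
          using \<open>y \<notin> {x}\<close> d(1) by (auto simp: t_def min_def max_def)
        then show False using d(2)[of t] valleyD(3)[OF x y] by (force simp: reach_def)
      qed
    qed
  qed
  have "range (\<lambda>k. {m k}) = valleys S 0" unfolding valleys_def using v b0 by (auto simp: image_iff)
  moreover have "increasing (\<lambda>k. {m k})"
    unfolding increasing_def using interlaced less_trans by blast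
  ultimately show ?thesis by (simp add: labels_valleys_def)
qed

lemma level_labels: "\<exists>h. labels_valleys S h (level a b m q)"
proof -
  have "\<exists>h. labels_valleys S h ((next_level a b ^^ n) (\<lambda>k. {m k}))" for n
  proof (induction n)
    case 0
    then show ?case using level_one_labels by auto
  next
    case (Suc n)
    then obtain h where "labels_valleys S h ((next_level a b ^^ n) (\<lambda>k. {m k}))" by blast
    then interpret L: level_family a b c\<^sub>0 N m \<sigma> "(next_level a b ^^ n) (\<lambda>k. {m k})" h
      by unfold_locales
    show ?case using L.next_level_labels by simp
  qed
  then show ?thesis by (simp add: level_def)
qed

end

section \<open>The nonreversible level\<close>

context level_family
begin

abbreviation "u \<equiv> num_wells M"

text \<open>Integer translation acts on labels as a shift by the period \<open>n\<close> from
  \<open>M_period\<close>, so the classes counted by \<open>num_wells\<close> are the residues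
  modulo \<open>n\<close>.\<close>

lemma num_wells_period: "u \<ge> 1" "M (k + int u) = (\<lambda>x. x + 1) ` M k"
proof -
  obtain n :: nat where n: "n \<ge> 1" "\<And>k. M (k + int n) = (\<lambda>x. x + 1) ` M k" using M_period by blast
  have shift_n: "M (k + j * int n) = (\<lambda>x. x + of_int j) ` M k" for k j
  proof (induction j rule: int_induct[where k = 0])
    case (step1 j)
    have "M (k + (j + 1) * int n) = (\<lambda>x. x + 1) ` M (k + j * int n)"
      using n(2)[of "k + j * int n"] by (simp add: algebra_simps)
    then show ?case using step1 by (simp add: image_image add_ac)
  next
    case (step2 j)
    have "(\<lambda>x. x + 1) ` M (k + (j - 1) * int n) = M (k + j * int n)"
      using n(2)[of "k + (j - 1) * int n"] by (simp add: algebra_simps)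
    then have "(\<lambda>x. x - 1) ` (\<lambda>x. x + 1) ` M (k + (j - 1) * int n) = (\<lambda>x. x - 1) ` M (k + j * int n)" by simp
    then show ?case using step2 by (simp add: image_image add_diff_eq)
  qed simp
  define R where "R = {(A, A'). \<exists>n::int. A' = (\<lambda>x. x + real_of_int n) ` A}"
  have R: "R `` {M k} = range (\<lambda>j. M (k + j * int n))" for k
    by (auto simp: R_def shift_n)
  have "range M // R = (\<lambda>k. R `` {M k}) ` {0..<int n}"
  proof
    show "(\<lambda>k. R `` {M k}) ` {0..<int n} \<subseteq> range M // R" by (auto intro: quotientI)
    show "range M // R \<subseteq> (\<lambda>k. R `` {M k}) ` {0..<int n}"
    proof
      fix X assume "X \<in> range M // R"
      then obtain k where X: "X = R `` {M k}" by (auto elim!: quotientE)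
      have "R `` {M k} = R `` {M (k mod int n)}"
      proof -
        have "range (\<lambda>j. M (k + j * int n)) = range (\<lambda>j. M (k mod int n + j * int n))"
        proof -
          have "M (k + j * int n) = M (k mod int n + (j + k div int n) * int n)"
            "M (k mod int n + j * int n) = M (k + (j - k div int n) * int n)" for j
            by (simp_all add: algebra_simps minus_div_mult_eq_mod[symmetric])
          then show ?thesis by blast
        qed
        then show ?thesis by (simp add: R)
      qed
      then show "X \<in> (\<lambda>k. R `` {M k}) ` {0..<int n}" using X n(1) by (auto intro!: image_eqI[of _ _ "k mod int n"])
    qed
  qed
  moreover have "inj_on (\<lambda>k. R `` {M k}) {0..<int n}"
  proof (rule inj_onI)
    fix k k' assume k: "k \<in> {0..<int n}" "k' \<in> {0..<int n}" "R `` {M k} = R `` {M k'}"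
    have "M k \<in> R `` {M k}" using R[of k] by (auto intro!: image_eqI[of _ _ 0])
    then obtain j where "M k = M (k' + j * int n)" using k(3) R by auto
    then have e: "k = k' + j * int n" using M_disjoint[OF lo_in, of k] lo_in[of k] by metis
    have "k mod int n = k' mod int n" unfolding e by simp
    then show "k = k'" using k by simp
  qed
  ultimately have "card (range M // R) = n" by (simp add: card_image)
  then have "u = n" by (simp add: num_wells_def R_def)
  then show "u \<ge> 1" "M (k + int u) = (\<lambda>x. x + 1) ` M k" using n by auto
qed

lemma M_shift: "M (k + j * int u) = (\<lambda>x. x + of_int j) ` M k"
proof (induction j rule: int_induct[where k = 0])
  case (step1 j)
  have "M (k + (j + 1) * int u) = (\<lambda>x. x + 1) ` M (k + j * int u)"
    using num_wells_period(2)[of "k + j * int u"] by (simp add: algebra_simps)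
  then show ?case using step1 by (simp add: image_image add_ac)
next
  case (step2 j)
  have "(\<lambda>x. x + 1) ` M (k + (j - 1) * int u) = M (k + j * int u)"
    using num_wells_period(2)[of "k + (j - 1) * int u"] by (simp add: algebra_simps)
  then have "(\<lambda>x. x - 1) ` (\<lambda>x. x + 1) ` M (k + (j - 1) * int u) = (\<lambda>x. x - 1) ` M (k + j * int u)" by simp
  then show ?case using step2 by (simp add: image_image add_diff_eq)
qed simp

lemma lo_shift: "lo (k + j * int u) = lo k + of_int j" and hi_shift: "hi (k + j * int u) = hi k + of_int j"
proof -
  have "mono (\<lambda>x::real. x + of_int j)" by (simp add: mono_def)
  then show "lo (k + j * int u) = lo k + of_int j" "hi (k + j * int u) = hi k + of_int j"
    unfolding lo_def hi_def M_shift using M_finite M_nonempty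
    by (simp_all add: mono_Min_commute[symmetric] mono_Max_commute[symmetric])
qed

lemma lev_shift: "lev (k + j * int u) = lev k - of_int j * circulation a b"
  by (simp add: lev_def hi_shift shift)

lemma gates_shift: "x + of_int j \<in> gates a b M (k + j * int u) \<longleftrightarrow> x \<in> gates a b M k"
proof -
  have 1: "x + of_int j \<in> gates a b M (k + j * int u)" if "x \<in> gates a b M k" for x j k
  proof -
    have "lo (k + j * int u + 1) = lo (k + 1) + of_int j"
      using lo_shift[of "k + 1" j] by (simp add: algebra_simps)
    then have I: "t \<in> {hi (k + j * int u)..lo (k + j * int u + 1)} \<longleftrightarrow> t - of_int j \<in> {hi k..lo (k + 1)}" for t
      by (auto simp: hi_shift)
    have "S t \<le> S (x + of_int j)" if "t - of_int j \<in> {hi k..lo (k + 1)}" for t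
      using shift[of "t - of_int j" j] shift[of x j] \<open>x \<in> gates a b M k\<close> that by (auto simp: gates_alt)
    moreover have "x + of_int j \<in> {hi (k + j * int u)..lo (k + j * int u + 1)}"
      unfolding I using that by (simp add: gates_alt)
    ultimately show ?thesis unfolding gates_alt using I by blast
  qed
  show ?thesis using 1[of "x + of_int j" "k + j * int u" "-j"] 1 by auto
qed

lemma gates_shift_image: "gates a b M (k + j * int u) = (\<lambda>x. x + of_int j) ` gates a b M k"
proof (intro set_eqI iffI)
  fix x assume "x \<in> gates a b M (k + j * int u)"
  then show "x \<in> (\<lambda>x. x + of_int j) ` gates a b M k"
    using gates_shift[of "x - of_int j" j k] by (auto intro!: image_eqI[of _ _ "x - of_int j"])
qed (auto simp: gates_shift)

lemma S2_shift: "S2 (x + of_int j) = S2 x"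
  using periodic1_shift[OF a_D(1)] periodic1_shift[OF b_D(1)]
    periodic1_shift[OF periodic1_deriv(1)[OF a_C2]] periodic1_shift[OF periodic1_deriv(1)[OF b_C2]]
  by (simp add: S2_def)

lemma minimum_weight_shift: "minimum_weight a b (x + of_int j) = minimum_weight a b x"
  using periodic1_shift[OF a_D(1)] by (simp add: minimum_weight_eq S2_shift)

lemma well_weight_shift: "well_weight a b M (k + j * int u) = well_weight a b M k"
  unfolding well_weight_def M_shift
  by (subst sum.reindex) (auto simp: minimum_weight_shift inj_on_def)

lemma gate_weight_shift: "gate_weight a b M (k + j * int u) = gate_weight a b M k"
  unfolding gate_weight_eq gates_shift_image
  by (subst sum.reindex) (auto simp: S2_shift inj_on_def)

lemma labels_eq: "labels M = {0..<int u}" by (simp add: labels_def)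

lemma proj_shift: "proj M (k + j * int u) = proj M k"
  unfolding proj_def M_shift by (auto simp: image_image frac_def)

lemma mod_labels: "k mod int u \<in> labels M"
  using num_wells_period(1) by (simp add: labels_eq)

lemma proj_mod: "proj M (k mod int u) = proj M k"
  using proj_shift[of "k mod int u" "k div int u"] by simp

lemma M_frac_eq:
  assumes "x \<in> M k" "y \<in> M j" "frac x = frac y"
  shows "k mod int u = j mod int u"
proof -
  have y: "y = x + of_int (\<lfloor>y\<rfloor> - \<lfloor>x\<rfloor>)" using assms(3) by (simp add: frac_def)
  then have "y \<in> M (k + (\<lfloor>y\<rfloor> - \<lfloor>x\<rfloor>) * int u)" unfolding M_shift using assms(1) by blast
  then have "j = k + (\<lfloor>y\<rfloor> - \<lfloor>x\<rfloor>) * int u" using M_disjoint assms(2) by blast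
  then show ?thesis by simp
qed

lemma proj_inj: "inj_on (proj M) (labels M)"
proof (rule inj_onI)
  fix k j assume kj: "k \<in> labels M" "j \<in> labels M" "proj M k = proj M j"
  have "frac (lo k) \<in> proj M j" using lo_in kj(3) by (auto simp: proj_def)
  then obtain y where "y \<in> M j" "frac (lo k) = frac y" by (auto simp: proj_def)
  then have "k mod int u = j mod int u" using M_frac_eq[OF lo_in] by blast
  then show "k = j" using kj by (simp add: labels_eq)
qed

lemma ex_label_cell: obtains k where "lo k \<le> z" "z < lo (k + 1)"
proof -
  define n where "n = \<lfloor>z - lo 0\<rfloor>"
  have n: "lo (n * int u) \<le> z" "z < lo (n * int u + int u)"
    using lo_shift[of 0 n] lo_shift[of "n * int u" 1] lo_shift[of 0 "n + 1"] unfolding n_def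
    by (auto simp: algebra_simps) linarith+
  define K where "K = {k \<in> {n * int u..n * int u + int u}. lo k \<le> z}"
  have "K \<subseteq> {n * int u..n * int u + int u}" "n * int u \<in> K" using n(1) by (auto simp: K_def)
  then have K: "finite K" "K \<noteq> {}" by (auto intro: finite_subset)
  then have mK: "Max K \<in> K" by (rule Max_in)
  have "z < lo (Max K + 1)"
  proof (rule ccontr)
    assume "\<not> z < lo (Max K + 1)"
    moreover have "Max K \<noteq> n * int u + int u" using mK n(2) by (auto simp: K_def)
    ultimately have "Max K + 1 \<in> K" using mK by (auto simp: K_def)
    then show False using Max_ge[OF K(1)] by force
  qed
  then show thesis using that mK by (auto simp: K_def)
qed

end

section \<open>Geometry of a level whose right rates are all positive\<close>

locale nonreversible = level_family +
  assumes right_rate: "jump_rate a b M k (k + 1) > 0"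
begin

lemma height_right_H: "height_right a b M k = H"
  using right_rate[of k] by (auto simp: jump_rate_def split: if_splits)

lemma h_less_H: "h < H" using height_right_greater[of 0] height_right_H by simp

lemma H_pos: "0 < H" using h_less_H h_nonneg by simp

lemma top_H: "top k = lev k + H" using height_right_H[of k] by (simp add: height_right_eq)

text \<open>The barrier at height \<open>lev k + H\<close> is also the left barrier of well
  \<open>k + 1\<close> and is at least \<open>H\<close> above it. Thus the wells descend to the
  right, and by \<open>jump_rate_left\<close> a left jump occurs exactly between wells of equal
  height.\<close>

lemma lev_step: "lev (k + 1) \<le> lev k"
  using depth_le(2)[of "k + 1"] top_H[of k] by (simp add: height_left_eq)

lemma lev_antimono: "j \<le> k \<Longrightarrow> lev k \<le> lev j"
proof (induction k rule: int_ge_induct)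
  case (step i) then show ?case using lev_step[of i] by simp
qed simp

lemma jump_rate_right: "jump_rate a b M k (k + 1) = 1 / (well_weight a b M k * gate_weight a b M k)"
  by (simp add: jump_rate_def height_right_H)

lemma jump_rate_left: "jump_rate a b M k (k - 1) =
    (if lev (k - 1) = lev k then 1 / (well_weight a b M k * gate_weight a b M (k - 1)) else 0)"
  by (simp add: jump_rate_def height_left_eq top_H)

lemma jump_rate_nonneg: "jump_rate a b M k j \<ge> 0"
  using well_weight_pos[of k] gate_weight_pos[of k] gate_weight_pos[of "k - 1"]
  by (auto simp: jump_rate_def intro!: divide_nonneg_nonneg mult_nonneg_nonneg)

lemma jump_rate_shift: "jump_rate a b M (k + n * int u) (k + n * int u + 1) = jump_rate a b M k (k + 1)"
    "jump_rate a b M (k + n * int u) (k + n * int u - 1) = jump_rate a b M k (k - 1)"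
proof -
  show "jump_rate a b M (k + n * int u) (k + n * int u + 1) = jump_rate a b M k (k + 1)"
    by (simp add: jump_rate_right well_weight_shift gate_weight_shift)
  have e: "k + n * int u - 1 = (k - 1) + n * int u" by simp
  show "jump_rate a b M (k + n * int u) (k + n * int u - 1) = jump_rate a b M k (k - 1)"
    unfolding jump_rate_left using well_weight_shift[of k n] gate_weight_shift[of "k - 1" n] lev_shift[of k n] lev_shift[of "k - 1" n]
    by (simp add: e)
qed

text \<open>To the right of well \<open>j\<close> all wells are at most as high. Within the spread
  of a valley \<open>S\<close> rises by at most \<open>h < H\<close>, and between valleys by at most
  \<open>H\<close>, with equality exactly at gates.\<close>

lemma ascent_below_bottom:
  assumes y: "y \<in> M j" and "y \<le> z"
  shows "S z \<le> lev j + H" and "S z = lev j + H \<Longrightarrow> \<exists>k\<ge>j. z \<in> gates a b M k \<and> lev k = lev j"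
proof -
  obtain k where k: "lo k \<le> z" "z < lo (k + 1)" by (rule ex_label_cell)
  have "j \<le> k"
  proof (rule ccontr)
    assume "\<not> j \<le> k"
    then have "lo (k + 1) \<le> lo j" using hi_less_lo[of "k + 1" j] lo_le_hi[of "k + 1"] by (cases "k + 1 = j") auto
    then show False using lo_le[OF y] k(2) \<open>y \<le> z\<close> by simp
  qed
  then have l: "lev k \<le> lev j" by (rule lev_antimono)
  consider "z < hi k" | "hi k \<le> z" by linarith
  then have *: "S z \<le> lev k + h \<or> z \<in> {hi k..lo (k + 1)}"
  proof cases
    case 1
    then show ?thesis using M_reach[OF lo_in hi_in, of k] k(1) S_lev[OF lo_in, of k] by (auto simp: reach_def)
  qed (use k(2) in auto)
  then have le: "S z \<le> lev k + H" using le_top[of z k] h_less_H top_H[of k] by auto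
  then show "S z \<le> lev j + H" using l by simp
  assume e: "S z = lev j + H"
  then have "lev k = lev j" "S z = lev k + H" using le l by auto
  then have "z \<in> gates a b M k" using * h_less_H top_H[of k] by (auto simp: gates_iff)
  then show "\<exists>k\<ge>j. z \<in> gates a b M k \<and> lev k = lev j" using \<open>j \<le> k\<close> \<open>lev k = lev j\<close> by blast
qed

text \<open>The point \<open>y\<close> is replaced by a bottom \<open>w\<close> reached from it with
  climb \<open>h\<close>. This determines where the kernel \<open>ker\<close> is not exponentially
  small: for \<open>y\<close> in a well and \<open>z\<close> a gate downstream of it, with no
  descent between the wells.\<close>

lemma ascent:
  assumes "y \<le> z"
  shows "S z \<le> S y + H"
    and "S z = S y + H \<Longrightarrow> \<exists>j k. j \<le> k \<and> y \<in> M j \<and> z \<in> gates a b M k \<and> lev k = lev j"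
proof -
  obtain w where w: "w \<in> bottoms S h" "reach S h y w" "S w \<le> S y"
    using reaches_bottom[OF h_nonneg bottoms_nonempty] by blast
  obtain j where j: "w \<in> M j" using Union_M w(1) by blast
  \<comment> \<open>If \<open>w\<close> lies beyond \<open>z\<close>, the segment from
    \<open>y\<close> to \<open>w\<close> passes over \<open>z\<close>, so \<open>S z\<close> obeys
    the smaller bound.\<close>
  have *: "S z \<le> S y + h \<or> w \<le> z"
    using w(2) assms by (force simp: reach_def)
  then show "S z \<le> S y + H"
    using ascent_below_bottom(1)[OF j, of z] S_lev[OF j] w(3) h_less_H by auto
  assume e: "S z = S y + H"
  then have "w \<le> z" using * h_less_H by auto
  then have l: "S z = lev j + H" "S w = S y"
    using ascent_below_bottom(1)[OF j] S_lev[OF j] w(3) e by force+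
  have "reach S h w y" using reach_sym[OF w(2)] l(2) by simp
  then have "y \<in> M j"
    using M_valley[OF j] bottoms_transfer[OF w(1)] l(2) by (simp add: valley_def)
  then show "\<exists>j k. j \<le> k \<and> y \<in> M j \<and> z \<in> gates a b M k \<and> lev k = lev j"
    using ascent_below_bottom(2)[OF j \<open>w \<le> z\<close> l(1)] by auto
qed

definition gl :: "int \<Rightarrow> real" where "gl k = Min (gates a b M k)"
definition gr :: "int \<Rightarrow> real" where "gr k = Max (gates a b M k)"

lemma gates_nonempty: "gates a b M k \<noteq> {}" using ex_gate[of k] by blast

lemma gl_in: "gl k \<in> gates a b M k" and gr_in: "gr k \<in> gates a b M k"
  unfolding gl_def gr_def using finite_gates gates_nonempty by auto

lemma gl_le: "z \<in> gates a b M k \<Longrightarrow> gl k \<le> z" and gr_ge: "z \<in> gates a b M k \<Longrightarrow> z \<le> gr k"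
  unfolding gl_def gr_def using finite_gates by auto

lemma hi_less_gl: "hi k < gl k" and gr_less_lo: "gr k < lo (k + 1)"
  using gate_interior gl_in gr_in by auto

lemma gl_le_gr: "gl k \<le> gr k" using gl_le gr_in by blast

lemma gates_order: "j < k \<Longrightarrow> gr j < gl k"
  using gr_less_lo[of j] hi_less_lo[of "j + 1" k] lo_le_hi[of k] lo_le_hi[of "j + 1"] hi_less_gl[of k]
  by (cases "j + 1 = k") auto

lemma gates_shift_gl: "gl (k + j * int u) = gl k + of_int j" and gates_shift_gr: "gr (k + j * int u) = gr k + of_int j"
proof -
  have "mono (\<lambda>x::real. x + of_int j)" by (simp add: mono_def)
  then show "gl (k + j * int u) = gl k + of_int j" "gr (k + j * int u) = gr k + of_int j"
    unfolding gl_def gr_def gates_shift_image using finite_gates gates_nonempty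
    by (simp_all add: mono_Min_commute[symmetric] mono_Max_commute[symmetric])
qed

text \<open>A barrier may have several gates. The basin ends at the last gate on its left and the
  first gate on its right; the stretch between the gates of one barrier belongs to no basin.\<close>

definition basin :: "int \<Rightarrow> real set" where "basin k = {gr (k - 1)<..<gl k}"

lemma M_basin: "M k \<subseteq> basin k"
proof
  fix x assume "x \<in> M k"
  then show "x \<in> basin k"
    using lo_le[of x k] hi_ge[of x k] gr_less_lo[of "k - 1"] hi_less_gl[of k] by (auto simp: basin_def)
qed

lemma basin_disjoint: "x \<in> basin j \<Longrightarrow> x \<in> basin k \<Longrightarrow> j = k"
proof -
  have "x \<notin> basin k" if "x \<in> basin j" "j < k" for j k
  proof -
    have "gl j \<le> gr (k - 1)" using gates_order[of j "k - 1"] gl_le_gr[of j] gl_le_gr[of "k - 1"] that(2)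
      by (cases "j = k - 1") auto
    then show ?thesis using that(1) by (auto simp: basin_def)
  qed
  then show "x \<in> basin j \<Longrightarrow> x \<in> basin k \<Longrightarrow> j = k" by (cases j k rule: linorder_cases) auto
qed

lemma basin_no_gate: "z \<in> gates a b M j \<Longrightarrow> z \<notin> basin k"
proof
  assume z: "z \<in> gates a b M j" "z \<in> basin k"
  show False
  proof (cases "j < k")
    case True
    then have "z \<le> gr (k - 1)" using gr_ge[OF z(1)] gates_order[of j "k - 1"] gl_le_gr[of "k - 1"]
      by (cases "j = k - 1") auto
    then show False using z(2) by (auto simp: basin_def)
  next
    case False
    then have "gl k \<le> z" using gl_le[OF z(1)] gates_order[of k j] gl_le_gr[of k] by (cases "j = k") auto
    then show False using z(2) by (auto simp: basin_def)
  qed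
qed

lemma basin_shift: "x + of_int j \<in> basin (k + j * int u) \<longleftrightarrow> x \<in> basin k"
  using gates_shift_gr[of "k - 1" j] gates_shift_gl[of k j]
  by (auto simp: basin_def algebra_simps)

lemma basin_frac_eq:
  assumes "x \<in> basin k" "y \<in> basin j" "frac x = frac y"
  shows "k mod int u = j mod int u"
proof -
  have y: "y = x + of_int (\<lfloor>y\<rfloor> - \<lfloor>x\<rfloor>)" using assms(3) by (simp add: frac_def)
  then have "y \<in> basin (k + (\<lfloor>y\<rfloor> - \<lfloor>x\<rfloor>) * int u)" using basin_shift[of x] assms(1) by metis
  then have "j = k + (\<lfloor>y\<rfloor> - \<lfloor>x\<rfloor>) * int u" using basin_disjoint assms(2) by blast
  then show ?thesis by simp
qed

text \<open>The radius of the neighbourhoods is bounded by the first depth and must be compared with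
  \<open>H\<close>. To the right of the local minimum \<open>hi 0\<close> some barrier of level one
  lies within \<open>[hi 0, lo 1]\<close>, so its height is at most \<open>H\<close>.\<close>

lemma level_one_depth_le: "depth a b (level a b m 1) \<le> H"
proof -
  interpret L: level_family a b c\<^sub>0 N m \<sigma> "\<lambda>k. {m k}" 0
    by unfold_locales (rule level_one_labels)
  have mono: "j < k \<Longrightarrow> m j < m k" for j k
    using step_less_imp_less[of m] interlaced less_trans by blast
  have "range m = bottoms S 0" using bottoms_zero minima by simp
  then have "M k \<subseteq> range m" for k using M_bottoms bottoms_antimono[OF h_nonneg, of S] by blast
  then obtain i i' where i: "hi 0 = m i" "lo 1 = m i'" using hi_in lo_in by blast
  have "m i < m i'" using hi_less_lo[of 0 1] i by simp
  then have "i < i'" using mono[of i' i] by (cases i i' rule: linorder_cases) auto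
  then have "m (i + 1) \<le> lo 1" using mono[of "i + 1" i'] i by (cases "i + 1 = i'") auto
  obtain z where z: "z \<in> gates a b (\<lambda>k. {m k}) i" using L.ex_gate by blast
  have "z \<in> {hi 0..lo 1}" using z \<open>m (i + 1) \<le> lo 1\<close> i by (auto simp: L.gates_iff L.hi_def L.lo_def)
  then have "L.top i \<le> lev 0 + H" using L.top_eq[OF z] le_top[of z 0] top_H[of 0] by simp
  moreover have "L.lev i = lev 0" using i by (simp add: L.lev_def L.hi_def lev_def)
  ultimately have "height_right a b (\<lambda>k. {m k}) i \<le> H" by (simp add: L.height_right_eq)
  then show ?thesis using L.depth_le(1)[of i] by (simp add: level_def)
qed

text \<open>The neighbourhoods are built around representatives in \<open>[0, 1)\<close>.
  Translation by the integer part of \<open>w\<close> brings them back to the level, and it shifts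
  \<open>S\<close> by a constant, so heights relative to the minimum are unchanged.\<close>

lemma well_nbhd_lift:
  assumes "x \<in> well_nbhd a b M r k"
  obtains y w where "w \<in> M k" "frac y = x" "\<And>t. t \<in> {min w y..max w y} \<Longrightarrow> S t < lev k + r"
proof -
  obtain x0 where x0: "x0 \<in> proj M k" "x \<in> minimum_nbhd a b r x0" using assms by (auto simp: well_nbhd_def)
  obtain w where w: "w \<in> M k" "x0 = frac w" using x0(1) by (auto simp: proj_def)
  let ?K = "connected_component_set {y. S y < S x0 + r} x0"
  obtain y0 where y0: "y0 \<in> ?K" "x = frac y0" using x0(2) by (auto simp: minimum_nbhd_def)
  have "x0 \<in> ?K" using y0(1) by (metis connected_component_refl_eq connected_component_in mem_Collect_eq connected_component_eq_empty emptyE)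
  moreover have "connected ?K" by (rule connected_connected_component)
  ultimately have sub: "{min x0 y0..max x0 y0} \<subseteq> ?K"
    using connected_contains_Icc[of ?K "min x0 y0" "max x0 y0"] y0(1) by (simp add: min_def max_def)
  have lt: "S t < S x0 + r" if "t \<in> {min x0 y0..max x0 y0}" for t
    using subsetD[OF sub that] connected_component_subset[of "{y. S y < S x0 + r}" x0] by blast
  have wx: "w = x0 + of_int \<lfloor>w\<rfloor>" using w(2) by (simp add: frac_def)
  show thesis
  proof (rule that[of w "y0 + of_int \<lfloor>w\<rfloor>"])
    show "frac (y0 + of_int \<lfloor>w\<rfloor>) = x" using y0(2) by (simp add: frac_def)
    fix t assume "t \<in> {min w (y0 + of_int \<lfloor>w\<rfloor>)..max w (y0 + of_int \<lfloor>w\<rfloor>)}"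
    then have "t - of_int \<lfloor>w\<rfloor> \<in> {min x0 y0..max x0 y0}"
      using wx by (auto simp: min_def max_def split: if_splits)
    then have "S (t - of_int \<lfloor>w\<rfloor>) < S x0 + r" by (rule lt)
    then show "S t < lev k + r"
      using shift[of "t - of_int \<lfloor>w\<rfloor>" "\<lfloor>w\<rfloor>"] shift[of x0 "\<lfloor>w\<rfloor>"] wx S_lev[OF w(1)] by simp
  qed (rule w(1))
qed

lemma minima_in_well_nbhd: "0 < r \<Longrightarrow> x \<in> M k \<Longrightarrow> frac x \<in> well_nbhd a b M r k"
proof -
  assume r: "0 < r" and x: "x \<in> M k"
  have "frac x \<in> minimum_nbhd a b r (frac x)"
    unfolding minimum_nbhd_def using r
    by (intro image_eqI[of _ _ "frac x"]) (auto simp: connected_component_refl_eq frac_def)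
  then show ?thesis using x by (auto simp: well_nbhd_def proj_def)
qed

text \<open>Since \<open>r < H\<close>, the potential exceeds \<open>lev k + r\<close> near the
  gates on both sides (on the left because \<open>lev (k - 1)\<close> is not below
  \<open>lev k\<close>). These walls confine all points joined to the well below that height to a
  compact interval within the basin.\<close>

lemma basin_core:
  assumes "r < H"
  obtains \<alpha> \<beta> where "{\<alpha>..\<beta>} \<subseteq> basin k" "\<alpha> \<le> lo k" "hi k \<le> \<beta>"
    "\<And>w y. w \<in> M k \<Longrightarrow> (\<And>t. t \<in> {min w y..max w y} \<Longrightarrow> S t < lev k + r) \<Longrightarrow> y \<in> {\<alpha>..\<beta>}"
proof -
  have R: "S (gl k) > lev k + r" using top_eq[OF gl_in] top_H assms by simp
  have L: "S (gr (k - 1)) > lev k + r"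
    using top_eq[OF gr_in, of "k - 1"] top_H[of "k - 1"] lev_step[of "k - 1"] assms by simp
  have "\<forall>\<^sub>F t in at_left (gl k). S t > lev k + r"
    using order_tendstoD(1)[OF isCont_S[unfolded isCont_def] R] by (simp add: eventually_at_split)
  then obtain \<beta>0 where \<beta>0: "\<beta>0 < gl k" "\<And>t. \<beta>0 < t \<Longrightarrow> t < gl k \<Longrightarrow> S t > lev k + r"
    using eventually_at_left_field[of _ "gl k"] by auto
  have "\<forall>\<^sub>F t in at_right (gr (k - 1)). S t > lev k + r"
    using order_tendstoD(1)[OF isCont_S[unfolded isCont_def] L] by (simp add: eventually_at_split)
  then obtain \<alpha>0 where \<alpha>0: "\<alpha>0 > gr (k - 1)" "\<And>t. gr (k - 1) < t \<Longrightarrow> t < \<alpha>0 \<Longrightarrow> S t > lev k + r"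
    using eventually_at_right_field[of _ "gr (k - 1)"] by auto
  define \<beta> where "\<beta> = (max \<beta>0 (hi k) + gl k) / 2"
  define \<alpha> where "\<alpha> = (min \<alpha>0 (lo k) + gr (k - 1)) / 2"
  have b: "\<beta>0 < \<beta>" "hi k \<le> \<beta>" "\<beta> < gl k" using \<beta>0(1) hi_less_gl[of k] by (auto simp: \<beta>_def max_def)
  have a: "\<alpha> < \<alpha>0" "\<alpha> \<le> lo k" "gr (k - 1) < \<alpha>" using \<alpha>0(1) gr_less_lo[of "k - 1"] by (auto simp: \<alpha>_def min_def)
  show thesis
  proof (rule that[of \<alpha> \<beta>])
    show "{\<alpha>..\<beta>} \<subseteq> basin k" using a b by (auto simp: basin_def)
    fix w y assume w: "w \<in> M k" and s: "\<And>t. t \<in> {min w y..max w y} \<Longrightarrow> S t < lev k + r"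
    have "lo k \<le> w" "w \<le> hi k" using w lo_le hi_ge by auto
    have "\<not> \<beta> < y"
    proof
      assume "\<beta> < y"
      then have "S \<beta> < lev k + r" using s[of \<beta>] \<open>w \<le> hi k\<close> b by auto
      then show False using \<beta>0(2)[of \<beta>] b by simp
    qed
    moreover have "\<not> y < \<alpha>"
    proof
      assume "y < \<alpha>"
      then have "S \<alpha> < lev k + r" using s[of \<alpha>] \<open>lo k \<le> w\<close> a by auto
      then show False using \<alpha>0(2)[of \<alpha>] a by simp
    qed
    ultimately show "y \<in> {\<alpha>..\<beta>}" by auto
  qed (use a b in auto)
qed

end

section \<open>Crossing integrals\<close>

lemma ex_antiderivative:
  fixes f :: "real \<Rightarrow> real"
  assumes "continuous_on UNIV f"
  obtains A where "\<And>x. (A has_real_derivative f x) (at x)"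
proof -
  have "\<exists>A. \<forall>x::real. -\<infinity> < ereal x \<longrightarrow> ereal x < \<infinity> \<longrightarrow> (A has_vector_derivative f x) (at x)"
    by (rule einterval_antiderivative) (use assms in \<open>auto simp: continuous_on_eq_continuous_at\<close>)
  then show thesis using that by (auto simp: has_real_derivative_iff_has_vector_derivative)
qed

lemma integral_eq_antiderivative:
  fixes f :: "real \<Rightarrow> real"
  assumes "\<And>x. (A has_real_derivative f x) (at x)" "p \<le> q"
  shows "integral {p..q} f = A q - A p"
  using assms
  by (intro integral_unique fundamental_theorem_of_calculus)
     (auto simp: has_real_derivative_iff_has_vector_derivative[symmetric] intro: has_field_derivative_at_within)

lemma periodic_continuous_bounded:
  fixes F :: "real \<Rightarrow> real"
  assumes "periodic1 F" "continuous_on UNIV F"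
  obtains C where "C > 0" "\<And>y. \<bar>F y\<bar> \<le> C"
proof -
  have "bounded (F ` {0..1})"
    using assms(2) by (intro compact_imp_bounded compact_continuous_image) (auto intro: continuous_on_subset)
  then obtain C where C: "C > 0" "\<And>y. y \<in> {0..1} \<Longrightarrow> \<bar>F y\<bar> \<le> C" unfolding bounded_pos by auto
  have "\<bar>F y\<bar> \<le> C" for y
    using C(2)[of "frac y"] periodic1_frac[OF assms(1), of y] by (simp add: frac_lt_1 less_imp_le)
  then show thesis using that C(1) by blast
qed

context nonreversible
begin

text \<open>The factor \<open>exp (- H / \<epsilon>)\<close> is the inverse of the time scale, so
  \<open>F\<close> in \<open>V\<close> is the source of the accelerated equation.\<close>

definition ker :: "real \<Rightarrow> real \<Rightarrow> real \<Rightarrow> real" where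
  "ker \<epsilon> z y = exp ((S z - S y - H) / \<epsilon>) / (\<epsilon> * a y)"

text \<open>One period suffices: going back one further period multiplies the kernel by
  \<open>exp (- B / \<epsilon>)\<close>, so integrating over the whole half line would only produce
  the geometric factor \<open>1 / (1 - exp (- B / \<epsilon>))\<close>.\<close>

definition V :: "real \<Rightarrow> (real \<Rightarrow> real) \<Rightarrow> real \<Rightarrow> real" where
  "V \<epsilon> F z = integral {z - 1..z} (\<lambda>y. F y * ker \<epsilon> z y)"

abbreviation "B \<equiv> circulation a b"

lemma a_nz: "a x \<noteq> 0" using a_pos[of x] by simp

lemma ker_pos: "\<epsilon> > 0 \<Longrightarrow> ker \<epsilon> z y > 0" by (simp add: ker_def a_pos)

lemma continuous_on_ker: "\<epsilon> > 0 \<Longrightarrow> continuous_on A (ker \<epsilon> z)"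
  unfolding ker_def[abs_def] by (intro continuous_intros continuous_on_S a_D) (auto simp: a_nz)

lemma ker_integrable: "\<epsilon> > 0 \<Longrightarrow> continuous_on UNIV F \<Longrightarrow> (\<lambda>y. F y * ker \<epsilon> z y) integrable_on {p..q}"
  by (intro integrable_continuous_real continuous_intros continuous_on_ker) (auto intro: continuous_on_subset)

lemma V_abs_le:
  assumes "\<epsilon> > 0" "continuous_on UNIV F" "continuous_on UNIV G" "\<And>y. \<bar>F y\<bar> \<le> G y"
  shows "\<bar>V \<epsilon> F z\<bar> \<le> V \<epsilon> G z"
proof -
  have "norm (integral {z - 1..z} (\<lambda>y. F y * ker \<epsilon> z y)) \<le> integral {z - 1..z} (\<lambda>y. G y * ker \<epsilon> z y)"
    using assms ker_pos[OF assms(1), of z]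
    by (intro integral_norm_bound_integral ker_integrable) (auto simp: abs_mult less_imp_le intro!: mult_right_mono)
  then show ?thesis by (simp add: V_def)
qed

lemma V_scale: "V \<epsilon> (\<lambda>y. c * F y) z = c * V \<epsilon> F z"
  by (simp add: V_def mult.assoc)

lemma V_add: "\<epsilon> > 0 \<Longrightarrow> continuous_on UNIV F \<Longrightarrow> continuous_on UNIV G \<Longrightarrow>
    V \<epsilon> (\<lambda>y. F y + G y) z = V \<epsilon> F z + V \<epsilon> G z"
  unfolding V_def by (simp add: distrib_right integral_add ker_integrable)

lemma V_nonneg: "\<epsilon> > 0 \<Longrightarrow> continuous_on UNIV F \<Longrightarrow> (\<And>y. 0 \<le> F y) \<Longrightarrow> 0 \<le> V \<epsilon> F z"
  using V_abs_le[of \<epsilon> F F z] by fastforce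

lemma V_diff: "\<epsilon> > 0 \<Longrightarrow> continuous_on UNIV F \<Longrightarrow> continuous_on UNIV G \<Longrightarrow>
    V \<epsilon> (\<lambda>y. F y - G y) z = V \<epsilon> F z - V \<epsilon> G z"
  unfolding V_def by (simp add: left_diff_distrib integral_diff ker_integrable)

lemma V_sum: "\<epsilon> > 0 \<Longrightarrow> finite I \<Longrightarrow> (\<And>i. i \<in> I \<Longrightarrow> continuous_on UNIV (F i)) \<Longrightarrow>
    V \<epsilon> (\<lambda>y. \<Sum>i\<in>I. F i y) z = (\<Sum>i\<in>I. V \<epsilon> (F i) z)"
  unfolding V_def by (simp add: sum_distrib_right integral_sum ker_integrable)

text \<open>This separates the two dependences on \<open>z\<close>, through the kernel and through
  the moving window, so that differentiability and periodicity follow from those of an ordinary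
  antiderivative.\<close>

lemma V_antiderivative:
  assumes "\<epsilon> > 0" "continuous_on UNIV F"
  shows "\<exists>A. (\<forall>y. (A has_real_derivative F y * exp ((- S y - H) / \<epsilon>) / (\<epsilon> * a y)) (at y)) \<and>
    (\<forall>z. V \<epsilon> F z = exp (S z / \<epsilon>) * (A z - A (z - 1)))"
proof -
  have "continuous_on UNIV (\<lambda>y. F y * exp ((- S y - H) / \<epsilon>) / (\<epsilon> * a y))"
    using assms by (intro continuous_intros continuous_on_S a_D) (auto simp: a_nz)
  then obtain A where A: "\<And>y. (A has_real_derivative F y * exp ((- S y - H) / \<epsilon>) / (\<epsilon> * a y)) (at y)"
    using ex_antiderivative by blast
  have "V \<epsilon> F z = exp (S z / \<epsilon>) * (A z - A (z - 1))" for z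
  proof -
    have e: "exp ((S z - S y - H) / \<epsilon>) = exp (S z / \<epsilon>) * exp ((- S y - H) / \<epsilon>)" for y
      by (simp add: exp_add[symmetric] add_divide_distrib[symmetric])
    have "V \<epsilon> F z = integral {z - 1..z} (\<lambda>y. exp (S z / \<epsilon>) * (F y * exp ((- S y - H) / \<epsilon>) / (\<epsilon> * a y)))"
      unfolding V_def ker_def e by (simp add: mult_ac)
    also have "\<dots> = exp (S z / \<epsilon>) * (A z - A (z - 1))"
      by (subst integral_mult_right) (simp add: integral_eq_antiderivative[OF A])
    finally show ?thesis .
  qed
  then show ?thesis using A by blast
qed

lemma exp_shift: "exp ((- S (y - 1) - H) / \<epsilon>) = exp (- B / \<epsilon>) * exp ((- S y - H) / \<epsilon>)"
  using shift[of y "-1"]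
  by (simp add: exp_add[symmetric] add_divide_distrib[symmetric] algebra_simps)

text \<open>The right end of the window contributes the source at \<open>z\<close>, the left end
  minus the same term discounted by \<open>exp (- B / \<epsilon>)\<close>.\<close>

lemma V_deriv:
  assumes "\<epsilon> > 0" "continuous_on UNIV F" "periodic1 F"
  shows "(V \<epsilon> F has_real_derivative
      - (b z / a z) / \<epsilon> * V \<epsilon> F z + (1 - exp (- B / \<epsilon>)) * (F z * exp (- H / \<epsilon>) / (\<epsilon> * a z))) (at z)"
proof -
  obtain A where A: "\<And>y. (A has_real_derivative F y * exp ((- S y - H) / \<epsilon>) / (\<epsilon> * a y)) (at y)"
    and V: "\<And>z. V \<epsilon> F z = exp (S z / \<epsilon>) * (A z - A (z - 1))"
    using V_antiderivative[OF assms(1,2)] by blast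
  have A1: "((\<lambda>z. A (z - 1)) has_real_derivative exp (- B / \<epsilon>) * (F z * exp ((- S z - H) / \<epsilon>) / (\<epsilon> * a z))) (at z)"
  proof -
    have "F (z - 1) = F z" "a (z - 1) = a z"
      using periodic1_shift[OF assms(3), of z "-1"] periodic1_shift[OF a_D(1), of z "-1"] by simp_all
    then have "(A has_real_derivative exp (- B / \<epsilon>) * (F z * exp ((- S z - H) / \<epsilon>) / (\<epsilon> * a z))) (at (z - 1))"
      using A[of "z - 1"] by (simp add: exp_shift mult_ac)
    then show ?thesis using DERIV_shift[of A _ z "-1"] by simp
  qed
  have E: "((\<lambda>z. exp (S z / \<epsilon>)) has_real_derivative exp (S z / \<epsilon>) * (- (b z / a z) / \<epsilon>)) (at z)"
    using assms(1) by (auto intro!: derivative_eq_intros S_deriv)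
  have e: "exp (S z / \<epsilon>) * exp ((- S z - H) / \<epsilon>) = exp (- H / \<epsilon>)"
    by (simp add: exp_add[symmetric] add_divide_distrib[symmetric])
  have "((\<lambda>z. exp (S z / \<epsilon>) * (A z - A (z - 1))) has_real_derivative
     exp (S z / \<epsilon>) * (- (b z / a z) / \<epsilon>) * (A z - A (z - 1)) +
     (F z * exp ((- S z - H) / \<epsilon>) / (\<epsilon> * a z) - exp (- B / \<epsilon>) * (F z * exp ((- S z - H) / \<epsilon>) / (\<epsilon> * a z))) * exp (S z / \<epsilon>)) (at z)"
    by (rule DERIV_mult[OF E DERIV_diff[OF A A1]])
  moreover have "exp (S z / \<epsilon>) * (- (b z / a z) / \<epsilon>) * (A z - A (z - 1)) +
     (F z * exp ((- S z - H) / \<epsilon>) / (\<epsilon> * a z) - exp (- B / \<epsilon>) * (F z * exp ((- S z - H) / \<epsilon>) / (\<epsilon> * a z))) * exp (S z / \<epsilon>)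
     = - (b z / a z) / \<epsilon> * V \<epsilon> F z + (1 - exp (- B / \<epsilon>)) * (F z * (exp (S z / \<epsilon>) * exp ((- S z - H) / \<epsilon>)) / (\<epsilon> * a z))"
    unfolding V using assms(1) a_nz[of z] by (simp add: field_simps)
  moreover have "V \<epsilon> F = (\<lambda>z. exp (S z / \<epsilon>) * (A z - A (z - 1)))" using V by auto
  ultimately show ?thesis unfolding e by simp
qed

lemma continuous_on_V:
  assumes "\<epsilon> > 0" "continuous_on UNIV F"
  shows "continuous_on X (V \<epsilon> F)"
proof -
  obtain A where A: "\<And>y. (A has_real_derivative F y * exp ((- S y - H) / \<epsilon>) / (\<epsilon> * a y)) (at y)"
    and V: "\<And>z. V \<epsilon> F z = exp (S z / \<epsilon>) * (A z - A (z - 1))"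
    using V_antiderivative[OF assms] by blast
  have "continuous_on UNIV A" using A DERIV_isCont by (intro continuous_at_imp_continuous_on) blast
  then have "continuous_on X A" "continuous_on X (\<lambda>z. A (z - 1))"
    by (auto intro: continuous_on_subset intro!: continuous_on_compose2[of UNIV A] continuous_intros)
  then have "continuous_on X (\<lambda>z. exp (S z / \<epsilon>) * (A z - A (z - 1)))"
    using assms(1) by (intro continuous_intros continuous_on_S) auto
  moreover have "V \<epsilon> F = (\<lambda>z. exp (S z / \<epsilon>) * (A z - A (z - 1)))" using V by auto
  ultimately show ?thesis by simp
qed

lemma V_integrable: "\<epsilon> > 0 \<Longrightarrow> continuous_on UNIV F \<Longrightarrow> V \<epsilon> F integrable_on {p..q}"
  by (intro integrable_continuous_real continuous_on_V)

lemma V_periodic: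
  assumes "\<epsilon> > 0" "continuous_on UNIV F" "periodic1 F"
  shows "periodic1 (V \<epsilon> F)"
  unfolding periodic1_def
proof
  fix z
  obtain A where A: "\<And>y. (A has_real_derivative F y * exp ((- S y - H) / \<epsilon>) / (\<epsilon> * a y)) (at y)"
    and V: "\<And>z. V \<epsilon> F z = exp (S z / \<epsilon>) * (A z - A (z - 1))"
    using V_antiderivative[OF assms(1,2)] by blast
  have "((\<lambda>y. A (y + 1) - exp (B / \<epsilon>) * A y) has_real_derivative 0) (at y)" for y
  proof -
    have "F (y + 1) = F y" "a (y + 1) = a y" using assms(3) a_D(1) by (auto simp: periodic1_def)
    moreover have "exp ((- S (y + 1) - H) / \<epsilon>) = exp (B / \<epsilon>) * exp ((- S y - H) / \<epsilon>)"
      by (simp add: exp_add[symmetric] add_divide_distrib[symmetric] S_shift1)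
    ultimately have "((\<lambda>y. A (y + 1)) has_real_derivative exp (B / \<epsilon>) * (F y * exp ((- S y - H) / \<epsilon>) / (\<epsilon> * a y))) (at y)"
      using A[of "y + 1"] by (simp add: DERIV_shift mult_ac)
    from DERIV_diff[OF this DERIV_cmult[OF A[of y], of "exp (B / \<epsilon>)"]] show ?thesis by simp
  qed
  then have "A (z + 1) - exp (B / \<epsilon>) * A z = A (z - 1 + 1) - exp (B / \<epsilon>) * A (z - 1)"
    using DERIV_isconst_all[of "\<lambda>y. A (y + 1) - exp (B / \<epsilon>) * A y" z "z - 1"] by blast
  then have "A (z + 1) - A z = exp (B / \<epsilon>) * (A z - A (z - 1))" by (simp add: algebra_simps)
  moreover have "exp (S (z + 1) / \<epsilon>) * exp (B / \<epsilon>) = exp (S z / \<epsilon>)"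
    by (simp add: exp_add[symmetric] add_divide_distrib[symmetric] S_shift1)
  ultimately show "V \<epsilon> F (z + 1) = V \<epsilon> F z" using V[of "z + 1"] V[of z] by (simp add: mult.assoc[symmetric])
qed

lemma discount_pos: "\<epsilon> > 0 \<Longrightarrow> 0 < 1 - exp (- B / \<epsilon>)" "\<epsilon> > 0 \<Longrightarrow> 1 - exp (- B / \<epsilon>) \<le> 1"
  using circulation_pos by simp_all

text \<open>With the integrating factor \<open>exp (- S / \<epsilon>)\<close> the equation becomes
  exact. Integration over one period and periodicity of \<open>deriv f\<close> express
  \<open>deriv f z\<close> through \<open>V\<close>.\<close>

lemma generator_solution_deriv:
  assumes "\<epsilon> > 0" "f \<in> C2_torus" "continuous_on UNIV F"
    and gen: "\<And>x. time_scale a b M \<epsilon> * diffusion_gen a b \<epsilon> f x = F x"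
  shows "(1 - exp (- B / \<epsilon>)) * deriv f z = V \<epsilon> F z"
proof -
  define p where "p y = exp (- S y / \<epsilon>) * deriv f y" for y
  have p': "(p has_real_derivative F y * exp ((- S y - H) / \<epsilon>) / (\<epsilon> * a y)) (at y)" for y
  proof -
    have D: "(p has_real_derivative exp (- S y / \<epsilon>) * ((b y / a y) / \<epsilon>) * deriv f y + deriv (deriv f) y * exp (- S y / \<epsilon>)) (at y)"
      unfolding p_def using assms(1)
      by (auto intro!: derivative_eq_intros S_deriv C2_torusD[OF assms(2)] simp: field_simps)
    have "exp ((- S y - H) / \<epsilon>) = exp (- S y / \<epsilon>) * exp (- (H / \<epsilon>))"
      by (simp add: exp_add[symmetric] diff_divide_distrib)
    moreover have "F y * exp (- (H / \<epsilon>)) = b y * deriv f y + \<epsilon> * a y * deriv (deriv f) y"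
      using gen[of y, symmetric] by (simp add: time_scale_def diffusion_gen_def exp_minus field_simps)
    ultimately have "F y * exp ((- S y - H) / \<epsilon>) = exp (- S y / \<epsilon>) * (b y * deriv f y + \<epsilon> * a y * deriv (deriv f) y)"
      by (metis mult.left_commute)
    then have "exp (- S y / \<epsilon>) * ((b y / a y) / \<epsilon>) * deriv f y + deriv (deriv f) y * exp (- S y / \<epsilon>) = F y * exp ((- S y - H) / \<epsilon>) / (\<epsilon> * a y)"
      using assms(1) a_nz[of y] by (simp add: field_simps)
    then show ?thesis using D by simp
  qed
  have "V \<epsilon> F z = exp (S z / \<epsilon>) * (p z - p (z - 1))"
  proof -
    have e: "exp ((S z - S y - H) / \<epsilon>) = exp (S z / \<epsilon>) * exp ((- S y - H) / \<epsilon>)" for y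
      by (simp add: exp_add[symmetric] add_divide_distrib[symmetric])
    have "V \<epsilon> F z = integral {z - 1..z} (\<lambda>y. exp (S z / \<epsilon>) * (F y * exp ((- S y - H) / \<epsilon>) / (\<epsilon> * a y)))"
      unfolding V_def ker_def e by (simp add: mult_ac)
    also have "\<dots> = exp (S z / \<epsilon>) * (p z - p (z - 1))"
      by (subst integral_mult_right) (simp add: integral_eq_antiderivative[OF p'])
    finally show ?thesis .
  qed
  moreover have "deriv f (z - 1) = deriv f z"
    using periodic1_shift[OF periodic1_deriv(1)[OF assms(2)], of z "-1"] by simp
  moreover have "exp (S z / \<epsilon>) * exp (- S z / \<epsilon>) = 1" "exp (S z / \<epsilon>) * exp (- S (z - 1) / \<epsilon>) = exp (- B / \<epsilon>)"
    using shift[of z "-1"] by (simp_all add: exp_add[symmetric] add_divide_distrib[symmetric])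
  ultimately show ?thesis
    by (simp add: p_def right_diff_distrib mult.assoc[symmetric]) (simp add: left_diff_distrib)
qed

lemma generator_solution_increment:
  assumes "\<epsilon> > 0" "f \<in> C2_torus" "continuous_on UNIV F"
    and gen: "\<And>x. time_scale a b M \<epsilon> * diffusion_gen a b \<epsilon> f x = F x" and "x \<le> x'"
  shows "(1 - exp (- B / \<epsilon>)) * (f x' - f x) = integral {x..x'} (V \<epsilon> F)"
proof -
  have "((\<lambda>y. (1 - exp (- B / \<epsilon>)) * f y) has_real_derivative V \<epsilon> F y) (at y)" for y
    using DERIV_cmult[OF C2_torusD(2)[OF assms(2)], of "1 - exp (- B / \<epsilon>)" y]
    by (simp only: generator_solution_deriv[OF assms(1-4)])
  from integral_eq_antiderivative[OF this \<open>x \<le> x'\<close>] show ?thesis by (simp add: right_diff_distrib)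
qed

text \<open>Integrating \<open>V \<epsilon> F\<close> divided by the discount solves the equation on
  the line; a vanishing integral over one period is what makes the result a function on the
  torus.\<close>

lemma ex_generator_solution:
  assumes "\<epsilon> > 0" "continuous_on UNIV F" "periodic1 F" and zero: "integral {x0..x0 + 1} (V \<epsilon> F) = 0"
  obtains f where "f \<in> C2_torus" "f x0 = v" "\<And>x. time_scale a b M \<epsilon> * diffusion_gen a b \<epsilon> f x = F x"
proof -
  let ?d = "1 - exp (- B / \<epsilon>)"
  have d: "?d > 0" by (rule discount_pos(1)[OF assms(1)])
  have split: "(x + D * y) / D = x / D + y" if "D > 0" for x y D :: real
    using that by (simp add: field_simps)
  define f' where "f' z = V \<epsilon> F z / ?d" for z
  define f'' where "f'' z = - (b z / a z) / \<epsilon> * f' z + F z * exp (- H / \<epsilon>) / (\<epsilon> * a z)" for z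
  have cV: "continuous_on UNIV (V \<epsilon> F)" by (rule continuous_on_V[OF assms(1,2)])
  obtain U where U: "\<And>x. (U has_real_derivative V \<epsilon> F x) (at x)" using ex_antiderivative[OF cV] by blast
  define f where "f x = v + (U x - U x0) / ?d" for x
  have f1: "(f has_real_derivative f' x) (at x)" for x
    unfolding f_def f'_def using d by (auto intro!: derivative_eq_intros U)
  have f2: "(f' has_real_derivative f'' x) (at x)" for x
  proof -
    have "(f' has_real_derivative (- (b x / a x) / \<epsilon> * V \<epsilon> F x + ?d * (F x * exp (- H / \<epsilon>) / (\<epsilon> * a x))) / ?d) (at x)"
      unfolding f'_def by (rule DERIV_cdivide[OF V_deriv[OF assms(1-3)]])
    moreover have "(- (b x / a x) / \<epsilon> * V \<epsilon> F x + ?d * (F x * exp (- H / \<epsilon>) / (\<epsilon> * a x))) / ?d = f'' x"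
      unfolding f''_def f'_def split[OF d] by simp
    ultimately show ?thesis by simp
  qed
  have per: "periodic1 f" unfolding periodic1_def
  proof
    fix x
    have "((\<lambda>x. U (x + 1) - U x) has_real_derivative 0) (at x)" for x
    proof -
      have "((\<lambda>x. U (x + 1)) has_real_derivative V \<epsilon> F x) (at x)"
        using U[of "x + 1"] V_periodic[OF assms(1-3)] by (simp add: DERIV_shift periodic1_def)
      from DERIV_diff[OF this U[of x]] show ?thesis by simp
    qed
    then have "U (x + 1) - U x = U (x0 + 1) - U x0"
      using DERIV_isconst_all[of "\<lambda>x. U (x + 1) - U x" x x0] by blast
    also have "\<dots> = 0" using integral_eq_antiderivative[OF U, of x0 "x0 + 1"] zero by simp
    finally show "f (x + 1) = f x" by (simp add: f_def)
  qed
  have "isCont f'' x" for x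
  proof -
    have "isCont f' x" using f2 DERIV_isCont by blast
    moreover have "isCont F x" using assms(2) by (simp add: continuous_on_eq_continuous_at)
    ultimately show ?thesis unfolding f''_def using assms(1)
      by (intro continuous_intros a_D b_D) (auto simp: a_nz)
  qed
  from C2_torusI[OF per f1 f2 this] have f: "f \<in> C2_torus" "deriv f = f'" "deriv (deriv f) = f''" by auto
  show thesis
  proof (rule that[OF f(1)])
    show "f x0 = v" by (simp add: f_def)
    have f3: "deriv f' = f''" using f by simp
    have "exp (H / \<epsilon>) * exp (- H / \<epsilon>) = 1" by (simp add: exp_add[symmetric] add_divide_distrib[symmetric])
    then show "time_scale a b M \<epsilon> * diffusion_gen a b \<epsilon> f x = F x" for x
      unfolding time_scale_def diffusion_gen_def f(2) f3 f''_def using assms(1) a_pos[of x]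
      by (simp add: field_simps)
  qed
qed

lemma V_one_integral_mono:
  assumes "\<epsilon> > 0" "p \<le> p'" "q' \<le> q" "p' \<le> q'"
  shows "integral {p'..q'} (V \<epsilon> (\<lambda>_. 1)) \<le> integral {p..q} (V \<epsilon> (\<lambda>_. 1))"
  using assms by (intro integral_subset_le V_integrable) (auto intro!: V_nonneg)

lemma V_integral_bound:
  assumes "\<epsilon> > 0" "continuous_on UNIV F" "continuous_on UNIV G" "\<And>y. \<bar>F y\<bar> \<le> G y"
  shows "\<bar>integral {p..q} (V \<epsilon> F)\<bar> \<le> integral {p..q} (V \<epsilon> G)"
proof -
  have "norm (integral {p..q} (V \<epsilon> F)) \<le> integral {p..q} (V \<epsilon> G)"
    using V_abs_le[OF assms(1-4)] assms by (intro integral_norm_bound_integral V_integrable) auto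
  then show ?thesis by simp
qed

lemma V_integral_bound_one:
  assumes "\<epsilon> > 0" "continuous_on UNIV F" "\<And>y. \<bar>F y\<bar> \<le> C"
  shows "\<bar>integral {p..q} (V \<epsilon> F)\<bar> \<le> C * integral {p..q} (V \<epsilon> (\<lambda>_. 1))"
proof -
  have "V \<epsilon> (\<lambda>_. C) = (\<lambda>z. C * V \<epsilon> (\<lambda>_. 1) z)" using V_scale[of \<epsilon> C "\<lambda>_. 1"] by auto
  then show ?thesis using V_integral_bound[of \<epsilon> F "\<lambda>_. C" p q] assms by simp
qed

text \<open>By \<open>ascent\<close> the exponent is strictly negative for every \<open>z\<close> in
  the interval; compactness turns this into a uniform gap \<eta>, against which
  \<open>1 / \<epsilon>\<close> is harmless.\<close>

lemma no_gate_integral: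
  assumes ng: "\<And>z k. z \<in> {p..q} \<Longrightarrow> z \<notin> gates a b M k"
  shows "((\<lambda>\<epsilon>. integral {p..q} (V \<epsilon> (\<lambda>_. 1))) \<longlongrightarrow> 0) (at_right 0)"
proof (cases "p \<le> q")
  case True
  \<comment> \<open>The coordinates \<open>z\<close> and \<open>z - y\<close> turn the moving window
    into a fixed compact rectangle.\<close>
  define f where "f w = S (fst w) - S (fst w - snd w)" for w :: "real \<times> real"
  let ?K = "{p..q} \<times> {0..1::real}"
  have "continuous_on ?K f"
    unfolding f_def by (intro continuous_intros continuous_on_compose2[OF continuous_on_S]) auto
  moreover have "compact ?K" "?K \<noteq> {}" using True by (auto intro: compact_Times)
  ultimately obtain w where w: "w \<in> ?K" "\<And>v. v \<in> ?K \<Longrightarrow> f v \<le> f w"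
    using continuous_attains_sup by metis
  have "f w < H"
  proof -
    obtain z s where zs: "w = (z, s)" "z \<in> {p..q}" "0 \<le> s" using w(1) by (cases w) auto
    then have "S z \<le> S (z - s) + H" "S z \<noteq> S (z - s) + H"
      using ascent[of "z - s" z] ng[of z] by auto
    then show ?thesis by (simp add: f_def zs)
  qed
  define \<eta> where "\<eta> = H - f w"
  have \<eta>: "\<eta> > 0" using \<open>f w < H\<close> by (simp add: \<eta>_def)
  have ker_le: "ker \<epsilon> z y \<le> exp (- \<eta> / \<epsilon>) / (\<epsilon> * c\<^sub>0)" if "\<epsilon> > 0" "z \<in> {p..q}" "y \<in> {z - 1..z}" for \<epsilon> z y
  proof -
    have "f (z, z - y) \<le> f w" using that by (intro w(2)) auto
    then have "S z - S y - H \<le> - \<eta>" by (simp add: f_def \<eta>_def)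
    then have "(S z - S y - H) / \<epsilon> \<le> - \<eta> / \<epsilon>" using that(1) by (intro divide_right_mono) auto
    then have "exp ((S z - S y - H) / \<epsilon>) \<le> exp (- \<eta> / \<epsilon>)" by simp
    moreover have "\<epsilon> * c\<^sub>0 \<le> \<epsilon> * a y" "0 < \<epsilon> * c\<^sub>0" using a_lower[of y] c0_pos that(1) by auto
    ultimately show ?thesis unfolding ker_def by (intro frac_le) auto
  qed
  have V_le: "V \<epsilon> (\<lambda>_. 1) z \<le> exp (- \<eta> / \<epsilon>) / (\<epsilon> * c\<^sub>0)" if "\<epsilon> > 0" "z \<in> {p..q}" for \<epsilon> z
  proof -
    have "norm (integral {z - 1..z} (\<lambda>y. 1 * ker \<epsilon> z y)) \<le> exp (- \<eta> / \<epsilon>) / (\<epsilon> * c\<^sub>0) * (z - (z - 1))"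
      using that ker_le ker_pos[of \<epsilon> z] continuous_on_ker by (intro integral_bound) (auto simp: less_imp_le)
    then show ?thesis by (simp add: V_def)
  qed
  show ?thesis
  proof (rule Lim_null_comparison)
    show "((\<lambda>\<epsilon>. (q - p) / c\<^sub>0 * (exp (- \<eta> / \<epsilon>) / \<epsilon>)) \<longlongrightarrow> 0) (at_right 0)"
      by (intro tendsto_mult_right_zero exp_over_power_limit(1)[OF \<eta>])
    show "\<forall>\<^sub>F \<epsilon> in at_right 0. norm (integral {p..q} (V \<epsilon> (\<lambda>_. 1))) \<le> (q - p) / c\<^sub>0 * (exp (- \<eta> / \<epsilon>) / \<epsilon>)"
      using eventually_at_right_less[of 0]
    proof eventually_elim
      case (elim \<epsilon>)
      have "norm (integral {p..q} (V \<epsilon> (\<lambda>_. 1))) \<le> exp (- \<eta> / \<epsilon>) / (\<epsilon> * c\<^sub>0) * (q - p)"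
        using V_le[OF elim] V_nonneg[OF elim, of "\<lambda>_. 1"] continuous_on_V[OF elim]
        by (intro integral_bound[OF True]) auto
      then show ?case by (simp add: field_simps)
    qed
  qed
qed simp

lemma no_gate_integral_bounded:
  assumes ng: "\<And>z k. z \<in> {p..q} \<Longrightarrow> z \<notin> gates a b M k" and F: "continuous_on UNIV F" "periodic1 F"
  shows "((\<lambda>\<epsilon>. integral {p..q} (V \<epsilon> F)) \<longlongrightarrow> 0) (at_right 0)"
proof -
  obtain C where C: "C > 0" "\<And>y. \<bar>F y\<bar> \<le> C" using periodic_continuous_bounded[OF F(2,1)] by blast
  show ?thesis
  proof (rule Lim_null_comparison)
    show "((\<lambda>\<epsilon>. C * integral {p..q} (V \<epsilon> (\<lambda>_. 1))) \<longlongrightarrow> 0) (at_right 0)"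
      using tendsto_mult[OF tendsto_const no_gate_integral[OF ng]] by simp
    show "\<forall>\<^sub>F \<epsilon> in at_right 0. norm (integral {p..q} (V \<epsilon> F)) \<le> C * integral {p..q} (V \<epsilon> (\<lambda>_. 1))"
      using eventually_at_right_less[of 0] by eventually_elim (use V_integral_bound_one F C in auto)
  qed
qed

text \<open>These are the minima for which gate \<open>k\<close> is exactly \<open>H\<close> above
  and to the right, that is, the zeros of the exponent at that gate.\<close>

definition upstream :: "int \<Rightarrow> real set" where
  "upstream k = (\<Union>j\<in>{j. j \<le> k \<and> lev j = lev k}. M j)"

definition upstream_sum :: "int \<Rightarrow> (real \<Rightarrow> real) \<Rightarrow> real" where
  "upstream_sum k F = (\<Sum>y\<in>upstream k. F y * minimum_weight a b y)"

lemma gate_label_unique: "z \<in> gates a b M j \<Longrightarrow> z \<in> gates a b M k \<Longrightarrow> j = k"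
  using gates_order[of j k] gates_order[of k j] gl_le[of z] gr_ge[of z]
  by (cases j k rule: linorder_cases) force+

text \<open>One period before the gate contains them all: if a minimum at height
  \<open>lev k\<close> lay further back, its translate by 1 would still be upstream of the gate and
  lower by \<open>B\<close>, contradicting the descent of the wells. Conversely,
  \<open>ascent\<close> identifies every point at that height.\<close>

lemma upstream_window:
  assumes "hi k < \<alpha>" "\<alpha> \<le> gl k"
  shows "upstream k = {y \<in> {\<alpha> - 1..\<alpha>}. S y - lev k = 0}"
proof (intro set_eqI iffI)
  fix y assume "y \<in> upstream k"
  then obtain j where j: "j \<le> k" "lev j = lev k" "y \<in> M j" by (auto simp: upstream_def)
  have "y \<le> hi k" using hi_ge[OF j(3)] hi_less_lo[of j k] lo_le_hi[of k] j(1) by (cases "j = k") auto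
  moreover have "\<alpha> - 1 \<le> y"
  proof (rule ccontr)
    assume "\<not> \<alpha> - 1 \<le> y"
    then have y: "y + 1 < gl k" using assms by simp
    have y1: "y + 1 \<in> M (j + int u)" using j(3) num_wells_period(2)[of j] by auto
    have "j + int u \<le> k"
    proof (rule ccontr)
      assume "\<not> j + int u \<le> k"
      then have "gl k \<le> gr k" "gr k < lo (j + int u)"
        using gl_le_gr gr_less_lo[of k] hi_less_lo[of "k + 1" "j + int u"] lo_le_hi[of "k + 1"]
        by (auto) (cases "k + 1 = j + int u"; auto)
      then show False using lo_le[OF y1] y by simp
    qed
    then have "lev k \<le> lev (j + int u)" by (rule lev_antimono)
    also have "\<dots> = lev j - B" using lev_shift[of j 1] by simp
    finally show False using j(2) circulation_pos by simp
  qed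
  ultimately show "y \<in> {y \<in> {\<alpha> - 1..\<alpha>}. S y - lev k = 0}" using assms S_lev[OF j(3)] j(2) by auto
next
  fix y assume y: "y \<in> {y \<in> {\<alpha> - 1..\<alpha>}. S y - lev k = 0}"
  then have "S (gl k) = S y + H" "y \<le> gl k" using top_eq[OF gl_in] top_H[of k] assms by auto
  then obtain j k' where "j \<le> k'" "y \<in> M j" "gl k \<in> gates a b M k'" "lev k' = lev j"
    using ascent(2) by blast
  then show "y \<in> upstream k" using gate_label_unique[OF gl_in] by (force simp: upstream_def)
qed

lemma finite_upstream: "finite (upstream k)"
  using upstream_window[OF hi_less_gl order_refl] M_zero(1)
  by (intro finite_subset[OF _ finite_zeros_Icc[of "gl k - 1" "gl k"]]) (auto simp: upstream_def)

lemma upstream_rec: "upstream k = M k \<union> (if lev (k - 1) = lev k then upstream (k - 1) else {})"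
proof -
  have "{j. j \<le> k \<and> lev j = lev k} = {k} \<union> (if lev (k - 1) = lev k then {j. j \<le> k - 1 \<and> lev j = lev (k - 1)} else {})"
  proof (intro set_eqI iffI)
    fix j assume j: "j \<in> {j. j \<le> k \<and> lev j = lev k}"
    show "j \<in> {k} \<union> (if lev (k - 1) = lev k then {j. j \<le> k - 1 \<and> lev j = lev (k - 1)} else {})"
    proof (cases "j = k")
      case False
      then have "lev (k - 1) \<le> lev j" "lev k \<le> lev (k - 1)" using j lev_antimono[of j "k - 1"] lev_antimono[of "k - 1" k] by auto
      then show ?thesis using j False by auto
    qed simp
  qed (auto split: if_splits)
  then show ?thesis by (auto simp: upstream_def)
qed

lemma upstream_sum_rec: "upstream_sum k F = (\<Sum>y\<in>M k. F y * minimum_weight a b y) + (if lev (k - 1) = lev k then upstream_sum (k - 1) F else 0)"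
proof (cases "lev (k - 1) = lev k")
  case True
  have "M k \<inter> upstream (k - 1) = {}" using M_disjoint by (fastforce simp: upstream_def)
  then show ?thesis
    unfolding upstream_sum_def upstream_rec[of k] using True M_finite finite_upstream[of "k - 1"]
    by (simp add: sum.union_disjoint)
next
  case False
  then show ?thesis unfolding upstream_sum_def upstream_rec[of k] by simp
qed

lemma quotient_limit_S:
  "b y = 0 \<Longrightarrow> ((\<lambda>z. (S z - S y) / (z - y)\<^sup>2) \<longlongrightarrow> S2 y / 2) (at y)"
  "b y = 0 \<Longrightarrow> ((\<lambda>z. (S y - S z) / (z - y)\<^sup>2) \<longlongrightarrow> - S2 y / 2) (at y)"
proof -
  assume b: "b y = 0"
  show 1: "((\<lambda>z. (S z - S y) / (z - y)\<^sup>2) \<longlongrightarrow> S2 y / 2) (at y)"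
    by (rule second_order_quotient_limit[where f' = "\<lambda>x. - (b x / a x)"])
       (auto intro!: derivative_eq_intros S_deriv S_deriv2 simp: b)
  have "(\<lambda>z. (S y - S z) / (z - y)\<^sup>2) = (\<lambda>z. - ((S z - S y) / (z - y)\<^sup>2))"
    by (simp only: minus_divide_left minus_diff_eq)
  then show "((\<lambda>z. (S y - S z) / (z - y)\<^sup>2) \<longlongrightarrow> - S2 y / 2) (at y)"
    using tendsto_minus[OF 1] by simp
qed

text \<open>On a neighbourhood of the whole gate set \<open>S\<close> stays above
  \<open>lev k\<close>, so sources located there are negligible. Near the outer gates this is
  continuity; between gates, equality would by \<open>ascent\<close> put a minimum of the level
  outside every basin.\<close>

lemma gate_window:
  obtains \<alpha> \<beta> where "hi k < \<alpha>" "\<alpha> < gl k" "gr k < \<beta>" "\<beta> < lo (k + 1)"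
    "\<And>t. t \<in> {\<alpha>..\<beta>} \<Longrightarrow> lev k < S t"
proof -
  have R: "S (gr k) > lev k" and L: "S (gl k) > lev k"
    using top_eq[OF gl_in, of k] top_eq[OF gr_in, of k] top_H[of k] H_pos by auto
  have "\<forall>\<^sub>F t in at_right (gr k). S t > lev k"
    using order_tendstoD(1)[OF isCont_S[unfolded isCont_def] R] by (simp add: eventually_at_split)
  then obtain \<beta>0 where \<beta>0: "\<beta>0 > gr k" "\<And>t. gr k < t \<Longrightarrow> t < \<beta>0 \<Longrightarrow> S t > lev k"
    using eventually_at_right_field[of _ "gr k"] by auto
  have "\<forall>\<^sub>F t in at_left (gl k). S t > lev k"
    using order_tendstoD(1)[OF isCont_S[unfolded isCont_def] L] by (simp add: eventually_at_split)
  then obtain \<alpha>0 where \<alpha>0: "\<alpha>0 < gl k" "\<And>t. \<alpha>0 < t \<Longrightarrow> t < gl k \<Longrightarrow> S t > lev k"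
    using eventually_at_left_field[of _ "gl k"] by auto
  define \<alpha> where "\<alpha> = (max \<alpha>0 (hi k) + gl k) / 2"
  define \<beta> where "\<beta> = (min \<beta>0 (lo (k + 1)) + gr k) / 2"
  have a: "\<alpha>0 < \<alpha>" "hi k < \<alpha>" "\<alpha> < gl k" using \<alpha>0(1) hi_less_gl[of k] by (auto simp: \<alpha>_def max_def)
  have b: "\<beta> < \<beta>0" "\<beta> < lo (k + 1)" "gr k < \<beta>" using \<beta>0(1) gr_less_lo[of k] by (auto simp: \<beta>_def min_def)
  show thesis
  proof (rule that[of \<alpha> \<beta>])
    fix t assume t: "t \<in> {\<alpha>..\<beta>}"
    consider "t < gl k" | "gr k < t" | "gl k \<le> t" "t \<le> gr k" by linarith
    then show "lev k < S t"
    proof cases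
      case 3
      have e: "S (gr k) = lev k + H" using top_eq[OF gr_in] top_H by simp
      have "S (gr k) \<noteq> S t + H"
      proof
        assume "S (gr k) = S t + H"
        then obtain j k' where "t \<in> M j" using ascent(2)[OF 3(2)] by blast
        then have "t \<in> basin j" using M_basin by blast
        moreover have "t \<notin> basin j"
        proof (cases "j \<le> k")
          case True
          then have "gl j \<le> t" using 3(1) gates_order[of j k] gl_le_gr[of j] by (cases "j = k") auto
          then show ?thesis by (auto simp: basin_def)
        next
          case False
          then have "t \<le> gr (j - 1)" using 3(2) gates_order[of k "j - 1"] gl_le_gr[of "j - 1"] by (cases "j - 1 = k") auto
          then show ?thesis by (auto simp: basin_def)
        qed
        ultimately show False by blast
      qed
      then show ?thesis using ascent(1)[OF 3(2)] e by simp
    qed (use \<alpha>0(2)[of t] \<beta>0(2)[of t] a b t in auto)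
  qed (use a b in auto)
qed

text \<open>The double integral factors: Laplace's method at the upstream minima yields
  \<open>upstream_sum\<close>, and at the gates it yields \<open>gate_weight\<close>. The coupling
  through the moving window is exponentially small.\<close>

lemma gate_crossing_limit:
  assumes F: "continuous_on UNIV F" "periodic1 F"
  shows "((\<lambda>\<epsilon>. integral {hi k..lo (k + 1)} (V \<epsilon> F)) \<longlongrightarrow> gate_weight a b M k * upstream_sum k F) (at_right 0)"
proof -
  obtain \<alpha> \<beta> where ab: "hi k < \<alpha>" "\<alpha> < gl k" "gr k < \<beta>" "\<beta> < lo (k + 1)"
    and above: "\<And>t. t \<in> {\<alpha>..\<beta>} \<Longrightarrow> lev k < S t" using gate_window by blast
  have le: "\<alpha> \<le> \<beta>" using ab gl_le_gr[of k] by simp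
  have "lo (k + 1) \<le> lo (k + int u)"
    using hi_less_lo[of "k + 1" "k + int u"] lo_le_hi[of "k + 1"] num_wells_period(1) by (cases "k + 1 = k + int u") auto
  then have short: "\<beta> - \<alpha> < 1" using lo_shift[of k 1] lo_le_hi[of k] ab by simp
  \<comment> \<open>The exponent splits as \<open>- (top k - S z) - (S y - lev k)\<close>. The
    prefactor \<open>1 / \<epsilon>\<close> is shared, one \<open>1 / sqrt \<epsilon>\<close> for
    each of the two Laplace integrals.\<close>
  define f where "f \<epsilon> y = F y / a y * exp (- (S y - lev k) / \<epsilon>)" for \<epsilon> y
  define T where "T \<epsilon> z = integral {z - 1..z} (f \<epsilon>) / sqrt \<epsilon>" for \<epsilon> z
  define \<rho> where "\<rho> \<epsilon> z = 1 * exp (- (top k - S z) / \<epsilon>)" for \<epsilon> z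
  have VT: "V \<epsilon> F z = \<rho> \<epsilon> z / sqrt \<epsilon> * T \<epsilon> z" if \<epsilon>: "\<epsilon> > 0" for \<epsilon> z
  proof -
    have "F y * ker \<epsilon> z y = (\<rho> \<epsilon> z / \<epsilon>) * f \<epsilon> y" for y
    proof -
      have "exp ((S z - S y - H) / \<epsilon>) = exp (- (top k - S z) / \<epsilon>) * exp (- (S y - lev k) / \<epsilon>)"
        by (simp add: exp_add[symmetric] add_divide_distrib[symmetric] top_H)
      then show ?thesis by (simp add: ker_def \<rho>_def f_def)
    qed
    moreover have "\<epsilon> = sqrt \<epsilon> * sqrt \<epsilon>" using \<epsilon> by simp
    ultimately show ?thesis unfolding V_def T_def by (simp add: mult.assoc)
  qed
  have cf: "continuous_on X (f \<epsilon>)" if "\<epsilon> > 0" for \<epsilon> X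
    unfolding f_def using F(1) that
    by (intro continuous_intros a_D continuous_on_S) (auto intro: continuous_on_subset simp: a_nz)
  have S_ge: "lev k \<le> S y" if "y \<le> \<alpha>" for y
    using ascent(1)[of y "gl k"] top_eq[OF gl_in, of k] top_H[of k] that ab by simp
  have Tlim: "((\<lambda>\<epsilon>. T \<epsilon> \<alpha>) \<longlongrightarrow> upstream_sum k F) (at_right 0)"
  proof -
    have "((\<lambda>\<epsilon>. integral {\<alpha> - 1..\<alpha>} (\<lambda>y. F y / a y * exp (- (S y - lev k) / \<epsilon>)) / sqrt \<epsilon>) \<longlongrightarrow>
      (\<Sum>y\<in>upstream k. F y / a y * sqrt (2 * pi / S2 y))) (at_right 0)"
    proof (rule laplace_finite)
      show "upstream k = {y \<in> {\<alpha> - 1..\<alpha>}. S y - lev k = 0}" using upstream_window[of k \<alpha>] ab by simp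
      show "0 < S (\<alpha> - 1) - lev k" "0 < S \<alpha> - lev k"
        using above[of \<alpha>] le shift[of \<alpha> "-1"] circulation_pos by auto
      show "continuous_on {\<alpha> - 1..\<alpha>} (\<lambda>a. S a - lev k)" by (intro continuous_intros continuous_on_S)
      show "continuous_on {\<alpha> - 1..\<alpha>} (\<lambda>y. F y / a y)"
        using F(1) by (intro continuous_intros a_D) (auto intro: continuous_on_subset simp: a_nz)
      show "0 \<le> S y - lev k" if "y \<in> {\<alpha> - 1..\<alpha>}" for y using S_ge that by simp
      show "0 < S2 y \<and> (\<lambda>z. (S z - lev k) / (z - y)\<^sup>2) \<midarrow>y\<rightarrow> S2 y / 2" if y: "y \<in> upstream k" for y
      proof -
        obtain j where j: "y \<in> M j" "lev j = lev k" using y unfolding upstream_def by blast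
        then show ?thesis using S2_M_pos[OF j(1)] quotient_limit_S(1)[OF M_zero(1)[OF j(1)]] S_lev[OF j(1)] by simp
      qed
    qed (auto simp: finite_upstream)
    moreover have "T \<epsilon> \<alpha> = integral {\<alpha> - 1..\<alpha>} (\<lambda>y. F y / a y * exp (- (S y - lev k) / \<epsilon>)) / sqrt \<epsilon>" for \<epsilon>
      by (simp only: T_def f_def[abs_def])
    ultimately show ?thesis by (simp add: upstream_sum_def minimum_weight_eq)
  qed
  have \<rho>lim: "((\<lambda>\<epsilon>. integral {\<alpha>..\<beta>} (\<rho> \<epsilon>) / sqrt \<epsilon>) \<longlongrightarrow> gate_weight a b M k) (at_right 0)"
  proof -
    have g: "gates a b M k = {y \<in> {\<alpha>..\<beta>}. top k - S y = 0}"
    proof (intro set_eqI iffI)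
      fix y assume "y \<in> gates a b M k"
      then show "y \<in> {y \<in> {\<alpha>..\<beta>}. top k - S y = 0}" using ab gl_le[of y k] gr_ge[of y k] top_eq[of y k] by simp
    next
      fix y assume "y \<in> {y \<in> {\<alpha>..\<beta>}. top k - S y = 0}"
      then show "y \<in> gates a b M k" using ab by (simp add: gates_iff)
    qed
    have "((\<lambda>\<epsilon>. integral {\<alpha>..\<beta>} (\<lambda>y. 1 * exp (- (top k - S y) / \<epsilon>)) / sqrt \<epsilon>) \<longlongrightarrow>
      (\<Sum>y\<in>gates a b M k. 1 * sqrt (2 * pi / - S2 y))) (at_right 0)"
    proof (rule laplace_finite[OF finite_gates _ g])
      show "\<alpha> < \<beta>" using ab gl_le_gr[of k] by simp
      have "\<alpha> \<notin> gates a b M k" "\<beta> \<notin> gates a b M k" using ab gl_le[of \<alpha> k] gr_ge[of \<beta> k] by auto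
      then show "0 < top k - S \<alpha>" "0 < top k - S \<beta>"
        using le_top[of \<alpha> k] le_top[of \<beta> k] ab le gates_iff[of \<alpha> k] gates_iff[of \<beta> k] by (auto simp: order_less_le)
      show "0 \<le> top k - S y" if "y \<in> {\<alpha>..\<beta>}" for y using le_top[of y k] ab that by auto
      show "0 < - S2 y \<and> (\<lambda>z. (top k - S z) / (z - y)\<^sup>2) \<midarrow>y\<rightarrow> - S2 y / 2" if "y \<in> gates a b M k" for y
        using gate_zero[OF that] quotient_limit_S(2)[of y] top_eq[OF that] by simp
    qed (auto intro!: continuous_intros continuous_on_S)
    then show ?thesis by (simp only: \<rho>_def[abs_def] gate_weight_eq mult_1)
  qed
  obtain C0 where C0: "C0 > 0" "\<And>y. \<bar>F y\<bar> \<le> C0" using periodic_continuous_bounded[OF F(2,1)] by blast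
  define C where "C = C0 / c\<^sub>0"
  have C: "C > 0" "\<bar>F y / a y\<bar> \<le> C" for y
    using C0 c0_pos a_lower[of y] a_pos[of y] by (auto simp: C_def abs_divide intro!: frac_le)
  obtain t0 where t0: "t0 \<in> {\<alpha>..\<beta>}" "\<And>t. t \<in> {\<alpha>..\<beta>} \<Longrightarrow> S t0 \<le> S t"
    using continuous_attains_inf[of "{\<alpha>..\<beta>}" S] le continuous_on_S by auto
  define \<eta> where "\<eta> = S t0 - lev k"
  have \<eta>: "\<eta> > 0" using above[OF t0(1)] by (simp add: \<eta>_def)
  have f_le: "\<bar>f \<epsilon> y\<bar> \<le> C * exp (- \<eta> / \<epsilon>)" if "\<epsilon> > 0" "y \<in> {\<alpha>..\<beta>} \<or> y \<in> {\<alpha> - 1..\<beta> - 1}" for \<epsilon> y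
  proof -
    have "\<eta> \<le> S y - lev k"
      using that(2) t0(2)[of y] t0(2)[of "y + 1"] S_shift1[of y] circulation_pos by (auto simp: \<eta>_def)
    then have "- (S y - lev k) / \<epsilon> \<le> - \<eta> / \<epsilon>" using that(1) by (intro divide_right_mono) auto
    then have "exp (- (S y - lev k) / \<epsilon>) \<le> exp (- \<eta> / \<epsilon>)" by simp
    then have "\<bar>F y / a y\<bar> * exp (- (S y - lev k) / \<epsilon>) \<le> C * exp (- \<eta> / \<epsilon>)"
      using C by (intro mult_mono) auto
    then show ?thesis by (simp add: f_def abs_mult)
  qed
  \<comment> \<open>Since \<open>\<beta> - \<alpha> < 1\<close>, the windows ending at
    \<open>z\<close> and at \<alpha> differ only by \<open>[\<alpha>, z]\<close> and its translate
    by -1, where \<open>S - lev k\<close> is at least \<eta>.\<close>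
  have T_near: "\<bar>T \<epsilon> z - T \<epsilon> \<alpha>\<bar> \<le> 2 * C * (exp (- \<eta> / \<epsilon>) / sqrt \<epsilon>)" if \<epsilon>: "\<epsilon> > 0" and z: "z \<in> {\<alpha>..\<beta>}" for \<epsilon> z
  proof -
    have i: "f \<epsilon> integrable_on {p..q}" for p q by (intro integrable_continuous_real cf[OF \<epsilon>])
    have "integral {z - 1..\<alpha>} (f \<epsilon>) + integral {\<alpha>..z} (f \<epsilon>) = integral {z - 1..z} (f \<epsilon>)"
      "integral {\<alpha> - 1..z - 1} (f \<epsilon>) + integral {z - 1..\<alpha>} (f \<epsilon>) = integral {\<alpha> - 1..\<alpha>} (f \<epsilon>)"
      using z short by (intro Henstock_Kurzweil_Integration.integral_combine i; simp)+
    then have "integral {z - 1..z} (f \<epsilon>) - integral {\<alpha> - 1..\<alpha>} (f \<epsilon>) = integral {\<alpha>..z} (f \<epsilon>) - integral {\<alpha> - 1..z - 1} (f \<epsilon>)"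
      by simp
    moreover have "norm (integral {\<alpha>..z} (f \<epsilon>)) \<le> C * exp (- \<eta> / \<epsilon>) * (z - \<alpha>)"
      using z f_le[OF \<epsilon>] by (intro integral_bound cf[OF \<epsilon>]) auto
    moreover have "norm (integral {\<alpha> - 1..z - 1} (f \<epsilon>)) \<le> C * exp (- \<eta> / \<epsilon>) * (z - 1 - (\<alpha> - 1))"
      using z f_le[OF \<epsilon>] by (intro integral_bound cf[OF \<epsilon>]) auto
    moreover have "C * exp (- \<eta> / \<epsilon>) * (z - \<alpha>) \<le> C * exp (- \<eta> / \<epsilon>) * 1"
      using z short C(1) by (intro mult_left_mono) auto
    ultimately have "\<bar>integral {z - 1..z} (f \<epsilon>) - integral {\<alpha> - 1..\<alpha>} (f \<epsilon>)\<bar> \<le> 2 * C * exp (- \<eta> / \<epsilon>)" by simp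
    then have "\<bar>integral {z - 1..z} (f \<epsilon>) - integral {\<alpha> - 1..\<alpha>} (f \<epsilon>)\<bar> / sqrt \<epsilon> \<le> 2 * C * exp (- \<eta> / \<epsilon>) / sqrt \<epsilon>"
      using \<epsilon> by (intro divide_right_mono) auto
    then show ?thesis using \<epsilon> by (simp add: T_def diff_divide_distrib[symmetric] abs_divide)
  qed
  define R where "R \<epsilon> = integral {\<alpha>..\<beta>} (\<rho> \<epsilon>) / sqrt \<epsilon>" for \<epsilon>
  have mid: "((\<lambda>\<epsilon>. integral {\<alpha>..\<beta>} (V \<epsilon> F)) \<longlongrightarrow> gate_weight a b M k * upstream_sum k F) (at_right 0)"
  proof -
    have "((\<lambda>\<epsilon>. integral {\<alpha>..\<beta>} (V \<epsilon> F) - R \<epsilon> * T \<epsilon> \<alpha>) \<longlongrightarrow> 0) (at_right 0)"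
    proof (rule Lim_null_comparison)
      show "((\<lambda>\<epsilon>. R \<epsilon> * (2 * C * (exp (- \<eta> / \<epsilon>) / sqrt \<epsilon>))) \<longlongrightarrow> 0) (at_right 0)"
        using tendsto_mult[OF \<rho>lim tendsto_mult[OF tendsto_const exp_over_power_limit(2)[OF \<eta>], of "2 * C"]]
        by (simp add: R_def)
      show "\<forall>\<^sub>F \<epsilon> in at_right 0. norm (integral {\<alpha>..\<beta>} (V \<epsilon> F) - R \<epsilon> * T \<epsilon> \<alpha>) \<le> R \<epsilon> * (2 * C * (exp (- \<eta> / \<epsilon>) / sqrt \<epsilon>))"
        using eventually_at_right_less[of 0]
      proof eventually_elim
        case (elim \<epsilon>)
        have c\<rho>: "continuous_on {\<alpha>..\<beta>} (\<lambda>z. \<rho> \<epsilon> z / sqrt \<epsilon>)"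
          unfolding \<rho>_def using elim by (intro continuous_intros continuous_on_S) auto
        have i1: "(\<lambda>z. \<rho> \<epsilon> z / sqrt \<epsilon> * c) integrable_on {\<alpha>..\<beta>}" for c
          by (intro integrable_continuous_real continuous_intros c\<rho>)
        have i2: "V \<epsilon> F integrable_on {\<alpha>..\<beta>}" by (rule V_integrable[OF elim F(1)])
        have Rc: "R \<epsilon> * c = integral {\<alpha>..\<beta>} (\<lambda>z. \<rho> \<epsilon> z / sqrt \<epsilon> * c)" for c
          by (simp add: R_def)
        have e1: "integral {\<alpha>..\<beta>} (V \<epsilon> F) - R \<epsilon> * T \<epsilon> \<alpha> = integral {\<alpha>..\<beta>} (\<lambda>z. V \<epsilon> F z - \<rho> \<epsilon> z / sqrt \<epsilon> * T \<epsilon> \<alpha>)"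
          unfolding Rc by (rule integral_diff[symmetric, OF i2 i1])
        have e2: "norm (integral {\<alpha>..\<beta>} (\<lambda>z. V \<epsilon> F z - \<rho> \<epsilon> z / sqrt \<epsilon> * T \<epsilon> \<alpha>)) \<le> integral {\<alpha>..\<beta>} (\<lambda>z. \<rho> \<epsilon> z / sqrt \<epsilon> * (2 * C * (exp (- \<eta> / \<epsilon>) / sqrt \<epsilon>)))"
        proof (rule integral_norm_bound_integral)
          show "(\<lambda>z. V \<epsilon> F z - \<rho> \<epsilon> z / sqrt \<epsilon> * T \<epsilon> \<alpha>) integrable_on {\<alpha>..\<beta>}" by (rule integrable_diff[OF i2 i1])
          fix z assume z: "z \<in> {\<alpha>..\<beta>}"
          have "V \<epsilon> F z - \<rho> \<epsilon> z / sqrt \<epsilon> * T \<epsilon> \<alpha> = \<rho> \<epsilon> z / sqrt \<epsilon> * (T \<epsilon> z - T \<epsilon> \<alpha>)"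
            unfolding VT[OF elim] by (simp add: right_diff_distrib)
          moreover have "0 \<le> \<rho> \<epsilon> z / sqrt \<epsilon>" using elim by (simp add: \<rho>_def)
          ultimately show "norm (V \<epsilon> F z - \<rho> \<epsilon> z / sqrt \<epsilon> * T \<epsilon> \<alpha>) \<le> \<rho> \<epsilon> z / sqrt \<epsilon> * (2 * C * (exp (- \<eta> / \<epsilon>) / sqrt \<epsilon>))"
            using T_near[OF elim z] by (simp only: real_norm_def abs_mult abs_of_nonneg mult_left_mono)
        qed (rule i1)
        show ?case by (subst e1, subst Rc) (rule e2)
      qed
    qed
    moreover have "((\<lambda>\<epsilon>. R \<epsilon> * T \<epsilon> \<alpha>) \<longlongrightarrow> gate_weight a b M k * upstream_sum k F) (at_right 0)"
      unfolding R_def by (intro tendsto_mult \<rho>lim Tlim)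
    ultimately have "((\<lambda>\<epsilon>. (integral {\<alpha>..\<beta>} (V \<epsilon> F) - R \<epsilon> * T \<epsilon> \<alpha>) + R \<epsilon> * T \<epsilon> \<alpha>) \<longlongrightarrow> 0 + gate_weight a b M k * upstream_sum k F) (at_right 0)"
      by (rule tendsto_add)
    then show ?thesis by simp
  qed
  have no_M: "z \<notin> M j" if "z \<in> gates a b M i" for z i j
    using basin_no_gate[OF that] M_basin by blast
  have in_cell: "j = k" if "z \<in> gates a b M j" "hi k < z" "z < lo (k + 1)" for z j
  proof (cases j k rule: linorder_cases)
    case less
    then have "lo (j + 1) \<le> hi k"
      using hi_less_lo[of "j + 1" k] lo_le_hi[of "j + 1"] lo_le_hi[of k] by (cases "j + 1 = k") auto
    then show ?thesis using gate_interior[OF that(1)] that by simp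
  next
    case greater
    then have "lo (k + 1) \<le> hi j"
      using hi_less_lo[of "k + 1" j] lo_le_hi[of "k + 1"] lo_le_hi[of j] by (cases "k + 1 = j") auto
    then show ?thesis using gate_interior[OF that(1)] that by simp
  qed
  have left: "((\<lambda>\<epsilon>. integral {hi k..\<alpha>} (V \<epsilon> F)) \<longlongrightarrow> 0) (at_right 0)"
  proof (rule no_gate_integral_bounded[OF _ F])
    fix z j assume z: "z \<in> {hi k..\<alpha>}"
    show "z \<notin> gates a b M j"
    proof
      assume g: "z \<in> gates a b M j"
      then have "z \<noteq> hi k" using no_M hi_in by blast
      then have "j = k" using in_cell[OF g] z ab gl_le_gr[of k] gr_less_lo[of k] by simp
      then show False using gl_le g z ab by force
    qed
  qed
  have right: "((\<lambda>\<epsilon>. integral {\<beta>..lo (k + 1)} (V \<epsilon> F)) \<longlongrightarrow> 0) (at_right 0)"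
  proof (rule no_gate_integral_bounded[OF _ F])
    fix z j assume z: "z \<in> {\<beta>..lo (k + 1)}"
    show "z \<notin> gates a b M j"
    proof
      assume g: "z \<in> gates a b M j"
      then have "z \<noteq> lo (k + 1)" using no_M lo_in by blast
      then have "j = k" using in_cell[OF g] z ab gl_le_gr[of k] hi_less_gl[of k] by simp
      then show False using gr_ge g z ab by force
    qed
  qed
  have "((\<lambda>\<epsilon>. integral {hi k..\<alpha>} (V \<epsilon> F) + integral {\<alpha>..\<beta>} (V \<epsilon> F) + integral {\<beta>..lo (k + 1)} (V \<epsilon> F))
      \<longlongrightarrow> 0 + gate_weight a b M k * upstream_sum k F + 0) (at_right 0)"
    by (intro tendsto_add left mid right)
  then have "((\<lambda>\<epsilon>. integral {hi k..\<alpha>} (V \<epsilon> F) + integral {\<alpha>..\<beta>} (V \<epsilon> F) + integral {\<beta>..lo (k + 1)} (V \<epsilon> F))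
      \<longlongrightarrow> gate_weight a b M k * upstream_sum k F) (at_right 0)" by simp
  then show ?thesis
  proof (rule Lim_transform_eventually)
    show "\<forall>\<^sub>F \<epsilon> in at_right 0. integral {hi k..\<alpha>} (V \<epsilon> F) + integral {\<alpha>..\<beta>} (V \<epsilon> F) + integral {\<beta>..lo (k + 1)} (V \<epsilon> F)
      = integral {hi k..lo (k + 1)} (V \<epsilon> F)"
      using eventually_at_right_less[of 0]
    proof eventually_elim
      case (elim \<epsilon>)
      have "integral {hi k..\<alpha>} (V \<epsilon> F) + integral {\<alpha>..\<beta>} (V \<epsilon> F) = integral {hi k..\<beta>} (V \<epsilon> F)"
        "integral {hi k..\<beta>} (V \<epsilon> F) + integral {\<beta>..lo (k + 1)} (V \<epsilon> F) = integral {hi k..lo (k + 1)} (V \<epsilon> F)"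
        using ab le V_integrable[OF elim F(1)] by (intro Henstock_Kurzweil_Integration.integral_combine; simp)+
      then show ?case by simp
    qed
  qed
qed

lemma M_cell_no_gate: "z \<in> {lo k..hi k} \<Longrightarrow> z \<notin> gates a b M j"
  using basin_no_gate[of z j k] gr_less_lo[of "k - 1"] hi_less_gl[of k] by (auto simp: basin_def)

lemma period_crossing_limit:
  assumes F: "continuous_on UNIV F" "periodic1 F"
  shows "((\<lambda>\<epsilon>. integral {hi k..hi (k + 1)} (V \<epsilon> F)) \<longlongrightarrow> gate_weight a b M k * upstream_sum k F) (at_right 0)"
proof -
  have "((\<lambda>\<epsilon>. integral {lo (k + 1)..hi (k + 1)} (V \<epsilon> F)) \<longlongrightarrow> 0) (at_right 0)"
    by (rule no_gate_integral_bounded[OF M_cell_no_gate F])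
  from tendsto_add[OF gate_crossing_limit[OF F] this]
  have "((\<lambda>\<epsilon>. integral {hi k..lo (k + 1)} (V \<epsilon> F) + integral {lo (k + 1)..hi (k + 1)} (V \<epsilon> F))
      \<longlongrightarrow> gate_weight a b M k * upstream_sum k F) (at_right 0)" by simp
  then show ?thesis
  proof (rule Lim_transform_eventually)
    show "\<forall>\<^sub>F \<epsilon> in at_right 0. integral {hi k..lo (k + 1)} (V \<epsilon> F) + integral {lo (k + 1)..hi (k + 1)} (V \<epsilon> F)
      = integral {hi k..hi (k + 1)} (V \<epsilon> F)"
      using eventually_at_right_less[of 0]
      by eventually_elim
         (use hi_less_lo[of k "k + 1"] lo_le_hi[of "k + 1"] V_integrable[OF _ F(1)] in
           \<open>intro Henstock_Kurzweil_Integration.integral_combine; simp\<close>)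
  qed
qed

lemma period_limit:
  assumes F: "continuous_on UNIV F" "periodic1 F"
  shows "((\<lambda>\<epsilon>. integral {hi 0..hi (int n)} (V \<epsilon> F)) \<longlongrightarrow> (\<Sum>k<n. gate_weight a b M (int k) * upstream_sum (int k) F)) (at_right 0)"
proof (induction n)
  case (Suc n)
  have h1: "hi 0 \<le> hi (int n)"
    using hi_less_lo[of 0 "int n"] lo_le_hi[of "int n"] by (cases "n = 0") auto
  have h2: "hi (int n) \<le> hi (int n + 1)"
    using hi_less_lo[of "int n" "int n + 1"] lo_le_hi[of "int n + 1"] by simp
  have e: "\<forall>\<^sub>F \<epsilon> in at_right 0. integral {hi 0..hi (int n)} (V \<epsilon> F) + integral {hi (int n)..hi (int n + 1)} (V \<epsilon> F)
      = integral {hi 0..hi (int (Suc n))} (V \<epsilon> F)"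
    using eventually_at_right_less[of 0]
  proof eventually_elim
    case (elim \<epsilon>)
    have "int (Suc n) = int n + 1" by simp
    then show ?case using h1 h2 V_integrable[OF elim F(1)]
      by (simp add: Henstock_Kurzweil_Integration.integral_combine add.commute[of 1])
  qed
  from tendsto_add[OF Suc period_crossing_limit[OF F, of "int n"]]
  show ?case by (rule Lim_transform_eventually[OF _ e, THEN tendsto_eq_rhs]) simp
qed simp

end

section \<open>Poisson equations and cut-off functions\<close>

lemma C2_torus_linear:
  assumes f: "f \<in> C2_torus" and g: "g \<in> C2_torus"
  shows "(\<lambda>x. c * f x + d * g x) \<in> C2_torus"
    and "deriv (\<lambda>x. c * f x + d * g x) = (\<lambda>x. c * deriv f x + d * deriv g x)"
    and "deriv (deriv (\<lambda>x. c * f x + d * g x)) = (\<lambda>x. c * deriv (deriv f) x + d * deriv (deriv g) x)"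
proof -
  note F = C2_torusD[OF f] and G = C2_torusD[OF g]
  have per: "periodic1 (\<lambda>x. c * f x + d * g x)" using F(1) G(1) by (simp add: periodic1_def)
  have 1: "((\<lambda>x. c * f x + d * g x) has_real_derivative c * deriv f x + d * deriv g x) (at x)" for x
    by (intro DERIV_add DERIV_cmult F G)
  have 2: "((\<lambda>x. c * deriv f x + d * deriv g x) has_real_derivative c * deriv (deriv f) x + d * deriv (deriv g) x) (at x)" for x
    by (intro DERIV_add DERIV_cmult F G)
  have 3: "isCont (\<lambda>x. c * deriv (deriv f) x + d * deriv (deriv g) x) x" for x
    by (intro continuous_intros F G)
  from C2_torusI[OF per 1 2 3]
  show "(\<lambda>x. c * f x + d * g x) \<in> C2_torus"
    and "deriv (\<lambda>x. c * f x + d * g x) = (\<lambda>x. c * deriv f x + d * deriv g x)"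
    and "deriv (deriv (\<lambda>x. c * f x + d * g x)) = (\<lambda>x. c * deriv (deriv f) x + d * deriv (deriv g) x)" .
qed

lemma diffusion_gen_linear:
  assumes "f \<in> C2_torus" "g \<in> C2_torus"
  shows "diffusion_gen a b \<epsilon> (\<lambda>x. c * f x + d * g x) x = c * diffusion_gen a b \<epsilon> f x + d * diffusion_gen a b \<epsilon> g x"
proof -
  have "deriv (deriv (\<lambda>x. c * f x + d * g x)) x = c * deriv (deriv f) x + d * deriv (deriv g) x"
    "deriv (\<lambda>x. c * f x + d * g x) x = c * deriv f x + d * deriv g x"
    using C2_torus_linear(2,3)[OF assms] by metis+
  then show ?thesis unfolding diffusion_gen_def by (simp add: algebra_simps)
qed

lemma C2_torus_minimum:
  assumes f: "f \<in> C2_torus"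
  obtains x0 where "\<And>x. f x0 \<le> f x" "deriv f x0 = 0" "deriv (deriv f) x0 \<ge> 0"
proof -
  note F = C2_torusD[OF f]
  have "\<exists>x\<in>{0..1}. \<forall>y\<in>{0..1}. f x \<le> f y"
    by (rule continuous_attains_inf) (auto intro: F(7))
  then obtain x0 where x0: "\<And>x. x \<in> {0..1} \<Longrightarrow> f x0 \<le> f x" by blast
  have min: "f x0 \<le> f x" for x
    using x0[of "frac x"] periodic1_frac[OF F(1), of x] by (simp add: frac_lt_1 less_imp_le)
  have d0: "deriv f x0 = 0"
    using DERIV_local_min[OF F(2) zero_less_one] min by blast
  have "deriv (deriv f) x0 \<ge> 0"
  proof (rule ccontr)
    assume "\<not> deriv (deriv f) x0 \<ge> 0"
    then obtain d where d: "d > 0" "\<And>h. 0 < h \<Longrightarrow> h < d \<Longrightarrow> deriv f (x0 + h) < 0"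
      using DERIV_neg_dec_right[OF F(3), of x0] d0 by auto
    have "f (x0 + d / 2) < f x0"
    proof (rule DERIV_neg_imp_decreasing_open[of x0 "x0 + d / 2" f])
      fix x assume x: "x0 < x" "x < x0 + d / 2"
      then have "deriv f x < 0" using d(2)[of "x - x0"] by simp
      then show "\<exists>y. (f has_real_derivative y) (at x) \<and> y < 0" using F(2) by blast
    qed (use d F(7) in auto)
    then show False using min[of "x0 + d / 2"] by simp
  qed
  then show thesis using that min d0 by blast
qed

context nonreversible
begin

lemma time_scale_pos: "time_scale a b M \<epsilon> > 0" by (simp add: time_scale_def)

lemma minimum_principle:
  assumes "f \<in> C2_torus" "\<epsilon> > 0"
  obtains x0 where "\<And>x. f x0 \<le> f x" "time_scale a b M \<epsilon> * diffusion_gen a b \<epsilon> f x0 \<ge> 0"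
proof -
  obtain x0 where x0: "\<And>x. f x0 \<le> f x" "deriv f x0 = 0" "deriv (deriv f) x0 \<ge> 0"
    using C2_torus_minimum[OF assms(1)] by blast
  then have "diffusion_gen a b \<epsilon> f x0 \<ge> 0" using assms(2) a_pos[of x0] by (simp add: diffusion_gen_def)
  then have "time_scale a b M \<epsilon> * diffusion_gen a b \<epsilon> f x0 \<ge> 0" using time_scale_pos[of \<epsilon>] by simp
  then show thesis by (rule that[OF x0(1)])
qed

text \<open>At a minimum of \<open>f\<close> the generator is nonnegative, so \<open>lam * f\<close>
  is at least \<open>G\<close> there; the same applied to \<open>- f\<close> bounds the maximum. The
  bound does not depend on \<epsilon>.\<close>

lemma resolvent_bound:
  assumes f: "f \<in> C2_torus" and "\<epsilon> > 0" "lam > 0"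
    and eq: "\<And>x. lam * f x - time_scale a b M \<epsilon> * diffusion_gen a b \<epsilon> f x = G x" and G: "\<And>x. \<bar>G x\<bar> \<le> C"
  shows "\<bar>f x\<bar> \<le> C / lam"
proof -
  obtain x0 where x0: "\<And>x. f x0 \<le> f x" "time_scale a b M \<epsilon> * diffusion_gen a b \<epsilon> f x0 \<ge> 0"
    using minimum_principle[OF f \<open>\<epsilon> > 0\<close>] by blast
  have "lam * f x0 \<ge> - C" using eq[of x0] G[of x0] x0(2) by (simp add: abs_le_iff)
  then have 1: "- (C / lam) \<le> f x" using x0(1)[of x] \<open>lam > 0\<close> by (simp add: field_simps) (smt (verit) mult_le_cancel_left)
  \<comment> \<open>\<open>- f\<close> is written in the form of \<open>C2_torus_linear\<close> so
    that the linearity lemmas apply verbatim.\<close>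
  have m: "(\<lambda>x. (-1) * f x + 0 * f x) \<in> C2_torus" by (rule C2_torus_linear(1)[OF f f])
  obtain x1 where x1: "\<And>x. (-1) * f x1 + 0 * f x1 \<le> (-1) * f x + 0 * f x"
      "time_scale a b M \<epsilon> * diffusion_gen a b \<epsilon> (\<lambda>x. (-1) * f x + 0 * f x) x1 \<ge> 0"
    using minimum_principle[OF m \<open>\<epsilon> > 0\<close>] by blast
  have "lam * f x1 \<le> C" using eq[of x1] G[of x1] x1(2) unfolding diffusion_gen_linear[OF f f] by (simp add: abs_le_iff)
  then have "f x \<le> C / lam" using x1(1)[of x] \<open>lam > 0\<close> by (simp add: field_simps) (smt (verit) mult_le_cancel_left)
  with 1 show ?thesis by (simp add: abs_le_iff)
qed

lemma discount_limit: "((\<lambda>\<epsilon>. 1 - exp (- B / \<epsilon>)) \<longlongrightarrow> 1) (at_right 0)"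
  using tendsto_diff[OF tendsto_const exp_over_power_limit(3)[OF circulation_pos], of 1] by simp

lemma discount_half: "\<forall>\<^sub>F \<epsilon> in at_right 0. 1 / 2 \<le> 1 - exp (- B / \<epsilon>)"
  using order_tendstoD(1)[OF discount_limit, of "1 / 2"] by (auto elim: eventually_mono)

text \<open>Increments are integrals of \<open>V\<close>, dominated by the bound on the source times
  \<open>no_gate_integral\<close>. Only that bound is uniform: the source itself may depend on
  \<epsilon>, as it does for the resolvent.\<close>

lemma oscillation_limit:
  fixes f G :: "real \<Rightarrow> real \<Rightarrow> real"
  assumes ev: "\<forall>\<^sub>F \<epsilon> in at_right 0. f \<epsilon> \<in> C2_torus \<and> continuous_on UNIV (G \<epsilon>) \<and> (\<forall>x. \<bar>G \<epsilon> x\<bar> \<le> C) \<and>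
      (\<forall>x. time_scale a b M \<epsilon> * diffusion_gen a b \<epsilon> (f \<epsilon>) x = G \<epsilon> x)"
    and ng: "\<And>z k. z \<in> {p..q} \<Longrightarrow> z \<notin> gates a b M k" and "\<eta> > 0"
  shows "\<forall>\<^sub>F \<epsilon> in at_right 0. \<forall>x\<in>{p..q}. \<forall>y\<in>{p..q}. \<bar>f \<epsilon> x - f \<epsilon> y\<bar> \<le> \<eta>"
proof -
  have "((\<lambda>\<epsilon>. 2 * \<bar>C\<bar> * integral {p..q} (V \<epsilon> (\<lambda>_. 1))) \<longlongrightarrow> 0) (at_right 0)"
    by (intro tendsto_mult_right_zero no_gate_integral ng)
  then have small: "\<forall>\<^sub>F \<epsilon> in at_right 0. 2 * \<bar>C\<bar> * integral {p..q} (V \<epsilon> (\<lambda>_. 1)) < \<eta>"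
    using order_tendstoD(2) \<open>\<eta> > 0\<close> by blast
  show ?thesis
    using ev small discount_half eventually_at_right_less[of 0]
  proof eventually_elim
    case (elim \<epsilon>)
    have le: "\<bar>f \<epsilon> y - f \<epsilon> x\<bar> \<le> \<eta>" if "p \<le> x" "x \<le> y" "y \<le> q" for x y
    proof -
      have "(1 - exp (- B / \<epsilon>)) * (f \<epsilon> y - f \<epsilon> x) = integral {x..y} (V \<epsilon> (G \<epsilon>))"
        using elim that by (intro generator_solution_increment) auto
      then have "(1 - exp (- B / \<epsilon>)) * \<bar>f \<epsilon> y - f \<epsilon> x\<bar> = \<bar>integral {x..y} (V \<epsilon> (G \<epsilon>))\<bar>"
        using elim(3) by (metis abs_mult abs_of_nonneg order_trans zero_le_divide_1_iff zero_le_numeral)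
      also have "\<dots> \<le> \<bar>C\<bar> * integral {x..y} (V \<epsilon> (\<lambda>_. 1))"
        using elim by (intro V_integral_bound_one) (auto intro: order_trans)
      also have "\<dots> \<le> \<bar>C\<bar> * integral {p..q} (V \<epsilon> (\<lambda>_. 1))"
        using elim that by (intro mult_left_mono V_one_integral_mono) auto
      finally have "(1 - exp (- B / \<epsilon>)) * \<bar>f \<epsilon> y - f \<epsilon> x\<bar> \<le> \<eta> / 2" using elim(2) by simp
      moreover have "1 / 2 * \<bar>f \<epsilon> y - f \<epsilon> x\<bar> \<le> (1 - exp (- B / \<epsilon>)) * \<bar>f \<epsilon> y - f \<epsilon> x\<bar>"
        using elim(3) by (intro mult_right_mono) auto
      ultimately show ?thesis by simp
    qed
    show ?case
    proof (intro ballI)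
      fix x y assume "x \<in> {p..q}" "y \<in> {p..q}"
      then show "\<bar>f \<epsilon> x - f \<epsilon> y\<bar> \<le> \<eta>"
        using le[of x y] le[of y x] by (cases "x \<le> y") (auto simp: abs_minus_commute)
    qed
  qed
qed

section \<open>The limiting chain on integer labels and the solvability of the Poisson
  equation\<close>

definition chain_gen :: "(int \<Rightarrow> real) \<Rightarrow> int \<Rightarrow> real" where
  "chain_gen f k = jump_rate a b M k (k + 1) * (f (k + 1) - f k) + jump_rate a b M k (k - 1) * (f (k - 1) - f k)"

definition wells_periodic :: "(int \<Rightarrow> real) \<Rightarrow> bool" where
  "wells_periodic f \<longleftrightarrow> (\<forall>k. f (k + int u) = f k)"

lemma wells_periodic_shift: assumes "wells_periodic f" shows "f (k + n * int u) = f k"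
proof (induction n rule: int_induct[where k = 0])
  case (step1 i)
  then show ?case using assms[unfolded wells_periodic_def, rule_format, of "k + i * int u"] by (simp add: algebra_simps)
next
  case (step2 i)
  then show ?case using assms[unfolded wells_periodic_def, rule_format, of "k + (i - 1) * int u"] by (simp add: algebra_simps)
qed simp

lemma wells_periodic_mod: "wells_periodic f \<Longrightarrow> f (k mod int u) = f k"
  using wells_periodic_shift[of f "k mod int u" "k div int u"] by simp

lemma wells_periodic_chain_gen:
  assumes "wells_periodic f" shows "wells_periodic (chain_gen f)"
  unfolding wells_periodic_def
proof
  fix k
  have "f (k + int u + 1) = f (k + 1)" "f (k + int u - 1) = f (k - 1)" "f (k + int u) = f k"
    using assms[unfolded wells_periodic_def, rule_format, of "k + 1"] assms[unfolded wells_periodic_def, rule_format, of "k - 1"]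
      assms[unfolded wells_periodic_def, rule_format, of k] by (simp_all add: algebra_simps)
  then show "chain_gen f (k + int u) = chain_gen f k"
    using jump_rate_shift[of k 1] by (simp add: chain_gen_def)
qed

text \<open>Divergence form of the generator: the flux out over the right gate minus the flux in
  over the left gate, with conductances \<open>1 / gate_weight\<close>. The left flux is present
  exactly when \<open>upstream_sum\<close> continues into the previous well.\<close>

lemma well_weight_chain_gen:
  "well_weight a b M k * chain_gen f k =
     (f (k + 1) - f k) / gate_weight a b M k - (if lev (k - 1) = lev k then (f k - f (k - 1)) / gate_weight a b M (k - 1) else 0)"
  using well_weight_pos[of k] unfolding chain_gen_def jump_rate_right jump_rate_left
  by (simp add: distrib_left) (simp add: diff_divide_distrib)

lemma chain_maximum_principle:
  assumes e: "wells_periodic e" and "lam > 0" and le: "\<And>k. k \<in> labels M \<Longrightarrow> lam * e k - chain_gen e k \<le> \<delta>"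
  shows "e k \<le> \<delta> / lam"
proof -
  have fin: "finite (e ` labels M)" "e ` labels M \<noteq> {}" using num_wells_period(1) by (auto simp: labels_eq)
  then have "Max (e ` labels M) \<in> e ` labels M" by (rule Max_in)
  then obtain j where j: "j \<in> labels M" "Max (e ` labels M) = e j" by blast
  have max: "e i \<le> e j" for i
    using Max_ge[OF fin(1), of "e (i mod int u)"] mod_labels[of i] wells_periodic_mod[OF e, of i] j(2)
      imageI[OF mod_labels, of e i] by simp
  have "chain_gen e j \<le> 0"
    unfolding chain_gen_def using max[of "j + 1"] max[of "j - 1"] jump_rate_nonneg
    by (simp add: add_nonpos_nonpos mult_nonneg_nonpos)
  then have "lam * e j \<le> \<delta>" using le[OF j(1)] by simp
  then have "e j \<le> \<delta> / lam" using \<open>lam > 0\<close> by (simp add: field_simps)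
  then show ?thesis using max[of k] by simp
qed

text \<open>The limiting increment over one turn of a function with source \<open>F\<close>; it has
  to vanish for a periodic solution.\<close>

definition period_flux :: "(real \<Rightarrow> real) \<Rightarrow> real" where
  "period_flux F = (\<Sum>k<u. gate_weight a b M (int k) * upstream_sum (int k) F)"

lemma period_flux_limit:
  assumes "continuous_on UNIV F" "periodic1 F"
  shows "((\<lambda>\<epsilon>. integral {hi 0..hi 0 + 1} (V \<epsilon> F)) \<longlongrightarrow> period_flux F) (at_right 0)"
  using period_limit[OF assms, of u] hi_shift[of 0 1] by (simp add: period_flux_def)

lemma period_flux_one_pos: "period_flux (\<lambda>_. 1) > 0"
proof -
  have "upstream_sum k (\<lambda>_. 1) > 0" for k
  proof -
    have "upstream k \<noteq> {}" using hi_in[of k] by (auto simp: upstream_def)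
    then show ?thesis unfolding upstream_sum_def using finite_upstream
      by (intro sum_pos) (auto simp: upstream_def minimum_weight_pos)
  qed
  moreover have "{..<u} \<noteq> {}" using num_wells_period(1) by (simp add: lessThan_empty_iff)
  ultimately show ?thesis unfolding period_flux_def using gate_weight_pos by (intro sum_pos) auto
qed

text \<open>The constant subtracted from \<open>F\<close> makes the solution periodic; it vanishes in the limit
  because \<open>F\<close> carries no net flux.\<close>

lemma poisson_solution:
  assumes F: "continuous_on UNIV F" "periodic1 F" and flux: "period_flux F = 0"
  obtains U c where "(c \<longlongrightarrow> 0) (at_right 0)"
    "\<forall>\<^sub>F \<epsilon> in at_right 0. U \<epsilon> \<in> C2_torus \<and> U \<epsilon> (hi 0) = v \<and>
       (\<forall>x. time_scale a b M \<epsilon> * diffusion_gen a b \<epsilon> (U \<epsilon>) x = F x - c \<epsilon>)"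
proof -
  define D where "D \<epsilon> = integral {hi 0..hi 0 + 1} (V \<epsilon> (\<lambda>_. 1))" for \<epsilon>
  define c where "c \<epsilon> = integral {hi 0..hi 0 + 1} (V \<epsilon> F) / D \<epsilon>" for \<epsilon>
  have one: "continuous_on UNIV (\<lambda>_::real. 1::real)" "periodic1 (\<lambda>_. 1)" by (auto simp: periodic1_def)
  have D: "(D \<longlongrightarrow> period_flux (\<lambda>_. 1)) (at_right 0)" unfolding D_def[abs_def] by (rule period_flux_limit[OF one])
  have c0: "(c \<longlongrightarrow> 0) (at_right 0)"
    using tendsto_divide[OF period_flux_limit[OF F] D] period_flux_one_pos flux by (simp add: c_def[abs_def])
  have "\<forall>\<^sub>F \<epsilon> in at_right 0. D \<epsilon> > 0" using order_tendstoD(1)[OF D period_flux_one_pos] .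
  then have ex: "\<forall>\<^sub>F \<epsilon> in at_right 0. \<exists>f. f \<in> C2_torus \<and> f (hi 0) = v \<and>
       (\<forall>x. time_scale a b M \<epsilon> * diffusion_gen a b \<epsilon> f x = F x - c \<epsilon>)"
    using eventually_at_right_less[of 0]
  proof eventually_elim
    case (elim \<epsilon>)
    have F': "continuous_on UNIV (\<lambda>x. F x - c \<epsilon>)" "periodic1 (\<lambda>x. F x - c \<epsilon>)"
      using F by (auto intro: continuous_intros simp: periodic1_def)
    have "V \<epsilon> (\<lambda>x. F x - c \<epsilon>) z = V \<epsilon> F z - c \<epsilon> * V \<epsilon> (\<lambda>_. 1) z" for z
      using V_diff[of \<epsilon> F "\<lambda>_. c \<epsilon>" z] V_scale[of \<epsilon> "c \<epsilon>" "\<lambda>_. 1" z] elim F(1) by simp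
    then have "integral {hi 0..hi 0 + 1} (V \<epsilon> (\<lambda>x. F x - c \<epsilon>)) =
       integral {hi 0..hi 0 + 1} (\<lambda>z. V \<epsilon> F z - c \<epsilon> * V \<epsilon> (\<lambda>_. 1) z)" by presburger
    also have "\<dots> = integral {hi 0..hi 0 + 1} (V \<epsilon> F) - c \<epsilon> * D \<epsilon>"
      using elim F(1) one by (subst integral_diff) (auto intro!: V_integrable integrable_on_mult_right simp: D_def)
    also have "\<dots> = 0" using elim by (simp add: c_def)
    finally show ?case using ex_generator_solution[OF elim(2) F'] by metis
  qed
  define P where "P \<epsilon> f \<longleftrightarrow> f \<in> C2_torus \<and> f (hi 0) = v \<and>
       (\<forall>x. time_scale a b M \<epsilon> * diffusion_gen a b \<epsilon> f x = F x - c \<epsilon>)" for \<epsilon> f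
  define U where "U \<epsilon> = (SOME f. P \<epsilon> f)" for \<epsilon>
  have "\<forall>\<^sub>F \<epsilon> in at_right 0. P \<epsilon> (U \<epsilon>)"
    using ex unfolding P_def[symmetric]
  proof (rule eventually_mono)
    fix \<epsilon> assume "\<exists>f. P \<epsilon> f"
    then show "P \<epsilon> (U \<epsilon>)" unfolding U_def by (rule someI_ex[of "P \<epsilon>"])
  qed
  then show thesis using that c0 unfolding P_def by blast
qed

lemma solution_period_bound:
  assumes "\<epsilon> > 0" "f \<in> C2_torus" "continuous_on UNIV F" "continuous_on UNIV G" "1 / 2 \<le> 1 - exp (- B / \<epsilon>)"
    and "\<And>y. \<bar>F y\<bar> \<le> G y" and gen: "\<And>x. time_scale a b M \<epsilon> * diffusion_gen a b \<epsilon> f x = F x"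
  shows "\<bar>f x - f (hi 0)\<bar> \<le> 2 * integral {hi 0..hi 0 + 1} (V \<epsilon> G)"
proof -
  have G0: "0 \<le> G y" for y using assms(6)[of y] by linarith
  define y where "y = hi 0 + frac (x - hi 0)"
  have y: "hi 0 \<le> y" "y \<le> hi 0 + 1" by (auto simp: y_def frac_lt_1 less_imp_le)
  have "y = x + of_int (- \<lfloor>x - hi 0\<rfloor>)" by (simp add: y_def frac_def)
  then have fx: "f y = f x" using periodic1_shift[OF C2_torusD(1)[OF assms(2)]] by metis
  have "(1 - exp (- B / \<epsilon>)) * (f y - f (hi 0)) = integral {hi 0..y} (V \<epsilon> F)"
    by (rule generator_solution_increment[OF assms(1-3) gen y(1)])
  then have "(1 - exp (- B / \<epsilon>)) * \<bar>f y - f (hi 0)\<bar> = \<bar>integral {hi 0..y} (V \<epsilon> F)\<bar>"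
    using assms(5) by (metis abs_mult abs_of_nonneg order_trans zero_le_divide_1_iff zero_le_numeral)
  also have "\<dots> \<le> integral {hi 0..y} (V \<epsilon> G)" by (rule V_integral_bound[OF assms(1,3,4,6)])
  also have "\<dots> \<le> integral {hi 0..hi 0 + 1} (V \<epsilon> G)"
    using y assms(1,4) G0 by (intro integral_subset_le V_integrable) (auto intro!: V_nonneg)
  finally have 1: "(1 - exp (- B / \<epsilon>)) * \<bar>f y - f (hi 0)\<bar> \<le> integral {hi 0..hi 0 + 1} (V \<epsilon> G)" .
  have "1 / 2 * \<bar>f y - f (hi 0)\<bar> \<le> (1 - exp (- B / \<epsilon>)) * \<bar>f y - f (hi 0)\<bar>"
    using assms(5) by (intro mult_right_mono) auto
  then show ?thesis using 1 fx by simp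
qed

end

text \<open>\<open>p k\<close> and \<open>q k\<close> bound a compact core inside the basin, on the
  line; the functions \<open>\<zeta> k\<close> are periodic, so their support is described up to
  integer translation.\<close>

locale cutoffs = nonreversible +
  fixes \<zeta> :: "int \<Rightarrow> real \<Rightarrow> real" and p q :: "int \<Rightarrow> real"
  assumes cutoff_cont: "k \<in> labels M \<Longrightarrow> continuous_on UNIV (\<zeta> k)"
    and cutoff_periodic: "k \<in> labels M \<Longrightarrow> periodic1 (\<zeta> k)"
    and cutoff_bounds: "k \<in> labels M \<Longrightarrow> 0 \<le> \<zeta> k x" "k \<in> labels M \<Longrightarrow> \<zeta> k x \<le> 1"
    and cutoff_one: "k \<in> labels M \<Longrightarrow> y \<in> M k \<Longrightarrow> \<zeta> k y = 1"
    and cutoff_support: "k \<in> labels M \<Longrightarrow> \<zeta> k x \<noteq> 0 \<Longrightarrow> \<exists>n::int. x + of_int n \<in> {p k..q k}"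
    and core: "k \<in> labels M \<Longrightarrow> {p k..q k} \<subseteq> basin k" "k \<in> labels M \<Longrightarrow> p k \<le> lo k" "k \<in> labels M \<Longrightarrow> hi k \<le> q k"
begin

lemma finite_labels: "finite (labels M)" by (simp add: labels_eq)

lemma cutoff_unique:
  assumes "k \<in> labels M" "j \<in> labels M" "\<zeta> k x \<noteq> 0" "\<zeta> j x \<noteq> 0"
  shows "k = j"
proof -
  obtain n :: int where "x + of_int n \<in> basin k"
    using cutoff_support[OF assms(1,3)] core(1)[OF assms(1)] by blast
  moreover obtain n' :: int where "x + of_int n' \<in> basin j"
    using cutoff_support[OF assms(2,4)] core(1)[OF assms(2)] by blast
  moreover have "frac (x + of_int n) = frac (x + of_int n')" by (simp add: frac_def)
  ultimately have "k mod int u = j mod int u" using basin_frac_eq by blast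
  then show ?thesis using assms by (simp add: labels_eq)
qed

definition mix :: "(int \<Rightarrow> real) \<Rightarrow> real \<Rightarrow> real" where
  "mix f x = (\<Sum>k\<in>labels M. f k * \<zeta> k x)"

lemma mix_eq: "k \<in> labels M \<Longrightarrow> \<zeta> k x \<noteq> 0 \<Longrightarrow> mix f x = f k * \<zeta> k x"
proof -
  assume k: "k \<in> labels M" "\<zeta> k x \<noteq> 0"
  have "(\<Sum>j\<in>labels M - {k}. f j * \<zeta> j x) = 0"
    using cutoff_unique[OF k(1) _ k(2)] by (intro sum.neutral) auto
  then show ?thesis unfolding mix_def using sum.remove[OF finite_labels k(1), of "\<lambda>k. f k * \<zeta> k x"] by simp
qed

lemma mix_zero: "(\<And>k. k \<in> labels M \<Longrightarrow> \<zeta> k x = 0) \<Longrightarrow> mix f x = 0"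
  by (simp add: mix_def)

lemma mix_cont: "continuous_on UNIV (mix f)" and mix_periodic: "periodic1 (mix f)"
  unfolding mix_def[abs_def] periodic1_def using cutoff_cont cutoff_periodic
  by (auto intro!: continuous_intros sum.cong simp: periodic1_def)

lemma mix_abs_le: assumes "\<And>k. k \<in> labels M \<Longrightarrow> \<bar>f k\<bar> \<le> C" "0 \<le> C" shows "\<bar>mix f x\<bar> \<le> C"
proof (cases "\<exists>k\<in>labels M. \<zeta> k x \<noteq> 0")
  case True
  then obtain k where k: "k \<in> labels M" "\<zeta> k x \<noteq> 0" by blast
  have "\<bar>f k\<bar> * \<zeta> k x \<le> C * 1" using assms k cutoff_bounds[OF k(1)] by (intro mult_mono) auto
  then show ?thesis using mix_eq[OF k] cutoff_bounds[OF k(1)] by (simp add: abs_mult)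
next
  case False
  then show ?thesis using mix_zero assms(2) by simp
qed

lemma mix_on_M:
  assumes "wells_periodic f" "y \<in> M k" shows "mix f y = f k"
proof -
  let ?k = "k mod int u"
  have "M k = (\<lambda>x. x + of_int (k div int u)) ` M ?k" using M_shift[of ?k "k div int u"] by simp
  then obtain y' where y': "y' \<in> M ?k" "y = y' + of_int (k div int u)" using assms(2) by blast
  have "\<zeta> ?k y = 1"
    using y'(2) cutoff_one[OF mod_labels y'(1)] periodic1_shift[OF cutoff_periodic[OF mod_labels]] by simp
  then show ?thesis using mix_eq[OF mod_labels, of k y f] wells_periodic_mod[OF assms(1)] by simp
qed

text \<open>It vanishes at every minimum of the level and therefore sends no flux over any gate, in
  spite of being of order one elsewhere.\<close>

definition outside :: "real \<Rightarrow> real" where "outside x = 1 - mix (\<lambda>_. 1) x"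

lemma outside_cont: "continuous_on UNIV outside" and outside_periodic: "periodic1 outside"
  using mix_cont[of "\<lambda>_. 1"] mix_periodic[of "\<lambda>_. 1"]
  by (auto simp: outside_def[abs_def] periodic1_def intro: continuous_intros)

lemma mix_one_nonneg: "0 \<le> mix (\<lambda>_. 1) x"
  unfolding mix_def by (intro sum_nonneg) (simp add: cutoff_bounds)

lemma outside_bounds: "0 \<le> outside x" "outside x \<le> 1"
  using mix_abs_le[of "\<lambda>_. 1" 1 x] mix_one_nonneg[of x] by (auto simp: outside_def)

lemma outside_on_M: "y \<in> M k \<Longrightarrow> outside y = 0"
  using mix_on_M[of "\<lambda>_. 1"] by (simp add: outside_def wells_periodic_def)

lemma upstream_sum_outside: "upstream_sum k outside = 0"
  unfolding upstream_sum_def using outside_on_M by (intro sum.neutral) (auto simp: upstream_def)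

lemma upstream_sum_mix:
  assumes "wells_periodic f"
  shows "upstream_sum k (mix f) = well_weight a b M k * f k + (if lev (k - 1) = lev k then upstream_sum (k - 1) (mix f) else 0)"
proof -
  have "(\<Sum>y\<in>M k. mix f y * minimum_weight a b y) = well_weight a b M k * f k"
    unfolding well_weight_def sum_distrib_right using mix_on_M[OF assms] by (intro sum.cong) (auto simp: mult.commute)
  then show ?thesis using upstream_sum_rec[of k "mix f"] by simp
qed

lemma upstream_sum_mix_linear: "upstream_sum k (mix f) = (\<Sum>i\<in>labels M. f i * upstream_sum k (\<zeta> i))"
  unfolding upstream_sum_def mix_def sum_distrib_right sum_distrib_left
  by (subst sum.swap) (simp add: mult.assoc)

text \<open>By \<open>upstream_sum_mix\<close> and \<open>well_weight_chain_gen\<close>, the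
  upstream sum and the increment divided by the gate weight satisfy the same recursion in
  \<open>k\<close>. A nonzero difference would be carried back through wells of equal height for a
  whole turn, although the height changes by \<open>B\<close>.\<close>

lemma flux_of_chain_gen:
  assumes f: "wells_periodic f"
  shows "gate_weight a b M k * upstream_sum k (mix (chain_gen f)) = f (k + 1) - f k"
proof -
  define D where "D k = upstream_sum k (mix (chain_gen f)) - (f (k + 1) - f k) / gate_weight a b M k" for k
  have D: "D k = (if lev (k - 1) = lev k then D (k - 1) else 0)" for k
    unfolding D_def upstream_sum_mix[OF wells_periodic_chain_gen[OF f], of k] well_weight_chain_gen by simp
  have "D k = 0"
  proof (rule ccontr)
    assume nz: "D k \<noteq> 0"
    have "D (k - int n) \<noteq> 0 \<and> lev (k - int n) = lev k" for n
    proof (induction n)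
      case (Suc n)
      then have "lev (k - int n - 1) = lev (k - int n) \<and> D (k - int n - 1) \<noteq> 0"
        using D[of "k - int n"] by (auto split: if_splits)
      then show ?case using Suc by (simp add: algebra_simps)
    qed (use nz in simp)
    then have "lev (k - int u) = lev k" by blast
    then show False using lev_shift[of k "-1"] circulation_pos by simp
  qed
  then show ?thesis using gate_weight_pos[of k] by (simp add: D_def field_simps)
qed

lemma period_flux_chain_gen: "wells_periodic f \<Longrightarrow> period_flux (mix (chain_gen f)) = 0"
proof -
  assume f: "wells_periodic f"
  have "period_flux (mix (chain_gen f)) = (\<Sum>k<u. f (int (Suc k)) - f (int k))"
    unfolding period_flux_def flux_of_chain_gen[OF f] by (simp add: add.commute)
  also have "\<dots> = f (int u) - f 0" by (subst sum_lessThan_telescope) simp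
  also have "\<dots> = 0" using f by (simp add: wells_periodic_def) (metis add_0)
  finally show ?thesis .
qed

lemma core_no_gate: "k \<in> labels M \<Longrightarrow> z \<in> {p k..q k} \<Longrightarrow> z \<notin> gates a b M j"
  using core(1) basin_no_gate by blast

lemma hi_core: "k \<in> labels M \<Longrightarrow> hi k \<in> {p k..q k}"
  using core(2)[of k] core(3)[of k] lo_le_hi[of k] by simp

text \<open>Writing \<open>f\<close> as \<open>\<zeta> k * f + (1 - \<zeta> k) * f\<close>, the
  first part is close to the value on the well, and the second is charged to \<open>outside\<close>,
  whose contribution disappears later.\<close>

lemma mix_approx:
  assumes "periodic1 f" "\<And>x. \<bar>f x\<bar> \<le> C" "0 \<le> \<eta>"
    and near: "\<And>k x. k \<in> labels M \<Longrightarrow> x \<in> {p k..q k} \<Longrightarrow> \<bar>f x - w k\<bar> \<le> \<eta>"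
  shows "\<bar>f x - mix w x\<bar> \<le> \<eta> + C * outside x"
proof (cases "\<exists>k\<in>labels M. \<zeta> k x \<noteq> 0")
  case True
  then obtain k where k: "k \<in> labels M" "\<zeta> k x \<noteq> 0" by blast
  obtain n :: int where n: "x + of_int n \<in> {p k..q k}" using cutoff_support[OF k] by blast
  have "\<bar>f x - w k\<bar> \<le> \<eta>" using near[OF k(1) n] periodic1_shift[OF assms(1)] by simp
  then have "\<bar>f x - w k\<bar> * \<zeta> k x \<le> \<eta> * 1" using cutoff_bounds[OF k(1)] assms(3) by (intro mult_mono) auto
  moreover have "\<bar>f x\<bar> * (1 - \<zeta> k x) \<le> C * (1 - \<zeta> k x)" using assms(2) cutoff_bounds[OF k(1)] by (intro mult_right_mono) auto
  moreover have "f x - mix w x = (f x - w k) * \<zeta> k x + f x * (1 - \<zeta> k x)" using mix_eq[OF k, of w] by (simp add: algebra_simps)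
  moreover have "outside x = 1 - \<zeta> k x" using mix_eq[OF k, of "\<lambda>_. 1"] by (simp add: outside_def)
  ultimately show ?thesis
    using abs_triangle_ineq[of "(f x - w k) * \<zeta> k x" "f x * (1 - \<zeta> k x)"] cutoff_bounds[OF k(1), of x]
    by (simp add: abs_mult)
next
  case False
  then show ?thesis using mix_zero[of x] assms(2)[of x] assms(3) by (simp add: outside_def)
qed

end

section \<open>Convergence of the resolvent\<close>

context cutoffs
begin

lemma period_integral_V_tendsto_zero:
  assumes "\<And>\<epsilon>. 0 \<le> d \<epsilon>" "(d \<longlongrightarrow> 0) (at_right 0)"
  shows "((\<lambda>\<epsilon>. integral {hi 0..hi 0 + 1} (V \<epsilon> (\<lambda>y. outside y + d \<epsilon>))) \<longlongrightarrow> 0) (at_right 0)"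
proof -
  have one: "continuous_on UNIV (\<lambda>_::real. 1::real)" "periodic1 (\<lambda>_. 1)" by (auto simp: periodic1_def)
  have "period_flux outside = 0" by (simp add: period_flux_def upstream_sum_outside)
  then have "((\<lambda>\<epsilon>. integral {hi 0..hi 0 + 1} (V \<epsilon> outside)) \<longlongrightarrow> 0) (at_right 0)"
    using period_flux_limit[OF outside_cont outside_periodic] by simp
  from tendsto_add[OF this tendsto_mult[OF assms(2) period_flux_limit[OF one]]]
  have "((\<lambda>\<epsilon>. integral {hi 0..hi 0 + 1} (V \<epsilon> outside) + d \<epsilon> * integral {hi 0..hi 0 + 1} (V \<epsilon> (\<lambda>_. 1))) \<longlongrightarrow> 0) (at_right 0)"
    by simp
  then show ?thesis
  proof (rule Lim_transform_eventually)
    show "\<forall>\<^sub>F \<epsilon> in at_right 0. integral {hi 0..hi 0 + 1} (V \<epsilon> outside) + d \<epsilon> * integral {hi 0..hi 0 + 1} (V \<epsilon> (\<lambda>_. 1))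
       = integral {hi 0..hi 0 + 1} (V \<epsilon> (\<lambda>y. outside y + d \<epsilon>))"
      using eventually_at_right_less[of 0]
    proof eventually_elim
      case (elim \<epsilon>)
      have "V \<epsilon> (\<lambda>y. outside y + d \<epsilon>) z = V \<epsilon> outside z + d \<epsilon> * V \<epsilon> (\<lambda>_. 1) z" for z
        using V_add[OF elim outside_cont, of "\<lambda>_. d \<epsilon>" z] V_scale[of \<epsilon> "d \<epsilon>" "\<lambda>_. 1" z] by simp
      then have "V \<epsilon> (\<lambda>y. outside y + d \<epsilon>) = (\<lambda>z. V \<epsilon> outside z + d \<epsilon> * V \<epsilon> (\<lambda>_. 1) z)" by blast
      then show ?case
        using elim one outside_cont by (simp add: integral_add V_integrable integrable_on_mult_right)
    qed
  qed
qed

text \<open>The source has no flux, so the solution is uniformly small everywhere, although the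
  source itself is not. It is used for \<open>phi_lower_bound\<close> and for
  \<open>outside_mass\<close>.\<close>

lemma outside_solution:
  "\<exists>U c. (c \<longlongrightarrow> 0) (at_right 0) \<and>
    (\<forall>\<^sub>F \<epsilon> in at_right 0. U \<epsilon> \<in> C2_torus \<and> (\<forall>x. time_scale a b M \<epsilon> * diffusion_gen a b \<epsilon> (U \<epsilon>) x = outside x - c \<epsilon>)) \<and>
    (\<forall>\<eta>>0. \<forall>\<^sub>F \<epsilon> in at_right 0. \<forall>x. \<bar>U \<epsilon> x\<bar> \<le> \<eta>)"
proof -
  have "period_flux outside = 0" by (simp add: period_flux_def upstream_sum_outside)
  then obtain U c where c: "(c \<longlongrightarrow> 0) (at_right 0)"
    and U: "\<forall>\<^sub>F \<epsilon> in at_right 0. U \<epsilon> \<in> C2_torus \<and> U \<epsilon> (hi 0) = 0 \<and>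
       (\<forall>x. time_scale a b M \<epsilon> * diffusion_gen a b \<epsilon> (U \<epsilon>) x = outside x - c \<epsilon>)"
    using poisson_solution[OF outside_cont outside_periodic] by blast
  have lim: "((\<lambda>\<epsilon>. 2 * integral {hi 0..hi 0 + 1} (V \<epsilon> (\<lambda>y. outside y + \<bar>c \<epsilon>\<bar>))) \<longlongrightarrow> 0) (at_right 0)"
    using c by (intro tendsto_mult_right_zero period_integral_V_tendsto_zero tendsto_rabs_zero) auto
  have "\<forall>\<^sub>F \<epsilon> in at_right 0. \<forall>x. \<bar>U \<epsilon> x\<bar> \<le> \<eta>" if "\<eta> > 0" for \<eta>
    using order_tendstoD(2)[OF lim that] U discount_half eventually_at_right_less[of 0]
  proof eventually_elim
    case (elim \<epsilon>)
    have "\<bar>U \<epsilon> x - U \<epsilon> (hi 0)\<bar> \<le> 2 * integral {hi 0..hi 0 + 1} (V \<epsilon> (\<lambda>y. outside y + \<bar>c \<epsilon>\<bar>))" for x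
    proof (rule solution_period_bound[where F = "\<lambda>x. outside x - c \<epsilon>"])
      show "\<bar>outside y - c \<epsilon>\<bar> \<le> outside y + \<bar>c \<epsilon>\<bar>" for y
        using outside_bounds[of y] by linarith
    qed (use elim outside_cont in \<open>auto intro!: continuous_intros\<close>)
    then show ?case using elim by (fastforce intro: order_trans)
  qed
  moreover have "\<forall>\<^sub>F \<epsilon> in at_right 0. U \<epsilon> \<in> C2_torus \<and> (\<forall>x. time_scale a b M \<epsilon> * diffusion_gen a b \<epsilon> (U \<epsilon>) x = outside x - c \<epsilon>)"
    using U by (rule eventually_mono) simp
  ultimately show ?thesis using c by blast
qed

lemma eventually_labels:
  assumes "\<And>k. k \<in> labels M \<Longrightarrow> \<forall>\<^sub>F \<epsilon> in F. P k \<epsilon>"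
  shows "\<forall>\<^sub>F \<epsilon> in F. \<forall>k\<in>labels M. P k \<epsilon>"
  using assms finite_labels by (simp add: eventually_ball_finite)

text \<open>The source built from \<open>chain_gen f\<close> makes the increments of
  \<open>f\<close> the fluxes over the gates, so a solution starting from \<open>f 0\<close>
  approaches \<open>f k\<close> on every well: any function on the wells can be realized.\<close>

lemma test_function:
  assumes f: "wells_periodic f"
  shows "\<exists>U c C. (c \<longlongrightarrow> 0) (at_right 0) \<and>
    (\<forall>\<^sub>F \<epsilon> in at_right 0. U \<epsilon> \<in> C2_torus \<and> (\<forall>x. time_scale a b M \<epsilon> * diffusion_gen a b \<epsilon> (U \<epsilon>) x = mix (chain_gen f) x - c \<epsilon>)) \<and>
    (\<forall>\<^sub>F \<epsilon> in at_right 0. \<forall>x. \<bar>U \<epsilon> x\<bar> \<le> C) \<and>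
    (\<forall>\<eta>>0. \<forall>\<^sub>F \<epsilon> in at_right 0. \<forall>k\<in>labels M. \<forall>x\<in>{p k..q k}. \<bar>U \<epsilon> x - f k\<bar> \<le> \<eta>)"
proof -
  let ?F = "mix (chain_gen f)"
  have one: "continuous_on UNIV (\<lambda>_::real. 1::real)" "periodic1 (\<lambda>_. 1)" by (auto simp: periodic1_def)
  obtain U c where c: "(c \<longlongrightarrow> 0) (at_right 0)"
    and U: "\<forall>\<^sub>F \<epsilon> in at_right 0. U \<epsilon> \<in> C2_torus \<and> U \<epsilon> (hi 0) = f 0 \<and>
       (\<forall>x. time_scale a b M \<epsilon> * diffusion_gen a b \<epsilon> (U \<epsilon>) x = ?F x - c \<epsilon>)"
    using poisson_solution[OF mix_cont mix_periodic period_flux_chain_gen[OF f]] by blast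
  obtain CF where CF: "CF > 0" "\<And>x. \<bar>?F x\<bar> \<le> CF"
    using periodic_continuous_bounded[OF mix_periodic mix_cont] by blast
  have c1: "\<forall>\<^sub>F \<epsilon> in at_right 0. \<bar>c \<epsilon>\<bar> < 1" using order_tendstoD(2)[OF tendsto_rabs_zero[OF c]] by simp
  \<comment> \<open>\<open>CF + 1\<close> bounds the source including the constant
    \<open>c \<epsilon>\<close>, the last factor bounds the integral of
    \<open>V \<epsilon> 1\<close> over a period, and 2 absorbs the discount.\<close>
  define C where "C = \<bar>f 0\<bar> + 2 * ((CF + 1) * (period_flux (\<lambda>_. 1) + 1))"
  have one_lt: "\<forall>\<^sub>F \<epsilon> in at_right 0. integral {hi 0..hi 0 + 1} (V \<epsilon> (\<lambda>_. 1)) < period_flux (\<lambda>_. 1) + 1"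
    using order_tendstoD(2)[OF period_flux_limit[OF one]] by simp
  have bound: "\<forall>\<^sub>F \<epsilon> in at_right 0. \<forall>x. \<bar>U \<epsilon> x\<bar> \<le> C"
    using one_lt c1 U discount_half eventually_at_right_less[of 0]
  proof eventually_elim
    case (elim \<epsilon>)
    have "\<bar>U \<epsilon> x - U \<epsilon> (hi 0)\<bar> \<le> 2 * integral {hi 0..hi 0 + 1} (V \<epsilon> (\<lambda>_. CF + 1))" for x
    proof (rule solution_period_bound[where F = "\<lambda>x. ?F x - c \<epsilon>"])
      show "\<bar>?F y - c \<epsilon>\<bar> \<le> CF + 1" for y using CF(2)[of y] elim(2) by linarith
    qed (use elim mix_cont in \<open>auto intro!: continuous_intros\<close>)
    moreover have "V \<epsilon> (\<lambda>_. CF + 1) = (\<lambda>z. (CF + 1) * V \<epsilon> (\<lambda>_. 1) z)" using V_scale[of \<epsilon> "CF + 1" "\<lambda>_. 1"] by auto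
    ultimately have A: "\<bar>U \<epsilon> x - U \<epsilon> (hi 0)\<bar> \<le> 2 * ((CF + 1) * integral {hi 0..hi 0 + 1} (V \<epsilon> (\<lambda>_. 1)))" for x by simp
    have A': "(CF + 1) * integral {hi 0..hi 0 + 1} (V \<epsilon> (\<lambda>_. 1)) \<le> (CF + 1) * (period_flux (\<lambda>_. 1) + 1)"
      using elim(1) CF(1) by (intro mult_left_mono) auto
    have "U \<epsilon> (hi 0) = f 0" using elim(3) by blast
    then have le: "\<bar>U \<epsilon> x - f 0\<bar> \<le> 2 * ((CF + 1) * (period_flux (\<lambda>_. 1) + 1))" for x
      using order_trans[OF A mult_left_mono[OF A']] by simp
    show ?case
    proof
      fix x show "\<bar>U \<epsilon> x\<bar> \<le> C" using le[of x] unfolding C_def by linarith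
    qed
  qed
  have at_hi: "((\<lambda>\<epsilon>. U \<epsilon> (hi k)) \<longlongrightarrow> f k) (at_right 0)" if k: "k \<in> labels M" for k
  proof -
    have kn: "int (nat k) = k" "0 \<le> k" using k by (auto simp: labels_eq)
    have "hi 0 \<le> hi k" using hi_less_lo[of 0 k] lo_le_hi[of k] kn(2) by (cases "k = 0") auto
    have s: "(\<Sum>j<nat k. gate_weight a b M (int j) * upstream_sum (int j) ?F) = f k - f 0"
    proof -
      have "(\<Sum>j<nat k. gate_weight a b M (int j) * upstream_sum (int j) ?F) = (\<Sum>j<nat k. f (int (Suc j)) - f (int j))"
        unfolding flux_of_chain_gen[OF f] by (simp add: add.commute)
      also have "\<dots> = f k - f 0" by (subst sum_lessThan_telescope) (simp add: kn)
      finally show ?thesis .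
    qed
    have 1: "((\<lambda>\<epsilon>. integral {hi 0..hi k} (V \<epsilon> ?F)) \<longlongrightarrow> f k - f 0) (at_right 0)"
      using period_limit[OF mix_cont mix_periodic, of "nat k" "chain_gen f"] unfolding s kn(1) .
    have 2: "((\<lambda>\<epsilon>. c \<epsilon> * integral {hi 0..hi k} (V \<epsilon> (\<lambda>_. 1))) \<longlongrightarrow> 0) (at_right 0)"
      using tendsto_mult[OF c period_limit[OF one, of "nat k"]] unfolding kn(1) by simp
    have "((\<lambda>\<epsilon>. f 0 + (integral {hi 0..hi k} (V \<epsilon> ?F) - c \<epsilon> * integral {hi 0..hi k} (V \<epsilon> (\<lambda>_. 1))) / (1 - exp (- B / \<epsilon>)))
        \<longlongrightarrow> f 0 + (f k - f 0 - 0) / 1) (at_right 0)"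
      by (intro tendsto_add tendsto_const tendsto_divide tendsto_diff 1 2 discount_limit) simp
    then have "((\<lambda>\<epsilon>. f 0 + (integral {hi 0..hi k} (V \<epsilon> ?F) - c \<epsilon> * integral {hi 0..hi k} (V \<epsilon> (\<lambda>_. 1))) / (1 - exp (- B / \<epsilon>)))
        \<longlongrightarrow> f k) (at_right 0)" by simp
    then show ?thesis
    proof (rule Lim_transform_eventually)
      show "\<forall>\<^sub>F \<epsilon> in at_right 0. f 0 + (integral {hi 0..hi k} (V \<epsilon> ?F) - c \<epsilon> * integral {hi 0..hi k} (V \<epsilon> (\<lambda>_. 1))) / (1 - exp (- B / \<epsilon>)) = U \<epsilon> (hi k)"
        using U eventually_at_right_less[of 0]
      proof eventually_elim
        case (elim \<epsilon>)
        have "(1 - exp (- B / \<epsilon>)) * (U \<epsilon> (hi k) - U \<epsilon> (hi 0)) = integral {hi 0..hi k} (V \<epsilon> (\<lambda>x. ?F x - c \<epsilon>))"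
          using elim \<open>hi 0 \<le> hi k\<close> by (intro generator_solution_increment) (auto intro!: continuous_intros mix_cont)
        also have "V \<epsilon> (\<lambda>x. ?F x - c \<epsilon>) = (\<lambda>z. V \<epsilon> ?F z - c \<epsilon> * V \<epsilon> (\<lambda>_. 1) z)"
          using V_diff[OF elim(2) mix_cont, of "\<lambda>_. c \<epsilon>"] V_scale[of \<epsilon> "c \<epsilon>" "\<lambda>_. 1"] by auto
        also have "integral {hi 0..hi k} \<dots> = integral {hi 0..hi k} (V \<epsilon> ?F) - c \<epsilon> * integral {hi 0..hi k} (V \<epsilon> (\<lambda>_. 1))"
          using elim mix_cont one by (simp add: integral_diff V_integrable integrable_on_mult_right)
        finally have "(1 - exp (- B / \<epsilon>)) * (U \<epsilon> (hi k) - f 0) = integral {hi 0..hi k} (V \<epsilon> ?F) - c \<epsilon> * integral {hi 0..hi k} (V \<epsilon> (\<lambda>_. 1))"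
          using elim by simp
        moreover have "1 - exp (- B / \<epsilon>) > 0" by (rule discount_pos(1)[OF elim(2)])
        ultimately have "U \<epsilon> (hi k) - f 0 = (integral {hi 0..hi k} (V \<epsilon> ?F) - c \<epsilon> * integral {hi 0..hi k} (V \<epsilon> (\<lambda>_. 1))) / (1 - exp (- B / \<epsilon>))"
          by (metis less_irrefl nonzero_mult_div_cancel_left)
        then show ?case by simp
      qed
    qed
  qed
  have near: "\<forall>\<^sub>F \<epsilon> in at_right 0. \<forall>k\<in>labels M. \<forall>x\<in>{p k..q k}. \<bar>U \<epsilon> x - f k\<bar> \<le> \<eta>" if \<eta>: "\<eta> > 0" for \<eta>
  proof (rule eventually_labels)
    fix k assume k: "k \<in> labels M"
    have ev: "\<forall>\<^sub>F \<epsilon> in at_right 0. U \<epsilon> \<in> C2_torus \<and> continuous_on UNIV (\<lambda>x. ?F x - c \<epsilon>) \<and> (\<forall>x. \<bar>?F x - c \<epsilon>\<bar> \<le> CF + 1) \<and>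
      (\<forall>x. time_scale a b M \<epsilon> * diffusion_gen a b \<epsilon> (U \<epsilon>) x = ?F x - c \<epsilon>)"
      using U c1
    proof eventually_elim
      case (elim \<epsilon>)
      have "\<bar>?F x - c \<epsilon>\<bar> \<le> CF + 1" for x using CF(2)[of x] elim(2) by linarith
      then show ?case using elim by (auto intro!: continuous_intros mix_cont)
    qed
    have osc: "\<forall>\<^sub>F \<epsilon> in at_right 0. \<forall>x\<in>{p k..q k}. \<forall>y\<in>{p k..q k}. \<bar>U \<epsilon> x - U \<epsilon> y\<bar> \<le> \<eta> / 2"
      by (rule oscillation_limit[OF ev core_no_gate[OF k]]) (use \<eta> in simp_all)
    have "((\<lambda>\<epsilon>. \<bar>U \<epsilon> (hi k) - f k\<bar>) \<longlongrightarrow> 0) (at_right 0)"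
      using tendsto_rabs_zero[OF LIM_zero[OF at_hi[OF k]]] .
    then have "\<forall>\<^sub>F \<epsilon> in at_right 0. \<bar>U \<epsilon> (hi k) - f k\<bar> < \<eta> / 2" using order_tendstoD(2) \<eta> by (metis half_gt_zero)
    with osc show "\<forall>\<^sub>F \<epsilon> in at_right 0. \<forall>x\<in>{p k..q k}. \<bar>U \<epsilon> x - f k\<bar> \<le> \<eta>"
    proof eventually_elim
      case (elim \<epsilon>)
      show ?case
      proof
        fix x assume "x \<in> {p k..q k}"
        then have "\<bar>U \<epsilon> x - U \<epsilon> (hi k)\<bar> \<le> \<eta> / 2" using elim(1) hi_core[OF k] by blast
        then show "\<bar>U \<epsilon> x - f k\<bar> \<le> \<eta>" using elim(2) by linarith
      qed
    qed
  qed
  have "\<forall>\<^sub>F \<epsilon> in at_right 0. U \<epsilon> \<in> C2_torus \<and> (\<forall>x. time_scale a b M \<epsilon> * diffusion_gen a b \<epsilon> (U \<epsilon>) x = ?F x - c \<epsilon>)"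
    using U by (rule eventually_mono) simp
  with c bound near show ?thesis by blast
qed

end

section \<open>Limit and lower bound of the resolvent solution\<close>

locale resolvent = cutoffs +
  fixes lam :: real and hv :: "int \<Rightarrow> real" and \<phi> :: "real \<Rightarrow> real \<Rightarrow> real"
  assumes lam_pos: "lam > 0" and h_periodic: "wells_periodic hv" and h_pos: "hv k > 0"
    and phi_C2: "\<epsilon> > 0 \<Longrightarrow> \<phi> \<epsilon> \<in> C2_torus"
    and phi_eq: "\<epsilon> > 0 \<Longrightarrow> lam * \<phi> \<epsilon> x - time_scale a b M \<epsilon> * diffusion_gen a b \<epsilon> (\<phi> \<epsilon>) x
        = mix (\<lambda>k. lam * hv k - chain_gen hv k) x"
begin

definition g :: "int \<Rightarrow> real" where "g k = lam * hv k - chain_gen hv k"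

definition Cg :: real where "Cg = (\<Sum>k\<in>labels M. \<bar>g k\<bar>)"

lemma Cg_nonneg: "Cg \<ge> 0" by (simp add: Cg_def sum_nonneg)

lemma g_periodic: "wells_periodic g"
  using h_periodic wells_periodic_chain_gen[OF h_periodic] by (simp add: wells_periodic_def g_def)

lemma g_le: "k \<in> labels M \<Longrightarrow> \<bar>g k\<bar> \<le> Cg"
  unfolding Cg_def using finite_labels by (intro member_le_sum) auto

lemma mix_g_le: "\<bar>mix g x\<bar> \<le> Cg" by (rule mix_abs_le[OF g_le Cg_nonneg])

lemma phi_solution: "\<epsilon> > 0 \<Longrightarrow> time_scale a b M \<epsilon> * diffusion_gen a b \<epsilon> (\<phi> \<epsilon>) x = lam * \<phi> \<epsilon> x - mix g x"
  using phi_eq[of \<epsilon> x] unfolding g_def[abs_def] by simp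

lemma phi_le: "\<epsilon> > 0 \<Longrightarrow> \<bar>\<phi> \<epsilon> x\<bar> \<le> Cg / lam"
  by (rule resolvent_bound[OF phi_C2 _ lam_pos, where G = "mix g"]) (auto simp: phi_solution mix_g_le)

lemma source_le: "\<epsilon> > 0 \<Longrightarrow> \<bar>lam * \<phi> \<epsilon> x - mix g x\<bar> \<le> 2 * Cg"
proof -
  assume \<epsilon>: "\<epsilon> > 0"
  have "\<bar>lam * \<phi> \<epsilon> x\<bar> \<le> Cg" using phi_le[OF \<epsilon>, of x] lam_pos by (simp add: abs_mult field_simps)
  then show ?thesis using mix_g_le[of x] by linarith
qed

definition \<psi> :: "real \<Rightarrow> int \<Rightarrow> real" where "\<psi> \<epsilon> k = \<phi> \<epsilon> (hi k)"

lemma psi_le: "\<epsilon> > 0 \<Longrightarrow> \<bar>\<psi> \<epsilon> k\<bar> \<le> Cg / lam" by (simp add: \<psi>_def phi_le)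

lemma psi_periodic: "\<epsilon> > 0 \<Longrightarrow> wells_periodic (\<psi> \<epsilon>)"
  using hi_shift[of _ 1] C2_torusD(1)[OF phi_C2] by (simp add: wells_periodic_def \<psi>_def periodic1_def)

lemma source_cont: "\<epsilon> > 0 \<Longrightarrow> continuous_on UNIV (\<lambda>x. lam * \<phi> \<epsilon> x - mix g x)"
  by (intro continuous_intros mix_cont C2_torusD(7)[OF phi_C2])

lemma phi_near_psi:
  assumes \<eta>: "\<eta> > 0"
  shows "\<forall>\<^sub>F \<epsilon> in at_right 0. \<forall>k\<in>labels M. \<forall>x\<in>{p k..q k}. \<bar>\<phi> \<epsilon> x - \<psi> \<epsilon> k\<bar> \<le> \<eta>"
proof (rule eventually_labels)
  fix k assume k: "k \<in> labels M"
  have "\<forall>\<^sub>F \<epsilon> in at_right 0. \<forall>x\<in>{p k..q k}. \<forall>y\<in>{p k..q k}. \<bar>\<phi> \<epsilon> x - \<phi> \<epsilon> y\<bar> \<le> \<eta>"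
  proof (rule oscillation_limit[OF _ core_no_gate[OF k] \<eta>])
    show "\<forall>\<^sub>F \<epsilon> in at_right 0. \<phi> \<epsilon> \<in> C2_torus \<and> continuous_on UNIV (\<lambda>x. lam * \<phi> \<epsilon> x - mix g x) \<and>
       (\<forall>x. \<bar>lam * \<phi> \<epsilon> x - mix g x\<bar> \<le> 2 * Cg) \<and>
       (\<forall>x. time_scale a b M \<epsilon> * diffusion_gen a b \<epsilon> (\<phi> \<epsilon>) x = lam * \<phi> \<epsilon> x - mix g x)"
      using eventually_at_right_less[of 0]
      by eventually_elim (simp add: phi_C2 source_cont source_le phi_solution)
  qed
  then show "\<forall>\<^sub>F \<epsilon> in at_right 0. \<forall>x\<in>{p k..q k}. \<bar>\<phi> \<epsilon> x - \<psi> \<epsilon> k\<bar> \<le> \<eta>"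
    by eventually_elim (use hi_core[OF k] in \<open>auto simp: \<psi>_def\<close>)
qed

text \<open>The value on well \<open>k\<close> of the source
  \<open>lam * \<phi> \<epsilon> - mix g\<close> once \<phi> is replaced by its value at
  \<open>hi k\<close>.\<close>

definition excess :: "real \<Rightarrow> int \<Rightarrow> real" where "excess \<epsilon> k = lam * \<psi> \<epsilon> k - g k"

lemma excess_le: "\<epsilon> > 0 \<Longrightarrow> k \<in> labels M \<Longrightarrow> \<bar>excess \<epsilon> k\<bar> \<le> 2 * Cg"
proof -
  assume \<epsilon>: "\<epsilon> > 0" and k: "k \<in> labels M"
  have "\<bar>lam * \<psi> \<epsilon> k\<bar> \<le> Cg" using psi_le[OF \<epsilon>, of k] lam_pos by (simp add: abs_mult field_simps)
  then show ?thesis using g_le[OF k] by (simp add: excess_def)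
qed

definition flux_error :: "real \<Rightarrow> int \<Rightarrow> real" where
  "flux_error \<epsilon> k = \<psi> \<epsilon> (k + 1) - \<psi> \<epsilon> k - gate_weight a b M k * upstream_sum k (mix (excess \<epsilon>))"

text \<open>On the cores \<phi> is nearly constant, and elsewhere it is only bounded; there the
  error is a multiple of \<open>outside\<close>, which has no flux.\<close>

lemma crossing_source_limit:
  "((\<lambda>\<epsilon>. integral {hi k..hi (k + 1)} (V \<epsilon> (\<lambda>x. lam * \<phi> \<epsilon> x - mix g x)) - integral {hi k..hi (k + 1)} (V \<epsilon> (mix (excess \<epsilon>)))) \<longlongrightarrow> 0) (at_right 0)"
proof (rule tendstoI)
  fix e :: real assume e: "e > 0"
  let ?I = "{hi k..hi (k + 1)}"
  have one: "continuous_on UNIV (\<lambda>_::real. 1::real)" "periodic1 (\<lambda>_. 1)" by (auto simp: periodic1_def)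
  define A where "A = gate_weight a b M k * upstream_sum k (\<lambda>_. 1)"
  have A0: "A \<ge> 0" unfolding A_def upstream_sum_def
    using gate_weight_pos[of k] minimum_weight_pos
    by (intro mult_nonneg_nonneg sum_nonneg) (auto simp: upstream_def less_imp_le)
  \<comment> \<open>\<open>A + 1\<close> eventually bounds the crossing integral of the constant 1,
    so the error on the wells takes half of \<open>e\<close> and leaves the other half to
    \<open>outside\<close>.\<close>
  define \<eta> where "\<eta> = e / (2 * (A + 1))"
  have \<eta>: "\<eta> > 0" using e A0 by (simp add: \<eta>_def)
  have "((\<lambda>\<epsilon>. Cg * integral ?I (V \<epsilon> outside)) \<longlongrightarrow> 0) (at_right 0)"
    using tendsto_mult_right_zero[OF period_crossing_limit[OF outside_cont outside_periodic, of k, unfolded upstream_sum_outside mult_zero_right]] .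
  then have ev1: "\<forall>\<^sub>F \<epsilon> in at_right 0. Cg * integral ?I (V \<epsilon> outside) < e / 2"
    using order_tendstoD(2) e by (metis half_gt_zero)
  have ev2: "\<forall>\<^sub>F \<epsilon> in at_right 0. integral ?I (V \<epsilon> (\<lambda>_. 1)) < A + 1"
    using order_tendstoD(2)[OF period_crossing_limit[OF one, of k]] by (simp add: A_def)
  have ev3: "\<forall>\<^sub>F \<epsilon> in at_right 0. \<forall>k\<in>labels M. \<forall>x\<in>{p k..q k}. \<bar>\<phi> \<epsilon> x - \<psi> \<epsilon> k\<bar> \<le> \<eta> / lam"
    using \<eta> lam_pos by (intro phi_near_psi) simp
  show "\<forall>\<^sub>F \<epsilon> in at_right 0. dist (integral ?I (V \<epsilon> (\<lambda>x. lam * \<phi> \<epsilon> x - mix g x)) - integral ?I (V \<epsilon> (mix (excess \<epsilon>)))) 0 < e"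
    using ev1 ev2 ev3 eventually_at_right_less[of 0]
  proof eventually_elim
    case (elim \<epsilon>)
    have lin: "mix (excess \<epsilon>) x = lam * mix (\<psi> \<epsilon>) x - mix g x" for x
      by (simp add: mix_def excess_def left_diff_distrib sum_subtractf sum_distrib_left mult.assoc)
    have ap: "\<bar>\<phi> \<epsilon> x - mix (\<psi> \<epsilon>) x\<bar> \<le> \<eta> / lam + Cg / lam * outside x" for x
      using elim \<eta> lam_pos by (intro mix_approx C2_torusD(1)[OF phi_C2]) (auto simp: phi_le)
    have le: "\<bar>(lam * \<phi> \<epsilon> x - mix g x) - mix (excess \<epsilon>) x\<bar> \<le> \<eta> + Cg * outside x" for x
    proof -
      have "\<bar>(lam * \<phi> \<epsilon> x - mix g x) - mix (excess \<epsilon>) x\<bar> = lam * \<bar>\<phi> \<epsilon> x - mix (\<psi> \<epsilon>) x\<bar>"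
      proof -
        have "(lam * \<phi> \<epsilon> x - mix g x) - mix (excess \<epsilon>) x = lam * (\<phi> \<epsilon> x - mix (\<psi> \<epsilon>) x)"
          unfolding lin by (simp add: right_diff_distrib)
        then show ?thesis using lam_pos by (simp add: abs_mult)
      qed
      also have "\<dots> \<le> lam * (\<eta> / lam + Cg / lam * outside x)" using ap lam_pos by (intro mult_left_mono) auto
      also have "\<dots> = \<eta> + Cg * outside x" using lam_pos by (simp add: field_simps)
      finally show ?thesis .
    qed
    note i = V_integrable[OF elim(4)]
    have c: "continuous_on UNIV (\<lambda>x. \<eta> + Cg * outside x)" by (intro continuous_intros outside_cont)
    have "integral ?I (V \<epsilon> (\<lambda>x. lam * \<phi> \<epsilon> x - mix g x)) - integral ?I (V \<epsilon> (mix (excess \<epsilon>)))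
       = integral ?I (\<lambda>z. V \<epsilon> (\<lambda>x. lam * \<phi> \<epsilon> x - mix g x) z - V \<epsilon> (mix (excess \<epsilon>)) z)"
      by (rule integral_diff[symmetric]) (intro i source_cont[OF elim(4)] mix_cont)+
    also have "\<dots> = integral ?I (V \<epsilon> (\<lambda>x. (lam * \<phi> \<epsilon> x - mix g x) - mix (excess \<epsilon>) x))"
      by (intro arg_cong[of _ _ "integral ?I"] ext) (rule V_diff[OF elim(4) source_cont[OF elim(4)] mix_cont, symmetric])
    finally have eq: "integral ?I (V \<epsilon> (\<lambda>x. lam * \<phi> \<epsilon> x - mix g x)) - integral ?I (V \<epsilon> (mix (excess \<epsilon>)))
       = integral ?I (V \<epsilon> (\<lambda>x. (lam * \<phi> \<epsilon> x - mix g x) - mix (excess \<epsilon>) x))" .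
    have "\<bar>integral ?I (V \<epsilon> (\<lambda>x. (lam * \<phi> \<epsilon> x - mix g x) - mix (excess \<epsilon>) x))\<bar> \<le> integral ?I (V \<epsilon> (\<lambda>x. \<eta> + Cg * outside x))"
      by (rule V_integral_bound[OF elim(4) _ c le]) (intro continuous_intros mix_cont C2_torusD(7)[OF phi_C2[OF elim(4)]])
    also have "V \<epsilon> (\<lambda>x. \<eta> + Cg * outside x) = (\<lambda>z. \<eta> * V \<epsilon> (\<lambda>_. 1) z + Cg * V \<epsilon> outside z)"
      using V_add[OF elim(4) continuous_on_const continuous_on_mult_left[OF outside_cont], of \<eta> Cg]
        V_scale[of \<epsilon> \<eta> "\<lambda>_. 1"] V_scale[of \<epsilon> Cg outside]
      by (simp add: fun_eq_iff)
    also have "integral ?I \<dots> = \<eta> * integral ?I (V \<epsilon> (\<lambda>_. 1)) + Cg * integral ?I (V \<epsilon> outside)"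
      using i[OF one(1)] i[OF outside_cont] by (simp add: integral_add integrable_on_mult_right)
    also have "\<dots> < \<eta> * (A + 1) + e / 2"
      using elim(1) mult_strict_left_mono[OF elim(2) \<eta>] by linarith
    also have "\<dots> = e" using A0 by (simp add: \<eta>_def field_simps)
    finally show ?case unfolding eq by simp
  qed
qed

lemma flux_error_limit: "((\<lambda>\<epsilon>. flux_error \<epsilon> k) \<longlongrightarrow> 0) (at_right 0)"
proof -
  let ?I = "{hi k..hi (k + 1)}"
  let ?W = "\<lambda>\<epsilon>. integral ?I (V \<epsilon> (\<lambda>x. lam * \<phi> \<epsilon> x - mix g x))"
  let ?Q = "\<lambda>\<epsilon>. integral ?I (V \<epsilon> (mix (excess \<epsilon>)))"
  have hk: "hi k \<le> hi (k + 1)" using hi_less_lo[of k "k + 1"] lo_le_hi[of "k + 1"] by simp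
  \<comment> \<open>The source depends on \<epsilon> through its coefficients only. The crossing
    limit is taken for each fixed \<open>\<zeta> i\<close>, and the coefficients merely have to stay
    bounded.\<close>
  have a: "((\<lambda>\<epsilon>. ?Q \<epsilon> - gate_weight a b M k * upstream_sum k (mix (excess \<epsilon>))) \<longlongrightarrow> 0) (at_right 0)"
  proof (rule Lim_null_comparison)
    have "((\<lambda>\<epsilon>. \<Sum>i\<in>labels M. 2 * Cg * \<bar>integral ?I (V \<epsilon> (\<zeta> i)) - gate_weight a b M k * upstream_sum k (\<zeta> i)\<bar>)
      \<longlongrightarrow> (\<Sum>i\<in>labels M. 2 * Cg * 0)) (at_right 0)"
      by (intro tendsto_sum tendsto_mult tendsto_const tendsto_rabs_zero LIM_zero period_crossing_limit cutoff_cont cutoff_periodic)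
    then show "((\<lambda>\<epsilon>. \<Sum>i\<in>labels M. 2 * Cg * \<bar>integral ?I (V \<epsilon> (\<zeta> i)) - gate_weight a b M k * upstream_sum k (\<zeta> i)\<bar>)
      \<longlongrightarrow> 0) (at_right 0)" by simp
    show "\<forall>\<^sub>F \<epsilon> in at_right 0. norm (?Q \<epsilon> - gate_weight a b M k * upstream_sum k (mix (excess \<epsilon>))) \<le>
      (\<Sum>i\<in>labels M. 2 * Cg * \<bar>integral ?I (V \<epsilon> (\<zeta> i)) - gate_weight a b M k * upstream_sum k (\<zeta> i)\<bar>)"
      using eventually_at_right_less[of 0]
    proof eventually_elim
      case (elim \<epsilon>)
      have "V \<epsilon> (mix (excess \<epsilon>)) z = (\<Sum>i\<in>labels M. excess \<epsilon> i * V \<epsilon> (\<zeta> i) z)" for z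
        unfolding mix_def[abs_def] using V_sum[OF elim finite_labels, of "\<lambda>i y. excess \<epsilon> i * \<zeta> i y" z] cutoff_cont
        by (simp add: V_scale continuous_intros)
      then have "?Q \<epsilon> = integral ?I (\<lambda>z. \<Sum>i\<in>labels M. excess \<epsilon> i * V \<epsilon> (\<zeta> i) z)" by presburger
      also have "\<dots> = (\<Sum>i\<in>labels M. excess \<epsilon> i * integral ?I (V \<epsilon> (\<zeta> i)))"
        using V_integrable[OF elim cutoff_cont] by (subst integral_sum[OF finite_labels]) (auto intro: integrable_on_mult_right)
      finally have "?Q \<epsilon> = (\<Sum>i\<in>labels M. excess \<epsilon> i * integral ?I (V \<epsilon> (\<zeta> i)))" .
      then have eq: "?Q \<epsilon> - gate_weight a b M k * upstream_sum k (mix (excess \<epsilon>)) =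
         (\<Sum>i\<in>labels M. excess \<epsilon> i * (integral ?I (V \<epsilon> (\<zeta> i)) - gate_weight a b M k * upstream_sum k (\<zeta> i)))"
        unfolding upstream_sum_mix_linear by (simp add: sum_distrib_left right_diff_distrib sum_subtractf mult_ac)
      have "\<bar>\<Sum>i\<in>labels M. excess \<epsilon> i * (integral ?I (V \<epsilon> (\<zeta> i)) - gate_weight a b M k * upstream_sum k (\<zeta> i))\<bar> \<le> (\<Sum>i\<in>labels M. \<bar>excess \<epsilon> i * (integral ?I (V \<epsilon> (\<zeta> i)) - gate_weight a b M k * upstream_sum k (\<zeta> i))\<bar>)"
        by (rule sum_abs)
      also have "\<dots> \<le> (\<Sum>i\<in>labels M. 2 * Cg * \<bar>integral ?I (V \<epsilon> (\<zeta> i)) - gate_weight a b M k * upstream_sum k (\<zeta> i)\<bar>)"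
        using excess_le[OF elim] by (intro sum_mono) (auto simp: abs_mult intro!: mult_right_mono)
      finally show ?case unfolding eq by simp
    qed
  qed
  have b: "((\<lambda>\<epsilon>. \<psi> \<epsilon> (k + 1) - \<psi> \<epsilon> k - ?W \<epsilon>) \<longlongrightarrow> 0) (at_right 0)"
  proof (rule Lim_null_comparison)
    show "((\<lambda>\<epsilon>. 2 * (Cg / lam) * exp (- B / \<epsilon>)) \<longlongrightarrow> 0) (at_right 0)"
      by (intro tendsto_mult_right_zero exp_over_power_limit(3) circulation_pos)
    show "\<forall>\<^sub>F \<epsilon> in at_right 0. norm (\<psi> \<epsilon> (k + 1) - \<psi> \<epsilon> k - ?W \<epsilon>) \<le> 2 * (Cg / lam) * exp (- B / \<epsilon>)"
      using eventually_at_right_less[of 0]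
    proof eventually_elim
      case (elim \<epsilon>)
      have "(1 - exp (- B / \<epsilon>)) * (\<phi> \<epsilon> (hi (k + 1)) - \<phi> \<epsilon> (hi k)) = ?W \<epsilon>"
        by (rule generator_solution_increment[OF elim phi_C2[OF elim] source_cont[OF elim] phi_solution[OF elim] hk])
      then have "\<psi> \<epsilon> (k + 1) - \<psi> \<epsilon> k - ?W \<epsilon> = (\<psi> \<epsilon> (k + 1) - \<psi> \<epsilon> k) * exp (- B / \<epsilon>)"
        unfolding \<psi>_def by (simp add: algebra_simps)
      moreover have "\<bar>\<psi> \<epsilon> (k + 1) - \<psi> \<epsilon> k\<bar> \<le> 2 * (Cg / lam)"
        using psi_le[OF elim, of k] psi_le[OF elim, of "k + 1"] by linarith
      ultimately show ?case by (simp add: abs_mult mult_right_mono del: times_divide_eq_right)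
    qed
  qed
  have "((\<lambda>\<epsilon>. (\<psi> \<epsilon> (k + 1) - \<psi> \<epsilon> k - ?W \<epsilon>) + (?W \<epsilon> - ?Q \<epsilon>) + (?Q \<epsilon> - gate_weight a b M k * upstream_sum k (mix (excess \<epsilon>)))) \<longlongrightarrow> 0 + 0 + 0) (at_right 0)"
    by (intro tendsto_add a b crossing_source_limit)
  moreover have "(\<psi> \<epsilon> (k + 1) - \<psi> \<epsilon> k - ?W \<epsilon>) + (?W \<epsilon> - ?Q \<epsilon>) + (?Q \<epsilon> - gate_weight a b M k * upstream_sum k (mix (excess \<epsilon>))) = flux_error \<epsilon> k" for \<epsilon>
    by (simp add: flux_error_def)
  ultimately show ?thesis by (simp only: add_0)
qed

text \<open>Differencing the upstream sums isolates the source of a single well. So the values of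
  \<phi> on the wells solve the resolvent equation of the chain up to flux errors.\<close>

lemma well_weight_defect:
  assumes "\<epsilon> > 0"
  shows "well_weight a b M k * (lam * (\<psi> \<epsilon> k - hv k) - chain_gen (\<lambda>k. \<psi> \<epsilon> k - hv k) k) =
    - (flux_error \<epsilon> k / gate_weight a b M k) + (if lev (k - 1) = lev k then flux_error \<epsilon> (k - 1) / gate_weight a b M (k - 1) else 0)"
proof -
  have excess_per: "wells_periodic (excess \<epsilon>)" using psi_periodic[OF assms] g_periodic by (simp add: wells_periodic_def excess_def)
  have "lam * (\<psi> \<epsilon> k - hv k) - chain_gen (\<lambda>k. \<psi> \<epsilon> k - hv k) k = excess \<epsilon> k - chain_gen (\<psi> \<epsilon>) k"
    by (simp add: excess_def g_def chain_gen_def algebra_simps)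
  then have "well_weight a b M k * (lam * (\<psi> \<epsilon> k - hv k) - chain_gen (\<lambda>k. \<psi> \<epsilon> k - hv k) k)
     = well_weight a b M k * excess \<epsilon> k - well_weight a b M k * chain_gen (\<psi> \<epsilon>) k"
    by (simp add: right_diff_distrib)
  also have "well_weight a b M k * excess \<epsilon> k = upstream_sum k (mix (excess \<epsilon>)) - (if lev (k - 1) = lev k then upstream_sum (k - 1) (mix (excess \<epsilon>)) else 0)"
    using upstream_sum_mix[OF excess_per, of k] by simp
  also note well_weight_chain_gen
  finally show ?thesis
    using gate_weight_pos[of k] gate_weight_pos[of "k - 1"]
    by (simp add: flux_error_def diff_divide_distrib)
qed

text \<open>\<open>\<psi> \<epsilon> - hv\<close> solves the resolvent equation of the chain with a
  vanishing right-hand side; the discrete maximum principle, applied to it and to its negative,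
  closes the argument.\<close>

lemma psi_limit: "((\<lambda>\<epsilon>. \<psi> \<epsilon> k) \<longlongrightarrow> hv k) (at_right 0)"
proof -
  define \<delta> where "\<delta> \<epsilon> k = lam * (\<psi> \<epsilon> k - hv k) - chain_gen (\<lambda>k. \<psi> \<epsilon> k - hv k) k" for \<epsilon> k
  have "((\<lambda>\<epsilon>. \<delta> \<epsilon> k) \<longlongrightarrow> 0) (at_right 0)" for k
  proof -
    have z: "((\<lambda>\<epsilon>. flux_error \<epsilon> j / gate_weight a b M j) \<longlongrightarrow> 0) (at_right 0)" for j
      using tendsto_divide[OF flux_error_limit tendsto_const[of "gate_weight a b M j"]] gate_weight_pos[of j] by simp
    have "((\<lambda>\<epsilon>. (- (flux_error \<epsilon> k / gate_weight a b M k) + (if lev (k - 1) = lev k then flux_error \<epsilon> (k - 1) / gate_weight a b M (k - 1) else 0)) / well_weight a b M k)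
      \<longlongrightarrow> (- 0 + 0) / well_weight a b M k) (at_right 0)"
    proof (intro tendsto_divide tendsto_add tendsto_minus z tendsto_const)
      show "((\<lambda>\<epsilon>. if lev (k - 1) = lev k then flux_error \<epsilon> (k - 1) / gate_weight a b M (k - 1) else 0) \<longlongrightarrow> 0) (at_right 0)"
        using z[of "k - 1"] by (cases "lev (k - 1) = lev k") simp_all
    qed (use well_weight_pos[of k] in simp)
    then have "((\<lambda>\<epsilon>. (- (flux_error \<epsilon> k / gate_weight a b M k) + (if lev (k - 1) = lev k then flux_error \<epsilon> (k - 1) / gate_weight a b M (k - 1) else 0)) / well_weight a b M k)
      \<longlongrightarrow> 0) (at_right 0)" by simp
    then show ?thesis
    proof (rule Lim_transform_eventually)
      show "\<forall>\<^sub>F \<epsilon> in at_right 0. (- (flux_error \<epsilon> k / gate_weight a b M k) + (if lev (k - 1) = lev k then flux_error \<epsilon> (k - 1) / gate_weight a b M (k - 1) else 0)) / well_weight a b M k = \<delta> \<epsilon> k"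
        using eventually_at_right_less[of 0]
      proof eventually_elim
        case (elim \<epsilon>)
        show ?case using well_weight_pos[of k] by (simp only: well_weight_defect[OF elim, symmetric] \<delta>_def) simp
      qed
    qed
  qed
  from tendsto_sum[of "labels M", OF tendsto_rabs_zero[OF this]]
  have \<delta>0: "((\<lambda>\<epsilon>. (\<Sum>k\<in>labels M. \<bar>\<delta> \<epsilon> k\<bar>) / lam) \<longlongrightarrow> 0) (at_right 0)"
    using tendsto_divide[OF _ tendsto_const[of lam], of _ 0] lam_pos by fastforce
  have "((\<lambda>\<epsilon>. \<psi> \<epsilon> k - hv k) \<longlongrightarrow> 0) (at_right 0)"
  proof (rule Lim_null_comparison[OF _ \<delta>0])
    show "\<forall>\<^sub>F \<epsilon> in at_right 0. norm (\<psi> \<epsilon> k - hv k) \<le> (\<Sum>k\<in>labels M. \<bar>\<delta> \<epsilon> k\<bar>) / lam"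
      using eventually_at_right_less[of 0]
    proof eventually_elim
      case (elim \<epsilon>)
      have per: "wells_periodic (\<lambda>k. \<psi> \<epsilon> k - hv k)" "wells_periodic (\<lambda>k. hv k - \<psi> \<epsilon> k)"
        using psi_periodic[OF elim] h_periodic by (auto simp: wells_periodic_def)
      have le: "\<bar>\<delta> \<epsilon> k\<bar> \<le> (\<Sum>k\<in>labels M. \<bar>\<delta> \<epsilon> k\<bar>)" if "k \<in> labels M" for k
        using that finite_labels by (intro member_le_sum) auto
      have neg: "lam * (hv k - \<psi> \<epsilon> k) - chain_gen (\<lambda>k. hv k - \<psi> \<epsilon> k) k = - \<delta> \<epsilon> k" for k
        by (simp add: \<delta>_def chain_gen_def algebra_simps)
      have "\<psi> \<epsilon> k - hv k \<le> (\<Sum>k\<in>labels M. \<bar>\<delta> \<epsilon> k\<bar>) / lam"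
        by (rule chain_maximum_principle[OF per(1) lam_pos]) (use le \<delta>_def in \<open>force simp: abs_le_iff\<close>)
      moreover have "hv k - \<psi> \<epsilon> k \<le> (\<Sum>k\<in>labels M. \<bar>\<delta> \<epsilon> k\<bar>) / lam"
        by (rule chain_maximum_principle[OF per(2) lam_pos]) (use le neg in \<open>force simp: abs_le_iff\<close>)
      ultimately show ?case by (simp add: abs_le_iff)
    qed
  qed
  then show ?thesis by (rule LIM_zero_cancel)
qed

lemma phi_limit:
  assumes \<eta>: "\<eta> > 0"
  shows "\<forall>\<^sub>F \<epsilon> in at_right 0. \<forall>k\<in>labels M. \<forall>x\<in>{p k..q k}. \<bar>\<phi> \<epsilon> x - hv k\<bar> \<le> \<eta>"
proof -
  have "\<forall>\<^sub>F \<epsilon> in at_right 0. \<forall>k\<in>labels M. \<bar>\<psi> \<epsilon> k - hv k\<bar> < \<eta> / 2"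
  proof (rule eventually_labels)
    fix k
    have "((\<lambda>\<epsilon>. \<bar>\<psi> \<epsilon> k - hv k\<bar>) \<longlongrightarrow> 0) (at_right 0)" using tendsto_rabs_zero[OF LIM_zero[OF psi_limit]] .
    then show "\<forall>\<^sub>F \<epsilon> in at_right 0. \<bar>\<psi> \<epsilon> k - hv k\<bar> < \<eta> / 2" using order_tendstoD(2) \<eta> by (metis half_gt_zero)
  qed
  moreover have "\<forall>\<^sub>F \<epsilon> in at_right 0. \<forall>k\<in>labels M. \<forall>x\<in>{p k..q k}. \<bar>\<phi> \<epsilon> x - \<psi> \<epsilon> k\<bar> \<le> \<eta> / 2"
    using \<eta> by (intro phi_near_psi) simp
  ultimately show ?thesis
  proof eventually_elim
    case (elim \<epsilon>)
    show ?case
    proof (intro ballI)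
      fix k x assume "k \<in> labels M" "x \<in> {p k..q k}"
      then have "\<bar>\<psi> \<epsilon> k - hv k\<bar> < \<eta> / 2" "\<bar>\<phi> \<epsilon> x - \<psi> \<epsilon> k\<bar> \<le> \<eta> / 2" using elim by auto
      then show "\<bar>\<phi> \<epsilon> x - hv k\<bar> \<le> \<eta>" by linarith
    qed
  qed
qed

text \<open>Off the supports of the cut-offs the source of \<phi> is 0, so a minimum there would
  give no positive bound. Subtracting the small solution with source \<open>outside\<close> adds a
  source close to 1 there; on the wells \<open>phi_limit\<close> gives the bound.\<close>

lemma phi_lower_bound:
  obtains c where "c > 0" "\<forall>\<^sub>F \<epsilon> in at_right 0. \<forall>x. c \<le> \<phi> \<epsilon> x"
proof -
  obtain U c where c: "(c \<longlongrightarrow> 0) (at_right 0)"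
    and U: "\<forall>\<^sub>F \<epsilon> in at_right 0. U \<epsilon> \<in> C2_torus \<and> (\<forall>x. time_scale a b M \<epsilon> * diffusion_gen a b \<epsilon> (U \<epsilon>) x = outside x - c \<epsilon>)"
    and Us: "\<And>\<eta>. \<eta> > 0 \<Longrightarrow> \<forall>\<^sub>F \<epsilon> in at_right 0. \<forall>x. \<bar>U \<epsilon> x\<bar> \<le> \<eta>"
    using outside_solution by blast
  define hm where "hm = Min (hv ` labels M)"
  have ne: "labels M \<noteq> {}" using num_wells_period(1) by (simp add: labels_eq)
  have hm: "hm > 0" "\<And>k. k \<in> labels M \<Longrightarrow> hm \<le> hv k" using finite_labels ne h_pos by (auto simp: hm_def)
  \<comment> \<open>The two entries are the bounds in the two cases: half the smallest
    \<open>hv\<close> on a well, and \<open>1 / (2 * lam)\<close> off the supports, where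
    \<open>c \<epsilon> < 1 / 2\<close>.\<close>
  define m0 where "m0 = min (hm / 2) (1 / (2 * lam))"
  have m0: "m0 > 0" "m0 \<le> hm / 2" "m0 \<le> 1 / (2 * lam)" using hm(1) lam_pos by (auto simp: m0_def)
  have Us4: "\<forall>\<^sub>F \<epsilon> in at_right 0. \<forall>x. \<bar>U \<epsilon> x\<bar> \<le> m0 / 4" using m0(1) by (intro Us) simp
  have c1: "\<forall>\<^sub>F \<epsilon> in at_right 0. c \<epsilon> < 1 / 2" using order_tendstoD(2)[OF c, of "1 / 2"] by simp
  have "\<forall>\<^sub>F \<epsilon> in at_right 0. \<forall>x. m0 / 2 \<le> \<phi> \<epsilon> x"
    using U Us4 phi_limit[OF m0(1)] c1 eventually_at_right_less[of 0]
  proof eventually_elim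
    case (elim \<epsilon>)
    have \<phi>C: "\<phi> \<epsilon> \<in> C2_torus" using elim by (simp add: phi_C2)
    have UC: "U \<epsilon> \<in> C2_torus" using elim by simp
    obtain x0 where x0: "\<And>x. 1 * \<phi> \<epsilon> x0 + (-1) * U \<epsilon> x0 \<le> 1 * \<phi> \<epsilon> x + (-1) * U \<epsilon> x"
      "time_scale a b M \<epsilon> * diffusion_gen a b \<epsilon> (\<lambda>x. 1 * \<phi> \<epsilon> x + (-1) * U \<epsilon> x) x0 \<ge> 0"
      using minimum_principle[OF C2_torus_linear(1)[OF \<phi>C UC, of 1 "-1"] elim(5)] by blast
    have "time_scale a b M \<epsilon> * diffusion_gen a b \<epsilon> (\<phi> \<epsilon>) x0 - time_scale a b M \<epsilon> * diffusion_gen a b \<epsilon> (U \<epsilon>) x0 \<ge> 0"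
      using x0(2) unfolding diffusion_gen_linear[OF \<phi>C UC] by (simp add: right_diff_distrib)
    then have low: "lam * \<phi> \<epsilon> x0 \<ge> mix g x0 + outside x0 - c \<epsilon>"
      using elim phi_solution[of \<epsilon> x0] by simp
    have "m0 \<le> \<phi> \<epsilon> x0"
    proof (cases "\<exists>k\<in>labels M. \<zeta> k x0 \<noteq> 0")
      case True
      then obtain k where k: "k \<in> labels M" "\<zeta> k x0 \<noteq> 0" by blast
      then obtain n :: int where n: "x0 + of_int n \<in> {p k..q k}" using cutoff_support by blast
      have "\<bar>\<phi> \<epsilon> (x0 + of_int n) - hv k\<bar> \<le> m0" using elim k(1) n by blast
      then show ?thesis using hm(2)[OF k(1)] m0(2) periodic1_shift[OF C2_torusD(1)[OF \<phi>C], of x0 n] by simp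
    next
      case False
      then have "mix g x0 = 0" "outside x0 = 1" using mix_zero[of x0] by (auto simp: outside_def)
      then have "lam * \<phi> \<epsilon> x0 \<ge> 1 / 2" using low elim by simp
      then have "1 / (2 * lam) \<le> \<phi> \<epsilon> x0" using lam_pos by (simp add: field_simps)
      then show ?thesis using m0(3) by simp
    qed
    moreover have Ub: "\<bar>U \<epsilon> x\<bar> \<le> m0 / 4" for x using elim(2) by blast
    ultimately have "m0 / 2 \<le> \<phi> \<epsilon> x" for x
      using x0(1)[of x] Ub[of x] Ub[of x0] by linarith
    then show ?case by blast
  qed
  then show thesis using that[of "m0 / 2"] m0(1) by simp
qed

end

section \<open>The tilted diffusion\<close>

lemma tendsto_zero_linear_bound:
  fixes f :: "real \<Rightarrow> real"
  assumes "\<And>\<eta>. \<eta> > 0 \<Longrightarrow> \<forall>\<^sub>F \<epsilon> in F. \<bar>f \<epsilon>\<bar> \<le> K * \<eta>"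
  shows "(f \<longlongrightarrow> 0) F"
proof (rule tendstoI)
  fix e :: real assume e: "e > 0"
  define \<eta> where "\<eta> = e / (2 * (\<bar>K\<bar> + 1))"
  have \<eta>: "\<eta> > 0" using e by (simp add: \<eta>_def)
  have "K * \<eta> \<le> (\<bar>K\<bar> + 1) * \<eta>" using \<eta> by (intro mult_right_mono) auto
  also have "\<dots> = e / 2" by (simp add: \<eta>_def field_simps)
  finally have "K * \<eta> < e" using e by simp
  then show "\<forall>\<^sub>F \<epsilon> in F. dist (f \<epsilon>) 0 < e"
    using assms[OF \<eta>] by (auto elim: eventually_mono)
qed

lemma torus_probs_integrable:
  fixes f :: "real \<Rightarrow> real"
  assumes "\<mu> \<in> torus_probs" "continuous_on UNIV f"
  shows "integrable \<mu> f"
proof -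
  interpret prob_space \<mu> using assms(1) by (simp add: torus_probs_def)
  have sets: "sets \<mu> = sets torus_borel" using assms(1) by (simp add: torus_probs_def)
  then have space: "space \<mu> = {0..<1}" using sets_eq_imp_space_eq[OF sets] by (simp add: torus_borel_def space_restrict_space)
  have "f \<in> borel_measurable torus_borel"
    unfolding torus_borel_def using assms(2) by (intro measurable_restrict_space1 borel_measurable_continuous_onI)
  then have m: "f \<in> borel_measurable \<mu>" using measurable_cong_sets[OF sets refl] by blast
  have "bounded (f ` {0..1})"
    using assms(2) by (intro compact_imp_bounded compact_continuous_image) (auto intro: continuous_on_subset)
  then obtain C where "\<And>y. y \<in> {0..1} \<Longrightarrow> \<bar>f y\<bar> \<le> C" unfolding bounded_iff by (metis image_eqI real_norm_def)
  then show ?thesis by (intro integrable_const_bound[of _ C] m AE_I2) (simp add: space)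
qed

lemma torus_probs_integral_le:
  fixes f :: "real \<Rightarrow> real"
  assumes "\<mu> \<in> torus_probs" "continuous_on UNIV f" "continuous_on UNIV g" "\<And>x. f x \<le> g x"
  shows "(\<integral>x. f x \<partial>\<mu>) \<le> (\<integral>x. g x \<partial>\<mu>)"
  using torus_probs_integrable assms by (intro integral_mono) auto

lemma torus_probs_integral_const: "\<mu> \<in> torus_probs \<Longrightarrow> (\<integral>x. c \<partial>\<mu>) = (c :: real)"
  using prob_space.prob_space[of \<mu>] by (simp add: torus_probs_def)

lemma torus_probs_integral_abs_le:
  fixes f :: "real \<Rightarrow> real"
  assumes "\<mu> \<in> torus_probs" "continuous_on UNIV f" "continuous_on UNIV g" "\<And>x. \<bar>f x\<bar> \<le> g x"
  shows "\<bar>\<integral>x. f x \<partial>\<mu>\<bar> \<le> (\<integral>x. g x \<partial>\<mu>)"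
proof -
  have "- (\<integral>x. g x \<partial>\<mu>) = (\<integral>x. - g x \<partial>\<mu>)" by simp
  moreover have "(\<integral>x. - g x \<partial>\<mu>) \<le> (\<integral>x. f x \<partial>\<mu>)"
    using assms by (intro torus_probs_integral_le) (auto intro: continuous_intros simp: abs_le_iff minus_le_iff)
  moreover have "(\<integral>x. f x \<partial>\<mu>) \<le> (\<integral>x. g x \<partial>\<mu>)"
    using assms by (intro torus_probs_integral_le) (auto simp: abs_le_iff)
  ultimately show ?thesis by (simp add: abs_le_iff)
qed

section \<open>Quotients, logarithms and the tilted generator\<close>

lemma C2_torus_divide:
  assumes f: "f \<in> C2_torus" and g: "g \<in> C2_torus" and pos: "\<And>x. g x > 0"
  shows "(\<lambda>x. f x / g x) \<in> C2_torus"
    and "deriv (\<lambda>x. f x / g x) = (\<lambda>x. (deriv f x * g x - f x * deriv g x) / (g x)\<^sup>2)"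
    and "deriv (deriv (\<lambda>x. f x / g x)) = (\<lambda>x. (deriv (deriv f) x * g x - f x * deriv (deriv g) x) / (g x)\<^sup>2
      - 2 * deriv g x * (deriv f x * g x - f x * deriv g x) / (g x) ^ 3)"
proof -
  note F = C2_torusD[OF f] and G = C2_torusD[OF g]
  have nz: "g x \<noteq> 0" for x using pos[of x] by simp
  have per: "periodic1 (\<lambda>x. f x / g x)" using F(1) G(1) by (simp add: periodic1_def)
  have 1: "((\<lambda>x. f x / g x) has_real_derivative (deriv f x * g x - f x * deriv g x) / (g x)\<^sup>2) (at x)" for x
    using nz[of x] by (auto intro!: derivative_eq_intros F(2) G(2) simp: power2_eq_square)
  have 2: "((\<lambda>x. (deriv f x * g x - f x * deriv g x) / (g x)\<^sup>2) has_real_derivative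
      (deriv (deriv f) x * g x - f x * deriv (deriv g) x) / (g x)\<^sup>2
      - 2 * deriv g x * (deriv f x * g x - f x * deriv g x) / (g x) ^ 3) (at x)" for x
    using nz[of x]
    by (auto intro!: derivative_eq_intros F(2,3) G(2,3) simp: field_simps power2_eq_square power3_eq_cube)
  have 3: "isCont (\<lambda>x. (deriv (deriv f) x * g x - f x * deriv (deriv g) x) / (g x)\<^sup>2
      - 2 * deriv g x * (deriv f x * g x - f x * deriv g x) / (g x) ^ 3) x" for x
    using nz by (intro continuous_intros F G) auto
  from C2_torusI[OF per 1 2 3]
  show "(\<lambda>x. f x / g x) \<in> C2_torus"
    and "deriv (\<lambda>x. f x / g x) = (\<lambda>x. (deriv f x * g x - f x * deriv g x) / (g x)\<^sup>2)"
    and "deriv (deriv (\<lambda>x. f x / g x)) = (\<lambda>x. (deriv (deriv f) x * g x - f x * deriv (deriv g) x) / (g x)\<^sup>2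
      - 2 * deriv g x * (deriv f x * g x - f x * deriv g x) / (g x) ^ 3)" .
qed

lemma C2_torus_ln:
  assumes f: "f \<in> C2_torus" and pos: "\<And>x. f x > 0"
  shows "(\<lambda>x. ln (f x)) \<in> C2_torus"
    and "deriv (\<lambda>x. ln (f x)) = (\<lambda>x. deriv f x / f x)"
    and "deriv (deriv (\<lambda>x. ln (f x))) = (\<lambda>x. deriv (deriv f) x / f x - (deriv f x / f x)\<^sup>2)"
proof -
  note F = C2_torusD[OF f]
  have nz: "f x \<noteq> 0" for x using pos[of x] by simp
  have per: "periodic1 (\<lambda>x. ln (f x))" using F(1) by (simp add: periodic1_def)
  have 1: "((\<lambda>x. ln (f x)) has_real_derivative deriv f x / f x) (at x)" for x
    using pos[of x] by (auto intro!: derivative_eq_intros F(2))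
  have 2: "((\<lambda>x. deriv f x / f x) has_real_derivative deriv (deriv f) x / f x - (deriv f x / f x)\<^sup>2) (at x)" for x
    using nz[of x] by (auto intro!: derivative_eq_intros F(2,3) simp: field_simps power2_eq_square)
  have 3: "isCont (\<lambda>x. deriv (deriv f) x / f x - (deriv f x / f x)\<^sup>2) x" for x
    using nz by (intro continuous_intros F) auto
  from C2_torusI[OF per 1 2 3]
  show "(\<lambda>x. ln (f x)) \<in> C2_torus" and "deriv (\<lambda>x. ln (f x)) = (\<lambda>x. deriv f x / f x)"
    and "deriv (deriv (\<lambda>x. ln (f x))) = (\<lambda>x. deriv (deriv f) x / f x - (deriv f x / f x)\<^sup>2)" .
qed

text \<open>The tilted generator is the Doob transform of the diffusion by \<phi>; hence test
  functions of the form \<open>f / \<phi>\<close> reduce it to the original generator.\<close>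

lemma tilted_gen_divide:
  assumes "f \<in> C2_torus" "\<phi> \<in> C2_torus" "\<And>x. \<phi> x > 0"
  shows "tilted_gen a b \<phi> \<epsilon> (\<lambda>x. f x / \<phi> x) x =
    (diffusion_gen a b \<epsilon> f x - f x * diffusion_gen a b \<epsilon> \<phi> x / \<phi> x) / \<phi> x"
proof -
  define P P1 P2 F F1 F2 where "P = \<phi> x" and "P1 = deriv \<phi> x" and "P2 = deriv (deriv \<phi>) x"
    and "F = f x" and "F1 = deriv f x" and "F2 = deriv (deriv f) x"
  have P: "P \<noteq> 0" using assms(3)[of x] by (simp add: P_def)
  have "(b x + 2 * \<epsilon> * a x * (P1 / P)) * ((F1 * P - F * P1) / P\<^sup>2) +
      \<epsilon> * a x * ((F2 * P - F * P2) / P\<^sup>2 - 2 * P1 * (F1 * P - F * P1) / P ^ 3)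
    = ((b x * F1 + \<epsilon> * a x * F2) - F * (b x * P1 + \<epsilon> * a x * P2) / P) / P"
    using P by (simp add: field_simps power2_eq_square power3_eq_cube)
  then show ?thesis
    unfolding tilted_gen_def diffusion_gen_def C2_torus_divide(3)[OF assms]
    unfolding C2_torus_divide(2)[OF assms] P_def P1_def P2_def F_def F1_def F2_def .
qed

text \<open>The difference of the two sides is exactly \<open>\<epsilon> * a\<close> times the
  square of the difference of the logarithmic derivatives of \<open>u\<close> and \<phi>.\<close>

lemma tilted_gen_ln_le:
  assumes u: "u \<in> C2_torus" "\<And>x. u x > 0" and \<phi>: "\<phi> \<in> C2_torus" "\<And>x. \<phi> x > 0" and "\<epsilon> > 0" "a x \<ge> 0"
  shows "tilted_gen a b \<phi> \<epsilon> (\<lambda>x. 1 * ln (u x) + (-1) * ln (\<phi> x)) x + diffusion_gen a b \<epsilon> \<phi> x / \<phi> x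
    \<le> diffusion_gen a b \<epsilon> u x / u x"
proof -
  note lin = C2_torus_linear[OF C2_torus_ln(1)[OF u] C2_torus_ln(1)[OF \<phi>], of 1 "-1"]
  define U1 U2 P1 P2 where "U1 = deriv u x / u x" and "U2 = deriv (deriv u) x / u x"
    and "P1 = deriv \<phi> x / \<phi> x" and "P2 = deriv (deriv \<phi>) x / \<phi> x"
  have "tilted_gen a b \<phi> \<epsilon> (\<lambda>x. 1 * ln (u x) + (-1) * ln (\<phi> x)) x
      = (b x + 2 * \<epsilon> * a x * P1) * (U1 - P1) + \<epsilon> * a x * ((U2 - U1\<^sup>2) - (P2 - P1\<^sup>2))"
    unfolding tilted_gen_def lin(3) unfolding lin(2) C2_torus_ln(3)[OF u] C2_torus_ln(3)[OF \<phi>]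
    unfolding C2_torus_ln(2)[OF u] C2_torus_ln(2)[OF \<phi>]
    by (simp add: U1_def U2_def P1_def P2_def)
  moreover have "diffusion_gen a b \<epsilon> u x / u x = b x * U1 + \<epsilon> * a x * U2"
    "diffusion_gen a b \<epsilon> \<phi> x / \<phi> x = b x * P1 + \<epsilon> * a x * P2"
    by (simp_all add: diffusion_gen_def U1_def U2_def P1_def P2_def add_divide_distrib)
  moreover have "0 \<le> \<epsilon> * a x * (U1 - P1)\<^sup>2" using assms(5,6) by simp
  ultimately show ?thesis by (simp add: power2_eq_square algebra_simps)
qed

lemma rate_functional_le:
  assumes a: "continuous_on UNIV a" "\<And>x. a x \<ge> 0" and b: "continuous_on UNIV b"
    and \<phi>: "\<phi> \<in> C2_torus" "\<And>x. \<phi> x > 0" and "\<epsilon> > 0" and st: "stationary_state (tilted_gen a b \<phi> \<epsilon>) \<mu>"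
  shows "rate_functional a b \<epsilon> \<mu> \<le> ereal (- (\<integral>x. diffusion_gen a b \<epsilon> \<phi> x / \<phi> x \<partial>\<mu>))"
  unfolding rate_functional_def
proof (rule SUP_least)
  fix u assume "u \<in> {u \<in> C2_torus. \<forall>x. u x > 0}"
  then have u: "u \<in> C2_torus" "\<And>x. u x > 0" by auto
  have \<mu>: "\<mu> \<in> torus_probs" using st by (simp add: stationary_state_def)
  let ?w = "\<lambda>x. 1 * ln (u x) + (-1) * ln (\<phi> x)"
  have w: "?w \<in> C2_torus" by (rule C2_torus_linear(1)[OF C2_torus_ln(1)[OF u] C2_torus_ln(1)[OF \<phi>]])
  have nz: "u x \<noteq> 0" "\<phi> x \<noteq> 0" for x using u(2)[of x] \<phi>(2)[of x] by auto
  have cL: "continuous_on UNIV (\<lambda>x. diffusion_gen a b \<epsilon> v x / v x)" if "v \<in> C2_torus" "\<And>x. v x \<noteq> 0" for v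
    unfolding diffusion_gen_def using that by (intro continuous_intros a b C2_torusD(7-9)) auto
  have cT: "continuous_on UNIV (tilted_gen a b \<phi> \<epsilon> ?w)"
    unfolding tilted_gen_def[abs_def] using nz
    by (intro continuous_intros a b C2_torusD(7-9)[OF \<phi>(1)] C2_torusD(7-9)[OF w]) auto
  have "(\<integral>x. tilted_gen a b \<phi> \<epsilon> ?w x + diffusion_gen a b \<epsilon> \<phi> x / \<phi> x \<partial>\<mu>) \<le> (\<integral>x. diffusion_gen a b \<epsilon> u x / u x \<partial>\<mu>)"
    using tilted_gen_ln_le[of u \<phi> \<epsilon> a _ b] u \<phi> \<open>\<epsilon> > 0\<close> a(2) nz
    by (intro torus_probs_integral_le[OF \<mu>] continuous_intros cT cL) auto
  moreover have "(\<integral>x. tilted_gen a b \<phi> \<epsilon> ?w x + diffusion_gen a b \<epsilon> \<phi> x / \<phi> x \<partial>\<mu>) =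
     (\<integral>x. tilted_gen a b \<phi> \<epsilon> ?w x \<partial>\<mu>) + (\<integral>x. diffusion_gen a b \<epsilon> \<phi> x / \<phi> x \<partial>\<mu>)"
    by (intro Bochner_Integration.integral_add torus_probs_integrable[OF \<mu>] cT cL \<phi>(1) nz)
  moreover have "(\<integral>x. tilted_gen a b \<phi> \<epsilon> ?w x \<partial>\<mu>) = 0"
    using st w by (simp add: stationary_state_def)
  ultimately show "ereal (- (\<integral>x. diffusion_gen a b \<epsilon> u x / u x \<partial>\<mu>)) \<le> ereal (- (\<integral>x. diffusion_gen a b \<epsilon> \<phi> x / \<phi> x \<partial>\<mu>))"
    by simp
qed

section \<open>Stationary weights of the tilted chain\<close>

context nonreversible
begin

definition well_indicator :: "int \<Rightarrow> int \<Rightarrow> real" where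
  "well_indicator j i = (if i mod int u = j then 1 else 0)"

lemma well_indicator_periodic: "wells_periodic (well_indicator j)"
  by (simp add: wells_periodic_def well_indicator_def)

text \<open>For \<open>r = chain_gen hv / hv\<close> this is the integral of the tilted chain
  generator, applied to \<open>f / hv\<close>, against the weights \<open>hv * n\<close>: the
  discrete form of \<open>tilted_gen_divide\<close>.\<close>

definition tilted_pairing :: "(int \<Rightarrow> real) \<Rightarrow> (int \<Rightarrow> real) \<Rightarrow> (int \<Rightarrow> real) \<Rightarrow> real" where
  "tilted_pairing r n f = (\<Sum>i\<in>labels M. n i * (chain_gen f i - f i * r i))"

definition total_rate :: "int \<Rightarrow> real" where
  "total_rate i = jump_rate a b M i (i + 1) + jump_rate a b M i (i - 1)"

text \<open>Tested with the indicator of \<open>j\<close>, the pairing balances inflow against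
  outflow. All inflows \<open>T i\<close> are nonnegative, so the one from the left neighbour is
  bounded by the defect plus the outflow.\<close>

lemma predecessor_bound:
  assumes d: "\<And>i. i \<in> labels M \<Longrightarrow> 0 \<le> d i" and j: "j \<in> labels M"
  defines "i \<equiv> (j - 1) mod int u"
  shows "d i * jump_rate a b M i (i + 1) \<le> tilted_pairing r d (well_indicator j) + d j * (total_rate j + \<bar>r j\<bar>)"
proof -
  let ?f = "well_indicator j"
  have fin: "finite (labels M)" by (simp add: labels_eq)
  have f_eq: "?f i = (if i = j then 1 else 0)" if "i \<in> labels M" for i
    using that j by (simp add: well_indicator_def labels_eq)
  define T where "T i = d i * (jump_rate a b M i (i + 1) * ?f (i + 1) + jump_rate a b M i (i - 1) * ?f (i - 1))" for i
  have T0: "0 \<le> T i" if "i \<in> labels M" for i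
    unfolding T_def using d[OF that] jump_rate_nonneg by (simp add: well_indicator_def)
  have i: "i \<in> labels M" unfolding i_def by (rule mod_labels)
  have fi: "?f (i + 1) = 1"
  proof -
    have "(i + 1) mod int u = j mod int u" unfolding i_def by (simp add: mod_add_left_eq)
    then show ?thesis using j by (simp add: well_indicator_def labels_eq)
  qed
  have "d i * jump_rate a b M i (i + 1) \<le> T i"
    unfolding T_def fi using d[OF i] jump_rate_nonneg by (simp add: well_indicator_def mult_left_mono)
  also have "\<dots> \<le> (\<Sum>i\<in>labels M. T i)" by (rule member_le_sum[OF i _ fin]) (use T0 in auto)
  also have "\<dots> = (\<Sum>i\<in>labels M. d i * (chain_gen ?f i - ?f i * r i) + ?f i * (d i * (total_rate i + r i)))"
    by (intro sum.cong) (auto simp: T_def chain_gen_def total_rate_def algebra_simps)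
  also have "\<dots> = tilted_pairing r d ?f + (\<Sum>i\<in>labels M. ?f i * (d i * (total_rate i + r i)))"
    by (simp add: sum.distrib tilted_pairing_def)
  also have "(\<Sum>i\<in>labels M. ?f i * (d i * (total_rate i + r i))) = (\<Sum>i\<in>labels M. if i = j then d i * (total_rate i + r i) else 0)"
    by (intro sum.cong) (auto simp: f_eq)
  also have "\<dots> = d j * (total_rate j + r j)" using fin j by simp
  also have "d j * (total_rate j + r j) \<le> d j * (total_rate j + \<bar>r j\<bar>)" using d[OF j] by (intro mult_left_mono) auto
  finally show ?thesis by simp
qed

text \<open>Uniqueness of the stationary weights up to scaling, in quantitative form. Subtract the largest
  multiple of \<open>\<nu>\<close> that leaves nonnegative weights; the remainder vanishes at one well, and
  since every jump to the right is possible, smallness propagates to the left around the cycle.\<close>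

lemma stationary_weights_unique:
  assumes \<nu>: "\<And>k. k \<in> labels M \<Longrightarrow> \<nu> k > 0" and st: "\<And>j. j \<in> labels M \<Longrightarrow> tilted_pairing r \<nu> (well_indicator j) = 0"
  obtains C where "C \<ge> 0" "\<And>n. (\<And>k. k \<in> labels M \<Longrightarrow> 0 \<le> n k) \<Longrightarrow>
     \<exists>t. \<forall>k\<in>labels M. \<bar>n k - t * \<nu> k\<bar> \<le> C * (\<Sum>j\<in>labels M. \<bar>tilted_pairing r n (well_indicator j)\<bar>)"
proof -
  have fin: "finite (labels M)" and ne: "labels M \<noteq> {}" using num_wells_period(1) by (auto simp: labels_eq)
  define K where "K = (\<Sum>j\<in>labels M. total_rate j + \<bar>r j\<bar>)"
  have tr0: "0 \<le> total_rate j + \<bar>r j\<bar>" for j using jump_rate_nonneg by (simp add: total_rate_def)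
  have K: "total_rate j + \<bar>r j\<bar> \<le> K" if "j \<in> labels M" for j
    unfolding K_def using that tr0 fin by (intro member_le_sum) auto
  have K0: "0 \<le> K" unfolding K_def using tr0 by (intro sum_nonneg)
  define \<rho> where "\<rho> = Min ((\<lambda>i. jump_rate a b M i (i + 1)) ` labels M)"
  have \<rho>: "\<rho> > 0" "\<And>i. i \<in> labels M \<Longrightarrow> \<rho> \<le> jump_rate a b M i (i + 1)"
    using fin ne right_rate by (auto simp: \<rho>_def)
  \<comment> \<open>The growth of the error per step to the left: \<open>predecessor_bound\<close>
    gives the factor \<open>(1 + K) / \<rho>\<close>, and adding 1 makes the powers increasing, so
    that the \<open>u\<close>-th power covers the whole cycle.\<close>
  define A where "A = (1 + K) / \<rho> + 1"
  have A: "A \<ge> 1" "(1 + K) / \<rho> \<le> A" using K0 \<rho>(1) by (auto simp: A_def)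
  show thesis
  proof (rule that[of "A ^ u"])
    show "A ^ u \<ge> 0" using A(1) by simp
    fix n :: "int \<Rightarrow> real" assume n: "\<And>k. k \<in> labels M \<Longrightarrow> 0 \<le> n k"
    define e where "e = (\<Sum>j\<in>labels M. \<bar>tilted_pairing r n (well_indicator j)\<bar>)"
    have e0: "0 \<le> e" unfolding e_def by (intro sum_nonneg) simp
    define t where "t = Min ((\<lambda>k. n k / \<nu> k) ` labels M)"
    have "t \<in> (\<lambda>k. n k / \<nu> k) ` labels M" unfolding t_def using fin ne by (intro Min_in) auto
    then obtain k0 where k0: "k0 \<in> labels M" "t = n k0 / \<nu> k0" by blast
    have t_le: "t \<le> n k / \<nu> k" if "k \<in> labels M" for k using that fin by (auto simp: t_def)
    define d where "d k = n k - t * \<nu> k" for k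
    have d0: "0 \<le> d k" if "k \<in> labels M" for k
      using t_le[OF that] \<nu>[OF that] by (simp add: d_def field_simps)
    have dk0: "d k0 = 0" using k0 \<nu>[OF k0(1)] by (simp add: d_def)
    have pair: "tilted_pairing r d (well_indicator j) \<le> e" if j: "j \<in> labels M" for j
    proof -
      have "tilted_pairing r d (well_indicator j) = tilted_pairing r n (well_indicator j) - t * tilted_pairing r \<nu> (well_indicator j)"
        by (simp add: tilted_pairing_def d_def left_diff_distrib sum_subtractf sum_distrib_left mult.assoc)
      also have "\<dots> \<le> \<bar>tilted_pairing r n (well_indicator j)\<bar>" using st[OF j] by simp
      also have "\<dots> \<le> e" unfolding e_def using j fin by (intro member_le_sum) auto
      finally show ?thesis .
    qed
    have iter: "d ((k0 - int i) mod int u) \<le> e * A ^ i" for i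
    proof (induction i)
      case 0
      then show ?case using k0(1) dk0 e0 by (simp add: labels_eq)
    next
      case (Suc i)
      define j where "j = (k0 - int i) mod int u"
      define j' where "j' = (j - 1) mod int u"
      have jl: "j \<in> labels M" "j' \<in> labels M" unfolding j_def j'_def by (rule mod_labels)+
      have "j' = (k0 - int (Suc i)) mod int u" unfolding j'_def j_def by (simp add: mod_diff_left_eq algebra_simps)
      moreover have "d j' \<le> e * A ^ Suc i"
      proof -
        have "d j' * \<rho> \<le> d j' * jump_rate a b M j' (j' + 1)" using d0[OF jl(2)] \<rho>(2)[OF jl(2)] by (intro mult_left_mono)
        also have "\<dots> \<le> tilted_pairing r d (well_indicator j) + d j * (total_rate j + \<bar>r j\<bar>)"
          unfolding j'_def by (rule predecessor_bound[OF d0 jl(1)])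
        also have "\<dots> \<le> e + (e * A ^ i) * K"
          using pair[OF jl(1)] Suc K[OF jl(1)] d0[OF jl(1)] tr0[of j] e0 A(1) unfolding j_def[symmetric]
          by (intro add_mono mult_mono) auto
        also have "\<dots> \<le> e * A ^ i + (e * A ^ i) * K" using e0 A(1) one_le_power[OF A(1), of i]
          by (intro add_right_mono) (simp add: mult_le_cancel_left1)
        finally have "d j' \<le> (e * A ^ i) * ((1 + K) / \<rho>)" using \<rho>(1) by (simp add: field_simps)
        also have "\<dots> \<le> (e * A ^ i) * A" using A e0 by (intro mult_left_mono) auto
        finally show ?thesis by (simp add: mult_ac)
      qed
      ultimately show ?case by simp
    qed
    have "\<bar>n k - t * \<nu> k\<bar> \<le> A ^ u * e" if k: "k \<in> labels M" for k
    proof -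
      define i where "i = nat ((k0 - k) mod int u)"
      have u: "int u > 0" using num_wells_period(1) by simp
      have i: "int i = (k0 - k) mod int u" "i < u" using u by (auto simp: i_def nat_less_iff)
      have "(k0 - int i) mod int u = k" unfolding i(1) using k by (simp add: mod_diff_right_eq labels_eq)
      then have "d k \<le> e * A ^ i" using iter[of i] by simp
      also have "\<dots> \<le> e * A ^ u" using e0 A(1) i(2) by (intro mult_left_mono power_increasing) auto
      finally show ?thesis using d0[OF k] by (simp add: d_def mult.commute)
    qed
    then show "\<exists>t. \<forall>k\<in>labels M. \<bar>n k - t * \<nu> k\<bar> \<le> A ^ u * (\<Sum>j\<in>labels M. \<bar>tilted_pairing r n (well_indicator j)\<bar>)"
      unfolding e_def by blast
  qed
qed

end

section \<open>Masses of the wells under the stationary state of the tilted diffusion\<close>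

locale tilted = resolvent +
  fixes \<mu> :: "real \<Rightarrow> real measure" and wt :: "int \<Rightarrow> real"
  assumes stationary: "\<epsilon> > 0 \<Longrightarrow> (\<forall>x. \<phi> \<epsilon> x > 0) \<Longrightarrow> stationary_state (tilted_gen a b (\<phi> \<epsilon>) \<epsilon>) (\<mu> \<epsilon>)"
    and wt_pos: "k \<in> labels M \<Longrightarrow> wt k > 0" and wt_sum: "(\<Sum>k\<in>labels M. wt k) = 1"
    and first_order: "wells_periodic f \<Longrightarrow> (\<Sum>k\<in>labels M. wt k / hv k * (chain_gen f k - f k * (chain_gen hv k / hv k))) = 0"
begin

definition low :: real where
  "low = (SOME c. c > 0 \<and> (\<forall>\<^sub>F \<epsilon> in at_right 0. \<forall>x. c \<le> \<phi> \<epsilon> x))"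

lemma low: "low > 0" "\<forall>\<^sub>F \<epsilon> in at_right 0. \<forall>x. low \<le> \<phi> \<epsilon> x"
proof -
  have "\<exists>c. c > 0 \<and> (\<forall>\<^sub>F \<epsilon> in at_right 0. \<forall>x. c \<le> \<phi> \<epsilon> x)" using phi_lower_bound by blast
  from someI_ex[OF this] show "low > 0" "\<forall>\<^sub>F \<epsilon> in at_right 0. \<forall>x. low \<le> \<phi> \<epsilon> x" by (auto simp: low_def)
qed

definition good :: "real \<Rightarrow> bool" where "good \<epsilon> \<longleftrightarrow> \<epsilon> > 0 \<and> (\<forall>x. low \<le> \<phi> \<epsilon> x)"

lemma eventually_good: "\<forall>\<^sub>F \<epsilon> in at_right 0. good \<epsilon>"
  using low(2) eventually_at_right_less[of 0] by eventually_elim (simp add: good_def)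

lemma good_pos: "good \<epsilon> \<Longrightarrow> \<phi> \<epsilon> x > 0" using low(1) by (fastforce simp: good_def intro: less_le_trans)

lemma good_stationary: "good \<epsilon> \<Longrightarrow> stationary_state (tilted_gen a b (\<phi> \<epsilon>) \<epsilon>) (\<mu> \<epsilon>)"
  using stationary good_pos by (auto simp: good_def)

lemma good_probs: "good \<epsilon> \<Longrightarrow> \<mu> \<epsilon> \<in> torus_probs"
  using good_stationary by (simp add: stationary_state_def)

text \<open>The division by \<phi> comes from testing stationarity with
  \<open>v / \<phi> \<epsilon>\<close>, see \<open>stationary_identity\<close>.\<close>

definition E :: "real \<Rightarrow> (real \<Rightarrow> real) \<Rightarrow> real" where
  "E \<epsilon> X = (\<integral>x. X x / \<phi> \<epsilon> x \<partial>\<mu> \<epsilon>)"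

lemma cont_div: "good \<epsilon> \<Longrightarrow> continuous_on UNIV X \<Longrightarrow> continuous_on UNIV (\<lambda>x. X x / \<phi> \<epsilon> x)"
  using good_pos[of \<epsilon>] by (intro continuous_intros C2_torusD(7)[OF phi_C2]) (auto simp: good_def less_imp_neq[symmetric])

lemma E_add: "good \<epsilon> \<Longrightarrow> continuous_on UNIV X \<Longrightarrow> continuous_on UNIV Y \<Longrightarrow> E \<epsilon> (\<lambda>x. X x + Y x) = E \<epsilon> X + E \<epsilon> Y"
  unfolding E_def add_divide_distrib
  by (intro Bochner_Integration.integral_add torus_probs_integrable good_probs cont_div)

lemma E_diff: "good \<epsilon> \<Longrightarrow> continuous_on UNIV X \<Longrightarrow> continuous_on UNIV Y \<Longrightarrow> E \<epsilon> (\<lambda>x. X x - Y x) = E \<epsilon> X - E \<epsilon> Y"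
  unfolding E_def diff_divide_distrib
  by (intro Bochner_Integration.integral_diff torus_probs_integrable good_probs cont_div)

lemma E_scale: "E \<epsilon> (\<lambda>x. c * X x) = c * E \<epsilon> X"
  by (simp add: E_def times_divide_eq_right[symmetric] del: times_divide_eq_right)

lemma E_abs_le: "good \<epsilon> \<Longrightarrow> continuous_on UNIV X \<Longrightarrow> continuous_on UNIV Y \<Longrightarrow> (\<And>x. \<bar>X x\<bar> \<le> Y x) \<Longrightarrow> \<bar>E \<epsilon> X\<bar> \<le> E \<epsilon> Y"
  unfolding E_def using good_pos[of \<epsilon>]
  by (intro torus_probs_integral_abs_le good_probs cont_div) (auto simp: abs_divide less_imp_le abs_of_pos intro!: divide_right_mono)

lemma E_const_le: "good \<epsilon> \<Longrightarrow> 0 \<le> c \<Longrightarrow> E \<epsilon> (\<lambda>_. c) \<le> c / low"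
proof -
  assume g: "good \<epsilon>" and c: "0 \<le> c"
  have "E \<epsilon> (\<lambda>_. c) \<le> (\<integral>x. c / low \<partial>\<mu> \<epsilon>)"
    unfolding E_def using g c low(1) good_pos[OF g]
    by (intro torus_probs_integral_le good_probs cont_div) (auto simp: good_def intro!: divide_left_mono mult_pos_pos)
  then show ?thesis by (simp only: torus_probs_integral_const[OF good_probs[OF g]])
qed

lemma E_mix: "good \<epsilon> \<Longrightarrow> E \<epsilon> (mix f) = (\<Sum>k\<in>labels M. f k * E \<epsilon> (\<zeta> k))"
proof -
  assume g: "good \<epsilon>"
  have "E \<epsilon> (mix f) = (\<integral>x. (\<Sum>k\<in>labels M. f k * (\<zeta> k x / \<phi> \<epsilon> x)) \<partial>\<mu> \<epsilon>)"
    by (simp add: E_def mix_def sum_divide_distrib)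
  also have "\<dots> = (\<Sum>k\<in>labels M. \<integral>x. f k * (\<zeta> k x / \<phi> \<epsilon> x) \<partial>\<mu> \<epsilon>)"
    using g cutoff_cont by (intro Bochner_Integration.integral_sum integrable_mult_right torus_probs_integrable good_probs cont_div)
  also have "\<dots> = (\<Sum>k\<in>labels M. f k * E \<epsilon> (\<zeta> k))" by (simp only: E_def integral_mult_right_zero)
  finally show ?thesis .
qed

text \<open>Stationarity is tested with \<open>v / \<phi> \<epsilon>\<close>, and the resolvent
  equation replaces the generator applied to \<phi>. No derivative remains, so uniform information
  on \<open>v\<close> and \<phi> is enough.\<close>

lemma stationary_identity:
  assumes g: "good \<epsilon>" and v: "v \<in> C2_torus"
    and gen: "\<And>x. time_scale a b M \<epsilon> * diffusion_gen a b \<epsilon> v x = F x"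
  shows "E \<epsilon> (\<lambda>x. F x - lam * v x + v x * mix g x / \<phi> \<epsilon> x) = 0"
proof -
  have \<epsilon>: "\<epsilon> > 0" using g by (simp add: good_def)
  note \<phi>C = phi_C2[OF \<epsilon>]
  have "(\<integral>x. tilted_gen a b (\<phi> \<epsilon>) \<epsilon> (\<lambda>x. v x / \<phi> \<epsilon> x) x \<partial>\<mu> \<epsilon>) = 0"
    using good_stationary[OF g] C2_torus_divide(1)[OF v \<phi>C good_pos[OF g]] by (simp add: stationary_state_def)
  then have "(\<integral>x. time_scale a b M \<epsilon> * tilted_gen a b (\<phi> \<epsilon>) \<epsilon> (\<lambda>x. v x / \<phi> \<epsilon> x) x \<partial>\<mu> \<epsilon>) = 0" by simp
  moreover have "time_scale a b M \<epsilon> * tilted_gen a b (\<phi> \<epsilon>) \<epsilon> (\<lambda>x. v x / \<phi> \<epsilon> x) x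
     = (F x - lam * v x + v x * mix g x / \<phi> \<epsilon> x) / \<phi> \<epsilon> x" for x
  proof -
    have "time_scale a b M \<epsilon> * tilted_gen a b (\<phi> \<epsilon>) \<epsilon> (\<lambda>x. v x / \<phi> \<epsilon> x) x
      = (time_scale a b M \<epsilon> * diffusion_gen a b \<epsilon> v x - v x * (time_scale a b M \<epsilon> * diffusion_gen a b \<epsilon> (\<phi> \<epsilon>) x) / \<phi> \<epsilon> x) / \<phi> \<epsilon> x"
      unfolding tilted_gen_divide[OF v \<phi>C good_pos[OF g]] by (simp add: algebra_simps)
    then show ?thesis
      unfolding gen phi_solution[OF \<epsilon>] using good_pos[OF g, of x] by (simp add: field_simps)
  qed
  ultimately show ?thesis by (simp add: E_def)
qed

text \<open>With \<open>v\<close> the small solution for the source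
  \<open>outside - c \<epsilon>\<close>, every other term of \<open>stationary_identity\<close> is
  of the size of \<open>v\<close> or \<open>c \<epsilon>\<close>.\<close>

lemma outside_mass: "((\<lambda>\<epsilon>. E \<epsilon> outside) \<longlongrightarrow> 0) (at_right 0)"
proof -
  obtain U c where c: "(c \<longlongrightarrow> 0) (at_right 0)"
    and U: "\<forall>\<^sub>F \<epsilon> in at_right 0. U \<epsilon> \<in> C2_torus \<and> (\<forall>x. time_scale a b M \<epsilon> * diffusion_gen a b \<epsilon> (U \<epsilon>) x = outside x - c \<epsilon>)"
    and Us: "\<And>\<eta>. \<eta> > 0 \<Longrightarrow> \<forall>\<^sub>F \<epsilon> in at_right 0. \<forall>x. \<bar>U \<epsilon> x\<bar> \<le> \<eta>"
    using outside_solution by blast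
  show ?thesis
  proof (rule tendsto_zero_linear_bound[where K = "(1 + lam + Cg / low) / low"])
    fix \<eta> :: real assume \<eta>: "\<eta> > 0"
    have "\<forall>\<^sub>F \<epsilon> in at_right 0. \<bar>c \<epsilon>\<bar> < \<eta>" using order_tendstoD(2)[OF tendsto_rabs_zero[OF c] \<eta>] .
    then show "\<forall>\<^sub>F \<epsilon> in at_right 0. \<bar>E \<epsilon> outside\<bar> \<le> (1 + lam + Cg / low) / low * \<eta>"
      using U Us[OF \<eta>] eventually_good
    proof eventually_elim
      case (elim \<epsilon>)
      have UC: "U \<epsilon> \<in> C2_torus" using elim by blast
      let ?X = "\<lambda>x. c \<epsilon> + lam * U \<epsilon> x - U \<epsilon> x * mix g x / \<phi> \<epsilon> x"
      have cX: "continuous_on UNIV ?X"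
        by (intro continuous_intros cont_div elim C2_torusD(7)[OF UC] mix_cont)
      have "E \<epsilon> (\<lambda>x. outside x - ?X x) = 0"
        using stationary_identity[OF elim(4) UC, of "\<lambda>x. outside x - c \<epsilon>"] elim by (simp add: algebra_simps)
      then have eq: "E \<epsilon> outside = E \<epsilon> ?X" using E_diff[OF elim(4) outside_cont cX] by simp
      have "\<bar>?X x\<bar> \<le> (1 + lam + Cg / low) * \<eta>" for x
      proof -
        have U': "\<bar>U \<epsilon> x\<bar> \<le> \<eta>" using elim by blast
        have "\<bar>lam * U \<epsilon> x\<bar> \<le> lam * \<eta>" using U' lam_pos by (simp add: abs_mult)
        moreover have "\<bar>U \<epsilon> x * mix g x / \<phi> \<epsilon> x\<bar> \<le> \<eta> * Cg / low"
          using U' mix_g_le[of x] low(1) elim(4) good_pos[OF elim(4), of x] \<eta> Cg_nonneg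
          by (auto simp: abs_mult abs_divide good_def intro!: frac_le mult_mono)
        moreover have "(1 + lam + Cg / low) * \<eta> = \<eta> + lam * \<eta> + \<eta> * Cg / low" by (simp add: algebra_simps)
        ultimately show ?thesis using elim(1) by linarith
      qed
      from E_abs_le[OF elim(4) cX continuous_on_const this]
      have "\<bar>E \<epsilon> ?X\<bar> \<le> E \<epsilon> (\<lambda>_. (1 + lam + Cg / low) * \<eta>)" .
      also have "\<dots> \<le> ((1 + lam + Cg / low) * \<eta>) / low"
        using lam_pos Cg_nonneg low(1) \<eta> by (intro E_const_le elim) simp
      finally show ?case unfolding eq by simp
    qed
  qed
qed

lemma outside_mass_less: "\<eta> > 0 \<Longrightarrow> \<forall>\<^sub>F \<epsilon> in at_right 0. E \<epsilon> outside < \<eta>"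
  using order_tendstoD(2)[OF outside_mass] .

abbreviation "n \<epsilon> k \<equiv> E \<epsilon> (\<zeta> k)"

lemma n_nonneg: "good \<epsilon> \<Longrightarrow> k \<in> labels M \<Longrightarrow> 0 \<le> n \<epsilon> k"
  unfolding E_def using good_pos[of \<epsilon>] cutoff_bounds(1) by (intro integral_nonneg_AE AE_I2) (simp add: less_imp_le)

lemma phi_minus_mix_bound:
  assumes \<eta>: "\<eta> > 0"
  shows "\<forall>\<^sub>F \<epsilon> in at_right 0. \<bar>E \<epsilon> (\<lambda>x. \<phi> \<epsilon> x - mix hv x)\<bar> \<le> (1 / low + Cg / lam) * \<eta>"
  using phi_limit[OF \<eta>] outside_mass_less[OF \<eta>] eventually_good
proof eventually_elim
  case (elim \<epsilon>)
  have \<epsilon>: "\<epsilon> > 0" using elim by (simp add: good_def)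
  have le: "\<bar>\<phi> \<epsilon> x - mix hv x\<bar> \<le> \<eta> + Cg / lam * outside x" for x
    using elim(1) \<eta> by (intro mix_approx C2_torusD(1)[OF phi_C2[OF \<epsilon>]]) (auto simp: phi_le[OF \<epsilon>])
  have "\<bar>E \<epsilon> (\<lambda>x. \<phi> \<epsilon> x - mix hv x)\<bar> \<le> E \<epsilon> (\<lambda>x. \<eta> + Cg / lam * outside x)"
    using le by (intro E_abs_le elim continuous_intros mix_cont outside_cont C2_torusD(7)[OF phi_C2[OF \<epsilon>]])
  also have "\<dots> = E \<epsilon> (\<lambda>_. \<eta>) + Cg / lam * E \<epsilon> outside"
    by (subst E_add[OF elim(3)]) (auto intro!: continuous_intros outside_cont simp: E_scale simp del: times_divide_eq_left)
  also have "\<dots> \<le> \<eta> / low + Cg / lam * \<eta>"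
    using elim \<eta> Cg_nonneg lam_pos by (intro add_mono E_const_le mult_left_mono) auto
  finally show ?case by (simp add: algebra_simps)
qed

lemma E_phi_minus_mix: "((\<lambda>\<epsilon>. E \<epsilon> (\<lambda>x. \<phi> \<epsilon> x - mix hv x)) \<longlongrightarrow> 0) (at_right 0)"
  by (rule tendsto_zero_linear_bound[OF phi_minus_mix_bound])

lemma E_phi: "good \<epsilon> \<Longrightarrow> E \<epsilon> (\<phi> \<epsilon>) = 1"
proof -
  assume g: "good \<epsilon>"
  have "E \<epsilon> (\<phi> \<epsilon>) = (\<integral>x. 1 \<partial>\<mu> \<epsilon>)"
    unfolding E_def using good_pos[OF g] by (intro Bochner_Integration.integral_cong) (auto simp: less_imp_neq[symmetric])
  then show ?thesis using torus_probs_integral_const[OF good_probs[OF g], of 1] by simp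
qed

lemma E_phi_diff: "good \<epsilon> \<Longrightarrow> E \<epsilon> (\<lambda>x. \<phi> \<epsilon> x - mix hv x) = 1 - (\<Sum>k\<in>labels M. hv k * n \<epsilon> k)"
  using E_diff[of \<epsilon> "\<phi> \<epsilon>" "mix hv"] E_phi E_mix mix_cont C2_torusD(7)[OF phi_C2] by (simp add: good_def)

text \<open>The normalization of the measure, \<open>E \<epsilon> (\<phi> \<epsilon>) = 1\<close>,
  read on the wells; it fixes the scaling that stationarity leaves open.\<close>

lemma total_mass: "((\<lambda>\<epsilon>. \<Sum>k\<in>labels M. hv k * n \<epsilon> k) \<longlongrightarrow> 1) (at_right 0)"
proof -
  have "((\<lambda>\<epsilon>. 1 - E \<epsilon> (\<lambda>x. \<phi> \<epsilon> x - mix hv x)) \<longlongrightarrow> 1 - 0) (at_right 0)"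
    by (intro tendsto_diff tendsto_const E_phi_minus_mix)
  then have "((\<lambda>\<epsilon>. 1 - E \<epsilon> (\<lambda>x. \<phi> \<epsilon> x - mix hv x)) \<longlongrightarrow> 1) (at_right 0)" by simp
  then show ?thesis
    by (rule Lim_transform_eventually) (use eventually_good in eventually_elim, simp add: E_phi_diff)
qed

definition r :: "int \<Rightarrow> real" where "r k = chain_gen hv k / hv k"

lemma quotient_close:
  assumes "\<bar>U - f\<bar> \<le> \<eta>" "\<bar>P - h0\<bar> \<le> \<eta>" "low \<le> P" "0 < h0"
  shows "\<bar>U / P - f / h0\<bar> \<le> (h0 + \<bar>f\<bar>) / (low * h0) * \<eta>"
proof -
  have P: "P > 0" "P \<noteq> 0" using assms(3) low(1) by auto
  have eq: "U / P - f / h0 = ((U - f) * h0 + f * (h0 - P)) / (P * h0)" using P assms(4) by (simp add: field_simps)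
  have "\<bar>(U - f) * h0 + f * (h0 - P)\<bar> \<le> \<bar>(U - f) * h0\<bar> + \<bar>f * (h0 - P)\<bar>" by (rule abs_triangle_ineq)
  also have "\<dots> \<le> \<eta> * h0 + \<bar>f\<bar> * \<eta>"
    unfolding abs_mult using assms by (intro add_mono mult_mono) (auto simp: abs_minus_commute)
  finally have "\<bar>(U - f) * h0 + f * (h0 - P)\<bar> \<le> \<eta> * h0 + \<bar>f\<bar> * \<eta>" .
  moreover have "low * h0 \<le> P * h0" "0 < low * h0" using assms(3,4) low(1) by auto
  ultimately have "\<bar>(U - f) * h0 + f * (h0 - P)\<bar> / (P * h0) \<le> (\<eta> * h0 + \<bar>f\<bar> * \<eta>) / (low * h0)"
    by (intro frac_le) auto
  moreover have "\<bar>U / P - f / h0\<bar> = \<bar>(U - f) * h0 + f * (h0 - P)\<bar> / (P * h0)"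
    unfolding eq using P(1) assms(4) by (simp add: abs_divide abs_mult)
  ultimately show ?thesis by (simp add: algebra_simps)
qed

text \<open>\<open>stationary_identity\<close> for the function of \<open>test_function\<close> is
  the discrete pairing up to errors that are small on the wells and bounded by
  \<open>outside\<close> elsewhere.\<close>

lemma pairing_limit:
  assumes f: "wells_periodic f"
  shows "((\<lambda>\<epsilon>. tilted_pairing r (n \<epsilon>) f) \<longlongrightarrow> 0) (at_right 0)"
proof -
  obtain U c C where c: "(c \<longlongrightarrow> 0) (at_right 0)"
    and U: "\<forall>\<^sub>F \<epsilon> in at_right 0. U \<epsilon> \<in> C2_torus \<and> (\<forall>x. time_scale a b M \<epsilon> * diffusion_gen a b \<epsilon> (U \<epsilon>) x = mix (chain_gen f) x - c \<epsilon>)"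
    and UC: "\<forall>\<^sub>F \<epsilon> in at_right 0. \<forall>x. \<bar>U \<epsilon> x\<bar> \<le> C"
    and Us: "\<And>\<eta>. \<eta> > 0 \<Longrightarrow> \<forall>\<^sub>F \<epsilon> in at_right 0. \<forall>k\<in>labels M. \<forall>x\<in>{p k..q k}. \<bar>U \<epsilon> x - f k\<bar> \<le> \<eta>"
    using test_function[OF f] by blast
  define K1 where "K1 = (\<Sum>k\<in>labels M. (hv k + \<bar>f k\<bar>) / (low * hv k))"
  have K1t: "0 \<le> (hv k + \<bar>f k\<bar>) / (low * hv k)" for k using h_pos[of k] low(1) by simp
  have K1: "0 \<le> K1" "k \<in> labels M \<Longrightarrow> (hv k + \<bar>f k\<bar>) / (low * hv k) \<le> K1" for k
    unfolding K1_def using K1t finite_labels by (auto intro!: sum_nonneg member_le_sum)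
  let ?s = "\<lambda>k. chain_gen f k - f k * r k"
  show ?thesis
  proof (rule tendsto_zero_linear_bound[where K = "(1 + lam + Cg * K1) / low + lam * \<bar>C\<bar>"])
    fix \<eta> :: real assume \<eta>: "\<eta> > 0"
    have "\<forall>\<^sub>F \<epsilon> in at_right 0. \<bar>c \<epsilon>\<bar> < \<eta>" using order_tendstoD(2)[OF tendsto_rabs_zero[OF c] \<eta>] .
    then show "\<forall>\<^sub>F \<epsilon> in at_right 0. \<bar>tilted_pairing r (n \<epsilon>) f\<bar> \<le> ((1 + lam + Cg * K1) / low + lam * \<bar>C\<bar>) * \<eta>"
      using U UC Us[OF \<eta>] phi_limit[OF \<eta>] outside_mass_less[OF \<eta>] eventually_good
    proof eventually_elim
      case (elim \<epsilon>)
      have \<epsilon>: "\<epsilon> > 0" using elim by (simp add: good_def)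
      have UC2: "U \<epsilon> \<in> C2_torus" using elim by blast
      have C0: "\<bar>U \<epsilon> x\<bar> \<le> \<bar>C\<bar>" for x using elim(3) by (meson abs_ge_self order_trans)
      \<comment> \<open>The total error: the constant of the Poisson equation, the replacement of
        \<open>U\<close> by \<open>f\<close>, and the replacement of \<open>U / \<phi>\<close> by
        \<open>f / hv\<close> in the source term.\<close>
      let ?X = "\<lambda>x. c \<epsilon> + lam * (U \<epsilon> x - mix f x) - (U \<epsilon> x * mix g x / \<phi> \<epsilon> x - mix (\<lambda>k. f k * g k / hv k) x)"
      have cX: "continuous_on UNIV ?X"
        by (intro continuous_intros cont_div elim C2_torusD(7)[OF UC2] mix_cont)
      \<comment> \<open>Since \<open>g = lam * hv - chain_gen hv\<close>, the terms with
        \<open>lam\<close> cancel and leave \<open>- f * r\<close>.\<close>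
      have s: "mix ?s x = mix (chain_gen f) x - lam * mix f x + mix (\<lambda>k. f k * g k / hv k) x" for x
      proof -
        have "?s k = chain_gen f k - lam * f k + f k * g k / hv k" for k
          using h_pos[of k] by (simp add: g_def r_def field_simps)
        then have "?s k * \<zeta> k x = chain_gen f k * \<zeta> k x - lam * (f k * \<zeta> k x) + f k * g k / hv k * \<zeta> k x" for k
          by (simp only: distrib_right left_diff_distrib mult.assoc)
        then show ?thesis
          by (simp only: mix_def sum_subtractf sum.distrib sum_distrib_left)
      qed
      have "E \<epsilon> (\<lambda>x. mix ?s x - ?X x) = E \<epsilon> (\<lambda>x. (mix (chain_gen f) x - c \<epsilon>) - lam * U \<epsilon> x + U \<epsilon> x * mix g x / \<phi> \<epsilon> x)"
        unfolding s by (simp add: algebra_simps)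
      also have "\<dots> = 0" using elim by (intro stationary_identity) auto
      finally have "E \<epsilon> (mix ?s) = E \<epsilon> ?X" using E_diff[OF elim(7) mix_cont cX] by simp
      moreover have "E \<epsilon> (mix ?s) = tilted_pairing r (n \<epsilon>) f"
        using E_mix[OF elim(7)] by (simp add: tilted_pairing_def mult.commute)
      ultimately have eq: "tilted_pairing r (n \<epsilon>) f = E \<epsilon> ?X" by simp
      have le: "\<bar>?X x\<bar> \<le> (1 + lam + Cg * K1) * \<eta> + lam * \<bar>C\<bar> * outside x" for x
      proof -
        have "\<bar>U \<epsilon> x - mix f x\<bar> \<le> \<eta> + \<bar>C\<bar> * outside x"
          using elim(4) \<eta> C0 by (intro mix_approx C2_torusD(1)[OF UC2]) auto
        then have 1: "\<bar>lam * (U \<epsilon> x - mix f x)\<bar> \<le> lam * (\<eta> + \<bar>C\<bar> * outside x)" using lam_pos by (simp add: abs_mult)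
        have 2: "\<bar>U \<epsilon> x * mix g x / \<phi> \<epsilon> x - mix (\<lambda>k. f k * g k / hv k) x\<bar> \<le> Cg * K1 * \<eta>"
        proof (cases "\<exists>k\<in>labels M. \<zeta> k x \<noteq> 0")
          case True
          then obtain k where k: "k \<in> labels M" "\<zeta> k x \<noteq> 0" by blast
          obtain i :: int where i: "x + of_int i \<in> {p k..q k}" using cutoff_support[OF k] by blast
          have "\<bar>U \<epsilon> (x + of_int i) - f k\<bar> \<le> \<eta>" "\<bar>\<phi> \<epsilon> (x + of_int i) - hv k\<bar> \<le> \<eta>"
            using bspec[OF bspec[OF elim(4) k(1)] i] bspec[OF bspec[OF elim(5) k(1)] i] .
          then have "\<bar>U \<epsilon> x - f k\<bar> \<le> \<eta>" "\<bar>\<phi> \<epsilon> x - hv k\<bar> \<le> \<eta>"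
            by (simp_all only: periodic1_shift[OF C2_torusD(1)[OF UC2]] periodic1_shift[OF C2_torusD(1)[OF phi_C2[OF \<epsilon>]]])
          then have "\<bar>U \<epsilon> x / \<phi> \<epsilon> x - f k / hv k\<bar> \<le> (hv k + \<bar>f k\<bar>) / (low * hv k) * \<eta>"
            using elim(7) h_pos by (intro quotient_close) (auto simp: good_def)
          also have "\<dots> \<le> K1 * \<eta>" using K1(2)[OF k(1)] \<eta> by (intro mult_right_mono) auto
          finally have q: "\<bar>U \<epsilon> x / \<phi> \<epsilon> x - f k / hv k\<bar> \<le> K1 * \<eta>" .
          have "\<bar>g k\<bar> * \<zeta> k x \<le> Cg * 1"
            using g_le[OF k(1)] cutoff_bounds[OF k(1), of x] Cg_nonneg by (intro mult_mono) auto
          then have "(\<bar>g k\<bar> * \<zeta> k x) * \<bar>U \<epsilon> x / \<phi> \<epsilon> x - f k / hv k\<bar> \<le> (Cg * 1) * (K1 * \<eta>)"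
            by (rule mult_mono) (use q Cg_nonneg in auto)
          moreover have "U \<epsilon> x * mix g x / \<phi> \<epsilon> x - mix (\<lambda>k. f k * g k / hv k) x = (g k * \<zeta> k x) * (U \<epsilon> x / \<phi> \<epsilon> x - f k / hv k)"
            using mix_eq[OF k, of g] mix_eq[OF k, of "\<lambda>k. f k * g k / hv k"] by (simp add: right_diff_distrib mult_ac)
          ultimately show ?thesis using cutoff_bounds[OF k(1), of x] by (simp add: abs_mult)
        next
          case False
          then show ?thesis using mix_zero[of x] Cg_nonneg K1(1) \<eta> by simp
        qed
        have "\<bar>?X x\<bar> \<le> \<bar>c \<epsilon>\<bar> + \<bar>lam * (U \<epsilon> x - mix f x)\<bar> + \<bar>U \<epsilon> x * mix g x / \<phi> \<epsilon> x - mix (\<lambda>k. f k * g k / hv k) x\<bar>" by linarith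
        also have "\<dots> \<le> \<eta> + lam * (\<eta> + \<bar>C\<bar> * outside x) + Cg * K1 * \<eta>" using 1 2 elim(1) by linarith
        also have "\<dots> = (1 + lam + Cg * K1) * \<eta> + lam * \<bar>C\<bar> * outside x" by (simp add: algebra_simps)
        finally show ?thesis .
      qed
      have "\<bar>E \<epsilon> ?X\<bar> \<le> E \<epsilon> (\<lambda>x. (1 + lam + Cg * K1) * \<eta> + lam * \<bar>C\<bar> * outside x)"
        using le by (intro E_abs_le elim cX continuous_intros outside_cont)
      also have "\<dots> = E \<epsilon> (\<lambda>x. (1 + lam + Cg * K1) * \<eta>) + lam * \<bar>C\<bar> * E \<epsilon> outside"
        by (subst E_add[OF elim(7)]) (auto intro!: continuous_intros outside_cont simp only: E_scale)
      also have "\<dots> \<le> ((1 + lam + Cg * K1) * \<eta>) / low + lam * \<bar>C\<bar> * \<eta>"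
        using elim(6) \<eta> Cg_nonneg K1(1) lam_pos by (intro add_mono E_const_le elim mult_left_mono) auto
      finally show ?case unfolding eq by (simp add: algebra_simps)
    qed
  qed
qed

definition \<nu> :: "int \<Rightarrow> real" where "\<nu> k = wt k / hv k"

text \<open>Small pairings put the masses near a multiple \<open>t\<close> of \<nu>, where
  \<open>t\<close> may depend on \<epsilon>; \<open>total_mass\<close> then forces \<open>t\<close>
  to approach 1.\<close>

lemma n_limit: assumes k: "k \<in> labels M" shows "((\<lambda>\<epsilon>. n \<epsilon> k) \<longlongrightarrow> \<nu> k) (at_right 0)"
proof -
  have \<nu>_pos: "\<nu> k > 0" if "k \<in> labels M" for k using wt_pos[OF that] h_pos by (simp add: \<nu>_def)
  have st: "tilted_pairing r \<nu> (well_indicator j) = 0" for j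
    using first_order[OF well_indicator_periodic] by (simp add: tilted_pairing_def \<nu>_def r_def)
  obtain C where C: "C \<ge> 0" "\<And>n. (\<And>k. k \<in> labels M \<Longrightarrow> 0 \<le> n k) \<Longrightarrow>
     \<exists>t. \<forall>k\<in>labels M. \<bar>n k - t * \<nu> k\<bar> \<le> C * (\<Sum>j\<in>labels M. \<bar>tilted_pairing r n (well_indicator j)\<bar>)"
    using stationary_weights_unique[OF \<nu>_pos st] by metis
  define e where "e \<epsilon> = C * (\<Sum>j\<in>labels M. \<bar>tilted_pairing r (n \<epsilon>) (well_indicator j)\<bar>)" for \<epsilon>
  have "(e \<longlongrightarrow> C * (\<Sum>j\<in>labels M. 0)) (at_right 0)"
    unfolding e_def[abs_def]
    by (intro tendsto_mult tendsto_const tendsto_sum tendsto_rabs_zero pairing_limit well_indicator_periodic)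
  then have e0: "(e \<longlongrightarrow> 0) (at_right 0)" by simp
  define s where "s = (\<Sum>k\<in>labels M. hv k)"
  define m where "m \<epsilon> = (\<Sum>k\<in>labels M. hv k * n \<epsilon> k)" for \<epsilon>
  have \<nu>_sum: "(\<Sum>k\<in>labels M. hv k * \<nu> k) = 1"
  proof -
    have "hv k * \<nu> k = wt k" for k using h_pos[of k] by (simp add: \<nu>_def)
    then show ?thesis using wt_sum by simp
  qed
  have "((\<lambda>\<epsilon>. n \<epsilon> k - \<nu> k) \<longlongrightarrow> 0) (at_right 0)"
  proof (rule Lim_null_comparison)
    have "((\<lambda>\<epsilon>. e \<epsilon> + (e \<epsilon> * s + \<bar>m \<epsilon> - 1\<bar>) * \<nu> k) \<longlongrightarrow> 0 + (0 * s + 0) * \<nu> k) (at_right 0)"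
      unfolding m_def[abs_def] by (intro tendsto_add tendsto_mult tendsto_const e0 tendsto_rabs_zero LIM_zero total_mass)
    then show "((\<lambda>\<epsilon>. e \<epsilon> + (e \<epsilon> * s + \<bar>m \<epsilon> - 1\<bar>) * \<nu> k) \<longlongrightarrow> 0) (at_right 0)" by simp
    show "\<forall>\<^sub>F \<epsilon> in at_right 0. norm (n \<epsilon> k - \<nu> k) \<le> e \<epsilon> + (e \<epsilon> * s + \<bar>m \<epsilon> - 1\<bar>) * \<nu> k"
      using eventually_good
    proof eventually_elim
      case (elim \<epsilon>)
      obtain t where t: "\<And>k. k \<in> labels M \<Longrightarrow> \<bar>n \<epsilon> k - t * \<nu> k\<bar> \<le> e \<epsilon>"
        using C(2)[of "n \<epsilon>"] n_nonneg[OF elim] unfolding e_def by blast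
      have "t - m \<epsilon> = (\<Sum>k\<in>labels M. hv k * (t * \<nu> k - n \<epsilon> k))"
        unfolding m_def using \<nu>_sum
        by (simp add: right_diff_distrib sum_subtractf mult.left_commute[of _ t] sum_distrib_left[symmetric])
      then have "\<bar>t - m \<epsilon>\<bar> \<le> (\<Sum>k\<in>labels M. \<bar>hv k * (t * \<nu> k - n \<epsilon> k)\<bar>)" by (simp add: sum_abs)
      also have "\<dots> \<le> (\<Sum>k\<in>labels M. hv k * e \<epsilon>)"
        using t h_pos by (intro sum_mono) (simp add: abs_mult abs_minus_commute less_imp_le)
      finally have "\<bar>t - m \<epsilon>\<bar> \<le> e \<epsilon> * s" by (simp add: s_def sum_distrib_left mult.commute)
      then have "\<bar>t - 1\<bar> \<le> e \<epsilon> * s + \<bar>m \<epsilon> - 1\<bar>" by linarith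
      then have "\<bar>t - 1\<bar> * \<nu> k \<le> (e \<epsilon> * s + \<bar>m \<epsilon> - 1\<bar>) * \<nu> k" using \<nu>_pos[OF k] by (intro mult_right_mono) auto
      moreover have "\<bar>n \<epsilon> k - \<nu> k\<bar> \<le> \<bar>n \<epsilon> k - t * \<nu> k\<bar> + \<bar>(t - 1) * \<nu> k\<bar>" by (simp add: algebra_simps)
      moreover have "\<bar>(t - 1) * \<nu> k\<bar> = \<bar>t - 1\<bar> * \<nu> k" using \<nu>_pos[OF k] by (simp add: abs_mult)
      ultimately show ?case using t[OF k] by simp
    qed
  qed
  then show ?thesis by (rule LIM_zero_cancel)
qed

text \<open>\<open>g\<close> contains \<open>lam * hv\<close>, which cancels against
  \<open>lam * \<phi>\<close> up to the vanishing expectation of \<open>\<phi> - mix hv\<close>;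
  what remains is the value of the chain functional.\<close>

lemma source_limit:
  "((\<lambda>\<epsilon>. E \<epsilon> (\<lambda>x. mix g x - lam * \<phi> \<epsilon> x)) \<longlongrightarrow> - (\<Sum>k\<in>labels M. wt k * chain_gen hv k / hv k)) (at_right 0)"
proof -
  have "((\<lambda>\<epsilon>. (\<Sum>k\<in>labels M. - chain_gen hv k * n \<epsilon> k) - lam * E \<epsilon> (\<lambda>x. \<phi> \<epsilon> x - mix hv x))
    \<longlongrightarrow> (\<Sum>k\<in>labels M. - chain_gen hv k * \<nu> k) - lam * 0) (at_right 0)"
    by (intro tendsto_diff tendsto_sum tendsto_mult tendsto_const n_limit E_phi_minus_mix)
  then have "((\<lambda>\<epsilon>. (\<Sum>k\<in>labels M. - chain_gen hv k * n \<epsilon> k) - lam * E \<epsilon> (\<lambda>x. \<phi> \<epsilon> x - mix hv x))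
    \<longlongrightarrow> - (\<Sum>k\<in>labels M. wt k * chain_gen hv k / hv k)) (at_right 0)"
    by (simp add: \<nu>_def sum_negf mult.commute)
  then show ?thesis
  proof (rule Lim_transform_eventually)
    show "\<forall>\<^sub>F \<epsilon> in at_right 0. (\<Sum>k\<in>labels M. - chain_gen hv k * n \<epsilon> k) - lam * E \<epsilon> (\<lambda>x. \<phi> \<epsilon> x - mix hv x)
       = E \<epsilon> (\<lambda>x. mix g x - lam * \<phi> \<epsilon> x)"
      using eventually_good
    proof eventually_elim
      case (elim \<epsilon>)
      have \<phi>c: "continuous_on UNIV (\<phi> \<epsilon>)" using elim C2_torusD(7)[OF phi_C2] by (simp add: good_def)
      have "E \<epsilon> (\<lambda>x. mix g x - lam * \<phi> \<epsilon> x) = E \<epsilon> (mix g) - lam * E \<epsilon> (\<phi> \<epsilon>)"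
        by (subst E_diff[OF elim]) (auto intro!: continuous_intros mix_cont \<phi>c simp: E_scale)
      also have "E \<epsilon> (mix g) = lam * (\<Sum>k\<in>labels M. hv k * n \<epsilon> k) + (\<Sum>k\<in>labels M. - chain_gen hv k * n \<epsilon> k)"
        unfolding E_mix[OF elim] g_def by (simp add: sum_distrib_left sum.distrib[symmetric] algebra_simps)
      finally show ?case unfolding E_phi_diff[OF elim] E_phi[OF elim] by (simp add: algebra_simps)
    qed
  qed
qed

lemma rate_le: "good \<epsilon> \<Longrightarrow> ereal (time_scale a b M \<epsilon>) * rate_functional a b \<epsilon> (\<mu> \<epsilon>) \<le> ereal (E \<epsilon> (\<lambda>x. mix g x - lam * \<phi> \<epsilon> x))"
proof -
  assume g: "good \<epsilon>"
  then have \<epsilon>: "\<epsilon> > 0" by (simp add: good_def)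
  have "rate_functional a b \<epsilon> (\<mu> \<epsilon>) \<le> ereal (- (\<integral>x. diffusion_gen a b \<epsilon> (\<phi> \<epsilon>) x / \<phi> \<epsilon> x \<partial>\<mu> \<epsilon>))"
    by (rule rate_functional_le[OF a_D(7) less_imp_le[OF a_pos] b_D(7) phi_C2[OF \<epsilon>] good_pos[OF g] \<epsilon> good_stationary[OF g]])
  then have "ereal (time_scale a b M \<epsilon>) * rate_functional a b \<epsilon> (\<mu> \<epsilon>)
     \<le> ereal (time_scale a b M \<epsilon>) * ereal (- (\<integral>x. diffusion_gen a b \<epsilon> (\<phi> \<epsilon>) x / \<phi> \<epsilon> x \<partial>\<mu> \<epsilon>))"
    using time_scale_pos[of \<epsilon>] by (intro ereal_mult_left_mono) auto
  also have "\<dots> = ereal (- (\<integral>x. (time_scale a b M \<epsilon> * diffusion_gen a b \<epsilon> (\<phi> \<epsilon>) x) / \<phi> \<epsilon> x \<partial>\<mu> \<epsilon>))"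
    by (simp add: times_divide_eq_right[symmetric] del: times_divide_eq_right)
  also have "\<dots> = ereal (E \<epsilon> (\<lambda>x. mix g x - lam * \<phi> \<epsilon> x))"
    unfolding phi_solution[OF \<epsilon>] E_def integral_minus[symmetric] by (simp only: minus_divide_left minus_diff_eq)
  finally show ?thesis .
qed

lemma limsup_rate:
  "Limsup (at_right 0) (\<lambda>\<epsilon>. ereal (time_scale a b M \<epsilon>) * rate_functional a b \<epsilon> (\<mu> \<epsilon>))
    \<le> ereal (- (\<Sum>k\<in>labels M. wt k * chain_gen hv k / hv k))"
proof -
  have "Limsup (at_right 0) (\<lambda>\<epsilon>. ereal (time_scale a b M \<epsilon>) * rate_functional a b \<epsilon> (\<mu> \<epsilon>))
    \<le> Limsup (at_right 0) (\<lambda>\<epsilon>. ereal (E \<epsilon> (\<lambda>x. mix g x - lam * \<phi> \<epsilon> x)))"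
    by (rule Limsup_mono) (use eventually_good rate_le in \<open>auto elim: eventually_mono\<close>)
  also have "\<dots> = ereal (- (\<Sum>k\<in>labels M. wt k * chain_gen hv k / hv k))"
    by (rule lim_imp_Limsup) (simp, intro tendsto_intros source_limit)
  finally show ?thesis .
qed

end

section \<open>Recovering the weights from the limiting measure, and optimality in the chain
  functional\<close>

lemma sets_mixture: "sets (mixture I w \<nu>) = sets torus_borel"
  by (simp add: mixture_def)

lemma emeasure_mixture:
  assumes "finite I" "\<And>i. i \<in> I \<Longrightarrow> sets (\<nu> i) = sets torus_borel" "A \<in> sets torus_borel"
  shows "emeasure (mixture I w \<nu>) A = (\<Sum>i\<in>I. ennreal (w i) * emeasure (\<nu> i) A)"
proof (rule emeasure_measure_of[OF mixture_def])
  show "sets torus_borel \<subseteq> Pow (space torus_borel)" by (rule sets.space_closed)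
  show "A \<in> sets (mixture I w \<nu>)" using assms(3) by (simp add: sets_mixture)
  show "positive (sets (mixture I w \<nu>)) (\<lambda>E. \<Sum>i\<in>I. ennreal (w i) * emeasure (\<nu> i) E)"
    by (simp add: positive_def)
  show "countably_additive (sets (mixture I w \<nu>)) (\<lambda>E. \<Sum>i\<in>I. ennreal (w i) * emeasure (\<nu> i) E)"
  proof (rule countably_additiveI)
    fix F :: "nat \<Rightarrow> real set"
    assume F: "range F \<subseteq> sets (mixture I w \<nu>)" "disjoint_family F"
    have "(\<Sum>n. \<Sum>i\<in>I. ennreal (w i) * emeasure (\<nu> i) (F n)) = (\<Sum>i\<in>I. \<Sum>n. ennreal (w i) * emeasure (\<nu> i) (F n))"
      by (rule suminf_sum) simp
    also have "\<dots> = (\<Sum>i\<in>I. ennreal (w i) * emeasure (\<nu> i) (\<Union> (range F)))"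
      using F assms(2) by (intro sum.cong) (auto simp: ennreal_suminf_cmult suminf_emeasure sets_mixture)
    finally show "(\<Sum>n. \<Sum>i\<in>I. ennreal (w i) * emeasure (\<nu> i) (F n)) = (\<Sum>i\<in>I. ennreal (w i) * emeasure (\<nu> i) (\<Union> (range F)))" .
  qed
qed

lemma finite_sets_torus_borel: "finite A \<Longrightarrow> A \<subseteq> {0..<1} \<Longrightarrow> A \<in> sets torus_borel"
  unfolding torus_borel_def by (subst sets_restrict_space_iff) (auto intro: borel_closed finite_imp_closed)

context level_family
begin

lemma proj_sets: "proj M k \<in> sets torus_borel"
  unfolding proj_def using M_finite by (intro finite_sets_torus_borel) (auto simp: frac_lt_1)

lemma emeasure_well_measure:
  assumes k: "k \<in> labels M" and j: "j \<in> labels M"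
  shows "emeasure (well_measure a b M k) (proj M j) = (if k = j then 1 else 0)"
proof -
  have "emeasure (well_measure a b M k) (proj M j) =
     (\<Sum>x\<in>M k. ennreal (minimum_weight a b x / well_weight a b M k) * emeasure (return torus_borel (frac x)) (proj M j))"
    unfolding well_measure_def by (rule emeasure_mixture[OF M_finite _ proj_sets]) simp
  also have "\<dots> = (\<Sum>x\<in>M k. ennreal (minimum_weight a b x / well_weight a b M k) * (if k = j then 1 else 0))"
  proof (rule sum.cong[OF refl])
    fix x assume x: "x \<in> M k"
    have "frac x \<in> proj M j \<longleftrightarrow> k = j"
    proof
      assume "frac x \<in> proj M j"
      then obtain y where "y \<in> M j" "frac x = frac y" by (auto simp: proj_def)
      then have "k mod int u = j mod int u" using M_frac_eq[OF x] by blast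
      then show "k = j" using k j by (simp add: labels_eq)
    qed (use x in \<open>auto simp: proj_def\<close>)
    then show "ennreal (minimum_weight a b x / well_weight a b M k) * emeasure (return torus_borel (frac x)) (proj M j) =
      ennreal (minimum_weight a b x / well_weight a b M k) * (if k = j then 1 else 0)"
      using proj_sets by (simp add: indicator_def)
  qed
  also have "\<dots> = (if k = j then 1 else 0)"
  proof -
    have "(\<Sum>x\<in>M k. ennreal (minimum_weight a b x / well_weight a b M k)) = ennreal (\<Sum>x\<in>M k. minimum_weight a b x / well_weight a b M k)"
      using minimum_weight_pos well_weight_pos[of k] by (intro sum_ennreal) (simp add: less_imp_le)
    also have "(\<Sum>x\<in>M k. minimum_weight a b x / well_weight a b M k) = 1"
      using well_weight_pos[of k] by (simp add: sum_divide_distrib[symmetric] well_weight_def)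
    finally show ?thesis by (cases "k = j") simp_all
  qed
  finally show ?thesis .
qed

text \<open>The projected wells are disjoint for different labels, so evaluating the mixture on them
  returns the weights. Thus the weights are unique, and the definite description in
  \<open>level_rate\<close> denotes them.\<close>

lemma emeasure_state_mixture:
  assumes j: "j \<in> labels M"
  shows "emeasure (state_mixture a b M \<omega>) (proj M j) = ennreal (pmf \<omega> (proj M j))"
proof -
  have fin: "finite (labels M)" by (simp add: labels_eq)
  have "emeasure (state_mixture a b M \<omega>) (proj M j) = (\<Sum>k\<in>labels M. ennreal (pmf \<omega> (proj M k)) * emeasure (well_measure a b M k) (proj M j))"
    unfolding state_mixture_def by (rule emeasure_mixture[OF fin _ proj_sets]) (simp add: well_measure_def sets_mixture)
  also have "\<dots> = (\<Sum>k\<in>labels M. if k = j then ennreal (pmf \<omega> (proj M k)) else 0)"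
    using j by (intro sum.cong) (auto simp: emeasure_well_measure)
  also have "\<dots> = ennreal (pmf \<omega> (proj M j))" using fin j by simp
  finally show ?thesis .
qed

lemma state_mixture_inj:
  assumes "\<omega> \<in> state_probs M" "\<omega>' \<in> state_probs M" "state_mixture a b M \<omega> = state_mixture a b M \<omega>'"
  shows "\<omega> = \<omega>'"
proof (rule pmf_eqI)
  fix A
  show "pmf \<omega> A = pmf \<omega>' A"
  proof (cases "A \<in> states M")
    case True
    then obtain j where j: "j \<in> labels M" "A = proj M j" by (auto simp: states_def)
    have "ennreal (pmf \<omega> A) = ennreal (pmf \<omega>' A)"
      using emeasure_state_mixture[OF j(1), of \<omega>] emeasure_state_mixture[OF j(1), of \<omega>'] assms(3) j(2) by simp
    then show ?thesis by simp
  next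
    case False
    then have "A \<notin> set_pmf \<omega>" "A \<notin> set_pmf \<omega>'" using assms(1,2) by (auto simp: state_probs_def)
    then show ?thesis by (simp add: set_pmf_iff)
  qed
qed

lemma level_rate_state_mixture:
  assumes "\<omega> \<in> state_probs M"
  shows "level_rate a b M (state_mixture a b M \<omega>) = chain_rate a b M \<omega>"
proof -
  have "(THE \<omega>'. \<omega>' \<in> state_probs M \<and> state_mixture a b M \<omega> = state_mixture a b M \<omega>') = \<omega>"
    using assms state_mixture_inj by (intro the_equality) auto
  then show ?thesis unfolding level_rate_def using assms by auto
qed

lemma sum_state_probs:
  assumes "\<omega> \<in> state_probs M"
  shows "(\<Sum>k\<in>labels M. pmf \<omega> (proj M k)) = 1"
proof -
  have fin: "finite (states M)" by (simp add: states_def labels_eq)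
  have "(\<Sum>k\<in>labels M. pmf \<omega> (proj M k)) = (\<Sum>A\<in>states M. pmf \<omega> A)"
    unfolding states_def by (simp add: sum.reindex[OF proj_inj])
  also have "\<dots> = 1" using assms fin by (intro sum_pmf_eq_1) (auto simp: state_probs_def)
  finally show ?thesis .
qed

end

context nonreversible
begin

lemma proj_gen_eq: "proj_gen a b M f k = chain_gen (\<lambda>k. f (proj M k)) k"
  by (simp add: proj_gen_def chain_gen_def)

lemma wells_periodic_proj: "wells_periodic (\<lambda>k. f (proj M k))"
  using proj_shift[of _ 1] by (simp add: wells_periodic_def)

lemma proj_in_states: "proj M k \<in> states M"
  using mod_labels[of k] proj_mod[of k] unfolding states_def by (metis imageI)

lemma wells_periodic_factors:
  assumes "wells_periodic f"
  obtains F where "\<And>k. F (proj M k) = f k"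
proof -
  define F where "F A = f (inv_into (labels M) (proj M) A)" for A
  have "F (proj M k) = f k" for k
  proof -
    have "F (proj M k) = F (proj M (k mod int u))" by (simp add: proj_mod)
    also have "\<dots> = f (k mod int u)"
      unfolding F_def using inv_into_f_f[OF proj_inj mod_labels] by simp
    finally show ?thesis using wells_periodic_mod[OF assms] by simp
  qed
  then show thesis using that by blast
qed

text \<open>The optimizer makes \<open>\<omega>\<close> stationary for the tilted chain: differentiate the functional
  at \<open>G\<close> in an arbitrary direction \<open>f\<close>.\<close>

lemma optimizer_first_order:
  assumes G: "\<And>A. A \<in> states M \<Longrightarrow> G A > 0"
    and opt: "chain_rate a b M \<omega> = ereal (chain_functional a b M \<omega> G)" and f: "wells_periodic f"
  defines "hv \<equiv> \<lambda>k. G (proj M k)"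
  shows "(\<Sum>k\<in>labels M. pmf \<omega> (proj M k) / hv k * (chain_gen f k - f k * (chain_gen hv k / hv k))) = 0"
proof -
  obtain F where F: "\<And>k. F (proj M k) = f k" using wells_periodic_factors[OF f] by blast
  have fin: "finite (labels M)" and ne: "labels M \<noteq> {}" using num_wells_period(1) by (auto simp: labels_eq)
  have hv: "hv k > 0" for k using G[OF proj_in_states] by (simp add: hv_def)
  define \<Phi> where "\<Phi> t = chain_functional a b M \<omega> (\<lambda>A. G A + t * F A)" for t
  have lin: "chain_gen (\<lambda>k. hv k + t * f k) k = chain_gen hv k + t * chain_gen f k" for t k
    by (simp add: chain_gen_def algebra_simps)
  have \<Phi>: "\<Phi> t = - (\<Sum>k\<in>labels M. (chain_gen hv k + t * chain_gen f k) / (hv k + t * f k) * pmf \<omega> (proj M k))" for t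
    unfolding \<Phi>_def chain_functional_def proj_gen_eq F by (simp add: lin[unfolded hv_def] hv_def)
  define s where "s = (\<Sum>k\<in>labels M. \<bar>f k\<bar>) + 1"
  \<comment> \<open>For \<open>t\<close> smaller than this in absolute value, the perturbation
    \<open>hv + t * f\<close> stays positive on all wells and is admissible in the supremum.\<close>
  define d where "d = Min (hv ` labels M) / s"
  have s: "s > 0" "\<And>k. k \<in> labels M \<Longrightarrow> \<bar>f k\<bar> < s"
  proof -
    show "s > 0" unfolding s_def by (intro add_nonneg_pos sum_nonneg) auto
    show "\<bar>f k\<bar> < s" if "k \<in> labels M" for k
      using member_le_sum[OF that, of "\<lambda>k. \<bar>f k\<bar>"] fin by (simp add: s_def)
  qed
  have mh: "Min (hv ` labels M) > 0" "\<And>k. k \<in> labels M \<Longrightarrow> Min (hv ` labels M) \<le> hv k" using fin ne hv by auto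
  have d: "d > 0" unfolding d_def using s(1) mh(1) by simp
  have pos: "hv k + t * f k > 0" if "\<bar>t\<bar> < d" "k \<in> labels M" for t k
  proof -
    have "\<bar>t * f k\<bar> \<le> \<bar>t\<bar> * s" unfolding abs_mult using s(2)[OF that(2)] by (intro mult_left_mono) auto
    also have "\<dots> < d * s" using that(1) s(1) by simp
    also have "\<dots> = Min (hv ` labels M)" using s(1) by (simp add: d_def)
    also have "\<dots> \<le> hv k" by (rule mh(2)[OF that(2)])
    finally show ?thesis by linarith
  qed
  have max: "\<Phi> t \<le> \<Phi> 0" if "\<bar>t\<bar> < d" for t
  proof -
    have "G A + t * F A > 0" if "A \<in> states M" for A
      using that pos[OF \<open>\<bar>t\<bar> < d\<close>] F by (auto simp: states_def hv_def)
    then have "ereal (\<Phi> t) \<le> chain_rate a b M \<omega>"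
      unfolding chain_rate_def \<Phi>_def by (intro SUP_upper) simp
    then show ?thesis using opt by (simp add: \<Phi>_def)
  qed
  define D where "D = - (\<Sum>k\<in>labels M. (chain_gen f k * hv k - chain_gen hv k * f k) / (hv k * hv k) * pmf \<omega> (proj M k))"
  have "((\<lambda>t. - (\<Sum>k\<in>labels M. (chain_gen hv k + t * chain_gen f k) / (hv k + t * f k) * pmf \<omega> (proj M k))) has_real_derivative D) (at 0)"
    unfolding D_def using hv[THEN less_imp_neq]
    by (auto intro!: derivative_eq_intros sum.cong simp: algebra_simps)
  then have "(\<Phi> has_real_derivative D) (at 0)" unfolding \<Phi>[abs_def] .
  then have "D = 0" by (rule DERIV_local_max[OF _ d]) (use max in auto)
  moreover have "(chain_gen f k * hv k - chain_gen hv k * f k) / (hv k * hv k) * pmf \<omega> (proj M k) =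
     pmf \<omega> (proj M k) / hv k * (chain_gen f k - f k * (chain_gen hv k / hv k))" for k
    using hv[of k] by (simp add: field_simps)
  ultimately show ?thesis by (simp add: D_def)
qed

end

theorem proposition9p4:
  fixes a b :: "real \<Rightarrow> real" and c\<^sub>0 :: real and N :: nat and m \<sigma> :: "int \<Rightarrow> real"
    and M :: "int \<Rightarrow> real set"
    and rhat r\<^sub>0 r lam :: real
    and \<zeta> :: "int \<Rightarrow> real \<Rightarrow> real"
    and \<omega> :: "real set pmf"
    and hhat :: "real set \<Rightarrow> real"
    and \<phi> :: "real \<Rightarrow> real \<Rightarrow> real"
    and \<mu> :: "real measure"
    and \<mu>\<epsilon> :: "real \<Rightarrow> real measure"
  assumes setting: "torus_setting a b c\<^sub>0 N m \<sigma>"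
    and M: "M = level a b m (q_hat a b m)"
    \<comment> \<open>condition (NonRev)\<close>
    and B_pos: "circulation a b > 0"
    and right_pos: "\<And>k. jump_rate a b M k (k + 1) > 0"
    and left_zero: "\<exists>j. jump_rate a b M j (j - 1) = 0"
    \<comment> \<open>cut-off functions around the wells\<close>
    and rhat: "rhat > 0" "\<And>k. k \<in> {0..<int N} \<Longrightarrow> ball (m k) rhat \<subset> {0<..<1}"
    and r0: "0 < r\<^sub>0" "r\<^sub>0 < 1/2 * min (depth a b (level a b m 1)) rhat"
    and r: "2 * r\<^sub>0 < r" "r < min (depth a b (level a b m 1)) rhat"
    and \<zeta>_smooth: "\<And>k. k \<in> labels M \<Longrightarrow> \<zeta> k \<in> smooth_torus"
    and \<zeta>_bounds: "\<And>k x. k \<in> labels M \<Longrightarrow> x \<in> {0..<1} \<Longrightarrow>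
          indicator (well_nbhd a b M r\<^sub>0 k) x \<le> \<zeta> k x \<and> \<zeta> k x \<le> indicator (well_nbhd a b M r k) x"
    \<comment> \<open>the limiting measure\<close>
    and \<omega>: "\<omega> \<in> state_probs M" "\<And>A. A \<in> states M \<Longrightarrow> pmf \<omega> A > 0"
    and \<mu>: "\<mu> = state_mixture a b M \<omega>"
    \<comment> \<open>the tilted diffusion and its stationary state\<close>
    and hhat_pos: "\<And>A. A \<in> states M \<Longrightarrow> hhat A > 0"
    and hhat_opt: "chain_rate a b M \<omega> = ereal (chain_functional a b M \<omega> hhat)"
    and lam: "lam > 0"
    and \<phi>_C2: "\<And>\<epsilon>. \<epsilon> > 0 \<Longrightarrow> \<phi> \<epsilon> \<in> C2_torus"
    and \<phi>_eq: "\<And>\<epsilon> x. \<epsilon> > 0 \<Longrightarrow>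
          lam * \<phi> \<epsilon> x - time_scale a b M \<epsilon> * diffusion_gen a b \<epsilon> (\<phi> \<epsilon>) x =
          (\<Sum>k \<in> labels M. (lam * hhat (proj M k) - proj_gen a b M hhat k) * \<zeta> k x)"
    and \<mu>\<epsilon>: "\<And>\<epsilon>. \<epsilon> > 0 \<Longrightarrow> (\<forall>x. \<phi> \<epsilon> x > 0) \<Longrightarrow>
          stationary_state (tilted_gen a b (\<phi> \<epsilon>) \<epsilon>) (\<mu>\<epsilon> \<epsilon>)"
  shows "Limsup (at_right 0)
           (\<lambda>\<epsilon>. ereal (time_scale a b M \<epsilon>) * rate_functional a b \<epsilon> (\<mu>\<epsilon> \<epsilon>))
         \<le> level_rate a b M \<mu>"
proof -
  interpret drifting a b c\<^sub>0 N m \<sigma>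
    by (intro drifting.intro drifting_axioms.intro setting B_pos)
  obtain h where h: "labels_valleys (potential a b) h M" using level_labels M by blast
  interpret nonreversible a b c\<^sub>0 N m \<sigma> M h
    by (unfold_locales) (rule h, rule right_pos)
  \<comment> \<open>The radius is only bounded by the depth of the first level; monotonicity of the
    depth makes it fit into the basins of the final level.\<close>
  have rH: "r < H" using r(2) level_one_depth_le by simp
  have "\<exists>\<alpha> \<beta>. {\<alpha>..\<beta>} \<subseteq> basin k \<and> \<alpha> \<le> lo k \<and> hi k \<le> \<beta> \<and>
    (\<forall>w\<in>M k. \<forall>y. (\<forall>t\<in>{min w y..max w y}. S t < lev k + r) \<longrightarrow> y \<in> {\<alpha>..\<beta>})" for k
    using basin_core[OF rH, of k] by metis
  then obtain p q where core: "\<And>k. {p k..q k} \<subseteq> basin k" "\<And>k. p k \<le> lo k" "\<And>k. hi k \<le> q k"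
    and inside: "\<And>k w y. w \<in> M k \<Longrightarrow> (\<And>t. t \<in> {min w y..max w y} \<Longrightarrow> S t < lev k + r) \<Longrightarrow> y \<in> {p k..q k}"
    by metis
  have per: "periodic1 (\<zeta> k)" if "k \<in> labels M" for k using \<zeta>_smooth[OF that] by (simp add: smooth_torus_def)
  have bounds: "indicator (well_nbhd a b M r\<^sub>0 k) (frac x) \<le> \<zeta> k x" "\<zeta> k x \<le> indicator (well_nbhd a b M r k) (frac x)"
    if "k \<in> labels M" for k x
    using \<zeta>_bounds[OF that, of "frac x"] periodic1_frac[OF per[OF that]] by (auto simp: frac_lt_1)
  interpret cutoffs a b c\<^sub>0 N m \<sigma> M h \<zeta> p q
  proof unfold_locales
    fix k x assume k: "k \<in> labels M"
    have "\<zeta> k differentiable_on UNIV" using \<zeta>_smooth[OF k] unfolding smooth_torus_def by (metis (no_types, lifting) funpow_0 mem_Collect_eq)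
    then show "continuous_on UNIV (\<zeta> k)" by (rule differentiable_imp_continuous_on)
    show "periodic1 (\<zeta> k)" by (rule per[OF k])
    show "0 \<le> \<zeta> k x" using bounds(1)[OF k, of x] by (rule order_trans[rotated]) simp
    show le: "\<zeta> k x \<le> 1" using bounds(2)[OF k, of x] by (rule order_trans) (simp add: indicator_def)
    show "\<zeta> k x = 1" if "x \<in> M k"
      using bounds(1)[OF k, of x] le minima_in_well_nbhd[OF r0(1) that] by simp
    \<comment> \<open>A point where \<open>\<zeta> k\<close> is nonzero lies in the neighbourhood of
      radius \<open>r\<close>; its lift stays below \<open>lev k + r\<close> on the way from a
      minimum, hence in the core.\<close>
    show "\<exists>n::int. x + of_int n \<in> {p k..q k}" if "\<zeta> k x \<noteq> 0"
    proof -
      have "0 \<le> \<zeta> k x" using bounds(1)[OF k, of x] by (rule order_trans[rotated]) simp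
      then have "frac x \<in> well_nbhd a b M r k"
        using bounds(2)[OF k, of x] that by (cases "frac x \<in> well_nbhd a b M r k") auto
      then obtain y w where y: "w \<in> M k" "frac y = frac x" "\<And>t. t \<in> {min w y..max w y} \<Longrightarrow> S t < lev k + r"
        using well_nbhd_lift by metis
      have "y = x + of_int (\<lfloor>y\<rfloor> - \<lfloor>x\<rfloor>)" using y(2) by (simp add: frac_def)
      then show ?thesis using inside[OF y(1,3)] by metis
    qed
  qed (rule core)+
  define hv where "hv k = hhat (proj M k)" for k
  define wt where "wt k = pmf \<omega> (proj M k)" for k
  \<comment> \<open>The optimality of \<open>hhat\<close> enters here as the first order condition,
    which says that \<open>wt\<close> is stationary for the tilted chain.\<close>
  interpret tilted a b c\<^sub>0 N m \<sigma> M h \<zeta> p q lam hv \<phi> \<mu>\<epsilon> wt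
  proof unfold_locales
    show "wells_periodic hv" unfolding hv_def[abs_def] by (rule wells_periodic_proj)
    show "hv k > 0" for k using hhat_pos[OF proj_in_states] by (simp add: hv_def)
    show "lam * \<phi> \<epsilon> x - time_scale a b M \<epsilon> * diffusion_gen a b \<epsilon> (\<phi> \<epsilon>) x = mix (\<lambda>k. lam * hv k - chain_gen hv k) x" if "\<epsilon> > 0" for \<epsilon> x
      using \<phi>_eq[OF that] by (simp add: mix_def proj_gen_eq hv_def[abs_def])
    show "wt k > 0" for k using \<omega>(2)[OF proj_in_states] by (simp add: wt_def)
    show "(\<Sum>k\<in>labels M. wt k) = 1" unfolding wt_def by (rule sum_state_probs[OF \<omega>(1)])
    show "(\<Sum>k\<in>labels M. wt k / hv k * (chain_gen f k - f k * (chain_gen hv k / hv k))) = 0" if "wells_periodic f" for f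
      using optimizer_first_order[OF hhat_pos hhat_opt that] by (simp add: wt_def hv_def[abs_def])
  qed (use lam \<phi>_C2 \<mu>\<epsilon> in auto)
  have "chain_functional a b M \<omega> hhat = - (\<Sum>k\<in>labels M. wt k * chain_gen hv k / hv k)"
    by (simp add: chain_functional_def proj_gen_eq wt_def hv_def[abs_def] mult.commute)
  then have "level_rate a b M \<mu> = ereal (- (\<Sum>k\<in>labels M. wt k * chain_gen hv k / hv k))"
    using level_rate_state_mixture[OF \<omega>(1)] hhat_opt \<mu> by simp
  then show ?thesis using limsup_rate by simp
qed

end
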